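(* Assume $(\mathbf A_1)$ and let $\vartheta\in\mathcal P_1(\mathbb{R}^n)$. Suppose that a sequence $(\mu^k,u^k)$ of control processes of $(S)$ converges to some $(\mu,\mathfrak U)\in BV_+([0,T];\mathcal P_1)\times BV_+([0,T];\mathbb{R}^m)$ in the sense that $\mu^k\rightharpoondown\mu$ and $F_{u^k}\rightharpoondown\mathfrak U$. Let $(\nu^k,\alpha^k,\beta^k)$ be the control processes of $(\hat S)$ associated with $(\mu^k,u^k)$. Then (1) the sequence $(\nu^k,\alpha^k,\beta^k)$ has at least one cluster point $(\nu,\alpha,\beta)$ in $C^0([0,S];\mathcal P_1)\times L^\infty_w([0,S];\mathbb{R}^{m+1})$; (2) each cluster point $(\nu,\alpha,\beta)$ is a control process of $(\hat S)$; (3) each cluster point $(\nu,\alpha,\beta)$ satisfies $$\mu_t=\nu_{\xi^\leftarrow(t)},\qquad \mathfrak U(t)=\int_0^{\xi^\leftarrow(t)}\beta(s)\,ds,\qquad t\in[0,T],$$ where $\xi(s)=\int_0^s\alpha(\varsigma)\,d\varsigma$, $s\in[0,S]$.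
   Context: $|\cdot|$ is the Manhattan norm. $\mathcal P_1=\mathcal P_1(\mathbb{R}^n)$ is the set of Borel probability measures on $\mathbb{R}^n$ with finite first moment, with the Wasserstein distance $W_1(\mu,\nu)=\sup\{\int\varphi\,d(\mu-\nu)\colon\varphi\ 1\text{-Lipschitz}\}$. $(g*\mu)(x)=\int g(x-y)\,d\mu(y)$. Assumption $(\mathbf A_1)$ on $f_0,\dots,f_m,g\colon\mathbb{R}^n\to\mathbb{R}^n$: there exist $C,L>0$ with $\sum_{i=0}^m|f_i(x)|+|g(x)|\le C$ for all $x$ and $\sum_{i=0}^m|f_i(x^1)-f_i(x^2)|+|g(x^1)-g(x^2)|\le L|x^1-x^2|$ for all $x^1,x^2$. System $(S)$, with given $T,M>0$: $\partial_t\mu_t+\nabla\cdot(v_t\mu_t)=0$ on $[0,T]$, $\mu_0=\vartheta$, $v_t(x)=f_0(x)+\sum_{i=1}^m u_i(t)f_i(x)+(g*\mu_t)(x)$, where controls $u\in\mathcal U$ are Borel measurable essentially bounded functions $[0,T]\to\mathbb{R}^m$ with $\int_0^T\sum_i|u_i(t)|\,dt=M$. A control process of $(S)$ is a pair $(\mu,u)$ with $u\in\mathcal U$ and $\mu$ the corresponding solution. Reduced system $(\hat S)$, with $S=T+M$: $\partial_s\nu_s+\nabla\cdot(w_s\nu_s)=0$ on $[0,S]$, $\nu_0=\vartheta$, $w_s(x)=\alpha(s)\left(f_0(x)+(g*\nu_s)(x)\right)+\sum_{i=1}^m\beta_i(s)f_i(x)$, with controls $(\alpha,\beta)\in\hat{\mathcal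 U}=\{(\alpha,\beta)\in L^\infty([0,S];A)\colon\int_0^S\alpha\,ds=T\}$, $A=\{(a,b)\in\mathbb{R}^{1+m}\colon a\ge0,\ a+\sum_{j=1}^m|b_j|\le1\}$. A control process of $(\hat S)$ is a triple $(\nu,\alpha,\beta)$ with $(\alpha,\beta)\in\hat{\mathcal U}$ and $\nu$ the corresponding solution. Both equations are understood in the weak sense (absolutely continuous curves in $\mathcal P_1$, satisfying the continuity equation in the sense of distributions, together with the initial condition), and under $(\mathbf A_1)$ solutions are unique. The process $(\nu,\alpha,\beta)$ of $(\hat S)$ associated with a process $(\mu,u)$ of $(S)$: let $\xi$ be the inverse of $\Xi(t)=t+\int_0^t\sum_i|u_i(\varsigma)|\,d\varsigma$; then $\alpha(s)=\frac{1}{1+\sum_i|u_i(\xi(s))|}$, $\beta_i(s)=\frac{u_i(\xi(s))}{1+\sum_j|u_j(\xi(s))|}$, and $\nu$ is the solution of the reduced equation for $(\alpha,\beta)$. $F_f(t)=\int_0^tf(s)\,ds$. $BV_+([0,T];\mathcal X)$ is the set of functions of bounded variation $[0,T]\to\mathcal X$ that are right continuous on $[0,T)$. $F_k\rightharpoondown F$ means $F_k(t)\to F(t)$ at all continuity points $t$ of $F$ and at $t\in\{0,T\}$. $L^\infty_w$ is $L^\infty$ with the weak-$*$ topology $\sigma(L^\infty,L^1)$; $C^0([0,S];\mathcal P_1)$ carries the uniform metric. The pseudo-inverse of $\xi$ is $\xi^\leftarrow(t)=\inf\{s\in[0,S]\colon\xi(s)>t\}$ for $t\in[0,T)$ and $\xi^\leftarrow(T)=S$.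 *)

theory Defs
  imports "HOL-Probability.Probability"
begin

section \<open>Metrics\<close>

text \<open>The axioms bundled in the type \<open>'a metric\<close> require the distance to be nonnegative
  and symmetric also off the carrier, hence the default value.\<close>

definition metric_on :: "'a set \<Rightarrow> ('a \<Rightarrow> 'a \<Rightarrow> real) \<Rightarrow> 'a metric" where
  "metric_on X d = metric (X, \<lambda>x y. if x \<in> X \<and> y \<in> X then d x y else 0)"

lemma metric_on:
  assumes "\<And>x y. x \<in> X \<Longrightarrow> y \<in> X \<Longrightarrow> 0 \<le> d x y"
    and "\<And>x y. x \<in> X \<Longrightarrow> y \<in> X \<Longrightarrow> d x y = d y x"
    and "\<And>x y. x \<in> X \<Longrightarrow> y \<in> X \<Longrightarrow> d x y = 0 \<longleftrightarrow> x = y"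
    and "\<And>x y z. x \<in> X \<Longrightarrow> y \<in> X \<Longrightarrow> z \<in> X \<Longrightarrow> d x z \<le> d x y + d y z"
  shows "mspace (metric_on X d) = X"
    and "x \<in> X \<Longrightarrow> y \<in> X \<Longrightarrow> mdist (metric_on X d) x y = d x y"
proof -
  interpret Metric_space X "\<lambda>x y. if x \<in> X \<and> y \<in> X then d x y else 0"
    by unfold_locales (use assms in auto)
  show "mspace (metric_on X d) = X"
    by (simp add: metric_on_def)
  show "x \<in> X \<Longrightarrow> y \<in> X \<Longrightarrow> mdist (metric_on X d) x y = d x y"
    by (simp add: metric_on_def)
qed

definition norm1 :: "real ^ 'i::finite \<Rightarrow> real" where
  "norm1 x = (\<Sum>i\<in>UNIV. \<bar>x $ i\<bar>)"

definition manhattan_metric :: "(real ^ 'i::finite) metric" where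
  "manhattan_metric = metric_on UNIV (\<lambda>x y. norm1 (x - y))"

lemma norm1_nonneg: "0 \<le> norm1 x"
  by (simp add: norm1_def sum_nonneg)

lemma norm1_zero [simp]: "norm1 0 = 0"
  by (simp add: norm1_def)

lemma norm1_eq_0_iff: "norm1 x = 0 \<longleftrightarrow> x = 0"
  by (simp add: norm1_def sum_nonneg_eq_0_iff vec_eq_iff)

lemma norm1_minus_commute: "norm1 (x - y) = norm1 (y - x)"
  by (simp add: norm1_def abs_minus_commute)

lemma norm1_triangle: "norm1 (x + y) \<le> norm1 x + norm1 y"
  unfolding norm1_def sum.distrib[symmetric] by (rule sum_mono) (simp add: abs_triangle_ineq)

lemma norm_le_norm1: "norm x \<le> norm1 x"
  unfolding norm1_def by (rule norm_le_l1_cart)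

lemma norm1_le_norm: "norm1 x \<le> real CARD('i) * norm x" for x :: "real ^ 'i::finite"
  unfolding norm1_def by (rule sum_bounded_above[where A = UNIV, simplified]) (rule component_le_norm_cart)

lemma norm1_diff_triangle: "norm1 (x - z) \<le> norm1 (x - y) + norm1 (y - z)"
  using norm1_triangle[of "x - y" "y - z"] by simp

lemma mspace_manhattan_metric [simp]: "mspace manhattan_metric = UNIV"
  and mdist_manhattan_metric [simp]: "mdist manhattan_metric x y = norm1 (x - y)"
  unfolding manhattan_metric_def
  by (subst metric_on;
      simp add: norm1_nonneg norm1_eq_0_iff norm1_minus_commute norm1_diff_triangle)+


section \<open>The Wasserstein space\<close>

definition P1 :: "(real ^ 'n::finite) measure set" where
  "P1 = {\<mu>. prob_space \<mu> \<and> sets \<mu> = sets borel \<and> integrable \<mu> norm1}"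

definition Lip1 :: "(real ^ 'n::finite \<Rightarrow> real) set" where
  "Lip1 = {\<phi>. \<forall>x y. \<bar>\<phi> x - \<phi> y\<bar> \<le> norm1 (x - y)}"

definition W1 :: "(real ^ 'n::finite) measure \<Rightarrow> (real ^ 'n) measure \<Rightarrow> real" where
  "W1 \<mu> \<nu> = (SUP \<phi>\<in>Lip1. (LINT x|\<mu>. \<phi> x) - (LINT x|\<nu>. \<phi> x))"

definition W1_metric :: "(real ^ 'n::finite) measure metric" where
  "W1_metric = metric_on P1 W1"

lemma Lip1_D: "\<phi> \<in> Lip1 \<Longrightarrow> \<bar>\<phi> x - \<phi> y\<bar> \<le> norm1 (x - y)"
  by (simp add: Lip1_def)

lemma Lip1_continuous: "\<phi> \<in> Lip1 \<Longrightarrow> continuous_on UNIV \<phi>"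
  for \<phi> :: "real ^ 'n::finite \<Rightarrow> real"
proof -
  assume "\<phi> \<in> Lip1"
  then have "(real CARD('n))-lipschitz_on UNIV \<phi>"
    unfolding Lip1_def
    by (auto intro!: lipschitz_onI simp: dist_norm) (meson norm1_le_norm order_trans)
  then show ?thesis by (rule lipschitz_on_continuous_on)
qed

lemma Lip1_integrable:
  assumes "\<phi> \<in> Lip1" "\<mu> \<in> P1"
  shows "integrable \<mu> \<phi>"
proof -
  interpret prob_space \<mu> using assms by (simp add: P1_def)
  have s [measurable_cong]: "sets \<mu> = sets borel" and i: "integrable \<mu> norm1"
    using assms by (auto simp: P1_def)
  have m: "\<phi> \<in> borel_measurable \<mu>"
    using borel_measurable_continuous_onI[OF Lip1_continuous[OF assms(1)]]
    by (simp add: measurable_cong_sets[OF s refl])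
  have "\<bar>\<phi> x\<bar> \<le> \<bar>\<phi> 0\<bar> + norm1 x" for x
    using Lip1_D[OF assms(1), of x 0] by simp
  then show ?thesis
    by (intro Bochner_Integration.integrable_bound[OF Bochner_Integration.integrable_add[OF integrable_const i] m])
       (auto simp: norm1_nonneg intro!: AE_I2 order_trans[OF _ abs_ge_self])
qed

lemma W1_upper:
  assumes "\<mu> \<in> P1" "\<nu> \<in> P1" "\<phi> \<in> Lip1"
  shows "(LINT x|\<mu>. \<phi> x) - (LINT x|\<nu>. \<phi> x) \<le> (LINT x|\<mu>. norm1 x) + (LINT x|\<nu>. norm1 x)"
proof -
  interpret m: prob_space \<mu> using assms by (simp add: P1_def)
  interpret n: prob_space \<nu> using assms by (simp add: P1_def)
  have b: "\<phi> x \<le> \<phi> 0 + norm1 x" "\<phi> 0 - norm1 x \<le> \<phi> x" for x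
    using Lip1_D[OF assms(3), of x 0] by simp_all
  have i: "integrable \<mu> norm1" "integrable \<nu> norm1" "integrable \<mu> \<phi>" "integrable \<nu> \<phi>"
    using assms by (auto simp: P1_def Lip1_integrable)
  have "(LINT x|\<mu>. \<phi> x) \<le> (LINT x|\<mu>. \<phi> 0 + norm1 x)"
    by (rule integral_mono) (use i b in auto)
  also have "\<dots> = \<phi> 0 + (LINT x|\<mu>. norm1 x)"
    using i by (simp add: m.prob_space)
  finally have 1: "(LINT x|\<mu>. \<phi> x) \<le> \<phi> 0 + (LINT x|\<mu>. norm1 x)" .
  have "\<phi> 0 - (LINT x|\<nu>. norm1 x) = (LINT x|\<nu>. \<phi> 0 - norm1 x)"
    using i by (simp add: n.prob_space)
  also have "\<dots> \<le> (LINT x|\<nu>. \<phi> x)"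
    by (rule integral_mono) (use i b in auto)
  finally show ?thesis using 1 by linarith
qed

lemma W1_bdd_above:
  assumes "\<mu> \<in> P1" "\<nu> \<in> P1"
  shows "bdd_above ((\<lambda>\<phi>. (LINT x|\<mu>. \<phi> x) - (LINT x|\<nu>. \<phi> x)) ` Lip1)"
  using W1_upper[OF assms] by (auto simp: bdd_above_def)

lemma W1_ge:
  assumes "\<mu> \<in> P1" "\<nu> \<in> P1" "\<phi> \<in> Lip1"
  shows "(LINT x|\<mu>. \<phi> x) - (LINT x|\<nu>. \<phi> x) \<le> W1 \<mu> \<nu>"
  unfolding W1_def by (rule cSUP_upper[OF assms(3) W1_bdd_above[OF assms(1,2)]])

lemma zero_in_Lip1: "(\<lambda>x. 0) \<in> Lip1"
  by (simp add: Lip1_def norm1_nonneg)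

lemma uminus_in_Lip1: "\<phi> \<in> Lip1 \<Longrightarrow> (\<lambda>x. - \<phi> x) \<in> Lip1"
  by (simp add: Lip1_def) (metis abs_minus_commute)

lemma W1_commute: "W1 \<mu> \<nu> = W1 \<nu> \<mu>"
proof -
  have "(\<lambda>\<phi>. (LINT x|\<mu>. \<phi> x) - (LINT x|\<nu>. \<phi> x)) ` Lip1
      = (\<lambda>\<phi>. (LINT x|\<nu>. \<phi> x) - (LINT x|\<mu>. \<phi> x)) ` Lip1"
  proof -
    have "(\<lambda>\<phi>. (LINT x|\<mu>. \<phi> x) - (LINT x|\<nu>. \<phi> x)) ` Lip1
        \<subseteq> (\<lambda>\<phi>. (LINT x|\<nu>. \<phi> x) - (LINT x|\<mu>. \<phi> x)) ` Lip1" for \<mu> \<nu> :: "(real ^ 'a) measure"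
    proof clarify
      fix \<phi> :: "real ^ 'a \<Rightarrow> real" assume "\<phi> \<in> Lip1"
      then show "(LINT x|\<mu>. \<phi> x) - (LINT x|\<nu>. \<phi> x)
          \<in> (\<lambda>\<phi>. (LINT x|\<nu>. \<phi> x) - (LINT x|\<mu>. \<phi> x)) ` Lip1"
        by (intro image_eqI[where x = "\<lambda>x. - \<phi> x"]) (auto simp: uminus_in_Lip1)
    qed
    then show ?thesis by (intro equalityI)
  qed
  then show ?thesis by (simp add: W1_def)
qed

lemma W1_nonneg: "\<mu> \<in> P1 \<Longrightarrow> \<nu> \<in> P1 \<Longrightarrow> 0 \<le> W1 \<mu> \<nu>"
  using W1_ge[OF _ _ zero_in_Lip1] by fastforce

lemma W1_self: "W1 \<mu> \<mu> = 0"
proof -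
  have "Lip1 \<noteq> ({} :: (real ^ 'a \<Rightarrow> real) set)" using zero_in_Lip1 by blast
  then show ?thesis by (simp add: W1_def)
qed

lemma W1_triangle:
  assumes "\<mu> \<in> P1" "\<nu> \<in> P1" "\<rho> \<in> P1"
  shows "W1 \<mu> \<rho> \<le> W1 \<mu> \<nu> + W1 \<nu> \<rho>"
  unfolding W1_def[of \<mu> \<rho>]
proof (rule cSUP_least)
  show "Lip1 \<noteq> {}" using zero_in_Lip1 by blast
  fix \<phi> :: "real ^ 'a \<Rightarrow> real" assume "\<phi> \<in> Lip1"
  then show "(LINT x|\<mu>. \<phi> x) - (LINT x|\<rho>. \<phi> x) \<le> W1 \<mu> \<nu> + W1 \<nu> \<rho>"
    using W1_ge[of \<mu> \<nu> \<phi>] W1_ge[of \<nu> \<rho> \<phi>] assms by linarith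
qed

lemma W1_eq_0:
  fixes \<mu> \<nu> :: "(real ^ 'n::finite) measure"
  assumes "\<mu> \<in> P1" "\<nu> \<in> P1" "W1 \<mu> \<nu> = 0"
  shows "\<mu> = \<nu>"
proof -
  interpret m: prob_space \<mu> using assms by (simp add: P1_def)
  interpret n: prob_space \<nu> using assms by (simp add: P1_def)
  have s: "sets \<mu> = sets borel" "sets \<nu> = sets borel" using assms by (auto simp: P1_def)
  have eq: "(LINT x|\<mu>. \<phi> x) = (LINT x|\<nu>. \<phi> x)" if "\<phi> \<in> Lip1" for \<phi>
    using W1_ge[OF assms(1,2) that] W1_ge[OF assms(2,1) that] assms(3) W1_commute[of \<mu> \<nu>] by simp
  have closed_eq: "emeasure \<mu> F = emeasure \<nu> F" if F: "closed F" "F \<noteq> {}" for F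
  proof -
    define h where "h j x = max 0 (1 - real j * infdist x F)" for j :: nat and x :: "real ^ 'n"
    have cont: "continuous_on UNIV (h j)" for j
      unfolding h_def by (intro continuous_intros)
    have heq: "(LINT x|\<mu>. h j x) = (LINT x|\<nu>. h j x)" for j
    proof (cases "j = 0")
      case True
      then show ?thesis by (simp add: h_def m.prob_space n.prob_space)
    next
      case False
      have "(\<lambda>x. h j x / real j) \<in> Lip1"
        unfolding Lip1_def
      proof safe
        fix x y :: "real ^ 'n"
        have 1: "\<bar>infdist x F - infdist y F\<bar> \<le> norm1 (x - y)"
          using infdist_triangle_abs[of x F y] norm_le_norm1[of "x - y"] by (simp add: dist_norm)
        have "\<bar>h j x - h j y\<bar> \<le> \<bar>real j * infdist x F - real j * infdist y F\<bar>"
          unfolding h_def by linarith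
        also have "\<dots> = real j * \<bar>infdist x F - infdist y F\<bar>"
          by (simp add: abs_mult flip: right_diff_distrib)
        finally have "\<bar>h j x - h j y\<bar> / real j \<le> \<bar>infdist x F - infdist y F\<bar>"
          using False by (simp add: divide_le_eq mult.commute)
        then show "\<bar>h j x / real j - h j y / real j\<bar> \<le> norm1 (x - y)"
          using 1 by (simp flip: diff_divide_distrib)
      qed
      from eq[OF this] False show ?thesis by simp
    qed
    have lim: "(\<lambda>j. h j x) \<longlonglongrightarrow> indicator F x" for x
    proof (cases "x \<in> F")
      case True
      then show ?thesis by (simp add: h_def)
    next
      case False
      then have p: "infdist x F > 0"
        using F in_closed_iff_infdist_zero infdist_nonneg[of x F] by (metis order_le_less)
      then obtain N :: nat where N: "1 < real N * infdist x F"
        using reals_Archimedean3 by blast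
      have "h j x = 0" if "j \<ge> N" for j
      proof -
        have "real N * infdist x F \<le> real j * infdist x F"
          using that p by (intro mult_right_mono) auto
        then show ?thesis using N by (simp add: h_def)
      qed
      then show ?thesis using False
        by (intro tendsto_eventually eventually_sequentiallyI[of N]) simp
    qed
    have meas: "h j \<in> borel_measurable \<mu>" "h j \<in> borel_measurable \<nu>" for j
      using borel_measurable_continuous_onI[OF cont[of j]] s
      by (auto simp: measurable_cong_sets[OF s(1) refl] measurable_cong_sets[OF s(2) refl])
    have Fm: "F \<in> sets \<mu>" "F \<in> sets \<nu>" using F s by auto
    have hb: "norm (h j x) \<le> 1" for j x
      using infdist_nonneg[of x F] by (auto simp: h_def)
    have "(\<lambda>j. LINT x|\<mu>. h j x) \<longlonglongrightarrow> (LINT x|\<mu>. indicator F x)"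
      by (rule integral_dominated_convergence[where w = "\<lambda>_. 1"])
         (use lim Fm meas hb in \<open>auto intro!: AE_I2\<close>)
    moreover have "(\<lambda>j. LINT x|\<nu>. h j x) \<longlonglongrightarrow> (LINT x|\<nu>. indicator F x)"
      by (rule integral_dominated_convergence[where w = "\<lambda>_. 1"])
         (use lim Fm meas hb in \<open>auto intro!: AE_I2\<close>)
    ultimately have "(LINT x|\<mu>. indicator F x :: real) = (LINT x|\<nu>. indicator F x)"
      unfolding heq by (rule LIMSEQ_unique)
    then show ?thesis
      using Fm by (simp add: m.emeasure_eq_measure n.emeasure_eq_measure)
  qed
  show ?thesis
  proof (rule measure_eqI_generator_eq[where A = "\<lambda>_. UNIV" and \<Omega> = UNIV and E = "Collect closed"])
    show "Int_stable (Collect closed :: (real ^ 'n) set set)"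
      by (auto simp: Int_stable_def)
    show "emeasure \<mu> X = emeasure \<nu> X" if "X \<in> Collect closed" for X
      using that closed_eq by (cases "X = {}") auto
    show "sets \<mu> = sigma_sets UNIV (Collect closed)" "sets \<nu> = sigma_sets UNIV (Collect closed)"
      by (simp_all add: s borel_eq_closed)
  qed auto
qed

lemma mspace_W1_metric [simp]: "mspace W1_metric = (P1 :: (real ^ 'a::finite) measure set)"
  and mdist_W1_metric: "\<lbrakk>\<mu> \<in> P1; \<nu> \<in> P1\<rbrakk> \<Longrightarrow> mdist W1_metric \<mu> \<nu> = W1 \<mu> \<nu>"
  for \<mu> \<nu> :: "(real ^ 'a::finite) measure"
proof -
  have z: "W1 \<mu> \<nu> = 0 \<longleftrightarrow> \<mu> = \<nu>" if "\<mu> \<in> P1" "\<nu> \<in> P1" for \<mu> \<nu> :: "(real ^ 'a) measure"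
    using that W1_eq_0 W1_self by blast
  show "mspace W1_metric = (P1 :: (real ^ 'a) measure set)"
    unfolding W1_metric_def by (rule metric_on(1)[OF W1_nonneg W1_commute z W1_triangle])
  show "\<mu> \<in> P1 \<Longrightarrow> \<nu> \<in> P1 \<Longrightarrow> mdist W1_metric \<mu> \<nu> = W1 \<mu> \<nu>"
    unfolding W1_metric_def by (rule metric_on(2)[OF W1_nonneg W1_commute z W1_triangle])
qed


section \<open>Curves\<close>

text \<open>The curves below have values in an arbitrary metric space; only their values on the time
  interval matter.\<close>

definition abs_cont_curve :: "'a metric \<Rightarrow> real \<Rightarrow> (real \<Rightarrow> 'a) \<Rightarrow> bool" where
  "abs_cont_curve m T c \<longleftrightarrow>
    (\<forall>t\<in>{0..T}. c t \<in> mspace m) \<and>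
    (\<exists>\<rho>. set_integrable lborel {0..T} \<rho> \<and>
      (\<forall>s t. 0 \<le> s \<and> s \<le> t \<and> t \<le> T \<longrightarrow> mdist m (c s) (c t) \<le> (LINT r:{s..t}|lborel. \<rho> r)))"

definition BV_plus :: "'a metric \<Rightarrow> real \<Rightarrow> (real \<Rightarrow> 'a) set" where
  "BV_plus m T = {F.
    (\<forall>t\<in>{0..T}. F t \<in> mspace m) \<and>
    (\<exists>V. \<forall>N \<tau>. mono_on {..N} \<tau> \<and> \<tau> ` {..N} \<subseteq> {0..T} \<longrightarrow>
      (\<Sum>j<N. mdist m (F (\<tau> j)) (F (\<tau> (Suc j)))) \<le> V) \<and>
    (\<forall>t\<in>{0..<T}. limitin (mtopology_of m) F (F t) (at_right t))}"

definition conv_at_continuity ::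
    "'a metric \<Rightarrow> real \<Rightarrow> (nat \<Rightarrow> real \<Rightarrow> 'a) \<Rightarrow> (real \<Rightarrow> 'a) \<Rightarrow> bool" where
  "conv_at_continuity m T Fs F \<longleftrightarrow>
    (\<forall>t\<in>{0..T}. t = 0 \<or> t = T \<or> limitin (mtopology_of m) F (F t) (at t within {0..T}) \<longrightarrow>
      limitin (mtopology_of m) (\<lambda>k. Fs k t) (F t) sequentially)"

definition primitive :: "(real \<Rightarrow> 'a::euclidean_space) \<Rightarrow> real \<Rightarrow> 'a" where
  "primitive f t = (LINT s:{0..t}|lborel. f s)"

definition pseudo_inverse :: "real \<Rightarrow> real \<Rightarrow> (real \<Rightarrow> real) \<Rightarrow> real \<Rightarrow> real" where
  "pseudo_inverse T S \<xi> t = (if t < T then Inf {s \<in> {0..S}. t < \<xi> s} else S)"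


section \<open>The continuity equation\<close>

fun C_k :: "nat \<Rightarrow> ('a::euclidean_space \<Rightarrow> real) \<Rightarrow> bool" where
  "C_k 0 \<phi> \<longleftrightarrow> continuous_on UNIV \<phi>"
| "C_k (Suc k) \<phi> \<longleftrightarrow>
    (\<forall>z. \<phi> differentiable at z) \<and> (\<forall>b\<in>Basis. C_k k (\<lambda>z. frechet_derivative \<phi> (at z) b))"

definition test_functions :: "real \<Rightarrow> (real \<times> (real ^ 'n::finite) \<Rightarrow> real) set" where
  "test_functions T = {\<phi>. (\<forall>k. C_k k \<phi>) \<and>
    compact (closure {z. \<phi> z \<noteq> 0}) \<and> closure {z. \<phi> z \<noteq> 0} \<subseteq> {0<..<T} \<times> UNIV}"

text \<open>Note that \<open>D\<phi>(t,x)(1,v) = \<partial>\<^sub>t\<phi>(t,x) + \<nabla>\<phi>(t,x) \<bullet> v\<close>. For the vector fields considered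
  here, which are bounded in the space variable and essentially bounded in time, the integrals
  exist.\<close>

definition weak_solution :: "real \<Rightarrow> (real ^ 'n::finite) measure \<Rightarrow> (real \<Rightarrow> real ^ 'n \<Rightarrow> real ^ 'n) \<Rightarrow>
    (real \<Rightarrow> (real ^ 'n) measure) \<Rightarrow> bool" where
  "weak_solution T \<theta> v \<mu> \<longleftrightarrow>
    abs_cont_curve W1_metric T \<mu> \<and>
    (\<forall>\<phi>\<in>test_functions T.
      (LINT t:{0..T}|lborel. LINT x|\<mu> t. frechet_derivative \<phi> (at (t, x)) (1, v t x)) = 0) \<and>
    \<mu> 0 = \<theta>"

definition conv :: "(real ^ 'n::finite \<Rightarrow> real ^ 'n) \<Rightarrow> (real ^ 'n) measure \<Rightarrow> real ^ 'n \<Rightarrow> real ^ 'n" where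
  "conv g \<mu> x = (LINT y|\<mu>. g (x - y))"


section \<open>The two control systems\<close>

text \<open>The vector fields \<open>f\<^sub>1, \<dots>, f\<^sub>m\<close> are indexed by a finite type, so \<open>m \<ge> 1\<close>. Nothing is lost:
  for \<open>m = 0\<close> no control satisfies the constraint with \<open>M > 0\<close>.\<close>

definition A1 :: "(real ^ 'n::finite \<Rightarrow> real ^ 'n) \<Rightarrow> ('m::finite \<Rightarrow> real ^ 'n \<Rightarrow> real ^ 'n) \<Rightarrow>
    (real ^ 'n \<Rightarrow> real ^ 'n) \<Rightarrow> bool" where
  "A1 f0 f g \<longleftrightarrow> (\<exists>C>0. \<exists>L>0.
    (\<forall>x. norm1 (f0 x) + (\<Sum>i\<in>UNIV. norm1 (f i x)) + norm1 (g x) \<le> C) \<and>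
    (\<forall>x y. norm1 (f0 x - f0 y) + (\<Sum>i\<in>UNIV. norm1 (f i x - f i y)) + norm1 (g x - g y)
      \<le> L * norm1 (x - y)))"

text \<open>Borel representatives of the elements of \<open>L\<^sup>1\<close> and \<open>L\<^sup>\<infinity>\<close>.\<close>

definition L1 :: "real \<Rightarrow> (real \<Rightarrow> 'a::euclidean_space) set" where
  "L1 S = {h. set_integrable lborel {0..S} h}"

definition Linf :: "real \<Rightarrow> (real \<Rightarrow> 'a::euclidean_space) set" where
  "Linf S = {\<gamma>. set_borel_measurable borel {0..S} \<gamma> \<and>
    (\<exists>C. AE s in lborel. s \<in> {0..S} \<longrightarrow> norm (\<gamma> s) \<le> C)}"

definition controls :: "real \<Rightarrow> real \<Rightarrow> (real \<Rightarrow> real ^ 'm::finite) set" where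
  "controls T M = {u \<in> Linf T. (LINT t:{0..T}|lborel. norm1 (u t)) = M}"

definition process :: "real \<Rightarrow> real \<Rightarrow> (real ^ 'n::finite \<Rightarrow> real ^ 'n) \<Rightarrow>
    ('m::finite \<Rightarrow> real ^ 'n \<Rightarrow> real ^ 'n) \<Rightarrow> (real ^ 'n \<Rightarrow> real ^ 'n) \<Rightarrow> (real ^ 'n) measure \<Rightarrow>
    (real \<Rightarrow> (real ^ 'n) measure) \<Rightarrow> (real \<Rightarrow> real ^ 'm) \<Rightarrow> bool" where
  "process T M f0 f g \<theta> \<mu> u \<longleftrightarrow> u \<in> controls T M \<and>
    weak_solution T \<theta> (\<lambda>t x. f0 x + (\<Sum>i\<in>UNIV. u t $ i *\<^sub>R f i x) + conv g (\<mu> t) x) \<mu>"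

definition reduced_controls :: "real \<Rightarrow> real \<Rightarrow> ((real \<Rightarrow> real) \<times> (real \<Rightarrow> real ^ 'm::finite)) set" where
  "reduced_controls T M = {(\<alpha>, \<beta>).
    (\<lambda>s. (\<alpha> s, \<beta> s)) \<in> Linf (T + M) \<and>
    (AE s in lborel. s \<in> {0..T + M} \<longrightarrow> 0 \<le> \<alpha> s \<and> \<alpha> s + norm1 (\<beta> s) \<le> 1) \<and>
    (LINT s:{0..T + M}|lborel. \<alpha> s) = T}"

definition reduced_solution :: "real \<Rightarrow> real \<Rightarrow> (real ^ 'n::finite \<Rightarrow> real ^ 'n) \<Rightarrow>
    ('m::finite \<Rightarrow> real ^ 'n \<Rightarrow> real ^ 'n) \<Rightarrow> (real ^ 'n \<Rightarrow> real ^ 'n) \<Rightarrow> (real ^ 'n) measure \<Rightarrow>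
    (real \<Rightarrow> (real ^ 'n) measure) \<Rightarrow> (real \<Rightarrow> real) \<Rightarrow> (real \<Rightarrow> real ^ 'm) \<Rightarrow> bool" where
  "reduced_solution T M f0 f g \<theta> \<nu> \<alpha> \<beta> \<longleftrightarrow>
    weak_solution (T + M) \<theta>
      (\<lambda>s x. \<alpha> s *\<^sub>R (f0 x + conv g (\<nu> s) x) + (\<Sum>i\<in>UNIV. \<beta> s $ i *\<^sub>R f i x)) \<nu>"

definition reduced_process :: "real \<Rightarrow> real \<Rightarrow> (real ^ 'n::finite \<Rightarrow> real ^ 'n) \<Rightarrow>
    ('m::finite \<Rightarrow> real ^ 'n \<Rightarrow> real ^ 'n) \<Rightarrow> (real ^ 'n \<Rightarrow> real ^ 'n) \<Rightarrow> (real ^ 'n) measure \<Rightarrow>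
    (real \<Rightarrow> (real ^ 'n) measure) \<Rightarrow> (real \<Rightarrow> real) \<Rightarrow> (real \<Rightarrow> real ^ 'm) \<Rightarrow> bool" where
  "reduced_process T M f0 f g \<theta> \<nu> \<alpha> \<beta> \<longleftrightarrow>
    (\<alpha>, \<beta>) \<in> reduced_controls T M \<and> reduced_solution T M f0 f g \<theta> \<nu> \<alpha> \<beta>"

definition associated_process :: "real \<Rightarrow> real \<Rightarrow> (real ^ 'n::finite \<Rightarrow> real ^ 'n) \<Rightarrow>
    ('m::finite \<Rightarrow> real ^ 'n \<Rightarrow> real ^ 'n) \<Rightarrow> (real ^ 'n \<Rightarrow> real ^ 'n) \<Rightarrow> (real ^ 'n) measure \<Rightarrow>
    (real \<Rightarrow> real ^ 'm) \<Rightarrow>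
    (real \<Rightarrow> (real ^ 'n) measure) \<Rightarrow> (real \<Rightarrow> real) \<Rightarrow> (real \<Rightarrow> real ^ 'm) \<Rightarrow> bool" where
  "associated_process T M f0 f g \<theta> u \<nu> \<alpha> \<beta> \<longleftrightarrow>
    (let \<xi> = the_inv_into {0..T} (\<lambda>t. t + (LINT \<tau>:{0..t}|lborel. norm1 (u \<tau>))) in
      (\<forall>s\<in>{0..T + M}. \<alpha> s = 1 / (1 + norm1 (u (\<xi> s))) \<and>
        (\<forall>i. \<beta> s $ i = u (\<xi> s) $ i / (1 + norm1 (u (\<xi> s))))) \<and>
      reduced_solution T M f0 f g \<theta> \<nu> \<alpha> \<beta>)"


section \<open>Cluster points\<close>

text \<open>The elements of \<open>C\<^sup>0([0,S]; X)\<close> are taken extensional, to make the uniform distance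
  a metric.\<close>

definition C0_metric :: "real \<Rightarrow> 'a metric \<Rightarrow> (real \<Rightarrow> 'a) metric" where
  "C0_metric S m = metric_on
    {c \<in> extensional {0..S}. continuous_map (top_of_set {0..S}) (mtopology_of m) c}
    (\<lambda>c c'. SUP s\<in>{0..S}. mdist m (c s) (c' s))"

lemma C0_metric:
  assumes "0 \<le> S"
  shows "mspace (C0_metric S m) =
      {c \<in> extensional {0..S}. continuous_map (top_of_set {0..S}) (mtopology_of m) c}" (is "_ = ?X")
    and "\<lbrakk>c \<in> mspace (C0_metric S m); c' \<in> mspace (C0_metric S m)\<rbrakk> \<Longrightarrow>
      mdist (C0_metric S m) c c' = (SUP s\<in>{0..S}. mdist m (c s) (c' s))"
proof -
  let ?d = "\<lambda>c c'. SUP s\<in>{0..S}. mdist m (c s) (c' s)"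
  have ne: "{0..S} \<noteq> {}" using assms by simp
  have sp: "c s \<in> mspace m" if "c \<in> ?X" "s \<in> {0..S}" for c s
    using that continuous_map_image_subset_topspace by fastforce
  have bd: "bdd_above ((\<lambda>s. mdist m (c s) (c' s)) ` {0..S})" if "c \<in> ?X" "c' \<in> ?X" for c c'
  proof -
    have "continuous_map (top_of_set {0..S}) euclidean (\<lambda>s. mdist m (c s) (c' s))"
      using that by (intro continuous_map_mdist) auto
    then have "continuous_on {0..S} (\<lambda>s. mdist m (c s) (c' s))" by simp
    then show ?thesis
      by (intro bounded_imp_bdd_above compact_imp_bounded compact_continuous_image) auto
  qed
  have up: "mdist m (c s) (c' s) \<le> ?d c c'" if "c \<in> ?X" "c' \<in> ?X" "s \<in> {0..S}" for c c' s
    by (rule cSUP_upper[OF that(3) bd[OF that(1,2)]])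
  have nn: "0 \<le> ?d c c'" if "c \<in> ?X" "c' \<in> ?X" for c c'
    by (rule order_trans[OF mdist_nonneg up[OF that, of 0]]) (use assms in simp)
  have z: "?d c c' = 0 \<longleftrightarrow> c = c'" if c: "c \<in> ?X" and c': "c' \<in> ?X" for c c'
  proof
    assume 0: "?d c c' = 0"
    have "c s = c' s" if s: "s \<in> {0..S}" for s
    proof -
      have "mdist m (c s) (c' s) = 0"
        using up[OF c c' s] 0 mdist_nonneg[of m "c s" "c' s"] by linarith
      then show ?thesis using sp[OF c s] sp[OF c' s] by simp
    qed
    then show "c = c'"
      using c c' by (intro extensionalityI[of c "{0..S}" c']) auto
  next
    assume "c = c'"
    then have "?d c c' = (SUP s\<in>{0..S}. 0)" using sp[OF c] by (intro SUP_cong) auto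
    then show "?d c c' = 0" using ne by simp
  qed
  have tr: "?d c c'' \<le> ?d c c' + ?d c' c''" if "c \<in> ?X" "c' \<in> ?X" "c'' \<in> ?X" for c c' c''
  proof (rule cSUP_least[OF ne])
    fix s assume s: "s \<in> {0..S}"
    have "mdist m (c s) (c'' s) \<le> mdist m (c s) (c' s) + mdist m (c' s) (c'' s)"
      using sp that s by (intro mdist_triangle) blast+
    then show "mdist m (c s) (c'' s) \<le> ?d c c' + ?d c' c''"
      using up[OF that(1,2) s] up[OF that(2,3) s] by linarith
  qed
  have co: "?d c c' = ?d c' c" for c c'
    by (simp add: mdist_commute)
  note * = metric_on[of ?X ?d, OF nn co z tr, folded C0_metric_def]
  show 1: "mspace (C0_metric S m) = ?X"
    by (rule *)
  show "\<lbrakk>c \<in> mspace (C0_metric S m); c' \<in> mspace (C0_metric S m)\<rbrakk> \<Longrightarrow>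
      mdist (C0_metric S m) c c' = ?d c c'"
    unfolding 1 by (rule *)
qed

definition weak_star_topology :: "real \<Rightarrow> (real \<Rightarrow> 'a::euclidean_space) topology" where
  "weak_star_topology S = pullback_topology (Linf S)
    (\<lambda>\<gamma>. \<lambda>h\<in>L1 S. LINT s:{0..S}|lborel. \<gamma> s \<bullet> h s) (powertop_real (L1 S))"

lemma topspace_weak_star_topology: "topspace (weak_star_topology S) = Linf S"
  by (auto simp: weak_star_topology_def topspace_pullback_topology)

definition cluster_point :: "'a topology \<Rightarrow> (nat \<Rightarrow> 'a) \<Rightarrow> 'a \<Rightarrow> bool" where
  "cluster_point X x a \<longleftrightarrow>
    a \<in> topspace X \<and> (\<forall>U. openin X U \<and> a \<in> U \<longrightarrow> (\<exists>\<^sub>F k in sequentially. x k \<in> U))"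

definition process_cluster_point :: "real \<Rightarrow>
    (nat \<Rightarrow> real \<Rightarrow> (real ^ 'n::finite) measure) \<Rightarrow> (nat \<Rightarrow> real \<Rightarrow> real) \<Rightarrow> (nat \<Rightarrow> real \<Rightarrow> real ^ 'm::finite) \<Rightarrow>
    (real \<Rightarrow> (real ^ 'n) measure) \<Rightarrow> (real \<Rightarrow> real) \<Rightarrow> (real \<Rightarrow> real ^ 'm) \<Rightarrow> bool" where
  "process_cluster_point S \<nu>s \<alpha>s \<beta>s \<nu> \<alpha> \<beta> \<longleftrightarrow>
    cluster_point (prod_topology (mtopology_of (C0_metric S W1_metric)) (weak_star_topology S))
      (\<lambda>k. (restrict (\<nu>s k) {0..S}, \<lambda>s. (\<alpha>s k s, \<beta>s k s)))
      (restrict \<nu> {0..S}, \<lambda>s. (\<alpha> s, \<beta> s))"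

end

theory Submission
  imports Defs "HOL-Complex_Analysis.Great_Picard"
begin

text \<open>A weak solution is, up to a small \<open>W1\<close> error, the image of its initial measure under an Euler map whose
  displacement and Lipschitz constant depend only on a bound for the controls. No flow of the
  nonautonomous vector field is needed: the Euler maps give uniqueness by a Gronwall estimate, and compactness
  of families of solutions by an Arzela-Ascoli argument for maps that are almost Lipschitz in time.

  The clock \<open>\<Xi>\<close> of a control turns \<open>(\<mu>, u)\<close> into a solution of the reduced system whose primitives are
  \<open>\<xi>\<close> and \<open>F\<^sub>u \<circ> \<xi>\<close>, and by uniqueness this is the associated process. The controls of the
  reduced system lie in a bounded convex set, so they have a weak-* convergent subsequence, and the weak formulation
  passes to the limit because the velocity is affine in the controls and \<open>\<nu>\<^sup>k\<close> converges
  uniformly. Finally \<open>\<mu>\<^sup>k\<^sub>t = \<nu>\<^sup>k\<^bsub>\<Xi>\<^sup>k(t)\<^esub>\<close>, and \<open>\<Xi>\<^sup>k(t)\<close>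
  converges to the pseudo-inverse of \<open>\<xi>\<close> at all but countably many \<open>t\<close>.\<close>


section \<open>Smooth functions\<close>

text \<open>Two features shape the proof. The controls are only measurable in time, so a step of the
  Euler scheme uses their integrals over the step; linearity of the velocity in the controls makes
  this exact once the measure is frozen. And the equation may be tested only with smooth, compactly
  supported functions, whereas \<open>W1\<close> is a supremum over unbounded Lipschitz ones;
  composing a test with an Euler step must give a test again. Hence the smoothing of every step at
  scale 1/R, and the bookkeeping of a gradient bound \<open>l\<close> and a second-order bound
  \<open>K\<close>: \<open>l\<close> grows by a bounded factor over all steps, uniformly in R, while
  \<open>K\<close> may explode with R but is always multiplied by the square of the step size. So R
  is chosen first, from the tails of the first moments, and the number of steps afterwards. A
  cluster point is known only through its neighbourhoods, that is, through finitely many weak-*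
  tests and one uniform distance at a time. Every property of it is therefore derived from estimates
  at a single index \<open>k\<close>, not from a convergent subsequence.\<close>

lemma C_k_SucI:
  fixes \<phi> :: "'a::euclidean_space \<Rightarrow> real"
  assumes "\<And>z. (\<phi> has_derivative \<phi>' z) (at z)" and "\<And>b. b \<in> Basis \<Longrightarrow> C_k k (\<lambda>z. \<phi>' z b)"
  shows "C_k (Suc k) \<phi>"
proof -
  have "frechet_derivative \<phi> (at z) = \<phi>' z" for z
    using frechet_derivative_at[OF assms(1)] by simp
  with assms show ?thesis by (auto simp: differentiable_def)
qed

lemma C_k_Suc_has_derivative:
  "C_k (Suc k) \<phi> \<Longrightarrow> (\<phi> has_derivative frechet_derivative \<phi> (at z)) (at z)"
  by (simp add: frechet_derivative_works)

lemma C_k_Suc_D: "C_k (Suc k) \<phi> \<Longrightarrow> C_k k \<phi>"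
proof (induction k arbitrary: \<phi>)
  case 0
  then show ?case
    by (auto intro!: differentiable_imp_continuous_on simp: differentiable_on_def differentiable_at_withinI)
next
  case (Suc k)
  then show ?case by (metis C_k.simps(2))
qed

lemma C_k_continuous: "C_k k \<phi> \<Longrightarrow> continuous_on UNIV \<phi>"
  by (induction k) (auto dest: C_k_Suc_D simp del: C_k.simps(2))

lemma C_k_const: "C_k k (\<lambda>x. c)"
proof (induction k arbitrary: c)
  case (Suc k)
  show ?case by (rule C_k_SucI[OF has_derivative_const]) (rule Suc)
qed simp

lemma C_k_linear:
  assumes "bounded_linear h" shows "C_k k h"
proof (cases k)
  case 0
  then show ?thesis using assms by (simp add: linear_continuous_on)
next
  case (Suc j)
  show ?thesis unfolding Suc
    by (rule C_k_SucI[OF bounded_linear_imp_has_derivative[OF assms]]) (rule C_k_const)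
qed

lemma C_k_add: "C_k k f \<Longrightarrow> C_k k g \<Longrightarrow> C_k k (\<lambda>x. f x + g x)"
proof (induction k arbitrary: f g)
  case 0
  then show ?case by (auto intro: continuous_intros)
next
  case (Suc k)
  show ?case
    by (rule C_k_SucI[OF has_derivative_add[OF Suc.prems[THEN C_k_Suc_has_derivative]]])
       (use Suc in auto)
qed

lemma C_k_sum: "(\<And>i. i \<in> I \<Longrightarrow> C_k k (f i)) \<Longrightarrow> C_k k (\<lambda>x. \<Sum>i\<in>I. f i x)"
  by (induction I rule: infinite_finite_induct) (auto intro: C_k_const C_k_add)

lemma C_k_mult: "C_k k f \<Longrightarrow> C_k k g \<Longrightarrow> C_k k (\<lambda>x. f x * g x)"
proof (induction k arbitrary: f g)
  case 0
  then show ?case by (auto intro: continuous_intros)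
next
  case (Suc k)
  have k: "C_k k f" "C_k k g" using Suc.prems by (auto dest: C_k_Suc_D simp del: C_k.simps)
  show ?case
    by (rule C_k_SucI[OF has_derivative_mult[OF Suc.prems[THEN C_k_Suc_has_derivative]]])
       (use Suc k in \<open>auto intro!: C_k_add Suc.IH\<close>)
qed

lemma C_k_inverse: "C_k k f \<Longrightarrow> (\<And>x. f x \<noteq> 0) \<Longrightarrow> C_k k (\<lambda>x. inverse (f x))"
proof (induction k arbitrary: f)
  case 0
  then show ?case by (auto intro: continuous_intros)
next
  case (Suc k)
  have k: "C_k k f" using Suc.prems by (auto dest: C_k_Suc_D simp del: C_k.simps)
  have d: "((\<lambda>x. inverse (f x)) has_derivative
      (\<lambda>h. (- 1) * (inverse (f z) * (frechet_derivative f (at z) h * inverse (f z))))) (at z)" for z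
    using Deriv.has_derivative_inverse[OF Suc.prems(2) C_k_Suc_has_derivative[OF Suc.prems(1)]]
    by (simp add: mult.assoc)
  show ?case
    by (rule C_k_SucI[OF d], rule C_k_mult[OF C_k_const], rule C_k_mult[OF _ C_k_mult])
       (use Suc k in auto)
qed

text \<open>Only \<open>\<phi>\<close> varies in the induction: by the chain rule the partial
  derivatives of the composition are sums of products of those of \<open>\<Phi>\<close> with a
  partial derivative of \<open>\<phi>\<close>, composed with the same \<open>\<Phi>\<close>.\<close>

lemma C_k_compose:
  fixes \<phi> :: "'b::euclidean_space \<Rightarrow> real" and \<Phi> :: "'a::euclidean_space \<Rightarrow> 'b"
  shows "C_k k \<phi> \<Longrightarrow> (\<And>c. c \<in> Basis \<Longrightarrow> C_k k (\<lambda>x. \<Phi> x \<bullet> c)) \<Longrightarrow> C_k k (\<lambda>x. \<phi> (\<Phi> x))"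
proof (induction k arbitrary: \<phi>)
  case 0
  have "continuous_on UNIV \<Phi>"
    using 0 by (intro continuous_on_componentwise[THEN iffD2]) auto
  with 0 show ?case
    by (auto intro: continuous_on_compose2)
next
  case (Suc k)
  define D where "D z v = (\<Sum>c\<in>Basis. frechet_derivative (\<lambda>x. \<Phi> x \<bullet> c) (at z) v *\<^sub>R c)" for z v
  have d\<Phi>: "(\<Phi> has_derivative D z) (at z)" for z
    unfolding has_derivative_componentwise_within[of \<Phi>]
    using Suc.prems(2) by (auto simp: D_def inner_sum_left inner_Basis if_distrib frechet_derivative_works sum.delta' cong: if_cong)
  have d: "((\<lambda>x. \<phi> (\<Phi> x)) has_derivative (\<lambda>v. frechet_derivative \<phi> (at (\<Phi> z)) (D z v))) (at z)" for z
    using diff_chain_at[OF d\<Phi> C_k_Suc_has_derivative[OF Suc.prems(1)]] by (simp add: o_def)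
  show ?case
  proof (rule C_k_SucI[OF d])
    fix b :: 'a assume b: "b \<in> Basis"
    have lin: "linear (frechet_derivative \<phi> (at x))" for x
      using C_k_Suc_has_derivative[OF Suc.prems(1)] has_derivative_linear by blast
    have eq: "frechet_derivative \<phi> (at (\<Phi> z)) (D z b) =
       (\<Sum>c\<in>Basis. frechet_derivative (\<lambda>x. \<Phi> x \<bullet> c) (at z) b * frechet_derivative \<phi> (at (\<Phi> z)) c)" for z
      unfolding D_def using lin by (simp add: linear_sum linear_scale)
    have k: "C_k k (\<lambda>x. \<Phi> x \<bullet> c)" if "c \<in> Basis" for c
      using Suc.prems(2)[OF that] by (rule C_k_Suc_D)
    show "C_k k (\<lambda>z. frechet_derivative \<phi> (at (\<Phi> z)) (D z b))"
      unfolding eq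
    proof (intro C_k_sum C_k_mult)
      fix c :: 'b assume c: "c \<in> Basis"
      show "C_k k (\<lambda>x. frechet_derivative (\<lambda>x. \<Phi> x \<bullet> c) (at x) b)"
        using Suc.prems(2)[OF c] b by simp
      show "C_k k (\<lambda>x. frechet_derivative \<phi> (at (\<Phi> x)) c)"
        by (rule Suc.IH[of "\<lambda>y. frechet_derivative \<phi> (at y) c"]) (use Suc.prems(1) c k in auto)
    qed
  qed
qed

lemma C_k_compose_real:
  fixes \<phi> :: "real \<Rightarrow> real" and f :: "'a::euclidean_space \<Rightarrow> real"
  shows "C_k k \<phi> \<Longrightarrow> C_k k f \<Longrightarrow> C_k k (\<lambda>x. \<phi> (f x))"
  by (rule C_k_compose) auto

section \<open>Derivative bounds for compactly supported functions\<close>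

lemma frechet_derivative_support:
  assumes "x \<notin> closure {z. \<phi> z \<noteq> 0}"
  shows "frechet_derivative \<phi> (at x) v = (0 :: real)"
proof -
  have "((\<lambda>_. 0) has_derivative (\<lambda>_. 0)) (at x)" by simp
  then have "(\<phi> has_derivative (\<lambda>_. 0)) (at x)"
  proof (rule has_derivative_transform_within_open[where s = "- closure {z. \<phi> z \<noteq> 0}"])
    show "0 = \<phi> y" if "y \<in> - closure {z. \<phi> z \<noteq> 0}" for y
      using that closure_subset[of "{z. \<phi> z \<noteq> 0}"] by auto
  qed (use assms in auto)
  from frechet_derivative_at[OF this] show ?thesis by metis
qed

lemma linear_le_sum_Basis:
  fixes h :: "'a::euclidean_space \<Rightarrow> real"
  assumes "linear h" and "\<And>b. b \<in> Basis \<Longrightarrow> \<bar>h b\<bar> \<le> K b"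
  shows "\<bar>h v\<bar> \<le> (\<Sum>b\<in>Basis. K b) * norm v"
proof -
  have "h v = (\<Sum>b\<in>Basis. (v \<bullet> b) * h b)"
    using linear_sum[OF assms(1), of "\<lambda>b. (v \<bullet> b) *\<^sub>R b" Basis] linear_scale[OF assms(1)]
    by (simp add: euclidean_representation)
  also have "\<bar>\<dots>\<bar> \<le> (\<Sum>b\<in>Basis. \<bar>v \<bullet> b\<bar> * \<bar>h b\<bar>)"
    by (simp add: sum_abs flip: abs_mult)
  also have "\<dots> \<le> (\<Sum>b\<in>Basis. norm v * K b)"
    using assms(2) by (intro sum_mono mult_mono Basis_le_norm) auto
  finally show ?thesis by (simp add: sum_distrib_left mult.commute)
qed

lemma C_1_derivative_bounded:
  fixes \<phi> :: "'a::euclidean_space \<Rightarrow> real"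
  assumes "C_k (Suc 0) \<phi>" and "bounded {x. \<phi> x \<noteq> 0}"
  obtains K where "0 \<le> K" "\<And>x v. \<bar>frechet_derivative \<phi> (at x) v\<bar> \<le> K * norm v"
    "\<And>x y. \<bar>\<phi> x - \<phi> y\<bar> \<le> K * norm (x - y)"
proof -
  let ?S = "closure {x. \<phi> x \<noteq> 0}"
  have S: "compact ?S" using assms(2) by simp
  have "\<exists>K. \<forall>x. \<bar>frechet_derivative \<phi> (at x) b\<bar> \<le> K" if "b \<in> Basis" for b
  proof -
    have "continuous_on ?S (\<lambda>x. frechet_derivative \<phi> (at x) b)"
      using assms(1) that continuous_on_subset[OF _ subset_UNIV] by auto
    then have "bounded ((\<lambda>x. frechet_derivative \<phi> (at x) b) ` ?S)"
      using S compact_continuous_image compact_imp_bounded by blast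
    then obtain K where K: "\<And>x. x \<in> ?S \<Longrightarrow> \<bar>frechet_derivative \<phi> (at x) b\<bar> \<le> K"
      by (auto simp: bounded_iff)
    have "\<bar>frechet_derivative \<phi> (at x) b\<bar> \<le> max K 0" for x
      using K[of x] frechet_derivative_support[of x \<phi> b] by (cases "x \<in> ?S") auto
    then show ?thesis by blast
  qed
  then obtain K where K: "\<And>b x. b \<in> Basis \<Longrightarrow> \<bar>frechet_derivative \<phi> (at x) b\<bar> \<le> K b"
    by metis
  let ?K = "\<Sum>b\<in>Basis. K b"
  have der: "(\<phi> has_derivative frechet_derivative \<phi> (at x)) (at x)" for x
    by (rule C_k_Suc_has_derivative[OF assms(1)])
  have b: "\<bar>frechet_derivative \<phi> (at x) v\<bar> \<le> ?K * norm v" for x v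
    by (rule linear_le_sum_Basis[OF has_derivative_linear[OF der] K])
  have "0 \<le> ?K" using K by (intro sum_nonneg) (meson abs_ge_zero order_trans)
  moreover have "norm (\<phi> x - \<phi> y) \<le> ?K * norm (x - y)" for x y
    by (rule differentiable_bound[OF convex_UNIV, where f' = "\<lambda>x. frechet_derivative \<phi> (at x)"])
       (auto intro!: der onorm_le simp: b)
  ultimately show thesis using that b by auto
qed

text \<open>\<open>l\<close> bounds the gradient, and \<open>K\<close>, a Lipschitz constant of the
  derivative, stands in for a bound on second derivatives. The error estimates see a test function
  only through these two numbers.\<close>

definition bump_class :: "real \<Rightarrow> real \<Rightarrow> ('a::euclidean_space \<Rightarrow> real) \<Rightarrow> bool" where
  "bump_class l K \<phi> \<longleftrightarrow> (\<forall>k. C_k k \<phi>) \<and> bounded {x. \<phi> x \<noteq> 0} \<and>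
    (\<forall>x v. \<bar>frechet_derivative \<phi> (at x) v\<bar> \<le> l * norm v) \<and>
    (\<forall>x y v. \<bar>frechet_derivative \<phi> (at x) v - frechet_derivative \<phi> (at y) v\<bar> \<le> K * norm (x - y) * norm v)"

lemma bump_classE:
  fixes \<phi> :: "'a::euclidean_space \<Rightarrow> real"
  assumes "\<forall>k. C_k k \<phi>" "bounded {x. \<phi> x \<noteq> 0}"
  obtains l K where "0 \<le> l" "0 \<le> K" "bump_class l K \<phi>"
proof -
  obtain l where l: "0 \<le> l" "\<And>x v. \<bar>frechet_derivative \<phi> (at x) v\<bar> \<le> l * norm v"
    using C_1_derivative_bounded assms by metis
  have "\<exists>K. \<forall>x y. \<bar>frechet_derivative \<phi> (at x) b - frechet_derivative \<phi> (at y) b\<bar> \<le> K * norm (x - y)"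
    if "b \<in> Basis" for b
  proof -
    have C: "C_k (Suc 0) (\<lambda>x. frechet_derivative \<phi> (at x) b)"
      using assms(1)[rule_format, of "Suc (Suc 0)"] that by (auto simp del: One_nat_def)
    have "{x. frechet_derivative \<phi> (at x) b \<noteq> 0} \<subseteq> closure {x. \<phi> x \<noteq> 0}"
      using frechet_derivative_support by blast
    then have "bounded {x. frechet_derivative \<phi> (at x) b \<noteq> 0}"
      using assms(2) bounded_subset bounded_closure by blast
    then show ?thesis using C_1_derivative_bounded[OF C] by metis
  qed
  then obtain K where K: "\<And>b x y. b \<in> Basis \<Longrightarrow>
      \<bar>frechet_derivative \<phi> (at x) b - frechet_derivative \<phi> (at y) b\<bar> \<le> K b * norm (x - y)"
    by metis
  let ?K = "\<Sum>b\<in>Basis. \<bar>K b\<bar>"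
  have lin: "linear (frechet_derivative \<phi> (at x))" for x
    using C_k_Suc_has_derivative[of 0 \<phi>] assms(1) has_derivative_linear by blast
  have "\<bar>frechet_derivative \<phi> (at x) v - frechet_derivative \<phi> (at y) v\<bar> \<le> ?K * norm (x - y) * norm v" for x y v
  proof -
    have "\<bar>frechet_derivative \<phi> (at x) v - frechet_derivative \<phi> (at y) v\<bar>
        \<le> (\<Sum>b\<in>Basis. \<bar>K b\<bar> * norm (x - y)) * norm v"
    proof (rule linear_le_sum_Basis)
      show "linear (\<lambda>v. frechet_derivative \<phi> (at x) v - frechet_derivative \<phi> (at y) v)"
        using lin linear_compose_sub by blast
      show "\<bar>frechet_derivative \<phi> (at x) b - frechet_derivative \<phi> (at y) b\<bar> \<le> \<bar>K b\<bar> * norm (x - y)"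
        if "b \<in> Basis" for b
        using K[OF that, of x y] by (smt (verit) mult_right_mono norm_ge_zero)
    qed
    then show ?thesis by (simp add: sum_distrib_right)
  qed
  then show thesis using l assms that[of l ?K] by (auto simp: bump_class_def sum_nonneg)
qed

lemma bump_classD:
  assumes "bump_class l K \<phi>"
  shows "C_k k \<phi>" "bounded {x. \<phi> x \<noteq> 0}"
    "\<bar>frechet_derivative \<phi> (at x) v\<bar> \<le> l * norm v"
    "\<bar>frechet_derivative \<phi> (at x) v - frechet_derivative \<phi> (at y) v\<bar> \<le> K * norm (x - y) * norm v"
    "(\<phi> has_derivative frechet_derivative \<phi> (at x)) (at x)"
  using assms C_k_Suc_has_derivative[of 0 \<phi> x] by (auto simp: bump_class_def)

lemma bump_class_lipschitz:
  assumes "bump_class l K \<phi>"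
  shows "\<bar>\<phi> x - \<phi> y\<bar> \<le> l * norm (x - y)"
proof -
  have "norm (\<phi> x - \<phi> y) \<le> l * norm (x - y)"
  proof (rule differentiable_bound[OF convex_UNIV, where f' = "\<lambda>x. frechet_derivative \<phi> (at x)"])
    show "onorm (frechet_derivative \<phi> (at z)) \<le> l" for z
      by (rule onorm_le) (use bump_classD(3)[OF assms] in simp)
  qed (use bump_classD(5)[OF assms] in simp_all)
  then show ?thesis by simp
qed

text \<open>The mean value inequality for \<open>\<phi>\<close> minus its linear part at
  \<open>x\<close>, on the ball of radius \<open>norm v\<close>, where the derivative of that
  difference is at most \<open>K * norm v\<close>. This costs the factor 1/2 of Taylor's
  formula.\<close>

lemma bump_class_taylor:
  assumes "bump_class l K \<phi>" "0 \<le> K"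
  shows "\<bar>\<phi> (x + v) - \<phi> x - frechet_derivative \<phi> (at x) v\<bar> \<le> K * (norm v)\<^sup>2"
proof -
  define \<psi> where "\<psi> z = \<phi> z - frechet_derivative \<phi> (at x) z" for z
  have lin: "bounded_linear (frechet_derivative \<phi> (at x))"
    using bump_classD(5)[OF assms(1)] has_derivative_bounded_linear by blast
  have "norm (\<psi> (x + v) - \<psi> x) \<le> (K * norm v) * norm ((x + v) - x)"
  proof (rule differentiable_bound[where S = "cball x (norm v)"
        and f' = "\<lambda>z h. frechet_derivative \<phi> (at z) h - frechet_derivative \<phi> (at x) h"])
    fix z assume z: "z \<in> cball x (norm v)"
    show "(\<psi> has_derivative (\<lambda>h. frechet_derivative \<phi> (at z) h - frechet_derivative \<phi> (at x) h))
        (at z within cball x (norm v))"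
      unfolding \<psi>_def
      by (rule has_derivative_diff[OF has_derivative_at_withinI[OF bump_classD(5)[OF assms(1)]]
            bounded_linear_imp_has_derivative[OF lin]])
    show "onorm (\<lambda>h. frechet_derivative \<phi> (at z) h - frechet_derivative \<phi> (at x) h) \<le> K * norm v"
    proof (rule onorm_le)
      fix h :: 'a
      have "K * norm (z - x) * norm h \<le> K * norm v * norm h"
        using z assms(2) by (intro mult_right_mono mult_left_mono) (auto simp: dist_norm norm_minus_commute)
      then show "norm (frechet_derivative \<phi> (at z) h - frechet_derivative \<phi> (at x) h) \<le> K * norm v * norm h"
        using bump_classD(4)[OF assms(1), of z h x] by simp
    qed
  qed (auto simp: dist_norm)
  moreover have "\<psi> (x + v) - \<psi> x = \<phi> (x + v) - \<phi> x - frechet_derivative \<phi> (at x) v"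
    using bounded_linear.linear[OF lin] by (simp add: \<psi>_def linear_add)
  ultimately show ?thesis by (simp add: power2_eq_square mult.assoc)
qed

section \<open>A smooth step built from exp(-1/t)\<close>

definition flat_exp :: "real poly \<Rightarrow> real \<Rightarrow> real" where
  "flat_exp p t = (if 0 < t then poly p (inverse t) * exp (- inverse t) else 0)"

lemma flat_tendsto_0: "((\<lambda>h. flat_exp p h / h) \<longlongrightarrow> 0) (at 0)"
proof -
  have *: "((\<lambda>x. poly q x * exp (- x)) \<longlongrightarrow> 0) at_top" for q :: "real poly"
  proof -
    have "((\<lambda>x. \<Sum>i\<le>degree q. coeff q i * (x ^ i / exp x)) \<longlongrightarrow> (\<Sum>i\<le>degree q. coeff q i * 0)) at_top"
      by (intro tendsto_intros tendsto_power_div_exp_0)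
    then show ?thesis
      by (simp add: poly_altdef sum_distrib_right exp_minus divide_inverse mult.assoc)
  qed
  \<comment> \<open>\<open>pCons 0 p\<close> is the polynomial x p(x): dividing by \<open>h\<close>
    multiplies by the argument \<open>inverse h\<close>.\<close>
  have "((\<lambda>h. poly (pCons 0 p) (inverse h) * exp (- inverse h)) \<longlongrightarrow> 0) (at_right 0)"
    by (rule filterlim_compose[OF * filterlim_inverse_at_top_right])
  then have R: "((\<lambda>h. flat_exp p h / h) \<longlongrightarrow> 0) (at_right 0)"
    by (rule Lim_transform_eventually)
       (auto simp: eventually_at_filter flat_exp_def divide_inverse mult_ac)
  have L: "((\<lambda>h. flat_exp p h / h) \<longlongrightarrow> 0) (at_left 0)"
    by (rule tendsto_eventually) (auto simp: eventually_at_filter flat_exp_def)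
  show ?thesis using R L by (rule filterlim_split_at_real[rotated])
qed

text \<open>With y = 1/t the chain rule gives d/dt = -y^2 d/dy, and applied to p(y) exp(-y) this is
  y^2 (p(y) - p'(y)) exp(-y). The family is closed under differentiation, which is why
  \<open>flat_exp\<close> carries a polynomial.\<close>

lemma flat_has_derivative:
  "(flat_exp p has_real_derivative flat_exp ([:0, 0, 1:] * (p - pderiv p)) t) (at t)"
proof -
  consider "t < 0" | "t = 0" | "0 < t" by linarith
  then show ?thesis
  proof cases
    case 1
    have "((\<lambda>_. 0) has_real_derivative 0) (at t)" by simp
    then have "(flat_exp p has_real_derivative 0) (at t)"
      by (rule has_field_derivative_transform_within_open[where S = "{..<0}"]) (use 1 in \<open>auto simp: flat_exp_def\<close>)
    then show ?thesis using 1 by (simp add: flat_exp_def)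
  next
    case 2
    then show ?thesis using flat_tendsto_0[of p] by (simp add: has_field_derivative_iff flat_exp_def[of _ 0])
  next
    case 3
    have "((\<lambda>t. poly p (inverse t) * exp (- inverse t)) has_real_derivative
        flat_exp ([:0, 0, 1:] * (p - pderiv p)) t) (at t)"
      using 3 by (auto intro!: derivative_eq_intros DERIV_chain2[OF poly_DERIV]
          simp: flat_exp_def power2_eq_square field_simps)
    then show ?thesis
      by (rule has_field_derivative_transform_within_open[where S = "{0<..}"]) (use 3 in \<open>auto simp: flat_exp_def\<close>)
  qed
qed

lemma C_k_real_deriv:
  fixes \<phi> \<phi>' :: "real \<Rightarrow> real"
  assumes "\<And>t. (\<phi> has_real_derivative \<phi>' t) (at t)" "C_k k \<phi>'"
  shows "C_k (Suc k) \<phi>"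
proof (rule C_k_SucI)
  show "(\<phi> has_derivative (\<lambda>v. \<phi>' z * v)) (at z)" for z
    using assms(1) by (rule has_field_derivative_imp_has_derivative)
qed (use assms(2) in simp)

lemma C_k_flat: "C_k k (flat_exp p)"
proof (induction k arbitrary: p)
  case 0
  then show ?case
    using DERIV_isCont[OF flat_has_derivative] by (simp add: continuous_at_imp_continuous_on)
next
  case (Suc k)
  then show ?case using C_k_real_deriv[OF flat_has_derivative] by blast
qed

lemma smooth_step:
  obtains st :: "real \<Rightarrow> real" where "\<And>k. C_k k st" "\<And>t. t \<le> 0 \<Longrightarrow> st t = 0" "\<And>t. 1 \<le> t \<Longrightarrow> st t = 1"
proof -
  let ?F = "flat_exp 1"
  have F: "0 < ?F t" if "0 < t" for t using that by (simp add: flat_exp_def)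
  have F0: "?F t = 0" if "t \<le> 0" for t using that by (simp add: flat_exp_def)
  have nn: "0 \<le> ?F t" for t by (simp add: flat_exp_def)
  have pos: "?F t + ?F (1 - t) \<noteq> 0" for t
    using F[of t] F[of "1 - t"] nn[of t] nn[of "1 - t"] by (cases "0 < t") (auto simp: add_pos_nonneg)
  have C: "C_k k (\<lambda>t. 1 - t)" for k :: nat
    using C_k_add[OF C_k_const[of k 1] C_k_linear[OF bounded_linear_minus[OF bounded_linear_ident]]] by simp
  \<comment> \<open>The quotient F(t) / (F(t) + F(1 - t)) is smooth because one of t and 1 - t is
    always positive.\<close>
  show thesis
  proof (rule that[of "\<lambda>t. ?F t * inverse (?F t + ?F (1 - t))"])
    show "C_k k (\<lambda>t. ?F t * inverse (?F t + ?F (1 - t)))" for k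
      by (intro C_k_mult C_k_inverse C_k_add C_k_flat C_k_compose_real[OF C_k_flat] C pos)
  qed (use F0 F in \<open>auto simp: less_imp_neq[symmetric]\<close>)
qed

section \<open>Mollification\<close>

text \<open>Turns a Lebesgue integral over the whole space into a gauge integral over a box, the
  form in which differentiation under the integral sign is available.\<close>

lemma integrable_lborel_compact_support:
  fixes h :: "'a::euclidean_space \<Rightarrow> 'b::euclidean_space"
  assumes "continuous_on UNIV h" and "\<And>x. x \<notin> cbox a b \<Longrightarrow> h x = 0"
  shows "integrable lborel h" and "(LINT x|lborel. h x) = integral (cbox a b) h"
proof -
  have eq: "(\<lambda>x. indicator (cbox a b) x *\<^sub>R h x) = h"
    using assms(2) by (auto simp: indicator_def fun_eq_iff)
  have "integrable lborel (\<lambda>x. indicator (cbox a b) x *\<^sub>R h x)"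
    by (rule borel_integrable_compact) (use assms(1) continuous_on_subset[OF _ subset_UNIV] in auto)
  then show "integrable lborel h" by (simp only: eq)
  then have "set_integrable lborel (cbox a b) h"
    by (simp add: set_integrable_def eq)
  from set_borel_integral_eq_integral(2)[OF this]
  show "(LINT x|lborel. h x) = integral (cbox a b) h"
    by (simp only: set_lebesgue_integral_def eq)
qed

lemma lborel_integral_reflect:
  fixes h :: "'a::euclidean_space \<Rightarrow> 'b::{banach, second_countable_topology}"
  assumes [measurable]: "h \<in> borel_measurable borel"
  shows "(LINT z|lborel. h z) = (LINT y|lborel. h (x - y))"
proof -
  have l: "(lborel :: 'a measure) = distr lborel borel (\<lambda>y. x - y)"
    using lborel_affine[of "-1" x] by (simp add: density_1)
  have "(LINT z|lborel. h z) = (LINT z|distr lborel borel (\<lambda>y. x - y). h z)"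
    by (subst l) simp
  also have "\<dots> = (LINT y|lborel. h (x - y))"
    by (rule integral_distr) auto
  finally show ?thesis .
qed

text \<open>Differentiation under the integral sign, with the derivative falling on
  \<open>p\<close>; continuity of \<open>q\<close> is enough, which is how mollification gains
  smoothness. The bounded support of \<open>q\<close> reduces the integral to a box.\<close>

lemma conv_has_derivative:
  fixes p :: "'a::euclidean_space \<Rightarrow> real" and q :: "'a \<Rightarrow> 'b::euclidean_space"
  assumes p: "C_k (Suc 0) p" and q: "continuous_on UNIV q" "\<And>z. z \<notin> cbox a b \<Longrightarrow> q z = 0"
  shows "((\<lambda>x. LINT z|lborel. p (x - z) *\<^sub>R q z) has_derivative
    (\<lambda>v. LINT z|lborel. frechet_derivative p (at (x - z)) v *\<^sub>R q z)) (at x)"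
proof -
  let ?D = "\<lambda>x. frechet_derivative p (at x)"
  have dp: "(p has_derivative ?D z) (at z)" for z
    by (rule C_k_Suc_has_derivative[OF p])
  have cp: "continuous_on S (\<lambda>x. p (u x))" if "continuous_on S u" for S and u :: "'c::topological_space \<Rightarrow> 'a"
    by (rule continuous_on_compose2[OF C_k_continuous[OF p] that]) simp
  have cq: "continuous_on S (\<lambda>x. q (u x))" if "continuous_on S u" for S and u :: "'c::topological_space \<Rightarrow> 'a"
    by (rule continuous_on_compose2[OF q(1) that]) simp
  have cD: "continuous_on S (\<lambda>x. ?D (u x) v)" if "continuous_on S u" for S v and u :: "'c::topological_space \<Rightarrow> 'a"
  proof -
    have "continuous_on UNIV (\<lambda>x. ?D x v)"
    proof -
      have "?D x v = (\<Sum>c\<in>Basis. (v \<bullet> c) * ?D x c)" for x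
        using linear_sum[OF has_derivative_linear[OF dp], of x "\<lambda>c. (v \<bullet> c) *\<^sub>R c" Basis]
          linear_scale[OF has_derivative_linear[OF dp]]
        by (simp add: euclidean_representation)
      moreover have "continuous_on UNIV (\<lambda>x. \<Sum>c\<in>Basis. (v \<bullet> c) * ?D x c)"
        using p by (intro continuous_intros) auto
      ultimately show ?thesis by simp
    qed
    then show ?thesis by (rule continuous_on_compose2[OF _ that]) simp
  qed
  \<comment> \<open>\<open>leibniz_rule\<close> takes the derivative as a continuous map into the
    bounded linear operators.\<close>
  define B where "B x z = Blinfun (\<lambda>v. ?D (x - z) v *\<^sub>R q z)" for x z
  have B: "blinfun_apply (B x z) v = ?D (x - z) v *\<^sub>R q z" for x z v
    unfolding B_def
    by (subst bounded_linear_Blinfun_apply)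
       (auto intro: bounded_linear_compose[OF bounded_linear_scaleR_left has_derivative_bounded_linear[OF dp]])
  have eq: "(LINT z|lborel. p (x - z) *\<^sub>R q z) = integral (cbox a b) (\<lambda>z. p (x - z) *\<^sub>R q z)" for x
    by (rule integrable_lborel_compact_support) (auto intro!: continuous_intros cp cq q(2))
  have eqD: "(LINT z|lborel. ?D (x - z) v *\<^sub>R q z) = integral (cbox a b) (\<lambda>z. ?D (x - z) v *\<^sub>R q z)" for x v
    by (rule integrable_lborel_compact_support) (auto intro!: continuous_intros cD cq q(2))
  have cB: "continuous_on S (\<lambda>y. B (u y) (w y))" if "continuous_on S u" "continuous_on S w"
    for S and u w :: "'c::t2_space \<Rightarrow> 'a"
    by (rule continuous_on_blinfun_componentwise)
       (auto simp: B intro!: continuous_intros cD cq that)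
  have "((\<lambda>x. integral (cbox a b) (\<lambda>z. p (x - z) *\<^sub>R q z)) has_derivative
      blinfun_apply (integral (cbox a b) (B x))) (at x within UNIV)"
  proof (rule leibniz_rule)
    show "((\<lambda>x. p (x - z) *\<^sub>R q z) has_derivative blinfun_apply (B x z)) (at x within UNIV)" for x z
    proof -
      have "((\<lambda>x. p (x - z)) has_derivative ?D (x - z)) (at x)"
        using diff_chain_at[where f = "\<lambda>x. x - z" and g = p, OF has_derivative_diff[OF has_derivative_ident has_derivative_const] dp]
        by (simp add: o_def)
      from has_derivative_scaleR_left[OF this, of "q z"] show ?thesis by (simp add: B[abs_def])
    qed
    show "(\<lambda>z. p (x - z) *\<^sub>R q z) integrable_on cbox a b" for x
      by (intro integrable_continuous continuous_intros cp cq)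
    show "continuous_on (UNIV \<times> cbox a b) (\<lambda>(x, z). B x z)"
      unfolding case_prod_beta by (intro cB continuous_intros)
  qed auto
  moreover have eB: "blinfun_apply (integral (cbox a b) (B x)) v = integral (cbox a b) (\<lambda>z. ?D (x - z) v *\<^sub>R q z)" for v
    by (subst blinfun_apply_integral) (auto simp: B intro!: integrable_continuous cB continuous_intros)
  ultimately show ?thesis
    unfolding eq eqD eB[abs_def, symmetric] by simp
qed

lemma C_k_conv:
  fixes p q :: "'a::euclidean_space \<Rightarrow> real"
  assumes q: "continuous_on UNIV q" "\<And>z. z \<notin> cbox a b \<Longrightarrow> q z = 0"
  shows "(\<forall>k. C_k k p) \<Longrightarrow> C_k k (\<lambda>x. LINT z|lborel. p (x - z) * q z)"
proof (induction k arbitrary: p)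
  case 0
  have "C_k (Suc 0) p" using 0 by blast
  from conv_has_derivative[OF this q]
  show ?case
    by (auto intro!: continuous_at_imp_continuous_on has_derivative_continuous)
next
  case (Suc k)
  have "C_k (Suc 0) p" using Suc.prems by blast
  note d = conv_has_derivative[OF this q, simplified]
  show ?case
  proof (rule C_k_SucI[OF d])
    fix b :: 'a assume "b \<in> Basis"
    then have "\<forall>k. C_k k (\<lambda>z. frechet_derivative p (at z) b)"
      using Suc.prems by (metis C_k.simps(2))
    then show "C_k k (\<lambda>x. LINT z|lborel. frechet_derivative p (at (x - z)) b * q z)"
      by (rule Suc.IH)
  qed
qed

section \<open>The smoothing kernel and convolution with it\<close>

definition rho :: "real \<Rightarrow> 'a::euclidean_space \<Rightarrow> real" where
  "rho R x = flat_exp 1 (1 - R\<^sup>2 * (x \<bullet> x)) / (LINT y|lborel. flat_exp 1 (1 - R\<^sup>2 * ((y::'a) \<bullet> y)))"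

text \<open>The kernel is a function of \<open>x \<bullet> x\<close> rather than of the norm, which
  is not differentiable at the origin.\<close>

lemma C_k_flat_norm: "C_k k (\<lambda>x::'a::euclidean_space. flat_exp 1 (1 - R\<^sup>2 * (x \<bullet> x)))"
proof -
  have "C_k k (\<lambda>x::'a. x \<bullet> x)"
    unfolding euclidean_inner[of x x for x :: 'a]
    by (intro C_k_sum C_k_mult C_k_linear bounded_linear_inner_left)
  from C_k_add[OF C_k_const[of k 1] C_k_mult[OF C_k_const[of k "- R\<^sup>2"] this]]
  have "C_k k (\<lambda>x::'a. 1 - R\<^sup>2 * (x \<bullet> x))" by simp
  then show ?thesis by (rule C_k_compose_real[OF C_k_flat])
qed

context
  fixes R :: real assumes R: "0 < R"
begin

lemma flat_norm_eq_0: "1 / R \<le> norm x \<Longrightarrow> flat_exp 1 (1 - R\<^sup>2 * (x \<bullet> x)) = 0"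
proof -
  assume "1 / R \<le> norm x"
  then have "1 \<le> R * norm x" using R by (simp add: field_simps)
  then have "1 \<le> (R * norm x)\<^sup>2" by (rule one_le_power)
  then show ?thesis by (simp add: flat_exp_def power_mult_distrib power2_norm_eq_inner)
qed

lemma flat_norm_integrable:
  "integrable lborel (\<lambda>x::'a::euclidean_space. flat_exp 1 (1 - R\<^sup>2 * (x \<bullet> x)))"
proof -
  obtain a b where ab: "cball (0::'a) (1 / R) \<subseteq> cbox a b"
    using bounded_subset_cbox_symmetric[OF bounded_cball] by metis
  show ?thesis
  proof (rule integrable_lborel_compact_support(1))
    show "flat_exp 1 (1 - R\<^sup>2 * (x \<bullet> x)) = 0" if "x \<notin> cbox a b" for x :: 'a
      using ab that by (intro flat_norm_eq_0) (auto simp: subset_iff dist_norm intro: less_imp_le not_le_imp_less)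
  qed (use C_k_continuous[OF C_k_flat_norm] in blast)
qed

lemma flat_norm_integral_pos: "0 < (LINT y|lborel. flat_exp 1 (1 - R\<^sup>2 * ((y::'a::euclidean_space) \<bullet> y)))"
proof -
  let ?h = "\<lambda>y::'a. flat_exp 1 (1 - R\<^sup>2 * (y \<bullet> y))"
  have nn: "0 \<le> ?h y" for y by (simp add: flat_exp_def)
  have "\<not> (AE y in lborel. ?h y = 0)"
  proof
    assume "AE y in lborel. ?h y = 0"
    then have "AE y in lborel. y \<notin> ball (0::'a) (1 / R)"
    proof eventually_elim
      case (elim y)
      show ?case
      proof
        assume "y \<in> ball 0 (1 / R)"
        then have "R * norm y < 1" using R by (simp add: field_simps)
        then have "(R * norm y)\<^sup>2 < 1" using R by (simp add: power_less_one_iff abs_square_less_1)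
        with elim show False by (simp add: flat_exp_def power_mult_distrib power2_norm_eq_inner)
      qed
    qed
    then have "emeasure lborel (ball (0::'a) (1 / R)) = 0"
      by (simp add: AE_iff_measurable[of "ball (0::'a) (1 / R)"] ball_def dist_norm)
    then have "measure lborel (ball (0::'a) (1 / R)) = 0" by (simp add: measure_def)
    then show False using R content_ball_pos[of "1 / R" "0::'a"] by simp
  qed
  then have "(LINT y|lborel. ?h y) \<noteq> 0"
    using integral_nonneg_eq_0_iff_AE[OF flat_norm_integrable] nn by auto
  moreover have "0 \<le> (LINT y|lborel. ?h y)" using nn by simp
  ultimately show ?thesis by linarith
qed

lemma rho_nonneg: "0 \<le> rho R x"
  using flat_norm_integral_pos by (simp add: rho_def flat_exp_def)

lemma rho_eq_0: "1 / R \<le> norm x \<Longrightarrow> rho R x = 0"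
  by (simp add: rho_def flat_norm_eq_0)

lemma C_k_rho: "C_k k (rho R :: 'a::euclidean_space \<Rightarrow> real)"
  using C_k_mult[OF C_k_flat_norm C_k_const] unfolding rho_def[abs_def] divide_inverse .

lemma rho_continuous: "continuous_on UNIV (rho R :: 'a::euclidean_space \<Rightarrow> real)"
  by (rule C_k_continuous[OF C_k_rho])

lemma rho_integrable: "integrable lborel (rho R :: 'a::euclidean_space \<Rightarrow> real)"
  unfolding rho_def[abs_def] by (rule integrable_divide_zero) (simp add: flat_norm_integrable)

lemma rho_integral: "(LINT x|lborel. rho R (x::'a::euclidean_space)) = 1"
  using flat_norm_integral_pos[where 'a = 'a] unfolding rho_def by simp

lemma rho_bump_class: obtains l K where "0 \<le> l" "0 \<le> K" "bump_class l K (rho R :: 'a::euclidean_space \<Rightarrow> real)"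
proof (rule bump_classE)
  show "\<forall>k. C_k k (rho R :: 'a \<Rightarrow> real)" using C_k_rho by blast
  have "{x::'a. rho R x \<noteq> 0} \<subseteq> cball 0 (1 / R)"
    using rho_eq_0 by (force simp: not_le)
  then show "bounded {x::'a. rho R x \<noteq> 0}" using bounded_cball bounded_subset by blast
qed

end

definition mollify :: "real \<Rightarrow> ('a::euclidean_space \<Rightarrow> 'b::euclidean_space) \<Rightarrow> 'a \<Rightarrow> 'b" where
  "mollify R q x = (LINT z|lborel. rho R (x - z) *\<^sub>R q z)"

context
  fixes R r :: real and q :: "'a::euclidean_space \<Rightarrow> 'b::euclidean_space"
  assumes R: "0 < R" and q: "continuous_on UNIV q" "\<And>z. r < norm z \<Longrightarrow> q z = 0"
begin

lemma support_cbox: obtains a b where "\<And>z. z \<notin> cbox a b \<Longrightarrow> q z = 0"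
proof -
  obtain a b where "cball (0::'a) r \<subseteq> cbox a b"
    using bounded_subset_cbox_symmetric[OF bounded_cball] by metis
  then have "q z = 0" if "z \<notin> cbox a b" for z using that q(2)[of z] mem_cball_0[of z r] by (meson not_le subsetD)
  then show thesis by (rule that)
qed

lemma mollify_integrable: "integrable lborel (\<lambda>z. rho R (x - z) *\<^sub>R q z)"
proof -
  obtain a b where "\<And>z. z \<notin> cbox a b \<Longrightarrow> q z = 0" by (rule support_cbox) blast
  then show ?thesis
    by (intro integrable_lborel_compact_support(1)[of _ a b] continuous_intros q(1)
        continuous_on_compose2[OF rho_continuous[OF R]]) auto
qed

text \<open>The defining form puts \<open>x\<close> into the kernel and yields smoothness; this form
  puts it into \<open>q\<close>, so that bounds on \<open>q\<close> and on its increments are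
  inherited with the same constants.\<close>

lemma mollify_alt: "mollify R q x = (LINT y|lborel. rho R y *\<^sub>R q (x - y))"
proof -
  have "(\<lambda>z. rho R (x - z) *\<^sub>R q z) \<in> borel_measurable borel"
    by (intro borel_measurable_continuous_onI continuous_intros q(1)
        continuous_on_compose2[OF rho_continuous[OF R]]) auto
  from lborel_integral_reflect[OF this, of x] show ?thesis by (simp add: mollify_def)
qed

lemma q_bounded: obtains B where "0 \<le> B" "\<And>x. norm (q x) \<le> B"
proof -
  have "bounded (q ` cball 0 r)"
    by (intro compact_imp_bounded compact_continuous_image continuous_on_subset[OF q(1)]) auto
  then obtain B where B: "\<And>x. x \<in> cball 0 r \<Longrightarrow> norm (q x) \<le> B" unfolding bounded_iff by blast
  have "norm (q x) \<le> max 0 B" for x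
    using B[of x] q(2)[of x] by (cases "norm x \<le> r") auto
  then show thesis using that[of "max 0 B"] by simp
qed

lemma mollify_alt_integrable: "integrable lborel (\<lambda>y. rho R y *\<^sub>R q (x - y))"
proof -
  obtain B where B: "0 \<le> B" "\<And>x. norm (q x) \<le> B" by (rule q_bounded) blast
  show ?thesis
  proof (rule Bochner_Integration.integrable_bound[OF integrable_mult_left[OF rho_integrable[OF R], of B]])
    have "(\<lambda>y. rho R y *\<^sub>R q (x - y)) \<in> borel_measurable borel"
      by (intro borel_measurable_continuous_onI continuous_intros rho_continuous[OF R]
          continuous_on_compose2[OF q(1)]) auto
    then show "(\<lambda>y. rho R y *\<^sub>R q (x - y)) \<in> borel_measurable lborel" by simp
    show "AE y in lborel. norm (rho R y *\<^sub>R q (x - y)) \<le> norm (rho R y * B)"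
      using B by (auto intro!: AE_I2 mult_left_mono simp: abs_mult)
  qed
qed

text \<open>\<open>rho R\<close> is a probability density that vanishes where \<open>norm y\<close>
  is at least \<open>1 / R\<close>, so two averages over a small ball are compared. The choices 0,
  the constant \<open>q x\<close> and a shifted copy of \<open>q\<close> for \<open>w\<close> give
  the bound, the approximation error and the Lipschitz constant.\<close>

lemma mollify_diff_le:
  assumes "\<And>y. norm y \<le> 1 / R \<Longrightarrow> norm (q (x - y) - w y) \<le> e"
    and "integrable lborel (\<lambda>y. rho R y *\<^sub>R w y)"
  shows "norm (mollify R q x - (LINT y|lborel. rho R y *\<^sub>R w y)) \<le> e"
proof -
  have "mollify R q x - (LINT y|lborel. rho R y *\<^sub>R w y) = (LINT y|lborel. rho R y *\<^sub>R (q (x - y) - w y))"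
    using mollify_alt_integrable assms(2) by (simp add: mollify_alt scaleR_diff_right)
  also have "norm \<dots> \<le> (LINT y|lborel. rho R (y::'a) * e)"
  proof (rule Bochner_Integration.integral_norm_bound_integral)
    show "integrable lborel (\<lambda>y. rho R y *\<^sub>R (q (x - y) - w y))"
      using mollify_alt_integrable[of x] assms(2) by (simp add: scaleR_diff_right)
    show "integrable lborel (\<lambda>y::'a. rho R y * e)" using rho_integrable[OF R, where 'a='a] by simp
    show "norm (rho R y *\<^sub>R (q (x - y) - w y)) \<le> rho R y * e" for y
      using assms(1)[of y] rho_eq_0[OF R, of y] rho_nonneg[OF R, of y]
      by (cases "norm y \<le> 1 / R") (auto intro!: mult_left_mono)
  qed
  also have "\<dots> = e" by (simp add: rho_integral[OF R])
  finally show ?thesis .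
qed

lemma mollify_bounded:
  assumes "\<And>x. norm (q x) \<le> B" shows "norm (mollify R q x) \<le> B"
  using mollify_diff_le[of x "\<lambda>_. 0" B] assms by simp

lemma mollify_close:
  assumes "\<And>x y. norm (q x - q y) \<le> L * norm (x - y)" "0 \<le> L"
  shows "norm (mollify R q x - q x) \<le> L / R"
proof -
  have "norm (q (x - y) - q x) \<le> L / R" if "norm y \<le> 1 / R" for y
    using assms(1)[of "x - y" x] mult_left_mono[OF that assms(2)] by simp
  from mollify_diff_le[OF this]
  have "norm (mollify R q x - (LINT y|lborel. rho R (y::'a) *\<^sub>R q x)) \<le> L / R"
    using rho_integrable[OF R, where 'a='a] by simp
  moreover have "(LINT y|lborel. rho R (y::'a) *\<^sub>R q x) = q x"
    using rho_integrable[OF R, where 'a='a] rho_integral[OF R, where 'a='a] by simp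
  ultimately show ?thesis by simp
qed

lemma mollify_lipschitz:
  assumes "\<And>x y. norm (q x - q y) \<le> L * norm (x - y)"
  shows "norm (mollify R q x - mollify R q y) \<le> L * norm (x - y)"
  unfolding mollify_alt[of y]
  using assms[of "x - z" "y - z" for z] by (intro mollify_diff_le mollify_alt_integrable) simp

lemma mollify_eq_0: "r + 1 / R < norm x \<Longrightarrow> mollify R q x = 0"
proof -
  assume x: "r + 1 / R < norm x"
  have "rho R (x - z) *\<^sub>R q z = 0" for z
  proof (cases "r < norm z")
    case False
    then have "1 / R \<le> norm (x - z)" using x norm_triangle_ineq2[of x z] by linarith
    then show ?thesis using rho_eq_0[OF R, of "x - z"] by simp
  qed (use q in simp)
  then show ?thesis unfolding mollify_def by (simp del: scaleR_eq_0_iff)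
qed

lemma mollify_inner: "mollify R q x \<bullet> c = mollify R (\<lambda>z. q z \<bullet> c) x"
  using mollify_integrable[of x] unfolding mollify_def
  by (subst integral_inner_left[symmetric]) auto

lemma mollify_has_derivative:
  "(mollify R q has_derivative (\<lambda>v. LINT z|lborel. frechet_derivative (rho R) (at (x - z)) v *\<^sub>R q z)) (at x)"
proof -
  obtain a b where ab: "\<And>z. z \<notin> cbox a b \<Longrightarrow> q z = 0" by (rule support_cbox) blast
  show ?thesis
    using conv_has_derivative[OF C_k_rho[OF R] q(1) ab] by (simp add: mollify_def[abs_def])
qed

lemma C_k_mollify: "C_k k (\<lambda>x. mollify R q x \<bullet> c)"
proof -
  obtain a b where ab: "\<And>z. z \<notin> cbox a b \<Longrightarrow> q z = 0" by (rule support_cbox) blast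
  have "C_k k (\<lambda>x. LINT z|lborel. rho R (x - z) * (q z \<bullet> c))"
    using C_k_rho[OF R] by (intro C_k_conv[of _ a b] continuous_intros q(1)) (auto simp: ab)
  then show ?thesis by (simp add: mollify_inner) (simp add: mollify_def)
qed

end

lemma mollify_diff_bounded:
  fixes q1 q2 :: "'a::euclidean_space \<Rightarrow> 'b::euclidean_space"
  assumes R: "0 < R" and "continuous_on UNIV q1" "\<And>z. r < norm z \<Longrightarrow> q1 z = 0"
    and "continuous_on UNIV q2" "\<And>z. r < norm z \<Longrightarrow> q2 z = 0"
    and "\<And>x. norm (q1 x - q2 x) \<le> e"
  shows "norm (mollify R q1 x - mollify R q2 x) \<le> e"
proof -
  have "mollify R q1 x - mollify R q2 x = mollify R (\<lambda>z. q1 z - q2 z) x"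
    unfolding mollify_def scaleR_diff_right
    by (rule Bochner_Integration.integral_diff[symmetric])
       (rule mollify_integrable[OF R, where r = r]; use assms in simp)+
  moreover have "norm (mollify R (\<lambda>z. q1 z - q2 z) x) \<le> e"
    by (rule mollify_bounded[OF R, where r = r]) (use assms in \<open>auto intro!: continuous_intros\<close>)
  ultimately show ?thesis by simp
qed

text \<open>\<open>K\<close> is fixed before \<open>q\<close>. This uniformity is essential, since
  every Euler step smooths a different field.\<close>

lemma mollify_derivative_lipschitz:
  fixes R r :: real
  assumes R: "0 < R"
  obtains K where "0 \<le> K" "\<And>(q :: 'a::euclidean_space \<Rightarrow> 'b::euclidean_space) B x y v.
    continuous_on UNIV q \<Longrightarrow> (\<And>z. r < norm z \<Longrightarrow> q z = 0) \<Longrightarrow> (\<And>z. norm (q z) \<le> B) \<Longrightarrow>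
    norm ((LINT z|lborel. frechet_derivative (rho R) (at (x - z)) v *\<^sub>R q z) -
      (LINT z|lborel. frechet_derivative (rho R) (at (y - z)) v *\<^sub>R q z)) \<le> K * B * norm (x - y) * norm v"
proof -
  obtain l K where lK: "0 \<le> l" "0 \<le> K" "bump_class l K (rho R :: 'a \<Rightarrow> real)"
    using rho_bump_class[OF R] by metis
  obtain a b where ab: "cball (0::'a) r \<subseteq> cbox a b"
    using bounded_subset_cbox_symmetric[OF bounded_cball] by metis
  let ?c = "measure lborel (cbox a b)"
  let ?D = "\<lambda>x. frechet_derivative (rho R :: 'a \<Rightarrow> real) (at x)"
  show thesis
  proof (rule that[of "K * ?c"])
    fix q :: "'a \<Rightarrow> 'b" and B x y v
    assume q: "continuous_on UNIV q" "\<And>z. r < norm z \<Longrightarrow> q z = 0" "\<And>z. norm (q z) \<le> B"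
    have q0: "q z = 0" if "z \<notin> cbox a b" for z
      using that ab q(2)[of z] mem_cball_0[of z r] by (meson not_le subsetD)
    have B: "0 \<le> B" using q(3)[of 0] norm_ge_zero order_trans by blast
    have cD: "continuous_on UNIV (\<lambda>z. ?D (x - z) v)" for x
    proof (rule continuous_on_compose2[of UNIV "\<lambda>z. ?D z v"])
      show "continuous_on UNIV (\<lambda>z. ?D z v)"
        by (rule lipschitz_on_continuous_on[of "K * norm v"], rule lipschitz_onI)
           (use bump_classD(4)[OF lK(3)] lK in \<open>auto simp: dist_norm mult_ac\<close>)
    qed (auto intro: continuous_intros)
    have i: "integrable lborel (\<lambda>z. ?D (x - z) v *\<^sub>R q z)" for x
      by (rule integrable_lborel_compact_support(1)[of _ a b]) (auto intro!: continuous_intros cD q(1) q0)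
    have "norm ((LINT z|lborel. ?D (x - z) v *\<^sub>R q z) - (LINT z|lborel. ?D (y - z) v *\<^sub>R q z))
        = norm (LINT z|lborel. (?D (x - z) v - ?D (y - z) v) *\<^sub>R q z)"
      using i by (simp add: scaleR_diff_left)
    also have "\<dots> \<le> (LINT z|lborel. (K * norm (x - y) * norm v * B) * indicator (cbox a b) (z::'a))"
    proof (rule Bochner_Integration.integral_norm_bound_integral)
      show "integrable lborel (\<lambda>z. (?D (x - z) v - ?D (y - z) v) *\<^sub>R q z)"
        using i by (simp add: scaleR_diff_left)
      show "norm ((?D (x - z) v - ?D (y - z) v) *\<^sub>R q z)
          \<le> (K * norm (x - y) * norm v * B) * indicator (cbox a b) z" for z
      proof (cases "z \<in> cbox a b")
        case True
        have "\<bar>?D (x - z) v - ?D (y - z) v\<bar> \<le> K * norm (x - y) * norm v"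
          using bump_classD(4)[OF lK(3), of "x - z" v "y - z"] by simp
        then have "\<bar>?D (x - z) v - ?D (y - z) v\<bar> * norm (q z) \<le> K * norm (x - y) * norm v * B"
          using q(3) lK by (intro mult_mono) auto
        then show ?thesis using True by simp
      qed (simp add: q0)
    qed (intro integrable_mult_right integrable_real_indicator, use emeasure_lborel_cbox_finite[of a b] in simp_all)
    also have "\<dots> = K * ?c * B * norm (x - y) * norm v" by simp
    finally show "norm ((LINT z|lborel. ?D (x - z) v *\<^sub>R q z) - (LINT z|lborel. ?D (y - z) v *\<^sub>R q z))
        \<le> K * ?c * B * norm (x - y) * norm v" .
  qed (use lK in simp)
qed

lemma lipschitz_derivative_bound:
  assumes "(f has_derivative D) (at x)" and "\<And>x y. norm (f x - f y) \<le> L * norm (x - y)"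
  shows "norm (D v) \<le> L * norm v"
proof (cases "v = 0")
  case True
  then show ?thesis using has_derivative_linear[OF assms(1)] by (simp add: linear_0)
next
  case False
  have lin: "linear D" by (rule has_derivative_linear[OF assms(1)])
  have "norm (D v) \<le> (L + e) * norm v" if "0 < e" for e
  proof -
    obtain d where d: "0 < d" "\<And>y. norm (y - x) < d \<Longrightarrow> norm (f y - f x - D (y - x)) \<le> e * norm (y - x)"
      using assms(1) \<open>0 < e\<close> unfolding has_derivative_at_alt by blast
    define t where "t = d / (2 * norm v)"
    have t: "0 < t" "norm (t *\<^sub>R v) < d" using d(1) False by (auto simp: t_def)
    have "norm (D (t *\<^sub>R v)) \<le> norm (f (x + t *\<^sub>R v) - f x) + norm (f (x + t *\<^sub>R v) - f x - D (t *\<^sub>R v))"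
      using norm_triangle_ineq4[of "f (x + t *\<^sub>R v) - f x" "f (x + t *\<^sub>R v) - f x - D (t *\<^sub>R v)"] by simp
    also have "\<dots> \<le> L * norm (t *\<^sub>R v) + e * norm (t *\<^sub>R v)"
      using d(2)[of "x + t *\<^sub>R v"] t(2) assms(2)[of "x + t *\<^sub>R v" x] by (intro add_mono) simp_all
    finally have "t * norm (D v) \<le> t * ((L + e) * norm v)"
      using t(1) by (simp add: linear_scale[OF lin] algebra_simps)
    then show ?thesis using t(1) by simp
  qed
  then have "norm (D v) / norm v \<le> L + e" if "0 < e" for e
    using that False by (simp add: divide_le_eq)
  then have "norm (D v) / norm v \<le> L" by (rule field_le_epsilon)
  then show ?thesis using False by (simp add: divide_le_eq)
qed

section \<open>Truncation and smoothing\<close>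

text \<open>Piecewise linear between the radii \<open>R\<close> and \<open>2 * R\<close>, with slope
  \<open>1 / R\<close>; smoothness is left to the mollification.\<close>

definition cutoff :: "real \<Rightarrow> 'a::real_normed_vector \<Rightarrow> real" where
  "cutoff R x = max 0 (min 1 (2 - norm x / R))"

lemma cutoff_range: "0 \<le> cutoff R x" "cutoff R x \<le> 1" "\<bar>cutoff R x\<bar> \<le> 1"
  by (auto simp: cutoff_def)

lemma cutoff_eq_1: "0 < R \<Longrightarrow> norm x \<le> R \<Longrightarrow> cutoff R x = 1"
  by (simp add: cutoff_def min_def divide_le_eq)

lemma cutoff_eq_0: "0 < R \<Longrightarrow> 2 * R < norm x \<Longrightarrow> cutoff R x = 0"
  by (simp add: cutoff_def min_def field_simps)

lemma cutoff_continuous: "0 < R \<Longrightarrow> continuous_on S (cutoff R)"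
  unfolding cutoff_def by (intro continuous_intros) auto

lemma cutoff_diff: "0 < R \<Longrightarrow> \<bar>cutoff R x - cutoff R y\<bar> \<le> norm (x - y) / R"
proof -
  assume R: "0 < R"
  have "\<bar>cutoff R x - cutoff R y\<bar> \<le> \<bar>norm x / R - norm y / R\<bar>"
    unfolding cutoff_def by linarith
  also have "\<dots> = \<bar>norm x - norm y\<bar> / R" using R by (simp flip: diff_divide_distrib)
  also have "\<dots> \<le> norm (x - y) / R"
    using R norm_triangle_ineq3[of x y] by (simp add: divide_right_mono)
  finally show ?thesis .
qed

text \<open>An Euler step \<open>x \<mapsto> x + V x\<close> has to turn test functions into test functions. Smearing makes \<open>V\<close>
  smooth (the kernel \<open>rho R\<close> has width \<open>1 / R\<close>) and compactly supported without destroying its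
  Lipschitz constant, provided that \<open>V\<close> grows at most linearly on the ball of radius \<open>2 R\<close>.\<close>

definition smear :: "real \<Rightarrow> ('a::euclidean_space \<Rightarrow> 'b::euclidean_space) \<Rightarrow> 'a \<Rightarrow> 'b" where
  "smear R f = mollify R (\<lambda>z. cutoff R z *\<^sub>R f z)"

definition tame :: "real \<Rightarrow> real \<Rightarrow> real \<Rightarrow> ('a::euclidean_space \<Rightarrow> 'b::euclidean_space) \<Rightarrow> bool" where
  "tame R L c f \<longleftrightarrow> 0 < R \<and> 0 \<le> L \<and> 0 \<le> c \<and> (\<forall>x y. norm (f x - f y) \<le> L * norm (x - y)) \<and>
    (\<forall>x. norm x \<le> 2 * R \<longrightarrow> norm (f x) \<le> c * R)"

lemma lipschitz_continuous_on:
  fixes f :: "'a::real_normed_vector \<Rightarrow> 'b::real_normed_vector"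
  assumes "\<And>x y. norm (f x - f y) \<le> L * norm (x - y)"
  shows "continuous_on S f"
proof -
  have "norm (f x - f y) \<le> max 0 L * norm (x - y)" for x y
    using assms[of x y] by (rule order_trans) (simp add: mult_right_mono)
  then have "(max 0 L)-lipschitz_on S f"
    by (intro lipschitz_onI) (auto simp: dist_norm)
  then show ?thesis by (rule lipschitz_on_continuous_on)
qed

context
  fixes R L c :: real and f :: "'a::euclidean_space \<Rightarrow> 'b::euclidean_space"
  assumes t: "tame R L c f"
begin

lemma tameD: "0 < R" "0 \<le> L" "0 \<le> c" "norm (f x - f y) \<le> L * norm (x - y)"
  "norm x \<le> 2 * R \<Longrightarrow> norm (f x) \<le> c * R"
  using t by (auto simp: tame_def)

lemma truncated_continuous: "continuous_on UNIV (\<lambda>z. cutoff R z *\<^sub>R f z)"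
  by (intro continuous_intros cutoff_continuous tameD lipschitz_continuous_on[of f L])

lemma truncated_eq_0: "2 * R < norm z \<Longrightarrow> cutoff R z *\<^sub>R f z = 0"
  using cutoff_eq_0[OF tameD(1), of z] by simp

lemma truncated_bounded: "norm (cutoff R z *\<^sub>R f z) \<le> c * R"
proof (cases "norm z \<le> 2 * R")
  case True
  have "\<bar>cutoff R z\<bar> * norm (f z) \<le> 1 * (c * R)"
    by (intro mult_mono cutoff_range tameD(5) True) auto
  then show ?thesis by simp
qed (use tameD in \<open>simp add: cutoff_eq_0\<close>)

text \<open>Where the cutoff does not vanish, \<open>f\<close> is at most \<open>c * R\<close>;
  since the slope is \<open>1 / R\<close>, truncation adds only \<open>c\<close> to the Lipschitz
  constant, for every \<open>R\<close>. The product rule is applied at a point that lies in the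
  ball, whichever of the two it is.\<close>

lemma truncated_lipschitz:
  "norm (cutoff R x *\<^sub>R f x - cutoff R y *\<^sub>R f y) \<le> (L + c) * norm (x - y)"
proof -
  have *: "norm (cutoff R x *\<^sub>R f x - cutoff R y *\<^sub>R f y) \<le> (L + c) * norm (x - y)"
    if "norm x \<le> 2 * R" for x y
  proof -
    have "cutoff R x *\<^sub>R f x - cutoff R y *\<^sub>R f y = (cutoff R x - cutoff R y) *\<^sub>R f x + cutoff R y *\<^sub>R (f x - f y)"
      by (simp add: algebra_simps)
    also have "norm \<dots> \<le> \<bar>cutoff R x - cutoff R y\<bar> * norm (f x) + \<bar>cutoff R y\<bar> * norm (f x - f y)"
      by (rule order_trans[OF norm_triangle_ineq]) simp
    also have "\<dots> \<le> norm (x - y) / R * (c * R) + 1 * (L * norm (x - y))"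
      using tameD(1) by (intro add_mono mult_mono cutoff_diff cutoff_range tameD that) auto
    also have "\<dots> = (L + c) * norm (x - y)" using tameD(1) by (simp add: algebra_simps)
    finally show ?thesis .
  qed
  show ?thesis
  proof (cases "norm x \<le> 2 * R \<or> norm y \<le> 2 * R")
    case True
    then show ?thesis using *[of x y] *[of y x] by (auto simp: norm_minus_commute)
  next
    case False
    then show ?thesis using tameD(1-3) by (simp add: cutoff_eq_0)
  qed
qed

lemma smear_bounded: "(\<And>x. norm (f x) \<le> B) \<Longrightarrow> norm (smear R f x) \<le> B"
  unfolding smear_def
proof (rule mollify_bounded[OF tameD(1) truncated_continuous truncated_eq_0])
  fix x assume *: "\<And>x. norm (f x) \<le> B"
  have "\<bar>cutoff R x\<bar> * norm (f x) \<le> 1 * B" using * by (intro mult_mono cutoff_range) auto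
  then show "norm (cutoff R x *\<^sub>R f x) \<le> B" by simp
qed

lemma smear_lipschitz: "norm (smear R f x - smear R f y) \<le> (L + c) * norm (x - y)"
  unfolding smear_def
  by (rule mollify_lipschitz[OF tameD(1) truncated_continuous truncated_eq_0 truncated_lipschitz])

text \<open>Mollification moves the truncated function by at most its Lipschitz constant times
  \<open>1 / R\<close>; truncation is exact inside the ball of radius \<open>R\<close> and loses at
  most \<open>norm (f x)\<close> outside.\<close>

lemma smear_close: "norm (smear R f x - f x) \<le> (L + c) / R + (if norm x \<le> R then 0 else norm (f x))"
proof -
  have "norm (smear R f x - cutoff R x *\<^sub>R f x) \<le> (L + c) / R"
    unfolding smear_def
    by (rule mollify_close[OF tameD(1) truncated_continuous truncated_eq_0 truncated_lipschitz])
       (use tameD in auto)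
  moreover have "norm (cutoff R x *\<^sub>R f x - f x) \<le> (if norm x \<le> R then 0 else norm (f x))"
  proof (cases "norm x \<le> R")
    case False
    have "norm (cutoff R x *\<^sub>R f x - f x) = norm ((cutoff R x - 1) *\<^sub>R f x)" by (simp add: scaleR_diff_left)
    also have "\<dots> \<le> norm (f x)" using cutoff_range[of R x] by (simp add: mult_left_le_one_le)
    finally show ?thesis using False by simp
  qed (use tameD(1) in \<open>simp add: cutoff_eq_1\<close>)
  ultimately show ?thesis
    using norm_triangle_ineq[of "smear R f x - cutoff R x *\<^sub>R f x" "cutoff R x *\<^sub>R f x - f x"] by simp
qed

lemma smear_support: "bounded {x. smear R f x \<noteq> 0}"
proof -
  have "smear R f x = 0" if "2 * R + 1 / R < norm x" for x
    unfolding smear_def by (rule mollify_eq_0[OF tameD(1) truncated_continuous truncated_eq_0 that])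
  then have "{x. smear R f x \<noteq> 0} \<subseteq> cball 0 (2 * R + 1 / R)" by (force simp: not_le)
  then show ?thesis using bounded_cball bounded_subset by blast
qed

lemma C_k_smear: "C_k k (\<lambda>x. smear R f x \<bullet> b)"
  unfolding smear_def by (rule C_k_mollify[OF tameD(1) truncated_continuous truncated_eq_0])

lemma smear_continuous: "continuous_on S (smear R f)"
  by (rule lipschitz_continuous_on[OF smear_lipschitz])

end

lemma smear_diff_bounded:
  assumes "tame R L c f" "tame R L' c' g" and "\<And>x. norm (f x - g x) \<le> e"
  shows "norm (smear R f x - smear R g x) \<le> e"
  unfolding smear_def
proof (rule mollify_diff_bounded[OF tameD(1)[OF assms(1)] truncated_continuous[OF assms(1)] truncated_eq_0[OF assms(1)]
      truncated_continuous[OF assms(2)] truncated_eq_0[OF assms(2)]])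
  fix x :: 'a
  have "\<bar>cutoff R x\<bar> * norm (f x - g x) \<le> 1 * e" using assms(3) by (intro mult_mono cutoff_range) auto
  then show "norm (cutoff R x *\<^sub>R f x - cutoff R x *\<^sub>R g x) \<le> e" by (simp flip: scaleR_diff_right)
qed

text \<open>The constant \<open>K\<close> depends on \<open>R\<close> alone and the last bound is
  linear in \<open>c\<close>. For an Euler increment \<open>c\<close> is of the order of the step
  size, so the second-order constants added over all steps stay bounded for fixed
  \<open>R\<close>.\<close>

lemma smear_derivative:
  assumes R: "0 < R"
  obtains K where "0 \<le> K" "\<And>L c (f :: 'a::euclidean_space \<Rightarrow> 'b::euclidean_space). tame R L c f \<Longrightarrow>
    \<exists>D. (\<forall>x. (smear R f has_derivative D x) (at x)) \<and> (\<forall>x v. norm (D x v) \<le> (L + c) * norm v) \<and>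
      (\<forall>x y v. norm (D x v - D y v) \<le> K * c * norm (x - y) * norm v)"
proof -
  obtain K where K: "0 \<le> K" "\<And>(q :: 'a::euclidean_space \<Rightarrow> 'b::euclidean_space) B x y v.
    continuous_on UNIV q \<Longrightarrow> (\<And>z. 2 * R < norm z \<Longrightarrow> q z = 0) \<Longrightarrow> (\<And>z. norm (q z) \<le> B) \<Longrightarrow>
    norm ((LINT z|lborel. frechet_derivative (rho R) (at (x - z)) v *\<^sub>R q z) -
      (LINT z|lborel. frechet_derivative (rho R) (at (y - z)) v *\<^sub>R q z)) \<le> K * B * norm (x - y) * norm v"
    by (rule mollify_derivative_lipschitz[OF R, of "2 * R"]) blast
  show thesis
  proof (rule that[of "K * R"])
    fix L c and f :: "'a \<Rightarrow> 'b" assume t: "tame R L c f"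
    define D where "D x v = (LINT z|lborel. frechet_derivative (rho R) (at (x - z)) v *\<^sub>R (cutoff R z *\<^sub>R f z))" for x v
    have d: "(smear R f has_derivative D x) (at x)" for x
      unfolding smear_def D_def[abs_def]
      by (rule mollify_has_derivative[OF R truncated_continuous[OF t] truncated_eq_0[OF t]])
    have "norm (D x v) \<le> (L + c) * norm v" for x v
      by (rule lipschitz_derivative_bound[OF d smear_lipschitz[OF t]])
    moreover have "norm (D x v - D y v) \<le> K * (c * R) * norm (x - y) * norm v" for x y v
      unfolding D_def
      by (rule K(2)[OF truncated_continuous[OF t] truncated_eq_0[OF t] truncated_bounded[OF t]])
    ultimately show "\<exists>D. (\<forall>x. (smear R f has_derivative D x) (at x)) \<and> (\<forall>x v. norm (D x v) \<le> (L + c) * norm v) \<and>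
      (\<forall>x y v. norm (D x v - D y v) \<le> K * R * c * norm (x - y) * norm v)"
      using d by (intro exI[of _ D]) (simp add: mult_ac)
  qed (use K(1) R in simp)
qed

lemma smear_bump_class:
  assumes R: "0 < R"
  obtains K where "0 \<le> K" "\<And>L c (f :: 'a::euclidean_space \<Rightarrow> real). tame R L c f \<Longrightarrow>
    bump_class (L + c) (K * c) (smear R f)"
proof -
  obtain K where K: "0 \<le> K" "\<And>L c (f :: 'a::euclidean_space \<Rightarrow> real). tame R L c f \<Longrightarrow>
    \<exists>D. (\<forall>x. (smear R f has_derivative D x) (at x)) \<and> (\<forall>x v. norm (D x v) \<le> (L + c) * norm v) \<and>
      (\<forall>x y v. norm (D x v - D y v) \<le> K * c * norm (x - y) * norm v)"
    using smear_derivative[OF R] by metis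
  show thesis
  proof (rule that[OF K(1)])
    fix L c and f :: "'a \<Rightarrow> real" assume t: "tame R L c f"
    obtain D where D: "\<And>x. (smear R f has_derivative D x) (at x)" "\<And>x v. norm (D x v) \<le> (L + c) * norm v"
      "\<And>x y v. norm (D x v - D y v) \<le> K * c * norm (x - y) * norm v"
      using K(2)[OF t] by blast
    have "frechet_derivative (smear R f) (at x) = D x" for x
      using frechet_derivative_at[OF D(1)] by simp
    then show "bump_class (L + c) (K * c) (smear R f)"
      using D(2,3) C_k_smear[OF t, of _ 1] smear_support[OF t] by (simp add: bump_class_def)
  qed
qed

section \<open>Estimates in the Wasserstein space\<close>

lemma P1D:
  assumes "\<mu> \<in> P1" shows "prob_space \<mu>" "sets \<mu> = sets borel" "space \<mu> = UNIV" "integrable \<mu> norm1"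
  using assms sets_eq_imp_space_eq[of \<mu> borel] by (auto simp: P1_def)

lemma P1_measurable: "\<mu> \<in> P1 \<Longrightarrow> f \<in> borel_measurable borel \<Longrightarrow> f \<in> borel_measurable \<mu>"
  using measurable_cong_sets[OF P1D(2) refl] by blast

lemma P1_integrable_bounded:
  fixes f :: "real ^ 'n::finite \<Rightarrow> 'b::{banach, second_countable_topology}"
  assumes "\<mu> \<in> P1" "f \<in> borel_measurable borel" "\<And>x. norm (f x) \<le> B"
  shows "integrable \<mu> f"
proof -
  interpret prob_space \<mu> using P1D(1)[OF assms(1)] .
  show ?thesis by (rule integrable_const_bound[of _ B]) (use assms P1_measurable in auto)
qed

lemma P1_integrable_norm: assumes "\<mu> \<in> P1" shows "integrable \<mu> (\<lambda>x. norm x)"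
proof (rule Bochner_Integration.integrable_bound[OF P1D(4)[OF assms]])
  show "(\<lambda>x. norm x) \<in> borel_measurable \<mu>"
    by (rule P1_measurable[OF assms]) simp
  show "AE x in \<mu>. norm (norm x) \<le> norm (norm1 x)"
    by (rule AE_I2) (simp add: norm_le_norm1 norm1_nonneg)
qed

lemma P1_integrable_linear:
  fixes f :: "real ^ 'n::finite \<Rightarrow> 'b::{banach, second_countable_topology}"
  assumes "\<mu> \<in> P1" "f \<in> borel_measurable borel" "\<And>x. norm (f x) \<le> a + b * norm x"
  shows "integrable \<mu> f"
proof -
  interpret prob_space \<mu> using P1D(1)[OF assms(1)] .
  have "integrable \<mu> (\<lambda>x. a + b * norm x)" using P1_integrable_norm[OF assms(1)] by simp
  then show ?thesis
    by (rule Bochner_Integration.integrable_bound)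
       (use assms P1_measurable in \<open>auto intro!: AE_I2 order_trans[OF _ abs_ge_self]\<close>)
qed

lemma P1_integral_bounded:
  fixes f :: "real ^ 'n::finite \<Rightarrow> 'b::{banach, second_countable_topology}"
  assumes "\<mu> \<in> P1" "\<And>x. norm (f x) \<le> B"
  shows "norm (LINT x|\<mu>. f x) \<le> B"
proof -
  interpret prob_space \<mu> using P1D(1)[OF assms(1)] .
  have B: "0 \<le> B" using assms(2)[of undefined] norm_ge_zero order_trans by blast
  have "norm (LINT x|\<mu>. f x) \<le> (LINT x|\<mu>. norm (f x))" by simp
  also have "\<dots> \<le> (LINT x|\<mu>. B)"
    using assms(2) B by (intro integral_mono_AE') auto
  finally show ?thesis by (simp add: prob_space)
qed

lemma norm1_lipschitz_integral:
  fixes \<psi> :: "real ^ 'n::finite \<Rightarrow> real"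
  assumes \<mu>: "\<mu> \<in> P1" "\<nu> \<in> P1" and "0 \<le> l" and "\<And>x y. \<bar>\<psi> x - \<psi> y\<bar> \<le> l * norm1 (x - y)"
  shows "\<bar>(LINT x|\<mu>. \<psi> x) - (LINT x|\<nu>. \<psi> x)\<bar> \<le> l * W1 \<mu> \<nu>"
proof (cases "l = 0")
  case True
  interpret m: prob_space \<mu> using P1D(1)[OF \<mu>(1)] .
  interpret n: prob_space \<nu> using P1D(1)[OF \<mu>(2)] .
  have "\<psi> = (\<lambda>_. \<psi> 0)" using assms(4)[of _ 0] True by fastforce
  then have "(LINT x|\<mu>. \<psi> x) = \<psi> 0" "(LINT x|\<nu>. \<psi> x) = \<psi> 0"
    by (metis m.prob_space n.prob_space lebesgue_integral_const scaleR_one)+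
  then show ?thesis using True by simp
next
  case False
  then have l: "0 < l" using assms(3) by simp
  have L: "(\<lambda>x. \<psi> x / l) \<in> Lip1"
    using assms(4) l by (auto simp: Lip1_def divide_le_eq mult.commute simp flip: diff_divide_distrib)
  have "\<bar>(LINT x|\<mu>. \<psi> x / l) - (LINT x|\<nu>. \<psi> x / l)\<bar> \<le> W1 \<mu> \<nu>"
    using W1_ge[OF \<mu> L] W1_ge[OF \<mu>(2,1) L] W1_commute[of \<mu> \<nu>] by linarith
  then have "\<bar>(LINT x|\<mu>. \<psi> x) - (LINT x|\<nu>. \<psi> x)\<bar> / l \<le> W1 \<mu> \<nu>"
    using l by (simp flip: diff_divide_distrib)
  then show ?thesis using l by (simp add: divide_le_eq mult.commute)
qed

lemma lipschitz_integral:
  fixes \<psi> :: "real ^ 'n::finite \<Rightarrow> real"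
  assumes "\<mu> \<in> P1" "\<nu> \<in> P1" and "0 \<le> l" and "\<And>x y. \<bar>\<psi> x - \<psi> y\<bar> \<le> l * norm (x - y)"
  shows "\<bar>(LINT x|\<mu>. \<psi> x) - (LINT x|\<nu>. \<psi> x)\<bar> \<le> l * W1 \<mu> \<nu>"
proof (rule norm1_lipschitz_integral[OF assms(1-3)])
  show "\<bar>\<psi> x - \<psi> y\<bar> \<le> l * norm1 (x - y)" for x y
    using assms(4)[of x y] mult_left_mono[OF norm_le_norm1[of "x - y"] assms(3)] by linarith
qed

lemma lipschitz_measurable:
  fixes f :: "'a::euclidean_space \<Rightarrow> 'b::euclidean_space"
  assumes "\<And>x y. norm (f x - f y) \<le> L * norm (x - y)"
  shows "f \<in> borel_measurable borel"
  by (rule borel_measurable_continuous_onI[OF lipschitz_continuous_on[OF assms]])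

lemma distr_P1:
  fixes \<theta> :: "(real ^ 'n::finite) measure"
  assumes \<theta>: "\<theta> \<in> P1" and Y: "Y \<in> borel_measurable borel" "\<And>x. norm (Y x - x) \<le> c"
  shows "distr \<theta> borel Y \<in> P1"
proof -
  interpret prob_space \<theta> using P1D(1)[OF \<theta>] .
  have Ym: "Y \<in> \<theta> \<rightarrow>\<^sub>M borel" using P1_measurable[OF \<theta> Y(1)] .
  have n1: "norm1 \<in> borel_measurable (borel :: (real ^ 'n) measure)"
    unfolding norm1_def[abs_def] by measurable
  have "norm1 (Y x) \<le> real CARD('n) * c + real CARD('n) * norm x" for x
  proof -
    have "norm (Y x) \<le> c + norm x" using Y(2)[of x] norm_triangle_sub[of "Y x" x] by linarith
    then have "real CARD('n) * norm (Y x) \<le> real CARD('n) * (c + norm x)" by simp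
    then show ?thesis using norm1_le_norm[of "Y x"] by (simp add: distrib_left)
  qed
  then have "integrable \<theta> (\<lambda>x. norm1 (Y x))"
    by (intro P1_integrable_linear[OF \<theta>, of _ "real CARD('n) * c" "real CARD('n)"] measurable_compose[OF Y(1) n1])
       (simp add: norm1_nonneg)
  then have "integrable (distr \<theta> borel Y) norm1"
    using integrable_distr_eq[OF Ym n1] by simp
  then show ?thesis
    using prob_space_distr[OF Ym] by (simp add: P1_def)
qed

text \<open>Both images are read at the same point \<open>x\<close>, a coupling of the two measures.
  The factor converts the Euclidean norm into the Manhattan norm that defines
  \<open>Lip1\<close>.\<close>

lemma W1_distr_le:
  fixes \<theta> :: "(real ^ 'n::finite) measure"
  assumes \<theta>: "\<theta> \<in> P1" and Y: "Y \<in> borel_measurable borel" "\<And>x. norm (Y x - x) \<le> c"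
    and Z: "Z \<in> borel_measurable borel" "\<And>x. norm (Z x - x) \<le> c"
  shows "W1 (distr \<theta> borel Y) (distr \<theta> borel Z) \<le> real CARD('n) * (LINT x|\<theta>. norm (Y x - Z x))"
  unfolding W1_def
proof (rule cSUP_least)
  show "Lip1 \<noteq> ({} :: (real ^ 'n \<Rightarrow> real) set)" using zero_in_Lip1 by blast
  fix \<phi> :: "real ^ 'n \<Rightarrow> real" assume \<phi>: "\<phi> \<in> Lip1"
  have Ym: "Y \<in> \<theta> \<rightarrow>\<^sub>M borel" "Z \<in> \<theta> \<rightarrow>\<^sub>M borel" using P1_measurable[OF \<theta>] Y Z by auto
  have \<phi>m: "\<phi> \<in> borel_measurable borel" by (rule borel_measurable_continuous_onI[OF Lip1_continuous[OF \<phi>]])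
  have i: "integrable \<theta> (\<lambda>x. \<phi> (Y x))" "integrable \<theta> (\<lambda>x. \<phi> (Z x))"
    using Lip1_integrable[OF \<phi> distr_P1[OF \<theta> Y]] Lip1_integrable[OF \<phi> distr_P1[OF \<theta> Z]]
    by (simp_all add: integrable_distr_eq[OF Ym(1) \<phi>m] integrable_distr_eq[OF Ym(2) \<phi>m])
  have b: "\<phi> (Y x) - \<phi> (Z x) \<le> real CARD('n) * norm (Y x - Z x)" for x
    using Lip1_D[OF \<phi>, of "Y x" "Z x"] norm1_le_norm[of "Y x - Z x"] by linarith
  have d: "norm (Y x - Z x) \<le> 2 * c" for x
    using norm_triangle_ineq4[of "Y x - x" "Z x - x"] Y(2)[of x] Z(2)[of x] by simp
  have iN: "integrable \<theta> (\<lambda>x. norm (Y x - Z x))"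
    by (rule P1_integrable_bounded[OF \<theta>, of _ "2 * c"]) (use Y Z d in auto)
  have "(LINT x|distr \<theta> borel Y. \<phi> x) - (LINT x|distr \<theta> borel Z. \<phi> x)
      = (LINT x|\<theta>. \<phi> (Y x) - \<phi> (Z x))"
    using i by (simp add: integral_distr[OF Ym(1) \<phi>m] integral_distr[OF Ym(2) \<phi>m])
  also have "\<dots> \<le> (LINT x|\<theta>. real CARD('n) * norm (Y x - Z x))"
    using i iN b by (intro integral_mono) auto
  finally show "(LINT x|distr \<theta> borel Y. \<phi> x) - (LINT x|distr \<theta> borel Z. \<phi> x)
      \<le> real CARD('n) * (LINT x|\<theta>. norm (Y x - Z x))" by simp
qed

lemma W1_distr_le_sup:
  fixes \<theta> :: "(real ^ 'n::finite) measure"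
  assumes \<theta>: "\<theta> \<in> P1" and Y: "Y \<in> borel_measurable borel" "\<And>x. norm (Y x - x) \<le> c"
    and Z: "Z \<in> borel_measurable borel" "\<And>x. norm (Z x - x) \<le> c" and e: "\<And>x. norm (Y x - Z x) \<le> e"
  shows "W1 (distr \<theta> borel Y) (distr \<theta> borel Z) \<le> real CARD('n) * e"
proof -
  have "(LINT x|\<theta>. norm (Y x - Z x)) \<le> e"
    using P1_integral_bounded[OF \<theta>, of "\<lambda>x. norm (Y x - Z x)" e] e by simp
  then have "real CARD('n) * (LINT x|\<theta>. norm (Y x - Z x)) \<le> real CARD('n) * e" by simp
  with W1_distr_le[OF \<theta> Y Z] show ?thesis by linarith
qed

section \<open>Tails of the first moment\<close>

definition tail :: "real \<Rightarrow> (real ^ 'n::finite) measure \<Rightarrow> real" where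
  "tail R \<mu> = (LINT x|\<mu>. indicator {x. R < norm x} x * norm x)"

lemma tail_integrable: "\<mu> \<in> P1 \<Longrightarrow> integrable \<mu> (\<lambda>x. indicator {x. R < norm x} x * norm x)"
  by (rule P1_integrable_linear[of _ _ 0 1]) (auto simp: indicator_def)

lemma tail_antimono: "\<mu> \<in> P1 \<Longrightarrow> R \<le> R' \<Longrightarrow> tail R' \<mu> \<le> tail R \<mu>"
  unfolding tail_def by (rule integral_mono[OF tail_integrable tail_integrable]) (auto simp: indicator_def)

lemma tail_tendsto: assumes "\<mu> \<in> P1" shows "((\<lambda>n. tail (real n) \<mu>) \<longlongrightarrow> 0) sequentially"
proof -
  have "(\<lambda>n. LINT x|\<mu>. indicator {x. real n < norm x} x * norm x) \<longlonglongrightarrow> (LINT x|\<mu>. 0)"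
  proof (rule integral_dominated_convergence[where w = "\<lambda>x. norm x"])
    show "AE x in \<mu>. (\<lambda>n. indicator {x. real n < norm x} x * norm x) \<longlonglongrightarrow> 0"
    proof (rule AE_I2)
      fix x :: "real ^ 'a"
      obtain N :: nat where "norm x \<le> real N" using real_arch_simple by blast
      then have "indicator {x. real n < norm x} x * norm x = 0" if "N \<le> n" for n
        using that by (simp add: indicator_def)
      then show "(\<lambda>n. indicator {x. real n < norm x} x * norm x) \<longlonglongrightarrow> 0"
        by (intro tendsto_eventually eventually_sequentiallyI[of N])
    qed
  qed (use assms P1_integrable_norm tail_integrable in \<open>auto intro: borel_measurable_integrable simp: indicator_def\<close>)
  then show ?thesis by (simp add: tail_def)
qed

text \<open>The integrand of \<open>tail\<close> is not Lipschitz, hence not controlled by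
  \<open>W1\<close>. It is compared with the 1-Lipschitz function \<open>max 0 (norm x - R)\<close>,
  from below at the radius \<open>R\<close> and from above, up to a factor 2, at half the radius; a
  finite net of times then makes all tails small together.\<close>

lemma uniform_tail:
  fixes \<nu> :: "real \<Rightarrow> (real ^ 'n::finite) measure"
  assumes P: "\<And>s. s \<in> {0..\<tau>} \<Longrightarrow> \<nu> s \<in> P1"
    and c: "\<And>s t. s \<in> {0..\<tau>} \<Longrightarrow> t \<in> {0..\<tau>} \<Longrightarrow> W1 (\<nu> s) (\<nu> t) \<le> c * \<bar>s - t\<bar>" and "0 < \<eta>"
  shows "\<exists>R0. \<forall>R\<ge>R0. \<forall>s\<in>{0..\<tau>}. tail R (\<nu> s) \<le> \<eta>"
proof -
  let ?T = "\<lambda>R \<mu>. LINT x|\<mu>. max 0 (norm x - R)"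
  have iT: "integrable \<mu> (\<lambda>x. max 0 (norm x - R))" if "\<mu> \<in> P1" for R and \<mu> :: "(real ^ 'n) measure"
    by (rule P1_integrable_linear[OF that, of _ "\<bar>R\<bar>" 1]) auto
  have 1: "tail R \<mu> \<le> 2 * ?T (R / 2) \<mu>" if "\<mu> \<in> P1" for R and \<mu> :: "(real ^ 'n) measure"
  proof -
    have "indicator {x. R < norm x} x * norm x \<le> 2 * max 0 (norm x - R / 2)" for x :: "real ^ 'n"
      unfolding indicator_def using norm_ge_zero[of x] by (cases "R < norm x") (auto simp: max_def simp del: norm_ge_zero)
    then have "tail R \<mu> \<le> (LINT x|\<mu>. 2 * max 0 (norm x - R / 2))"
      unfolding tail_def using iT[OF that] that by (intro integral_mono tail_integrable) auto
    then show ?thesis by simp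
  qed
  have 2: "?T R \<mu> \<le> ?T R \<mu>' + W1 \<mu> \<mu>'" if "\<mu> \<in> P1" "\<mu>' \<in> P1" for R and \<mu> \<mu>' :: "(real ^ 'n) measure"
  proof -
    have "\<bar>max 0 (norm x - R) - max 0 (norm y - R)\<bar> \<le> 1 * norm (x - y)" for x y :: "real ^ 'n"
      using norm_triangle_ineq3[of x y] by linarith
    from lipschitz_integral[OF that _ this] show ?thesis by simp
  qed
  have 3: "?T R \<mu> \<le> tail R \<mu>" if "\<mu> \<in> P1" "0 \<le> R" for R and \<mu> :: "(real ^ 'n) measure"
    unfolding tail_def
    by (rule integral_mono[OF iT[OF that(1)] tail_integrable[OF that(1)]])
       (use that(2) in \<open>auto simp: indicator_def\<close>)
  \<comment> \<open>Net radius: within it \<open>W1\<close> changes by at most \<eta>/4. A second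
    \<eta>/4 comes from the tail at the net point, and passing from \<open>tail R\<close> to the
    radius R/2 doubles the sum.\<close>
  have "0 < \<eta> / (4 * (\<bar>c\<bar> + 1))" using \<open>0 < \<eta>\<close> by simp
  then obtain F where F: "finite F" "F \<subseteq> {0..\<tau>}" "{0..\<tau>} \<subseteq> (\<Union>s\<in>F. ball s (\<eta> / (4 * (\<bar>c\<bar> + 1))))"
    using seq_compact_imp_totally_bounded[of "{0..\<tau>}"] compact_imp_seq_compact[OF compact_Icc] by meson
  have "\<exists>N::nat. tail N (\<nu> s) \<le> \<eta> / 4" if "s \<in> F" for s
  proof -
    have "eventually (\<lambda>n. tail (real n) (\<nu> s) < \<eta> / 4) sequentially"
      using tail_tendsto[OF P] that F(2) \<open>0 < \<eta>\<close> by (intro order_tendstoD(2)[where y = 0]) auto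
    then show ?thesis by (meson eventually_sequentially less_imp_le order_refl)
  qed
  then obtain N where N: "\<And>s. s \<in> F \<Longrightarrow> tail (real (N s)) (\<nu> s) \<le> \<eta> / 4" by metis
  \<comment> \<open>Twice the largest radius, because the Lipschitz substitute is evaluated at R/2;
    0 is inserted in case the net is empty.\<close>
  define R0 where "R0 = 2 * real (Max (insert 0 (N ` F)))"
  have "tail R (\<nu> t) \<le> \<eta>" if "R0 \<le> R" "t \<in> {0..\<tau>}" for R t
  proof -
    obtain s where s: "s \<in> F" "\<bar>s - t\<bar> < \<eta> / (4 * (\<bar>c\<bar> + 1))"
      using F(3) \<open>t \<in> {0..\<tau>}\<close> by (auto simp: dist_real_def)
    have st: "s \<in> {0..\<tau>}" "\<nu> s \<in> P1" "\<nu> t \<in> P1" using s F(2) P \<open>t \<in> {0..\<tau>}\<close> by auto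
    have NR: "real (N s) \<le> R / 2"
    proof -
      have "N s \<le> Max (insert 0 (N ` F))" using s(1) F(1) by (intro Max_ge) auto
      then have "real (N s) \<le> R0 / 2" by (simp add: R0_def)
      then show ?thesis using \<open>R0 \<le> R\<close> by simp
    qed
    have "W1 (\<nu> t) (\<nu> s) \<le> c * \<bar>t - s\<bar>" using c st \<open>t \<in> {0..\<tau>}\<close> by blast
    also have "\<dots> \<le> (\<bar>c\<bar> + 1) * (\<eta> / (4 * (\<bar>c\<bar> + 1)))"
      using s(2) by (intro mult_mono) (auto simp: abs_minus_commute)
    also have "\<dots> = \<eta> / 4" by (simp add: field_simps)
    finally have w: "W1 (\<nu> t) (\<nu> s) \<le> \<eta> / 4" .
    have "?T (R / 2) (\<nu> s) \<le> tail (R / 2) (\<nu> s)" using st NR by (intro 3) auto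
    also have "\<dots> \<le> tail (real (N s)) (\<nu> s)" by (rule tail_antimono[OF st(2) NR])
    also have "\<dots> \<le> \<eta> / 4" by (rule N[OF s(1)])
    finally have "?T (R / 2) (\<nu> s) \<le> \<eta> / 4" .
    then show ?thesis using 1[OF st(3), of R] 2[OF st(3,2), of "R / 2"] w by linarith
  qed
  then show ?thesis by blast
qed

text \<open>If \<open>norm (Y x)\<close> exceeds \<open>R\<close>, then \<open>norm x\<close>
  exceeds \<open>R - c\<close>, which is at least \<open>c\<close>; hence \<open>norm (Y x)\<close>
  is at most \<open>2 * norm x\<close>.\<close>

lemma tail_distr:
  fixes \<theta> :: "(real ^ 'n::finite) measure"
  assumes \<theta>: "\<theta> \<in> P1" and Y: "Y \<in> borel_measurable borel" "\<And>x. norm (Y x - x) \<le> c" and "2 * c \<le> R"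
  shows "tail R (distr \<theta> borel Y) \<le> 2 * tail (R - c) \<theta>"
proof -
  have Ym: "Y \<in> \<theta> \<rightarrow>\<^sub>M borel" using P1_measurable[OF \<theta> Y(1)] .
  have "tail R (distr \<theta> borel Y) = (LINT x|\<theta>. indicator {x. R < norm x} (Y x) * norm (Y x))"
    unfolding tail_def by (rule integral_distr[OF Ym]) auto
  also have "\<dots> \<le> (LINT x|\<theta>. 2 * (indicator {x. R - c < norm x} x * norm x))"
  proof (rule integral_mono)
    have "integrable (distr \<theta> borel Y) (\<lambda>x. indicator {x. R < norm x} x * norm x)"
      by (rule tail_integrable[OF distr_P1[OF \<theta> Y]])
    then show "integrable \<theta> (\<lambda>x. indicator {x. R < norm x} (Y x) * norm (Y x))"
      by (rule integrable_distr[OF Ym])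
    show "integrable \<theta> (\<lambda>x. 2 * (indicator {x. R - c < norm x} x * norm x))"
      using tail_integrable[OF \<theta>] by simp
    fix x
    have "norm (Y x) \<le> c + norm x" using Y(2)[of x] norm_triangle_sub[of "Y x" x] by linarith
    then show "indicator {x. R < norm x} (Y x) * norm (Y x) \<le> 2 * (indicator {x. R - c < norm x} x * norm x)"
      using assms(4) by (auto simp: indicator_def)
  qed
  finally show ?thesis by (simp add: tail_def)
qed

text \<open>Each \<open>Lip1\<close> function, minus its value at 0, is smeared into a test
  function. It is N-Lipschitz for the Euclidean norm and at most 2 N R on the ball of radius 2 R, so
  the gradient bound is N + 2 N; smearing costs 3 N / R plus N times the tail for each of the two
  measures.\<close>

lemma W1_le_tests:
  fixes \<mu> \<nu> :: "(real ^ 'n::finite) measure"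
  defines "N \<equiv> real CARD('n)"
  assumes \<mu>: "\<mu> \<in> P1" "\<nu> \<in> P1" and R: "0 < R"
    and K: "\<And>L c (f :: real ^ 'n \<Rightarrow> real). tame R L c f \<Longrightarrow> bump_class (L + c) (K * c) (smear R f)"
    and B: "\<And>\<phi>. bump_class (3 * N) (K * (2 * N)) \<phi> \<Longrightarrow> (LINT x|\<mu>. \<phi> x) - (LINT x|\<nu>. \<phi> x) \<le> B"
  shows "W1 \<mu> \<nu> \<le> B + N * (6 / R + tail R \<mu> + tail R \<nu>)"
  unfolding W1_def
proof (rule cSUP_least)
  show "Lip1 \<noteq> ({} :: (real ^ 'n \<Rightarrow> real) set)" using zero_in_Lip1 by blast
  fix \<phi> :: "real ^ 'n \<Rightarrow> real" assume \<phi>: "\<phi> \<in> Lip1"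
  have N: "0 < N" by (simp add: N_def)
  let ?f = "\<lambda>x. \<phi> x - \<phi> 0"
  have lip: "\<bar>?f x - ?f y\<bar> \<le> N * norm (x - y)" for x y
    using Lip1_D[OF \<phi>, of x y] norm1_le_norm[of "x - y"] by (simp add: N_def)
  have fb: "\<bar>?f x\<bar> \<le> N * norm x" for x using lip[of x 0] by simp
  have t: "tame R N (2 * N) ?f"
    unfolding tame_def
  proof (intro conjI allI impI)
    fix x :: "real ^ 'n" assume "norm x \<le> 2 * R"
    then have "N * norm x \<le> N * (2 * R)" using N by simp
    then show "norm (?f x) \<le> 2 * N * R" using fb[of x] by simp
  qed (use R N lip in auto)
  have test: "(LINT x|\<mu>. smear R ?f x) - (LINT x|\<nu>. smear R ?f x) \<le> B"
    by (rule B) (use K[OF t] in simp)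
  have close: "\<bar>(LINT x|\<rho>. ?f x) - (LINT x|\<rho>. smear R ?f x)\<bar> \<le> N * (3 / R + tail R \<rho>) \<and>
      (LINT x|\<rho>. ?f x) = (LINT x|\<rho>. \<phi> x) - \<phi> 0" if \<rho>: "\<rho> \<in> P1" for \<rho>
  proof -
    interpret prob_space \<rho> using P1D(1)[OF \<rho>] .
    have i\<phi>: "integrable \<rho> \<phi>" by (rule Lip1_integrable[OF \<phi> \<rho>])
    have ism: "integrable \<rho> (smear R ?f)"
      by (rule P1_integrable_bounded[OF \<rho>, of _ "2 * N * R"])
         (auto intro!: borel_measurable_continuous_onI smear_continuous[OF t]
           mollify_bounded[OF R truncated_continuous[OF t] truncated_eq_0[OF t] truncated_bounded[OF t], folded smear_def, simplified])
    have "\<bar>(LINT x|\<rho>. ?f x) - (LINT x|\<rho>. smear R ?f x)\<bar> = norm (LINT x|\<rho>. smear R ?f x - ?f x)"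
      using i\<phi> ism by simp
    also have "\<dots> \<le> (LINT x|\<rho>. 3 * N / R + N * (indicator {x. R < norm x} x * norm x))"
    proof (rule Bochner_Integration.integral_norm_bound_integral)
      show "norm (smear R ?f x - ?f x) \<le> 3 * N / R + N * (indicator {x. R < norm x} x * norm x)" for x
        using smear_close[OF t, of x] fb[of x] by (auto simp: indicator_def split: if_splits)
    qed (use i\<phi> ism tail_integrable[OF \<rho>] in auto)
    also have "\<dots> = N * (3 / R + tail R \<rho>)"
      using tail_integrable[OF \<rho>] by (simp add: prob_space tail_def distrib_left)
    finally show ?thesis using i\<phi> by (simp add: prob_space)
  qed
  have "(LINT x|\<mu>. \<phi> x) - (LINT x|\<nu>. \<phi> x) \<le> B + N * (3 / R + tail R \<mu>) + N * (3 / R + tail R \<nu>)"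
    using test close[OF \<mu>(1)] close[OF \<mu>(2)] by linarith
  then show "(LINT x|\<mu>. \<phi> x) - (LINT x|\<nu>. \<phi> x) \<le> B + N * (6 / R + tail R \<mu> + tail R \<nu>)"
    by (simp add: algebra_simps)
qed

text \<open>The limit of \<open>W1_le_tests\<close> as \<open>R\<close> tends to infinity. Control
  of the second-order constant is lost on the way, so \<open>B\<close> has to serve for every
  \<open>K\<close>.\<close>

lemma W1_le_bump:
  fixes \<mu> \<nu> :: "(real ^ 'n::finite) measure"
  assumes \<mu>: "\<mu> \<in> P1" "\<nu> \<in> P1"
    and B: "\<And>K \<phi>. bump_class (3 * real CARD('n)) K \<phi> \<Longrightarrow> (LINT x|\<mu>. \<phi> x) - (LINT x|\<nu>. \<phi> x) \<le> B"
  shows "W1 \<mu> \<nu> \<le> B"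
proof (rule LIMSEQ_le_const)
  let ?N = "real CARD('n)"
  have "(\<lambda>n. B + ?N * (6 * inverse (real n) + tail (real n) \<mu> + tail (real n) \<nu>)) \<longlonglongrightarrow> B + ?N * (6 * 0 + 0 + 0)"
    by (intro tendsto_intros tail_tendsto \<mu> lim_inverse_n)
  then show "(\<lambda>n. B + ?N * (6 / real n + tail (real n) \<mu> + tail (real n) \<nu>)) \<longlonglongrightarrow> B"
    by (simp add: divide_inverse)
  have "W1 \<mu> \<nu> \<le> B + ?N * (6 / real n + tail (real n) \<mu> + tail (real n) \<nu>)" if "1 \<le> n" for n
  proof -
    have n: "0 < real n" using that by simp
    obtain K where "0 \<le> K" and K: "\<And>L c (f :: real ^ 'n \<Rightarrow> real). tame (real n) L c f \<Longrightarrow> bump_class (L + c) (K * c) (smear (real n) f)"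
      using smear_bump_class[OF n] by metis
    show ?thesis by (rule W1_le_tests[OF \<mu> n K]) (use B in auto)
  qed
  then show "\<exists>N. \<forall>n\<ge>N. W1 \<mu> \<nu> \<le> B + ?N * (6 / real n + tail (real n) \<mu> + tail (real n) \<nu>)" by blast
qed

section \<open>Controlled velocity fields\<close>

definition csize :: "real \<Rightarrow> real ^ 'm::finite \<Rightarrow> real" where
  "csize a b = \<bar>a\<bar> + norm1 b"

lemma csize_nonneg: "0 \<le> csize a b"
  by (simp add: csize_def norm1_nonneg)

text \<open>The Euclidean form of the assumption \<open>A1\<close>, with one constant for all bounds
  and Lipschitz constants; the change of norm costs a factor \<open>real CARD('n)\<close> in
  \<open>A1_drift\<close>.\<close>

locale drift =
  fixes f0 g :: "real ^ 'n::finite \<Rightarrow> real ^ 'n" and f :: "'m::finite \<Rightarrow> real ^ 'n \<Rightarrow> real ^ 'n" and c :: real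
  assumes c_pos: "0 < c"
    and field_bounds: "\<And>x. norm (f0 x) \<le> c" "\<And>i x. norm (f i x) \<le> c" "\<And>x. norm (g x) \<le> c"
    and field_lipschitz: "\<And>x y. norm (f0 x - f0 y) \<le> c * norm (x - y)"
      "\<And>i x y. norm (f i x - f i y) \<le> c * norm (x - y)"
      "\<And>x y. norm (g x - g y) \<le> c * norm (x - y)"

lemma A1_drift:
  fixes f0 g :: "real ^ 'n::finite \<Rightarrow> real ^ 'n" and f :: "'m::finite \<Rightarrow> real ^ 'n \<Rightarrow> real ^ 'n"
  assumes "A1 f0 f g"
  obtains c where "drift f0 g f c"
proof -
  obtain C L where CL: "0 < C" "0 < L"
    and b: "\<And>x. norm1 (f0 x) + (\<Sum>i\<in>UNIV. norm1 (f i x)) + norm1 (g x) \<le> C"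
    and l: "\<And>x y. norm1 (f0 x - f0 y) + (\<Sum>i\<in>UNIV. norm1 (f i x - f i y)) + norm1 (g x - g y) \<le> L * norm1 (x - y)"
    using assms unfolding A1_def by blast
  have s: "norm1 (f i x) \<le> (\<Sum>i\<in>UNIV. norm1 (f i x))"
    "norm1 (f i x - f i y) \<le> (\<Sum>i\<in>UNIV. norm1 (f i x - f i y))" for i x y
    by (rule member_le_sum; simp add: norm1_nonneg)+
  have sn: "0 \<le> (\<Sum>i\<in>UNIV. norm1 (f i x))" "0 \<le> (\<Sum>i\<in>UNIV. norm1 (f i x - f i y))" for x y
    by (simp_all add: sum_nonneg norm1_nonneg)
  let ?c = "max C (L * real CARD('n))"
  have b': "norm v \<le> ?c" if "norm1 v \<le> C" for v :: "real ^ 'n"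
    using norm_le_norm1[of v] that by linarith
  have l': "norm v \<le> ?c * norm (x - y)" if "norm1 v \<le> L * norm1 (x - y)" for v x y :: "real ^ 'n"
  proof -
    have "norm v \<le> L * norm1 (x - y)" using norm_le_norm1[of v] that by linarith
    also have "\<dots> \<le> L * (real CARD('n) * norm (x - y))"
      using CL norm1_le_norm[of "x - y"] by (intro mult_left_mono) auto
    also have "\<dots> \<le> ?c * norm (x - y)" by (simp flip: mult.assoc add: mult_right_mono)
    finally show ?thesis .
  qed
  have "drift f0 g f ?c"
  proof
    show "0 < ?c" using CL by simp
    fix x y :: "real ^ 'n" and i
    note * = b[of x] l[of x y] s(1)[of i x] s(2)[of i x y] sn(1)[of x] sn(2)[of x y]
      norm1_nonneg[of "f0 x"] norm1_nonneg[of "g x"] norm1_nonneg[of "f0 x - f0 y"] norm1_nonneg[of "g x - g y"]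
    show "norm (f0 x) \<le> ?c" "norm (f i x) \<le> ?c" "norm (g x) \<le> ?c"
      by (rule b'; use * in linarith)+
    show "norm (f0 x - f0 y) \<le> ?c * norm (x - y)" "norm (f i x - f i y) \<le> ?c * norm (x - y)"
      "norm (g x - g y) \<le> ?c * norm (x - y)"
      by (rule l'; use * in linarith)+
  qed
  then show thesis by (rule that)
qed

context drift
begin

lemma g_shift_measurable: "(\<lambda>y. g (x - y)) \<in> borel_measurable borel"
  by (rule lipschitz_measurable[of _ c])
     (use field_lipschitz(3)[of "x - y" "x - z" for y z] in \<open>simp add: norm_minus_commute\<close>)

lemma g_shift_integrable: "\<mu> \<in> P1 \<Longrightarrow> integrable \<mu> (\<lambda>y. g (x - y))"
  by (rule P1_integrable_bounded[OF _ g_shift_measurable field_bounds(3)])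

lemma conv_bounded: "\<mu> \<in> P1 \<Longrightarrow> norm (conv g \<mu> x) \<le> c"
  unfolding conv_def by (rule P1_integral_bounded[OF _ field_bounds(3)])

lemma conv_lipschitz: "\<mu> \<in> P1 \<Longrightarrow> norm (conv g \<mu> x - conv g \<mu> y) \<le> c * norm (x - y)"
proof -
  assume \<mu>: "\<mu> \<in> P1"
  have "conv g \<mu> x - conv g \<mu> y = (LINT z|\<mu>. g (x - z) - g (y - z))"
    using g_shift_integrable[OF \<mu>] by (simp add: conv_def)
  also have "norm \<dots> \<le> c * norm (x - y)"
    by (rule P1_integral_bounded[OF \<mu>]) (use field_lipschitz(3)[of "x - z" "y - z" for z] in simp)
  finally show ?thesis .
qed

lemma conv_diff: "\<mu> \<in> P1 \<Longrightarrow> \<nu> \<in> P1 \<Longrightarrow> norm (conv g \<mu> x - conv g \<nu> x) \<le> real CARD('n) * c * W1 \<mu> \<nu>"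
proof -
  assume \<mu>: "\<mu> \<in> P1" "\<nu> \<in> P1"
  have comp: "conv g \<rho> x $ i = (LINT y|\<rho>. g (x - y) $ i)" if "\<rho> \<in> P1" for \<rho> i
    unfolding conv_def
    using integral_inner_left[of "axis i 1" \<rho> "\<lambda>y. g (x - y)"] g_shift_integrable[OF that]
    by (simp add: inner_axis)
  have "\<bar>conv g \<mu> x $ i - conv g \<nu> x $ i\<bar> \<le> c * W1 \<mu> \<nu>" for i
    unfolding comp[OF \<mu>(1)] comp[OF \<mu>(2)]
  proof (rule lipschitz_integral[OF \<mu>])
    fix y z
    have "\<bar>g (x - y) $ i - g (x - z) $ i\<bar> \<le> norm (g (x - y) - g (x - z))"
      using component_le_norm_cart[of "g (x - y) - g (x - z)" i] by simp
    then show "\<bar>g (x - y) $ i - g (x - z) $ i\<bar> \<le> c * norm (y - z)"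
      using field_lipschitz(3)[of "x - y" "x - z"] by (simp add: norm_minus_commute)
  qed (use c_pos in simp)
  then have "norm1 (conv g \<mu> x - conv g \<nu> x) \<le> (\<Sum>i\<in>(UNIV :: 'n set). c * W1 \<mu> \<nu>)"
    unfolding norm1_def by (intro sum_mono) simp
  then show ?thesis using norm_le_norm1[of "conv g \<mu> x - conv g \<nu> x"] by simp
qed

text \<open>One field for both systems: \<open>a = 1\<close>, \<open>b = u\<close> gives the
  original one and \<open>a = \<alpha>\<close>, \<open>b = \<beta>\<close> the reduced one.\<close>

definition velocity :: "real \<Rightarrow> real ^ 'm \<Rightarrow> (real ^ 'n) measure \<Rightarrow> real ^ 'n \<Rightarrow> real ^ 'n" where
  "velocity a b \<mu> x = a *\<^sub>R (f0 x + conv g \<mu> x) + (\<Sum>i\<in>UNIV. b $ i *\<^sub>R f i x)"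

lemma velocity_est:
  fixes b :: "real ^ 'm"
  assumes "norm u \<le> 2 * c * e" "\<And>i. norm (w i) \<le> c * e" "0 \<le> e"
  shows "norm (a *\<^sub>R u + (\<Sum>i\<in>UNIV. b $ i *\<^sub>R w i)) \<le> 2 * c * csize a b * e"
proof -
  have "norm (\<Sum>i\<in>UNIV. b $ i *\<^sub>R w i) \<le> (\<Sum>i\<in>UNIV. \<bar>b $ i\<bar> * (c * e))"
    by (rule sum_norm_le) (simp add: assms mult_left_mono)
  also have "\<dots> = norm1 b * (c * e)" by (simp add: norm1_def sum_distrib_right)
  also have "\<dots> \<le> norm1 b * (2 * c * e)"
    using assms(3) c_pos by (intro mult_left_mono norm1_nonneg) auto
  finally have 1: "norm (\<Sum>i\<in>UNIV. b $ i *\<^sub>R w i) \<le> norm1 b * (2 * c * e)" .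
  have "norm (a *\<^sub>R u) \<le> \<bar>a\<bar> * (2 * c * e)" by (simp add: assms(1) mult_left_mono)
  with 1 have "norm (a *\<^sub>R u + (\<Sum>i\<in>UNIV. b $ i *\<^sub>R w i)) \<le> \<bar>a\<bar> * (2 * c * e) + norm1 b * (2 * c * e)"
    by (intro order_trans[OF norm_triangle_ineq] add_mono)
  then show ?thesis by (simp add: csize_def algebra_simps)
qed

lemma velocity_bounded: "\<mu> \<in> P1 \<Longrightarrow> norm (velocity a b \<mu> x) \<le> 2 * c * csize a b"
proof -
  assume \<mu>: "\<mu> \<in> P1"
  have "norm (f0 x + conv g \<mu> x) \<le> 2 * c"
    using norm_triangle_ineq[of "f0 x" "conv g \<mu> x"] field_bounds(1)[of x] conv_bounded[OF \<mu>, of x] by linarith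
  then show ?thesis
    using velocity_est[of "f0 x + conv g \<mu> x" 1 "\<lambda>i. f i x" a b] field_bounds(2)[of _ x] by (simp add: velocity_def)
qed

lemma velocity_lipschitz:
  "\<mu> \<in> P1 \<Longrightarrow> norm (velocity a b \<mu> x - velocity a b \<mu> y) \<le> 2 * c * csize a b * norm (x - y)"
proof -
  assume \<mu>: "\<mu> \<in> P1"
  have "norm ((f0 x - f0 y) + (conv g \<mu> x - conv g \<mu> y)) \<le> 2 * c * norm (x - y)"
    using norm_triangle_ineq[of "f0 x - f0 y" "conv g \<mu> x - conv g \<mu> y"]
      field_lipschitz(1)[of x y] conv_lipschitz[OF \<mu>, of x y] by linarith
  moreover have "velocity a b \<mu> x - velocity a b \<mu> y =
      a *\<^sub>R ((f0 x - f0 y) + (conv g \<mu> x - conv g \<mu> y)) + (\<Sum>i\<in>UNIV. b $ i *\<^sub>R (f i x - f i y))"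
    by (simp add: velocity_def algebra_simps sum_subtractf)
  ultimately show ?thesis
    using velocity_est[of _ "norm (x - y)" "\<lambda>i. f i x - f i y" a b] field_lipschitz(2)[of _ x y] by simp
qed

lemma velocity_diff:
  "\<mu> \<in> P1 \<Longrightarrow> \<nu> \<in> P1 \<Longrightarrow> norm (velocity a b \<mu> x - velocity a b \<nu> x) \<le> \<bar>a\<bar> * (real CARD('n) * c * W1 \<mu> \<nu>)"
proof -
  assume \<mu>: "\<mu> \<in> P1" "\<nu> \<in> P1"
  have "velocity a b \<mu> x - velocity a b \<nu> x = a *\<^sub>R (conv g \<mu> x - conv g \<nu> x)"
    by (simp add: velocity_def algebra_simps)
  then show ?thesis using conv_diff[OF \<mu>, of x] by (simp add: mult_left_mono)
qed

lemma velocity_expand: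
  "velocity a b \<mu> x = a *\<^sub>R velocity 1 0 \<mu> x + (\<Sum>i\<in>UNIV. b $ i *\<^sub>R velocity 0 (axis i 1) \<mu> x)"
proof -
  have "(\<Sum>j\<in>UNIV. axis i 1 $ j *\<^sub>R f j x) = f i x" for i
    by (simp add: axis_def if_distrib[of "\<lambda>r. r *\<^sub>R _"] cong: if_cong)
  then show ?thesis by (simp add: velocity_def)
qed

text \<open>The rate at which the integral of \<open>\<phi>\<close> changes along the continuity
  equation.\<close>

definition pairing :: "(real ^ 'n \<Rightarrow> real) \<Rightarrow> real \<Rightarrow> real ^ 'm \<Rightarrow> (real ^ 'n) measure \<Rightarrow> real" where
  "pairing \<phi> a b \<mu> = (LINT x|\<mu>. frechet_derivative \<phi> (at x) (velocity a b \<mu> x))"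

context
  fixes \<phi> :: "real ^ 'n \<Rightarrow> real" and l K :: real
  assumes \<phi>: "bump_class l K \<phi>" and lK: "0 \<le> l" "0 \<le> K"
begin

lemma derivative_lipschitz_field:
  assumes "\<And>x. norm (F x) \<le> B" "\<And>x y. norm (F x - F y) \<le> B * norm (x - y)"
  shows "\<bar>frechet_derivative \<phi> (at x) (F x) - frechet_derivative \<phi> (at y) (F y)\<bar> \<le> (K + l) * B * norm (x - y)"
proof -
  have lin: "linear (frechet_derivative \<phi> (at y))"
    using bump_classD(5)[OF \<phi>] has_derivative_linear by blast
  have "\<bar>frechet_derivative \<phi> (at x) (F x) - frechet_derivative \<phi> (at y) (F y)\<bar>
      \<le> \<bar>frechet_derivative \<phi> (at x) (F x) - frechet_derivative \<phi> (at y) (F x)\<bar>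
        + \<bar>frechet_derivative \<phi> (at y) (F x - F y)\<bar>"
    by (simp add: linear_diff[OF lin])
  also have "\<dots> \<le> K * norm (x - y) * norm (F x) + l * norm (F x - F y)"
    by (intro add_mono bump_classD[OF \<phi>])
  also have "\<dots> \<le> K * norm (x - y) * B + l * (B * norm (x - y))"
    by (intro add_mono mult_left_mono assms) (use lK in auto)
  finally show ?thesis by (simp add: algebra_simps)
qed

lemma derivative_field_measurable:
  assumes "continuous_on UNIV F"
  shows "(\<lambda>x. frechet_derivative \<phi> (at x) (F x)) \<in> borel_measurable borel"
proof -
  have lin: "linear (frechet_derivative \<phi> (at x))" for x
    using bump_classD(5)[OF \<phi>] has_derivative_linear by blast
  have "frechet_derivative \<phi> (at x) (F x) = (\<Sum>b\<in>Basis. (F x \<bullet> b) * frechet_derivative \<phi> (at x) b)" for x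
    using linear_sum[OF lin, of x "\<lambda>b. (F x \<bullet> b) *\<^sub>R b" Basis] linear_scale[OF lin]
    by (simp add: euclidean_representation)
  moreover have "continuous_on UNIV (\<lambda>x. \<Sum>b\<in>Basis. (F x \<bullet> b) * frechet_derivative \<phi> (at x) b)"
    using bump_classD(1)[OF \<phi>, of "Suc 0"] by (intro continuous_intros assms) auto
  ultimately show ?thesis by (simp add: borel_measurable_continuous_onI)
qed

lemma derivative_velocity_measurable:
  "\<mu> \<in> P1 \<Longrightarrow> (\<lambda>x. frechet_derivative \<phi> (at x) (velocity a b \<mu> x)) \<in> borel_measurable borel"
  by (rule derivative_field_measurable[OF lipschitz_continuous_on[OF velocity_lipschitz]])

lemma derivative_velocity_bounded:
  "\<mu> \<in> P1 \<Longrightarrow> \<bar>frechet_derivative \<phi> (at x) (velocity a b \<mu> x)\<bar> \<le> l * (2 * c * csize a b)"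
  by (rule order_trans[OF bump_classD(3)[OF \<phi>] mult_left_mono[OF velocity_bounded lK(1)]])

lemma derivative_velocity_integrable:
  "\<mu> \<in> P1 \<Longrightarrow> \<nu> \<in> P1 \<Longrightarrow> integrable \<nu> (\<lambda>x. frechet_derivative \<phi> (at x) (velocity a b \<mu> x))"
  by (rule P1_integrable_bounded[of _ _ "l * (2 * c * csize a b)"])
     (use derivative_velocity_measurable derivative_velocity_bounded in auto)

lemma pairing_bounded: "\<mu> \<in> P1 \<Longrightarrow> \<bar>pairing \<phi> a b \<mu>\<bar> \<le> l * (2 * c * csize a b)"
  unfolding pairing_def
  using P1_integral_bounded[of \<mu> "\<lambda>x. frechet_derivative \<phi> (at x) (velocity a b \<mu> x)" "l * (2 * c * csize a b)"]
    derivative_velocity_bounded by simp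

text \<open>Separates the controls, merely measurable in time, from integrals that are Lipschitz in
  \<open>\<mu>\<close> for \<open>W1\<close>.\<close>

lemma pairing_expand:
  assumes \<mu>: "\<mu> \<in> P1"
  shows "pairing \<phi> a b \<mu> = a * pairing \<phi> 1 0 \<mu> + (\<Sum>i\<in>UNIV. b $ i * pairing \<phi> 0 (axis i 1) \<mu>)"
proof -
  have lin: "linear (frechet_derivative \<phi> (at x))" for x
    using bump_classD(5)[OF \<phi>] has_derivative_linear by blast
  have "frechet_derivative \<phi> (at x) (velocity a b \<mu> x) =
      a * frechet_derivative \<phi> (at x) (velocity 1 0 \<mu> x) +
      (\<Sum>i\<in>UNIV. b $ i * frechet_derivative \<phi> (at x) (velocity 0 (axis i 1) \<mu> x))" for x
    by (subst velocity_expand) (simp add: linear_add[OF lin] linear_scale[OF lin] linear_sum[OF lin])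
  then show ?thesis
    unfolding pairing_def using derivative_velocity_integrable[OF \<mu> \<mu>]
    by simp
qed

text \<open>The measure enters twice, as the integrating measure and inside the convolution; the two
  effects give the two summands of the constant.\<close>

lemma pairing_diff:
  assumes \<mu>: "\<mu> \<in> P1" "\<nu> \<in> P1"
  shows "\<bar>pairing \<phi> a b \<mu> - pairing \<phi> a b \<nu>\<bar> \<le> (2 * c + real CARD('n) * c) * (K + l) * csize a b * W1 \<mu> \<nu>"
proof -
  let ?D = "\<lambda>x. frechet_derivative \<phi> (at x)"
  have lin: "linear (?D x)" for x
    using bump_classD(5)[OF \<phi>] has_derivative_linear by blast
  have W: "0 \<le> W1 \<mu> \<nu>" by (rule W1_nonneg[OF \<mu>])
  have 1: "\<bar>(LINT x|\<mu>. ?D x (velocity a b \<mu> x)) - (LINT x|\<nu>. ?D x (velocity a b \<mu> x))\<bar>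
      \<le> (K + l) * (2 * c * csize a b) * W1 \<mu> \<nu>"
    by (rule lipschitz_integral[OF \<mu>], use lK c_pos csize_nonneg[of a b] in simp)
       (rule derivative_lipschitz_field[OF velocity_bounded[OF \<mu>(1)] velocity_lipschitz[OF \<mu>(1)]])
  have "(LINT x|\<nu>. ?D x (velocity a b \<mu> x)) - (LINT x|\<nu>. ?D x (velocity a b \<nu> x))
      = (LINT x|\<nu>. ?D x (velocity a b \<mu> x - velocity a b \<nu> x))"
    using derivative_velocity_integrable \<mu> by (simp add: linear_diff[OF lin])
  also have "\<bar>\<dots>\<bar> \<le> l * (\<bar>a\<bar> * (real CARD('n) * c * W1 \<mu> \<nu>))"
  proof -
    have "norm (LINT x|\<nu>. ?D x (velocity a b \<mu> x - velocity a b \<nu> x)) \<le> l * (\<bar>a\<bar> * (real CARD('n) * c * W1 \<mu> \<nu>))"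
    proof (rule P1_integral_bounded[OF \<mu>(2)])
      show "norm (?D x (velocity a b \<mu> x - velocity a b \<nu> x)) \<le> l * (\<bar>a\<bar> * (real CARD('n) * c * W1 \<mu> \<nu>))" for x
        using order_trans[OF bump_classD(3)[OF \<phi>] mult_left_mono[OF velocity_diff[OF \<mu>] lK(1)]] by simp
    qed
    then show ?thesis by simp
  qed
  also have "\<dots> \<le> (K + l) * (csize a b * (real CARD('n) * c * W1 \<mu> \<nu>))"
    using lK c_pos W norm1_nonneg[of b] by (intro mult_mono) (auto simp: csize_def)
  finally show ?thesis using 1 unfolding pairing_def by (simp add: algebra_simps)
qed

end

end

section \<open>Integral form of the equation\<close>

lemma set_integrable_bounded:
  fixes h :: "real \<Rightarrow> 'b::euclidean_space"
  assumes "set_borel_measurable borel {0..\<tau>} h" "AE r in lborel. r \<in> {0..\<tau>} \<longrightarrow> norm (h r) \<le> B"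
  shows "set_integrable lborel {0..\<tau>} h"
  unfolding set_integrable_def
proof (rule integrableI_bounded_set[where A = "{0..\<tau>}" and B = B])
  show "(\<lambda>x. indicator {0..\<tau>} x *\<^sub>R h x) \<in> borel_measurable lborel"
    using assms(1) by (simp add: set_borel_measurable_def)
  show "emeasure lborel {0..\<tau>} < \<infinity>" by (simp add: emeasure_lborel_Icc_eq)
  show "AE x\<in>{0..\<tau>} in lborel. norm (indicator {0..\<tau>} x *\<^sub>R h x) \<le> B"
    using assms(2) by eventually_elim auto
qed auto

lemma set_integrable_sum:
  fixes h :: "'i \<Rightarrow> 'a \<Rightarrow> 'b::{banach, second_countable_topology}"
  assumes "\<And>i. i \<in> I \<Longrightarrow> set_integrable M A (h i)"
  shows "set_integrable M A (\<lambda>x. \<Sum>i\<in>I. h i x)"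
  using assms unfolding set_integrable_def scaleR_sum_right by (rule Bochner_Integration.integrable_sum)

lemma set_integrable_Icc_subset:
  fixes h :: "real \<Rightarrow> 'b::euclidean_space"
  shows "set_integrable lborel {0..\<tau>} h \<Longrightarrow> 0 \<le> s \<Longrightarrow> t \<le> \<tau> \<Longrightarrow> set_integrable lborel {s..t} h"
  by (rule set_integrable_subset) auto

lemma set_borel_measurable_mult_continuous:
  fixes q :: "real \<Rightarrow> real" and h :: "real \<Rightarrow> 'b::euclidean_space"
  assumes "set_borel_measurable borel {0..\<tau>} h" "continuous_on {0..\<tau>} q"
  shows "set_borel_measurable borel {0..\<tau>} (\<lambda>r. q r *\<^sub>R h r)"
proof -
  have "(\<lambda>r. (indicator {0..\<tau>} r *\<^sub>R q r) *\<^sub>R (indicator {0..\<tau>} r *\<^sub>R h r)) \<in> borel_measurable borel"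
    by (rule borel_measurable_scaleR)
       (use assms borel_measurable_continuous_on_indicator[OF _ assms(2)] in \<open>auto simp: set_borel_measurable_def\<close>)
  then show ?thesis
    unfolding set_borel_measurable_def
    by (rule measurable_cong[THEN iffD1, rotated]) (auto simp: indicator_def)
qed

lemma set_integrable_mult_continuous:
  fixes q :: "real \<Rightarrow> real" and h :: "real \<Rightarrow> 'b::euclidean_space"
  assumes "set_borel_measurable borel {0..\<tau>} h" "AE r in lborel. r \<in> {0..\<tau>} \<longrightarrow> norm (h r) \<le> B"
    and "continuous_on {0..\<tau>} q"
  shows "set_integrable lborel {0..\<tau>} (\<lambda>r. q r *\<^sub>R h r)"
proof -
  have "bounded (q ` {0..\<tau>})"
    using assms(3) compact_continuous_image compact_imp_bounded by blast
  then obtain Q where Q: "\<And>r. r \<in> {0..\<tau>} \<Longrightarrow> \<bar>q r\<bar> \<le> Q"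
    unfolding bounded_iff by (metis image_eqI real_norm_def)
  have "AE r in lborel. r \<in> {0..\<tau>} \<longrightarrow> norm (q r *\<^sub>R h r) \<le> \<bar>Q\<bar> * B"
    using assms(2)
  proof eventually_elim
    case (elim r)
    show ?case
    proof
      assume r: "r \<in> {0..\<tau>}"
      have "\<bar>q r\<bar> * norm (h r) \<le> \<bar>Q\<bar> * B" using elim r Q[OF r] by (intro mult_mono) auto
      then show "norm (q r *\<^sub>R h r) \<le> \<bar>Q\<bar> * B" by simp
    qed
  qed
  then show ?thesis
    by (rule set_integrable_bounded[OF set_borel_measurable_mult_continuous[OF assms(1,3)]])
qed

definition coefficients :: "real \<Rightarrow> real \<Rightarrow> (real \<Rightarrow> real) \<Rightarrow> (real \<Rightarrow> real ^ 'm::finite) \<Rightarrow> bool" where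
  "coefficients \<tau> B a b \<longleftrightarrow> set_borel_measurable borel {0..\<tau>} a \<and> set_borel_measurable borel {0..\<tau>} b \<and>
    0 \<le> B \<and> (AE r in lborel. r \<in> {0..\<tau>} \<longrightarrow> csize (a r) (b r) \<le> B)"

lemma abs_component_le_norm1: "\<bar>b $ i\<bar> \<le> norm1 b"
  unfolding norm1_def by (rule member_le_sum) auto

lemma set_borel_measurable_component:
  fixes b :: "real \<Rightarrow> real ^ 'm::finite"
  assumes "set_borel_measurable borel A b"
  shows "set_borel_measurable borel A (\<lambda>r. b r $ i)"
proof -
  have "(\<lambda>r. (indicator A r *\<^sub>R b r) \<bullet> axis i 1) \<in> borel_measurable borel"
    using assms by (intro borel_measurable_inner) (auto simp: set_borel_measurable_def)
  then show ?thesis by (simp add: set_borel_measurable_def inner_axis)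
qed

context
  fixes \<tau> B :: real and a :: "real \<Rightarrow> real" and b :: "real \<Rightarrow> real ^ 'm::finite"
  assumes co: "coefficients \<tau> B a b"
begin

lemma coefficientsD:
  "set_borel_measurable borel {0..\<tau>} a" "set_borel_measurable borel {0..\<tau>} b" "0 \<le> B"
  "AE r in lborel. r \<in> {0..\<tau>} \<longrightarrow> csize (a r) (b r) \<le> B"
  "AE r in lborel. r \<in> {0..\<tau>} \<longrightarrow> norm (a r) \<le> B"
  "AE r in lborel. r \<in> {0..\<tau>} \<longrightarrow> norm (b r) \<le> B"
  "AE r in lborel. r \<in> {0..\<tau>} \<longrightarrow> norm (b r $ i) \<le> B"
proof -
  show c: "AE r in lborel. r \<in> {0..\<tau>} \<longrightarrow> csize (a r) (b r) \<le> B"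
    using co by (simp add: coefficients_def)
  have 1: "\<bar>a r\<bar> \<le> csize (a r) (b r)" for r using norm1_nonneg[of "b r"] by (simp add: csize_def)
  have 2: "norm (b r) \<le> csize (a r) (b r)" for r using norm_le_norm1[of "b r"] by (simp add: csize_def)
  have 3: "\<bar>b r $ i\<bar> \<le> csize (a r) (b r)" for r using abs_component_le_norm1[of "b r" i] by (simp add: csize_def)
  show "AE r in lborel. r \<in> {0..\<tau>} \<longrightarrow> norm (a r) \<le> B"
    using c by eventually_elim (auto intro: order_trans[OF 1])
  show "AE r in lborel. r \<in> {0..\<tau>} \<longrightarrow> norm (b r) \<le> B"
    using c by eventually_elim (auto intro: order_trans[OF 2])
  show "AE r in lborel. r \<in> {0..\<tau>} \<longrightarrow> norm (b r $ i) \<le> B"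
    using c by eventually_elim (auto intro: order_trans[OF 3])
qed (use co in \<open>auto simp: coefficients_def\<close>)

lemma coefficients_integrable:
  assumes "0 \<le> s" "t \<le> \<tau>"
  shows "set_integrable lborel {s..t} a" "set_integrable lborel {s..t} b" "set_integrable lborel {s..t} (\<lambda>r. b r $ i)"
  by (rule set_integrable_Icc_subset[OF set_integrable_bounded assms];
      rule coefficientsD set_borel_measurable_component[OF coefficientsD(2)])+

lemma coefficients_integral_component:
  assumes "0 \<le> s" "t \<le> \<tau>"
  shows "(LINT r:{s..t}|lborel. b r) $ i = (LINT r:{s..t}|lborel. b r $ i)"
  using integral_inner_left[of "axis i 1" lborel "\<lambda>r. indicator {s..t} r *\<^sub>R b r"] coefficients_integrable(2)[OF assms]
  by (simp add: set_integrable_def set_lebesgue_integral_def inner_axis)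

lemma set_integral_le_bound:
  assumes "0 \<le> s" "s \<le> t" "t \<le> \<tau>" "set_integrable lborel {s..t} h"
    and "AE r in lborel. r \<in> {s..t} \<longrightarrow> h r \<le> C"
  shows "(LINT r:{s..t}|lborel. h r) \<le> C * (t - s)"
proof -
  have "(LINT r:{s..t}|lborel. h r) \<le> (LINT r:{s..t}|lborel. C)"
    unfolding set_lebesgue_integral_def
  proof (rule integral_mono_AE)
    show "integrable lborel (\<lambda>r. indicator {s..t} r *\<^sub>R h r)"
      using assms(4) by (simp add: set_integrable_def)
    show "integrable lborel (\<lambda>r. indicator {s..t} r *\<^sub>R C)"
      by (intro integrable_scaleR_left integrable_real_indicator) (auto simp: emeasure_lborel_Icc_eq)
    show "AE r in lborel. indicator {s..t} r *\<^sub>R h r \<le> indicator {s..t} r *\<^sub>R C"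
      using assms(5) by eventually_elim (auto simp: indicator_def)
  qed
  then show ?thesis using assms by (simp add: set_lebesgue_integral_def mult.commute)
qed

lemma csize_integral_le:
  assumes "0 \<le> s" "s \<le> t" "t \<le> \<tau>"
  shows "csize (LINT r:{s..t}|lborel. a r) (LINT r:{s..t}|lborel. b r) \<le> B * (t - s)"
proof -
  note i = coefficients_integrable[OF assms(1,3)]
  have ia: "set_integrable lborel {s..t} (\<lambda>r. \<bar>a r\<bar>)" "set_integrable lborel {s..t} (\<lambda>r. \<bar>b r $ j\<bar>)" for j
    using set_integrable_abs[OF i(1)] set_integrable_abs[OF i(3)] by auto
  have ab: "\<bar>LINT r:{s..t}|lborel. h r\<bar> \<le> (LINT r:{s..t}|lborel. \<bar>h r\<bar>)" for h :: "real \<Rightarrow> real"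
    unfolding set_lebesgue_integral_def
    by (rule order_trans[OF integral_abs_bound]) (simp add: abs_mult)
  have is1: "set_integrable lborel {s..t} (\<lambda>r. norm1 (b r))"
    unfolding norm1_def by (intro set_integrable_sum ia)
  have "norm1 (LINT r:{s..t}|lborel. b r) \<le> (\<Sum>j\<in>UNIV. LINT r:{s..t}|lborel. \<bar>b r $ j\<bar>)"
    unfolding norm1_def coefficients_integral_component[OF assms(1,3)] by (intro sum_mono ab)
  also have "\<dots> = (LINT r:{s..t}|lborel. norm1 (b r))"
    unfolding norm1_def using ia(2)
    by (simp add: set_lebesgue_integral_def set_integrable_def sum_distrib_left flip: Bochner_Integration.integral_sum)
  finally have "csize (LINT r:{s..t}|lborel. a r) (LINT r:{s..t}|lborel. b r)
      \<le> (LINT r:{s..t}|lborel. \<bar>a r\<bar>) + (LINT r:{s..t}|lborel. norm1 (b r))"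
    using ab[of a] by (simp add: csize_def)
  also have "\<dots> = (LINT r:{s..t}|lborel. csize (a r) (b r))"
    unfolding csize_def using ia(1) is1 by (rule set_integral_add(2)[symmetric])
  also have "\<dots> \<le> B * (t - s)"
  proof (rule set_integral_le_bound[OF assms])
    show "set_integrable lborel {s..t} (\<lambda>r. csize (a r) (b r))"
      unfolding csize_def using ia(1) is1 by (rule set_integral_add(1))
    show "AE r in lborel. r \<in> {s..t} \<longrightarrow> csize (a r) (b r) \<le> B"
      using coefficientsD(4) by eventually_elim (use assms in auto)
  qed
  finally show ?thesis .
qed

end

section \<open>Solutions in integral form\<close>

definition W1_continuous :: "real \<Rightarrow> (real \<Rightarrow> (real ^ 'n::finite) measure) \<Rightarrow> bool" where
  "W1_continuous \<tau> \<nu> \<longleftrightarrow> (\<forall>s\<in>{0..\<tau>}. \<nu> s \<in> P1) \<and>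
    (\<forall>s\<in>{0..\<tau>}. ((\<lambda>r. W1 (\<nu> r) (\<nu> s)) \<longlongrightarrow> 0) (at s within {0..\<tau>}))"

lemma W1_continuous_functional:
  assumes "W1_continuous \<tau> \<nu>"
    and "\<And>\<mu> \<mu>'. \<mu> \<in> P1 \<Longrightarrow> \<mu>' \<in> P1 \<Longrightarrow> \<bar>F \<mu> - F \<mu>'\<bar> \<le> C * W1 \<mu> \<mu>'"
  shows "continuous_on {0..\<tau>} (\<lambda>r. F (\<nu> r) :: real)"
  unfolding continuous_on_def
proof
  have P: "\<nu> r \<in> P1" if "r \<in> {0..\<tau>}" for r using assms(1) that by (simp add: W1_continuous_def)
  fix s assume s: "s \<in> {0..\<tau>}"
  have "((\<lambda>r. C * W1 (\<nu> r) (\<nu> s)) \<longlongrightarrow> C * 0) (at s within {0..\<tau>})"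
    using assms(1) s by (intro tendsto_intros) (simp add: W1_continuous_def)
  then have lim: "((\<lambda>r. C * W1 (\<nu> r) (\<nu> s)) \<longlongrightarrow> 0) (at s within {0..\<tau>})" by simp
  have "((\<lambda>r. F (\<nu> r) - F (\<nu> s)) \<longlongrightarrow> 0) (at s within {0..\<tau>})"
  proof (rule Lim_null_comparison[OF _ lim])
    show "\<forall>\<^sub>F r in at s within {0..\<tau>}. norm (F (\<nu> r) - F (\<nu> s)) \<le> C * W1 (\<nu> r) (\<nu> s)"
      unfolding eventually_at_filter
      by (rule always_eventually) (use assms(2) P s in simp)
  qed
  then show "((\<lambda>r. F (\<nu> r)) \<longlongrightarrow> F (\<nu> s)) (at s within {0..\<tau>})"
    by (simp add: LIM_zero_iff)
qed

context drift
begin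

text \<open>Tests that do not depend on time, on arbitrary subintervals: the form in which a
  solution can be followed step by step. \<open>weak_solution_solves\<close> derives it from the
  weak formulation.\<close>

definition solves :: "real \<Rightarrow> (real \<Rightarrow> real) \<Rightarrow> (real \<Rightarrow> real ^ 'm) \<Rightarrow> (real \<Rightarrow> (real ^ 'n) measure) \<Rightarrow> bool" where
  "solves \<tau> a b \<nu> \<longleftrightarrow> W1_continuous \<tau> \<nu> \<and>
    (\<forall>\<phi> l K s t. bump_class l K \<phi> \<and> 0 \<le> s \<and> s \<le> t \<and> t \<le> \<tau> \<longrightarrow>
      (LINT x|\<nu> t. \<phi> x) - (LINT x|\<nu> s. \<phi> x) = (LINT r:{s..t}|lborel. pairing \<phi> (a r) (b r) (\<nu> r)))"

text \<open>Integrability in time comes from \<open>pairing_expand\<close>: products of bounded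
  measurable controls with functions that are continuous along the curve.\<close>

lemma pairing_set_integrable:
  assumes "coefficients \<tau> B a b" "W1_continuous \<tau> \<nu>" "bump_class l K \<phi>" "0 \<le> l" "0 \<le> K"
  shows "set_integrable lborel {0..\<tau>} (\<lambda>r. pairing \<phi> (a r) (b r) (\<nu> r))"
proof -
  have P: "\<nu> r \<in> P1" if "r \<in> {0..\<tau>}" for r using assms(2) that by (simp add: W1_continuous_def)
  have q: "continuous_on {0..\<tau>} (\<lambda>r. pairing \<phi> a' b' (\<nu> r))" for a' b'
    by (rule W1_continuous_functional[OF assms(2) pairing_diff[OF assms(3-5)]])
  have "set_integrable lborel {0..\<tau>} (\<lambda>r. pairing \<phi> 1 0 (\<nu> r) *\<^sub>R a r)"
    by (rule set_integrable_mult_continuous[OF _ _ q]) (rule coefficientsD[OF assms(1)])+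
  moreover have "set_integrable lborel {0..\<tau>} (\<lambda>r. pairing \<phi> 0 (axis i 1) (\<nu> r) *\<^sub>R b r $ i)" for i
    by (rule set_integrable_mult_continuous[OF _ _ q])
       (rule coefficientsD[OF assms(1)] set_borel_measurable_component)+
  ultimately have "set_integrable lborel {0..\<tau>} (\<lambda>r. pairing \<phi> 1 0 (\<nu> r) *\<^sub>R a r
      + (\<Sum>i\<in>UNIV. pairing \<phi> 0 (axis i 1) (\<nu> r) *\<^sub>R b r $ i))"
    by (intro set_integral_add(1) set_integrable_sum) auto
  then show ?thesis
    by (rule set_integrable_cong[THEN iffD1, rotated -1])
       (auto simp: pairing_expand[OF assms(3-5) P, of _ "a r" "b r" for r] mult.commute)
qed

end

section \<open>Euler approximation\<close>

lemma bump_class_mono: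
  assumes "bump_class l K \<phi>" "l \<le> l'" "K \<le> K'"
  shows "bump_class l' K' \<phi>"
  unfolding bump_class_def
proof (intro conjI allI)
  fix x y v
  show "\<bar>frechet_derivative \<phi> (at x) v\<bar> \<le> l' * norm v"
    using bump_classD(3)[OF assms(1), of x v] mult_right_mono[OF assms(2) norm_ge_zero[of v]] by linarith
  have "K * norm (x - y) * norm v \<le> K' * norm (x - y) * norm v"
    using assms(3) by (intro mult_right_mono) auto
  then show "\<bar>frechet_derivative \<phi> (at x) v - frechet_derivative \<phi> (at y) v\<bar> \<le> K' * norm (x - y) * norm v"
    using bump_classD(4)[OF assms(1), of x v y] by linarith
qed (use bump_classD[OF assms(1)] in auto)

text \<open>In the second-order constant \<open>K\<close> is multiplied by \<open>1 + p\<close>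
  twice, for the displaced base point and for the displaced direction; \<open>l * k\<close> comes
  from the variation of the derivative of \<open>V\<close>.\<close>

lemma bump_class_compose:
  fixes V :: "'a::euclidean_space \<Rightarrow> 'a"
  assumes \<phi>: "bump_class l K \<phi>" "0 \<le> l" "0 \<le> K"
    and V: "\<And>k b. C_k k (\<lambda>x. V x \<bullet> b)" "bounded {x. V x \<noteq> 0}"
    and D: "\<And>x. (V has_derivative D x) (at x)" "\<And>x v. norm (D x v) \<le> p * norm v"
      "\<And>x y v. norm (D x v - D y v) \<le> k * norm (x - y) * norm v" "0 \<le> p"
  shows "bump_class (l * (1 + p)) (K * (1 + p)\<^sup>2 + l * k) (\<lambda>x. \<phi> (x + V x))"
proof -
  let ?D\<phi> = "\<lambda>x. frechet_derivative \<phi> (at x)"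
  have lin: "linear (?D\<phi> x)" for x
    using bump_classD(5)[OF \<phi>(1)] has_derivative_linear by blast
  have hd: "((\<lambda>x. \<phi> (x + V x)) has_derivative (\<lambda>v. ?D\<phi> (x + V x) (v + D x v))) (at x)" for x
    using diff_chain_at[where f = "\<lambda>x. x + V x" and g = \<phi>, OF has_derivative_add[OF has_derivative_ident D(1)] bump_classD(5)[OF \<phi>(1)]]
    by (simp add: o_def)
  have fd: "frechet_derivative (\<lambda>x. \<phi> (x + V x)) (at x) v = ?D\<phi> (x + V x) (v + D x v)" for x v
    using fun_cong[OF frechet_derivative_at[OF hd], of x v] by simp
  have D1: "norm (v + D x v) \<le> (1 + p) * norm v" for x v
    using norm_triangle_ineq[of v "D x v"] D(2)[of x v] by (simp add: distrib_right)
  have V1: "norm ((x + V x) - (y + V y)) \<le> (1 + p) * norm (x - y)" for x y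
  proof -
    have "norm (V x - V y) \<le> p * norm (x - y)"
      by (rule differentiable_bound[OF convex_UNIV, where f' = D])
         (use D(1) onorm_le[OF D(2)] in auto)
    then show ?thesis
      using norm_triangle_ineq[of "x - y" "V x - V y"] by (simp add: distrib_right algebra_simps)
  qed
  show ?thesis
    unfolding bump_class_def fd
  proof (intro conjI allI)
    show "C_k j (\<lambda>x. \<phi> (x + V x))" for j
      by (rule C_k_compose[OF bump_classD(1)[OF \<phi>(1)]])
         (unfold inner_add_left, rule C_k_add[OF C_k_linear[OF bounded_linear_inner_left] V(1)])
    \<comment> \<open>Where \<open>V\<close> vanishes the composition is \<open>\<phi>\<close>
      itself, so the two bounded supports suffice.\<close>
    have "{x. \<phi> (x + V x) \<noteq> 0} \<subseteq> {x. V x \<noteq> 0} \<union> {x. \<phi> x \<noteq> 0}"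
      by (auto simp: add.right_neutral)
    then show "bounded {x. \<phi> (x + V x) \<noteq> 0}"
      using V(2) bump_classD(2)[OF \<phi>(1)] bounded_subset bounded_Un by blast
    fix x y v
    have "\<bar>?D\<phi> (x + V x) (v + D x v)\<bar> \<le> l * ((1 + p) * norm v)"
      by (rule order_trans[OF bump_classD(3)[OF \<phi>(1)] mult_left_mono[OF D1 \<phi>(2)]])
    then show "\<bar>?D\<phi> (x + V x) (v + D x v)\<bar> \<le> l * (1 + p) * norm v" by (simp add: mult.assoc)
    have "\<bar>?D\<phi> (x + V x) (v + D x v) - ?D\<phi> (y + V y) (v + D y v)\<bar>
       \<le> \<bar>?D\<phi> (x + V x) (v + D x v) - ?D\<phi> (y + V y) (v + D x v)\<bar> + \<bar>?D\<phi> (y + V y) (D x v - D y v)\<bar>"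
      by (simp add: linear_diff[OF lin] linear_add[OF lin])
    also have "\<dots> \<le> K * norm ((x + V x) - (y + V y)) * norm (v + D x v) + l * norm (D x v - D y v)"
      by (intro add_mono bump_classD(3,4)[OF \<phi>(1)])
    also have "\<dots> \<le> K * ((1 + p) * norm (x - y)) * ((1 + p) * norm v) + l * (k * norm (x - y) * norm v)"
      using \<phi> \<open>0 \<le> p\<close> by (intro add_mono mult_mono mult_left_mono V1 D1 D) auto
    finally show "\<bar>?D\<phi> (x + V x) (v + D x v) - ?D\<phi> (y + V y) (v + D y v)\<bar>
       \<le> (K * (1 + p)\<^sup>2 + l * k) * norm (x - y) * norm v"
      by (simp add: power2_eq_square algebra_simps)
  qed
qed

locale controlled = drift f0 g f c for f0 g :: "real ^ 'n::finite \<Rightarrow> real ^ 'n" and f :: "'m::finite \<Rightarrow> real ^ 'n \<Rightarrow> real ^ 'n" and c +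
  fixes \<tau> B :: real and a :: "real \<Rightarrow> real" and b :: "real \<Rightarrow> real ^ 'm"
  assumes co: "coefficients \<tau> B a b" and \<tau>: "0 < \<tau>" and B1: "1 \<le> B"
begin

definition speed :: real where "speed = 2 * c * B"

lemma speed_pos: "0 < speed" using c_pos B1 by (simp add: speed_def)

text \<open>The controls are integrated, not averaged: this is the displacement over
  \<open>{s..t}\<close> with the measure frozen at \<open>\<mu>\<close>. By linearity in the
  controls it equals the time integral of the velocity, and no pointwise value of a measurable
  control is used.\<close>

definition mean_velocity :: "(real ^ 'n) measure \<Rightarrow> real \<Rightarrow> real \<Rightarrow> real ^ 'n \<Rightarrow> real ^ 'n" where
  "mean_velocity \<mu> s t = velocity (LINT r:{s..t}|lborel. a r) (LINT r:{s..t}|lborel. b r) \<mu>"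

lemma mean_velocity_tame:
  assumes "\<mu> \<in> P1" "0 \<le> s" "s \<le> t" "t \<le> \<tau>"
  shows "norm (mean_velocity \<mu> s t x) \<le> speed * (t - s)"
    and "norm (mean_velocity \<mu> s t x - mean_velocity \<mu> s t y) \<le> speed * (t - s) * norm (x - y)"
    and "1 \<le> R \<Longrightarrow> tame R (speed * (t - s)) (speed * (t - s)) (mean_velocity \<mu> s t)"
proof -
  have "2 * c * csize (LINT r:{s..t}|lborel. a r) (LINT r:{s..t}|lborel. b r) \<le> 2 * c * (B * (t - s))"
    using csize_integral_le[OF co assms(2-4)] c_pos by simp
  then have *: "2 * c * csize (LINT r:{s..t}|lborel. a r) (LINT r:{s..t}|lborel. b r) \<le> speed * (t - s)"
    by (simp add: speed_def)
  show 1: "norm (mean_velocity \<mu> s t x) \<le> speed * (t - s)" for x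
    unfolding mean_velocity_def by (rule order_trans[OF velocity_bounded[OF assms(1)] *])
  show 2: "norm (mean_velocity \<mu> s t x - mean_velocity \<mu> s t y) \<le> speed * (t - s) * norm (x - y)" for x y
    unfolding mean_velocity_def
    by (rule order_trans[OF velocity_lipschitz[OF assms(1)] mult_right_mono[OF *]]) simp
  show "tame R (speed * (t - s)) (speed * (t - s)) (mean_velocity \<mu> s t)" if R: "1 \<le> R"
    unfolding tame_def
  proof (intro conjI allI impI)
    have s0: "0 \<le> speed * (t - s)" using speed_pos assms by simp
    show "norm (mean_velocity \<mu> s t x) \<le> speed * (t - s) * R" for x
      using 1[of x] mult_left_mono[OF R s0] by simp
  qed (use R 2 speed_pos assms in auto)
qed

lemma solves_P1: "solves \<tau> a b \<nu> \<Longrightarrow> s \<in> {0..\<tau>} \<Longrightarrow> \<nu> s \<in> P1"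
  by (simp add: solves_def W1_continuous_def)

text \<open>\<open>pairing_bounded\<close>, integrated over time. \<open>3 * real CARD('n)\<close>
  is the gradient bound of the tests in \<open>W1_le_bump\<close>; the estimate is uniform in their
  second-order constant, as that lemma demands.\<close>

lemma solves_lipschitz:
  assumes "solves \<tau> a b \<nu>" "s \<in> {0..\<tau>}" "t \<in> {0..\<tau>}"
  shows "W1 (\<nu> s) (\<nu> t) \<le> 3 * real CARD('n) * speed * \<bar>s - t\<bar>"
proof -
  have *: "W1 (\<nu> t) (\<nu> s) \<le> 3 * real CARD('n) * speed * (t - s)" if st: "0 \<le> s" "s \<le> t" "t \<le> \<tau>" for s t
  proof (rule W1_le_bump)
    show "\<nu> t \<in> P1" "\<nu> s \<in> P1" using solves_P1[OF assms(1)] st by auto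
    fix K' and \<phi> :: "real ^ 'n \<Rightarrow> real" assume "bump_class (3 * real CARD('n)) K' \<phi>"
    then have \<phi>: "bump_class (3 * real CARD('n)) (max 0 K') \<phi>" by (rule bump_class_mono) auto
    have "(LINT x|\<nu> t. \<phi> x) - (LINT x|\<nu> s. \<phi> x) = (LINT r:{s..t}|lborel. pairing \<phi> (a r) (b r) (\<nu> r))"
      using assms(1) \<phi> st unfolding solves_def by blast
    also have "\<dots> \<le> (3 * real CARD('n) * speed) * (t - s)"
    proof (rule set_integral_le_bound[OF co st])
      show "set_integrable lborel {s..t} (\<lambda>r. pairing \<phi> (a r) (b r) (\<nu> r))"
        by (rule set_integrable_Icc_subset[OF pairing_set_integrable[OF co _ \<phi>] st(1,3)])
           (use assms(1) in \<open>auto simp: solves_def\<close>)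
      show "AE r in lborel. r \<in> {s..t} \<longrightarrow> pairing \<phi> (a r) (b r) (\<nu> r) \<le> 3 * real CARD('n) * speed"
        using coefficientsD(4)[OF co]
      proof eventually_elim
        case (elim r)
        show ?case
        proof
          assume "r \<in> {s..t}"
          then have r: "r \<in> {0..\<tau>}" using st by auto
          have "\<bar>pairing \<phi> (a r) (b r) (\<nu> r)\<bar> \<le> 3 * real CARD('n) * (2 * c * csize (a r) (b r))"
            by (rule pairing_bounded[OF \<phi>]) (use solves_P1[OF assms(1) r] in auto)
          also have "\<dots> \<le> 3 * real CARD('n) * speed"
            unfolding speed_def using elim r c_pos by (intro mult_left_mono) auto
          finally show "pairing \<phi> (a r) (b r) (\<nu> r) \<le> 3 * real CARD('n) * speed" by linarith
        qed
      qed
    qed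
    finally show "(LINT x|\<nu> t. \<phi> x) - (LINT x|\<nu> s. \<phi> x) \<le> 3 * real CARD('n) * speed * (t - s)" .
  qed
  show ?thesis
    using *[of s t] *[of t s] assms(2,3) W1_commute[of "\<nu> s" "\<nu> t"] by (cases "s \<le> t") auto
qed

definition step_const :: real where
  "step_const = speed\<^sup>2 + (2 * c + real CARD('n) * c) * B * (3 * real CARD('n) * speed)"

lemma step_const_nonneg: "0 \<le> step_const"
  using c_pos B1 speed_pos by (simp add: step_const_def)

lemma pairing_mean:
  assumes "bump_class l K \<phi>" "0 \<le> l" "0 \<le> K" "\<mu> \<in> P1" "0 \<le> s" "t \<le> \<tau>"
  shows "(LINT r:{s..t}|lborel. pairing \<phi> (a r) (b r) \<mu>) = (LINT x|\<mu>. frechet_derivative \<phi> (at x) (mean_velocity \<mu> s t x))"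
proof -
  note i = coefficients_integrable[OF co assms(5,6)]
  note ex = pairing_expand[OF assms(1-4)]
  have "(LINT r:{s..t}|lborel. pairing \<phi> (a r) (b r) \<mu>) =
      (LINT r:{s..t}|lborel. a r * pairing \<phi> 1 0 \<mu> + (\<Sum>i\<in>UNIV. b r $ i * pairing \<phi> 0 (axis i 1) \<mu>))"
    by (simp only: ex[symmetric])
  also have "\<dots> = (LINT r:{s..t}|lborel. a r * pairing \<phi> 1 0 \<mu>) +
      (LINT r:{s..t}|lborel. (\<Sum>i\<in>UNIV. b r $ i * pairing \<phi> 0 (axis i 1) \<mu>))"
    by (intro set_integral_add(2) set_integrable_sum set_integrable_mult_left i)
  also have "(LINT r:{s..t}|lborel. (\<Sum>i\<in>UNIV. b r $ i * pairing \<phi> 0 (axis i 1) \<mu>)) =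
      (\<Sum>i\<in>UNIV. LINT r:{s..t}|lborel. b r $ i * pairing \<phi> 0 (axis i 1) \<mu>)"
    unfolding set_lebesgue_integral_def scaleR_sum_right
    by (rule Bochner_Integration.integral_sum)
       (use set_integrable_mult_left[OF i(3)] in \<open>simp add: set_integrable_def\<close>)
  also have "(LINT r:{s..t}|lborel. a r * pairing \<phi> 1 0 \<mu>) + \<dots> =
      pairing \<phi> (LINT r:{s..t}|lborel. a r) (LINT r:{s..t}|lborel. b r) \<mu>"
    by (subst (3) ex) (simp add: coefficients_integral_component[OF co assms(5,6)])
  finally show ?thesis by (simp add: pairing_def mean_velocity_def)
qed

text \<open>Three errors add up: freezing the measure at time \<open>s\<close>, Taylor's formula for
  \<open>\<phi> (x + V x)\<close>, and the use of \<open>V\<close> in place of the mean velocity.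
  The first two are quadratic in \<open>t - s\<close>; the third is kept as
  \<open>\<sigma>\<close>.\<close>

lemma one_step:
  assumes sol: "solves \<tau> a b \<nu>" and st: "0 \<le> s" "s \<le> t" "t \<le> \<tau>"
    and \<phi>: "bump_class l K \<phi>" "0 \<le> l" "0 \<le> K"
    and V: "continuous_on UNIV V" "\<And>x. norm (V x) \<le> speed * (t - s)"
    and \<sigma>: "(LINT x|\<nu> s. norm (V x - mean_velocity (\<nu> s) s t x)) \<le> \<sigma>"
  shows "\<bar>(LINT x|\<nu> t. \<phi> x) - (LINT x|\<nu> s. \<phi> (x + V x))\<bar> \<le> l * \<sigma> + step_const * (t - s)\<^sup>2 * (l + K)"
proof -
  let ?D = "\<lambda>x. frechet_derivative \<phi> (at x)" and ?W = "mean_velocity (\<nu> s) s t" and ?h = "t - s"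
  let ?C = "(2 * c + real CARD('n) * c) * (K + l)"
  have P: "\<nu> r \<in> P1" if "r \<in> {s..t}" for r using solves_P1[OF sol] that st by auto
  have Ps: "\<nu> s \<in> P1" using P st by auto
  interpret prob_space "\<nu> s" using P1D(1)[OF Ps] .
  have lin: "linear (?D x)" for x
    using bump_classD(5)[OF \<phi>(1)] has_derivative_linear by blast
  have C0: "0 \<le> ?C" using c_pos \<phi> by simp
  have 1: "\<bar>(LINT x|\<nu> t. \<phi> x) - (LINT x|\<nu> s. \<phi> x) - (LINT x|\<nu> s. ?D x (?W x))\<bar>
      \<le> ?C * B * (3 * real CARD('n) * speed * ?h) * ?h"
  proof -
    have i1: "set_integrable lborel {s..t} (\<lambda>r. pairing \<phi> (a r) (b r) (\<nu> r))"
      by (rule set_integrable_Icc_subset[OF pairing_set_integrable[OF co _ \<phi>] st(1,3)])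
         (use sol in \<open>auto simp: solves_def\<close>)
    have "W1_continuous \<tau> (\<lambda>_. \<nu> s)" using Ps by (simp add: W1_continuous_def W1_self)
    then have i2: "set_integrable lborel {s..t} (\<lambda>r. pairing \<phi> (a r) (b r) (\<nu> s))"
      by (rule set_integrable_Icc_subset[OF pairing_set_integrable[OF co _ \<phi>] st(1,3)])
    have id: "set_integrable lborel {s..t} (\<lambda>r. \<bar>pairing \<phi> (a r) (b r) (\<nu> r) - pairing \<phi> (a r) (b r) (\<nu> s)\<bar>)"
      using set_integrable_abs[OF set_integral_diff(1)[OF i1 i2]] .
    have "(LINT x|\<nu> t. \<phi> x) - (LINT x|\<nu> s. \<phi> x) = (LINT r:{s..t}|lborel. pairing \<phi> (a r) (b r) (\<nu> r))"
      using sol \<phi> st unfolding solves_def by blast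
    then have eq: "(LINT x|\<nu> t. \<phi> x) - (LINT x|\<nu> s. \<phi> x) - (LINT x|\<nu> s. ?D x (?W x)) =
        (LINT r:{s..t}|lborel. pairing \<phi> (a r) (b r) (\<nu> r) - pairing \<phi> (a r) (b r) (\<nu> s))"
      using pairing_mean[OF \<phi> Ps st(1,3)] set_integral_diff(2)[OF i1 i2] by simp
    have "\<bar>LINT r:{s..t}|lborel. pairing \<phi> (a r) (b r) (\<nu> r) - pairing \<phi> (a r) (b r) (\<nu> s)\<bar>
        \<le> (LINT r:{s..t}|lborel. \<bar>pairing \<phi> (a r) (b r) (\<nu> r) - pairing \<phi> (a r) (b r) (\<nu> s)\<bar>)"
      unfolding set_lebesgue_integral_def
      by (rule order_trans[OF integral_abs_bound]) (simp add: abs_mult)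
    also have "\<dots> \<le> (?C * B * (3 * real CARD('n) * speed * ?h)) * ?h"
    proof (rule set_integral_le_bound[OF co st id])
      show "AE r in lborel. r \<in> {s..t} \<longrightarrow> \<bar>pairing \<phi> (a r) (b r) (\<nu> r) - pairing \<phi> (a r) (b r) (\<nu> s)\<bar>
          \<le> ?C * B * (3 * real CARD('n) * speed * ?h)"
        using coefficientsD(4)[OF co]
      proof eventually_elim
        case (elim r)
        show ?case
        proof
          assume r: "r \<in> {s..t}"
          have "W1 (\<nu> r) (\<nu> s) \<le> 3 * real CARD('n) * speed * \<bar>r - s\<bar>"
            by (rule solves_lipschitz[OF sol]) (use r st in auto)
          also have "\<dots> \<le> 3 * real CARD('n) * speed * ?h"
            using r speed_pos by (intro mult_left_mono) auto
          finally have w: "W1 (\<nu> r) (\<nu> s) \<le> 3 * real CARD('n) * speed * ?h" .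
          have "\<bar>pairing \<phi> (a r) (b r) (\<nu> r) - pairing \<phi> (a r) (b r) (\<nu> s)\<bar> \<le> ?C * csize (a r) (b r) * W1 (\<nu> r) (\<nu> s)"
            by (rule pairing_diff[OF \<phi> P[OF r] Ps])
          also have "\<dots> \<le> ?C * B * (3 * real CARD('n) * speed * ?h)"
            using elim r st C0 w W1_nonneg[OF P[OF r] Ps] csize_nonneg B1 c_pos \<phi>(2,3)
            by (intro mult_mono mult_left_mono mult_nonneg_nonneg) auto
          finally show "\<bar>pairing \<phi> (a r) (b r) (\<nu> r) - pairing \<phi> (a r) (b r) (\<nu> s)\<bar>
              \<le> ?C * B * (3 * real CARD('n) * speed * ?h)" .
        qed
      qed
    qed
    finally show ?thesis unfolding eq .
  qed
  have \<phi>V: "continuous_on UNIV (\<lambda>x. \<phi> (x + V x))"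
    by (rule continuous_on_compose2[OF C_k_continuous[OF bump_classD(1)[OF \<phi>(1), of 0]]])
       (auto intro!: continuous_intros V)
  obtain M where M: "\<And>x. \<bar>\<phi> x\<bar> \<le> M"
  proof -
    have "compact (closure {x. \<phi> x \<noteq> 0})" using bump_classD(2)[OF \<phi>(1)] by simp
    then have "bounded (\<phi> ` closure {x. \<phi> x \<noteq> 0})"
      by (intro compact_imp_bounded compact_continuous_image
          continuous_on_subset[OF C_k_continuous[OF bump_classD(1)[OF \<phi>(1), of 0]]]) auto
    then obtain M where M: "\<And>x. x \<in> closure {x. \<phi> x \<noteq> 0} \<Longrightarrow> \<bar>\<phi> x\<bar> \<le> M"
      unfolding bounded_iff by (metis image_eqI real_norm_def)
    have "\<bar>\<phi> x\<bar> \<le> max 0 M" for x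
      using M[of x] closure_subset[of "{x. \<phi> x \<noteq> 0}"] by (cases "\<phi> x = 0") auto
    then show thesis by (rule that)
  qed
  have i\<phi>: "integrable (\<nu> s) \<phi>" "integrable (\<nu> s) (\<lambda>x. \<phi> (x + V x))"
    using M by (auto intro!: P1_integrable_bounded[OF Ps, of _ M] borel_measurable_continuous_onI
        C_k_continuous[OF bump_classD(1)[OF \<phi>(1), of 0]] \<phi>V)
  have cW: "continuous_on UNIV ?W"
    by (rule lipschitz_continuous_on[OF mean_velocity_tame(2)[OF Ps st]])
  have bD: "\<bar>?D x (F x)\<bar> \<le> l * (speed * ?h)" if "norm (F x) \<le> speed * ?h" for F x
    using bump_classD(3)[OF \<phi>(1), of x "F x"] mult_left_mono[OF that \<phi>(2)] by linarith
  have iD: "integrable (\<nu> s) (\<lambda>x. ?D x (V x))" "integrable (\<nu> s) (\<lambda>x. ?D x (?W x))"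
    by (rule P1_integrable_bounded[OF Ps derivative_field_measurable[OF \<phi>], of _ "l * (speed * ?h)"];
        use V cW bD mean_velocity_tame(1)[OF Ps st] in auto)+
  have iVW: "integrable (\<nu> s) (\<lambda>x. norm (V x - ?W x))"
  proof (rule P1_integrable_bounded[OF Ps, of _ "2 * (speed * ?h)"])
    show "(\<lambda>x. norm (V x - ?W x)) \<in> borel_measurable borel"
      by (intro borel_measurable_continuous_onI continuous_intros V cW)
    show "norm (norm (V x - ?W x)) \<le> 2 * (speed * ?h)" for x
      using norm_triangle_ineq4[of "V x" "?W x"] V(2)[of x] mean_velocity_tame(1)[OF Ps st, of x] by simp
  qed
  have 2: "\<bar>(LINT x|\<nu> s. \<phi> (x + V x)) - (LINT x|\<nu> s. \<phi> x) - (LINT x|\<nu> s. ?D x (V x))\<bar> \<le> K * (speed * ?h)\<^sup>2"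
  proof -
    have "(LINT x|\<nu> s. \<phi> (x + V x)) - (LINT x|\<nu> s. \<phi> x) - (LINT x|\<nu> s. ?D x (V x))
        = (LINT x|\<nu> s. \<phi> (x + V x) - \<phi> x - ?D x (V x))"
      using i\<phi> iD by simp
    also have "norm \<dots> \<le> K * (speed * ?h)\<^sup>2"
    proof (rule P1_integral_bounded[OF Ps])
      show "norm (\<phi> (x + V x) - \<phi> x - ?D x (V x)) \<le> K * (speed * ?h)\<^sup>2" for x
        using bump_class_taylor[OF \<phi>(1,3), of x "V x"] mult_left_mono[OF power_mono[OF V(2)[of x] norm_ge_zero, of 2] \<phi>(3)]
        by simp
    qed
    finally show ?thesis by simp
  qed
  have 3: "\<bar>(LINT x|\<nu> s. ?D x (V x)) - (LINT x|\<nu> s. ?D x (?W x))\<bar> \<le> l * \<sigma>"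
  proof -
    have "(LINT x|\<nu> s. ?D x (V x)) - (LINT x|\<nu> s. ?D x (?W x)) = (LINT x|\<nu> s. ?D x (V x - ?W x))"
      using iD by (simp add: linear_diff[OF lin])
    also have "norm \<dots> \<le> (LINT x|\<nu> s. l * norm (V x - ?W x))"
    proof (rule Bochner_Integration.integral_norm_bound_integral)
      show "integrable (\<nu> s) (\<lambda>x. ?D x (V x - ?W x))"
        using Bochner_Integration.integrable_diff[OF iD] by (simp add: linear_diff[OF lin])
      show "norm (?D x (V x - ?W x)) \<le> l * norm (V x - ?W x)" for x
        using bump_classD(3)[OF \<phi>(1)] by simp
    qed (use iVW in simp)
    also have "\<dots> \<le> l * \<sigma>" using \<sigma> \<phi>(2) by (simp add: mult_left_mono)
    finally show ?thesis by simp
  qed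
  have "?C * B * (3 * real CARD('n) * speed * ?h) * ?h + K * (speed * ?h)\<^sup>2
      \<le> (l + K) * ((2 * c + real CARD('n) * c) * B * (3 * real CARD('n) * speed)) * ?h\<^sup>2 + (l + K) * (speed * ?h)\<^sup>2"
  proof (rule add_mono)
    show "K * (speed * ?h)\<^sup>2 \<le> (l + K) * (speed * ?h)\<^sup>2"
      using \<phi>(2) by (intro mult_right_mono) auto
  qed (simp add: power2_eq_square mult_ac add.commute)
  also have "\<dots> = step_const * ?h\<^sup>2 * (l + K)"
    unfolding step_const_def by algebra
  finally show ?thesis using 1 2 3 by linarith
qed

end

section \<open>The Euler scheme and its error\<close>

context controlled
begin

definition node :: "nat \<Rightarrow> nat \<Rightarrow> real" where
  "node n j = real j * \<tau> / real n"

text \<open>The measure in the velocity is taken from the given solution \<open>\<nu>\<close>: the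
  scheme does not construct a solution but represents one as an image of its initial
  measure.\<close>

definition increment :: "(real \<Rightarrow> (real ^ 'n) measure) \<Rightarrow> real \<Rightarrow> nat \<Rightarrow> nat \<Rightarrow> real ^ 'n \<Rightarrow> real ^ 'n" where
  "increment \<nu> R n j = smear R (mean_velocity (\<nu> (node n j)) (node n j) (node n (Suc j)))"

primrec euler :: "(real \<Rightarrow> (real ^ 'n) measure) \<Rightarrow> real \<Rightarrow> nat \<Rightarrow> nat \<Rightarrow> real ^ 'n \<Rightarrow> real ^ 'n" where
  "euler \<nu> R n 0 x = x"
| "euler \<nu> R n (Suc j) x = euler \<nu> R n j x + increment \<nu> R n j (euler \<nu> R n j x)"

lemma node_0 [simp]: "node n 0 = 0"
  by (simp add: node_def)

lemma node_range: "0 < n \<Longrightarrow> j \<le> n \<Longrightarrow> node n j \<in> {0..\<tau>}"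
proof -
  assume "0 < n" "j \<le> n"
  moreover from this have "real j * \<tau> \<le> real n * \<tau>" using \<tau> by (intro mult_right_mono) auto
  ultimately show ?thesis using \<tau> by (simp add: node_def divide_le_eq mult.commute)
qed

lemma node_Suc: "0 < n \<Longrightarrow> node n (Suc j) - node n j = \<tau> / real n" "node n j \<le> node n (Suc j)"
  using \<tau> by (auto simp: node_def distrib_right add_divide_distrib)

context
  fixes \<nu> :: "real \<Rightarrow> (real ^ 'n) measure" and R :: real and n :: nat
  assumes sol: "solves \<tau> a b \<nu>" and R: "1 \<le> R" and n: "0 < n"
begin

lemma increment_tame:
  assumes "j < n"
  shows "tame R (speed * (\<tau> / real n)) (speed * (\<tau> / real n)) (mean_velocity (\<nu> (node n j)) (node n j) (node n (Suc j)))"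
  using mean_velocity_tame(3)[of "\<nu> (node n j)" "node n j" "node n (Suc j)" R]
    solves_P1[OF sol] node_range[OF n] node_Suc[of n j] assms R n by auto

lemma increment_bounded: "j < n \<Longrightarrow> norm (increment \<nu> R n j x) \<le> speed * (\<tau> / real n)"
  unfolding increment_def
  by (rule smear_bounded[OF increment_tame])
     (use mean_velocity_tame(1)[of "\<nu> (node n j)" "node n j" "node n (Suc j)"]
    solves_P1[OF sol] node_range[OF n] node_Suc[of n j] n in auto)

lemma increment_lipschitz:
  "j < n \<Longrightarrow> norm (increment \<nu> R n j x - increment \<nu> R n j y) \<le> 2 * speed * (\<tau> / real n) * norm (x - y)"
  using smear_lipschitz[OF increment_tame, of j x y] unfolding increment_def by (simp add: mult_ac)

lemma euler_displacement: "j \<le> n \<Longrightarrow> norm (euler \<nu> R n j x - x) \<le> speed * node n j"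
proof (induction j)
  case (Suc j)
  have "norm (euler \<nu> R n (Suc j) x - x) \<le> norm (euler \<nu> R n j x - x) + norm (increment \<nu> R n j (euler \<nu> R n j x))"
    using norm_triangle_ineq[of "euler \<nu> R n j x - x" "increment \<nu> R n j (euler \<nu> R n j x)"] by (simp add: algebra_simps)
  also have "\<dots> \<le> speed * node n j + speed * (\<tau> / real n)"
    using Suc by (intro add_mono increment_bounded) auto
  also have "\<dots> = speed * node n (Suc j)"
    using node_Suc(1)[OF n, of j] by (simp add: distrib_left[symmetric] del: times_divide_eq_right)
  finally show ?case .
qed simp

lemma euler_displacement_le: "j \<le> n \<Longrightarrow> norm (euler \<nu> R n j x - x) \<le> speed * \<tau>"
  using euler_displacement[of j x] node_range[OF n, of j] speed_pos
  by (meson atLeastAtMost_iff less_imp_le mult_left_mono order_trans)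

lemma euler_increment: "i \<le> j \<Longrightarrow> j \<le> n \<Longrightarrow> norm (euler \<nu> R n j x - euler \<nu> R n i x) \<le> speed * (node n j - node n i)"
proof (induction j)
  case (Suc j)
  show ?case
  proof (cases "i = Suc j")
    case False
    have "norm (euler \<nu> R n (Suc j) x - euler \<nu> R n i x) \<le>
        norm (euler \<nu> R n j x - euler \<nu> R n i x) + norm (increment \<nu> R n j (euler \<nu> R n j x))"
      using norm_triangle_ineq[of "euler \<nu> R n j x - euler \<nu> R n i x" "increment \<nu> R n j (euler \<nu> R n j x)"]
      by (simp add: algebra_simps)
    also have "\<dots> \<le> speed * (node n j - node n i) + speed * (\<tau> / real n)"
      using Suc False by (intro add_mono increment_bounded) auto
    also have "\<dots> = speed * (node n (Suc j) - node n i)"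
      using node_Suc(1)[OF n, of j] by (simp add: distrib_left[symmetric] del: times_divide_eq_right)
    finally show ?thesis .
  qed simp
qed simp

lemma growth: "i \<le> n \<Longrightarrow> 0 \<le> p \<Longrightarrow> (1 + p * (\<tau> / real n)) ^ i \<le> exp (p * \<tau>)"
proof -
  assume i: "i \<le> n" and p: "0 \<le> p"
  have "(1 + p * (\<tau> / real n)) ^ i \<le> exp (p * (\<tau> / real n)) ^ i"
    using p \<tau> by (intro power_mono exp_ge_add_one_self) (auto simp: add_nonneg_nonneg)
  also have "\<dots> = exp (p * node n i)" by (simp add: node_def exp_of_nat_mult[symmetric] mult_ac)
  also have "\<dots> \<le> exp (p * \<tau>)" using node_range[OF n i] p by (simp add: mult_left_mono)
  finally show ?thesis .
qed

lemma euler_lipschitz: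
  "j \<le> n \<Longrightarrow> norm (euler \<nu> R n j x - euler \<nu> R n j y) \<le> exp (2 * speed * \<tau>) * norm (x - y)"
proof -
  assume j: "j \<le> n"
  have "norm (euler \<nu> R n j x - euler \<nu> R n j y) \<le> (1 + 2 * speed * (\<tau> / real n)) ^ j * norm (x - y)"
    using j
  proof (induction j)
    case (Suc j)
    let ?d = "euler \<nu> R n j x - euler \<nu> R n j y"
    have "norm (euler \<nu> R n (Suc j) x - euler \<nu> R n (Suc j) y) \<le> norm ?d +
        norm (increment \<nu> R n j (euler \<nu> R n j x) - increment \<nu> R n j (euler \<nu> R n j y))"
      using norm_triangle_ineq[of ?d "increment \<nu> R n j (euler \<nu> R n j x) - increment \<nu> R n j (euler \<nu> R n j y)"]
      by (simp add: algebra_simps)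
    also have "\<dots> \<le> norm ?d + 2 * speed * (\<tau> / real n) * norm ?d"
      using Suc by (intro add_left_mono increment_lipschitz) auto
    also have "\<dots> = (1 + 2 * speed * (\<tau> / real n)) * norm ?d" by (simp add: algebra_simps)
    also have "\<dots> \<le> (1 + 2 * speed * (\<tau> / real n)) * ((1 + 2 * speed * (\<tau> / real n)) ^ j * norm (x - y))"
      using Suc speed_pos \<tau> by (intro mult_left_mono) auto
    finally show ?case by (simp add: mult.assoc)
  qed simp
  also have "\<dots> \<le> exp (2 * speed * \<tau>) * norm (x - y)"
    using growth[OF j, of "2 * speed"] speed_pos by (intro mult_right_mono) auto
  finally show ?thesis .
qed

lemma euler_measurable: "j \<le> n \<Longrightarrow> euler \<nu> R n j \<in> borel_measurable borel"
  by (rule lipschitz_measurable[OF euler_lipschitz])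

text \<open>Smearing errs by 2 k / R everywhere, with k = speed * \<tau> / n the size of the
  increment; outside the ball of radius R the field itself may be lost, but there k is at most k |x|
  / R. The error carries the factor \<tau> / n, so its sum over all steps is of order 1/R.\<close>

lemma increment_error:
  assumes "j < n" "tail R (\<nu> (node n j)) \<le> 1"
  shows "(LINT x|\<nu> (node n j). norm (increment \<nu> R n j x - mean_velocity (\<nu> (node n j)) (node n j) (node n (Suc j)) x))
    \<le> 3 * (speed * (\<tau> / real n)) / R"
proof -
  let ?s = "node n j" and ?k = "speed * (\<tau> / real n)"
  let ?W = "mean_velocity (\<nu> ?s) ?s (node n (Suc j))"
  have P: "\<nu> ?s \<in> P1" using solves_P1[OF sol] node_range[OF n] assms(1) by simp
  interpret prob_space "\<nu> ?s" using P1D(1)[OF P] .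
  have st: "0 \<le> ?s" "?s \<le> node n (Suc j)" "node n (Suc j) \<le> \<tau>"
    using node_range[OF n, of j] node_range[OF n, of "Suc j"] node_Suc(2)[where j = j] assms(1) by auto
  have k: "0 \<le> ?k" using speed_pos \<tau> by simp
  have Wb: "norm (?W x) \<le> ?k" for x
    using mean_velocity_tame(1)[OF P st, of x] node_Suc(1)[OF n, of j] by simp
  have bd: "norm (increment \<nu> R n j x - ?W x) \<le> 2 * ?k / R + ?k / R * (indicator {x. R < norm x} x * norm x)" for x
  proof (cases "norm x \<le> R")
    case True
    then show ?thesis using smear_close[OF increment_tame[OF assms(1)], of x] by (simp add: increment_def mult_ac)
  next
    case False
    have "norm (?W x) \<le> ?k * 1" using Wb by simp
    also have "\<dots> \<le> ?k * (norm x / R)" using False R k by (intro mult_left_mono) auto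
    finally show ?thesis
      using smear_close[OF increment_tame[OF assms(1)], of x] False
      by (simp add: increment_def mult.commute[of \<tau> speed])
  qed
  have "(LINT x|\<nu> ?s. norm (increment \<nu> R n j x - ?W x))
      \<le> (LINT x|\<nu> ?s. 2 * ?k / R + ?k / R * (indicator {x. R < norm x} x * norm x))"
  proof (rule integral_mono)
    show "integrable (\<nu> ?s) (\<lambda>x. norm (increment \<nu> R n j x - ?W x))"
    proof (rule P1_integrable_bounded[OF P, of _ "2 * ?k"])
      show "(\<lambda>x. norm (increment \<nu> R n j x - ?W x)) \<in> borel_measurable borel"
        using lipschitz_measurable[OF increment_lipschitz[OF assms(1)]]
          lipschitz_measurable[OF mean_velocity_tame(2)[OF P st]] by auto
      show "norm (norm (increment \<nu> R n j x - ?W x)) \<le> 2 * ?k" for x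
        using order_trans[OF norm_triangle_ineq4 add_mono[OF increment_bounded[OF assms(1), of x] Wb[of x]]]
        unfolding real_norm_def abs_norm_cancel mult_2 .
    qed
    show "integrable (\<nu> ?s) (\<lambda>x. 2 * ?k / R + ?k / R * (indicator {x. R < norm x} x * norm x))"
      by (intro Bochner_Integration.integrable_add integrable_mult_right tail_integrable[OF P] integrable_const)
    show "norm (increment \<nu> R n j x - ?W x) \<le> 2 * ?k / R + ?k / R * (indicator {x. R < norm x} x * norm x)" for x
      by (rule bd)
  qed
  also have "\<dots> = 2 * ?k / R + ?k / R * tail R (\<nu> ?s)"
    using tail_integrable[OF P] by (simp add: prob_space tail_def)
  also have "\<dots> \<le> 2 * ?k / R + ?k / R * 1"
    by (intro add_left_mono mult_left_mono assms(2) divide_nonneg_nonneg k) (use R in simp)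
  finally show ?thesis by (simp add: field_simps)
qed

text \<open>The last step is peeled off and moved into the test function: \<open>\<phi>\<close> at
  node \<open>Suc j\<close> becomes its composition with the step, tested at node \<open>j\<close>.
  The index \<open>i\<close> counts the steps already absorbed. By \<open>bump_class_compose\<close>
  each absorption multiplies the gradient bound by q = 1 + 2 speed h and turns the second-order
  bound K into q^2 K + l KR speed h; the stated expressions dominate these recursions. Both stay
  bounded as long as \<open>i \<le> n\<close>, which gives the same error \<open>E\<close> for every
  step.\<close>

lemma euler_test:
  fixes K0 KR l0 :: real
  defines "h \<equiv> \<tau> / real n" and "Q \<equiv> exp (2 * speed * \<tau>)"
  defines "E \<equiv> l0 * Q * (3 * (speed * h) / R) + step_const * h\<^sup>2 * (l0 * Q + Q\<^sup>2 * (K0 + \<tau> * (KR * speed) * l0))"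
  assumes tail: "\<And>s. s \<in> {0..\<tau>} \<Longrightarrow> tail R (\<nu> s) \<le> 1"
    and KR: "0 \<le> KR" "\<And>L c (f :: real ^ 'n \<Rightarrow> real ^ 'n). tame R L c f \<Longrightarrow>
    \<exists>D. (\<forall>x. (smear R f has_derivative D x) (at x)) \<and> (\<forall>x v. norm (D x v) \<le> (L + c) * norm v) \<and>
      (\<forall>x y v. norm (D x v - D y v) \<le> KR * c * norm (x - y) * norm v)"
    and lK: "0 \<le> l0" "0 \<le> K0"
  shows "i + j \<le> n \<Longrightarrow>
    bump_class (l0 * (1 + 2 * speed * h) ^ i) ((1 + 2 * speed * h) ^ (2 * i) * (K0 + real i * h * (KR * speed) * l0)) \<phi> \<Longrightarrow>
    \<bar>(LINT x|\<nu> (node n j). \<phi> x) - (LINT x|\<nu> 0. \<phi> (euler \<nu> R n j x))\<bar> \<le> real j * E"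
proof (induction j arbitrary: i \<phi>)
  case 0
  then show ?case by simp
next
  case (Suc j)
  let ?q = "1 + 2 * speed * h" and ?\<kappa> = "KR * speed"
  let ?l = "\<lambda>i. l0 * ?q ^ i" and ?K = "\<lambda>i. ?q ^ (2 * i) * (K0 + real i * h * ?\<kappa> * l0)"
  let ?s = "node n j" and ?t = "node n (Suc j)" and ?V = "increment \<nu> R n j"
  have j: "j < n" using Suc.prems by simp
  have h: "0 < h" using \<tau> n by (simp add: h_def)
  have q: "1 \<le> ?q" using speed_pos h by simp
  have \<kappa>: "0 \<le> ?\<kappa>" using KR(1) speed_pos by simp
  have st: "0 \<le> ?s" "?s \<le> ?t" "?t \<le> \<tau>" and ts: "?t - ?s = h"
    using node_range[OF n, of j] node_range[OF n, of "Suc j"] node_Suc(2)[where j = j] node_Suc(1)[OF n, of j] j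
    by (auto simp: h_def)
  have l0: "0 \<le> ?l i" "0 \<le> ?K i" for i
    using lK q h \<kappa> by simp_all
  have i: "i \<le> n" using Suc.prems by simp
  have qi: "?q ^ i \<le> Q" unfolding h_def Q_def by (rule growth[OF i]) (use speed_pos in simp)
  have lQ: "?l i \<le> l0 * Q" using qi lK by (simp add: mult_left_mono)
  have KQ: "?K i \<le> Q\<^sup>2 * (K0 + \<tau> * ?\<kappa> * l0)"
  proof (rule mult_mono)
    have "(?q ^ i)\<^sup>2 \<le> Q\<^sup>2" using qi q by (intro power_mono) auto
    then show "?q ^ (2 * i) \<le> Q\<^sup>2" by (simp add: power_mult mult.commute flip: power_mult)
    have "real i * h \<le> \<tau>" using node_range[OF n i] by (simp add: node_def h_def)
    then have "real i * h * (?\<kappa> * l0) \<le> \<tau> * (?\<kappa> * l0)" using \<kappa> lK by (intro mult_right_mono) auto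
    then show "K0 + real i * h * ?\<kappa> * l0 \<le> K0 + \<tau> * ?\<kappa> * l0" by (simp add: mult.assoc)
  qed (use lK h \<kappa> in auto)
  have err: "(LINT x|\<nu> ?s. norm (?V x - mean_velocity (\<nu> ?s) ?s ?t x)) \<le> 3 * (speed * h) / R"
    unfolding h_def by (rule increment_error[OF j]) (use tail st in auto)
  have "\<bar>(LINT x|\<nu> ?t. \<phi> x) - (LINT x|\<nu> ?s. \<phi> (x + ?V x))\<bar>
      \<le> ?l i * (3 * (speed * h) / R) + step_const * (?t - ?s)\<^sup>2 * (?l i + ?K i)"
  proof (rule one_step[OF sol st Suc.prems(2) l0 _ _ err])
    show "continuous_on UNIV ?V" by (rule lipschitz_continuous_on[OF increment_lipschitz[OF j]])
    show "norm (?V x) \<le> speed * (?t - ?s)" for x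
      using increment_bounded[OF j, of x] by (simp add: ts h_def)
  qed
  also have "\<dots> \<le> E"
    unfolding E_def ts using lQ KQ speed_pos h R step_const_nonneg qi lK
    by (intro add_mono mult_right_mono mult_left_mono) auto
  finally have 1: "\<bar>(LINT x|\<nu> ?t. \<phi> x) - (LINT x|\<nu> ?s. \<phi> (x + ?V x))\<bar> \<le> E" .
  obtain D where D: "\<And>x. (?V has_derivative D x) (at x)" "\<And>x v. norm (D x v) \<le> (speed * h + speed * h) * norm v"
      "\<And>x y v. norm (D x v - D y v) \<le> KR * (speed * h) * norm (x - y) * norm v"
    using KR(2)[OF increment_tame[OF j]] unfolding increment_def[symmetric] h_def[symmetric] by blast
  have "bump_class (?l i * (1 + (speed * h + speed * h))) (?K i * (1 + (speed * h + speed * h))\<^sup>2 + ?l i * (KR * (speed * h)))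
      (\<lambda>x. \<phi> (x + ?V x))"
  proof (rule bump_class_compose[OF Suc.prems(2) l0 _ _ D])
    show "C_k k (\<lambda>x. ?V x \<bullet> b)" for k b
      unfolding increment_def by (rule C_k_smear[OF increment_tame[OF j]])
    show "bounded {x. ?V x \<noteq> 0}"
      unfolding increment_def by (rule smear_support[OF increment_tame[OF j]])
  qed (use speed_pos h in simp)
  then have "bump_class (?l (Suc i)) (?K (Suc i)) (\<lambda>x. \<phi> (x + ?V x))"
  proof (rule bump_class_mono)
    \<comment> \<open>The power \<open>i\<close> is enlarged to \<open>2 * Suc i\<close>, so that
      the new summand fits the closed form of the second-order bound.\<close>
    have "?l i * (KR * (speed * h)) \<le> ?q ^ (2 * Suc i) * (h * ?\<kappa> * l0)"
    proof -
      have "?q ^ i * (l0 * (KR * (speed * h))) \<le> ?q ^ (2 * Suc i) * (l0 * (KR * (speed * h)))"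
        using q lK KR(1) speed_pos h by (intro mult_right_mono power_increasing) auto
      then show ?thesis by (simp add: mult_ac)
    qed
    moreover have "?K i * (1 + (speed * h + speed * h))\<^sup>2 = ?q ^ (2 * Suc i) * (K0 + real i * h * ?\<kappa> * l0)"
      by (simp add: power2_eq_square mult_ac)
    ultimately show "?K i * (1 + (speed * h + speed * h))\<^sup>2 + ?l i * (KR * (speed * h)) \<le> ?K (Suc i)"
      by (simp only: of_nat_Suc) (simp add: distrib_left distrib_right)
  qed (simp add: algebra_simps)
  from Suc.IH[OF _ this] Suc.prems
  have 2: "\<bar>(LINT x|\<nu> ?s. \<phi> (x + ?V x)) - (LINT x|\<nu> 0. \<phi> (euler \<nu> R n (Suc j) x))\<bar> \<le> real j * E"
    by simp
  have "real (Suc j) * E = E + real j * E" by (simp add: distrib_right)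
  then show ?case using 1 2 by linarith
qed

end

theorem euler_convergence:
  assumes sol: "solves \<tau> a b \<nu>" and \<eta>: "0 < \<eta>"
  shows "\<exists>R0\<ge>1. \<forall>R\<ge>R0. \<exists>n0>0. \<forall>n\<ge>n0. \<forall>j\<le>n.
    W1 (\<nu> (node n j)) (distr (\<nu> 0) borel (euler \<nu> R n j)) \<le> \<eta>"
proof -
  let ?N = "real CARD('n)" and ?Q = "exp (2 * speed * \<tau>)"
  have N: "0 < ?N" by simp
  have P: "\<nu> s \<in> P1" if "s \<in> {0..\<tau>}" for s by (rule solves_P1[OF sol that])
  have P0: "\<nu> 0 \<in> P1" using P \<tau> by simp
  \<comment> \<open>Three tails of this size, multiplied by \<open>?N\<close>, use up \<eta>/8 of
    the error.\<close>
  have "0 < min 1 (\<eta> / (24 * ?N))" using \<eta> by simp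
  from uniform_tail[OF P solves_lipschitz[OF sol] this]
  obtain R1 where R1: "\<And>R s. R1 \<le> R \<Longrightarrow> s \<in> {0..\<tau>} \<Longrightarrow> tail R (\<nu> s) \<le> min 1 (\<eta> / (24 * ?N))"
    by metis
  \<comment> \<open>\<open>A\<close> collects what decays like 1/R: the smearing errors of all
    steps, tested with gradient bound \<open>3 * ?N * ?Q\<close>, and the term \<open>6 / R\<close>
    of \<open>W1_le_tests\<close>.\<close>
  define A where "A = 3 * ?N * ?Q * (3 * speed) * \<tau> + 6 * ?N"
  have A: "0 \<le> A" using speed_pos \<tau> by (simp add: A_def)
  \<comment> \<open>The entries serve, in order, tameness, \<open>tail_distr\<close>, the tails at
    radius \<open>R - speed * \<tau>\<close>, and the bound \<eta>/8 for
    \<open>A / R\<close>.\<close>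
  define R0 where "R0 = Max {1, 2 * (speed * \<tau>), R1 + speed * \<tau>, 8 * A / \<eta>}"
  have R0: "1 \<le> R" "2 * (speed * \<tau>) \<le> R" "R1 + speed * \<tau> \<le> R" "8 * A / \<eta> \<le> R" if "R0 \<le> R" for R
    using that unfolding R0_def by (auto simp: Max_le_iff)
  have "\<exists>n0>0. \<forall>n\<ge>n0. \<forall>j\<le>n. W1 (\<nu> (node n j)) (distr (\<nu> 0) borel (euler \<nu> R n j)) \<le> \<eta>"
    if "R0 \<le> R" for R
  proof -
    note R = R0[OF that]
    have Rp: "0 < R" using R(1) by simp
    obtain KR where KR: "0 \<le> KR" "\<And>L c (f :: real ^ 'n \<Rightarrow> real ^ 'n). tame R L c f \<Longrightarrow>
      \<exists>D. (\<forall>x. (smear R f has_derivative D x) (at x)) \<and> (\<forall>x v. norm (D x v) \<le> (L + c) * norm v) \<and>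
      (\<forall>x y v. norm (D x v - D y v) \<le> KR * c * norm (x - y) * norm v)"
      by (rule smear_derivative[OF Rp]) blast
    obtain K where K: "0 \<le> K" "\<And>L c (f :: real ^ 'n \<Rightarrow> real). tame R L c f \<Longrightarrow> bump_class (L + c) (K * c) (smear R f)"
      using smear_bump_class[OF Rp] by metis
    let ?K0 = "K * (2 * ?N)"
    \<comment> \<open>The errors quadratic in the step size, summed over all steps, give
      \<open>Z\<close> times one step. \<open>Z\<close> contains \<open>K\<close> and
      \<open>KR\<close>, which come from \<open>R\<close>.\<close>
    define Z where "Z = step_const * \<tau> * (3 * ?N * ?Q + ?Q\<^sup>2 * (?K0 + \<tau> * (KR * speed) * (3 * ?N)))"
    have Z: "0 \<le> Z"
      unfolding Z_def using step_const_nonneg \<tau> K KR speed_pos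
      by (intro mult_nonneg_nonneg add_nonneg_nonneg) auto
    obtain n0 :: nat where n0: "2 * Z * \<tau> / \<eta> < real n0" "0 < n0"
      using reals_Archimedean2[of "max 0 (2 * Z * \<tau> / \<eta>)"] by force
    have "W1 (\<nu> (node n j)) (distr (\<nu> 0) borel (euler \<nu> R n j)) \<le> \<eta>" if nj: "n0 \<le> n" "j \<le> n" for n j
    proof -
      have n: "0 < n" using n0 nj by simp
      let ?h = "\<tau> / real n"
      let ?E = "3 * ?N * ?Q * (3 * (speed * ?h) / R) + step_const * ?h\<^sup>2 * (3 * ?N * ?Q + ?Q\<^sup>2 * (?K0 + \<tau> * (KR * speed) * (3 * ?N)))"
      have R1': "R1 \<le> R" "R1 \<le> R - speed * \<tau>"
        using R(3) mult_pos_pos[OF speed_pos \<tau>] by linarith+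
      have tails: "tail R (\<nu> s) \<le> 1" "tail R (\<nu> s) \<le> \<eta> / (24 * ?N)" "tail (R - speed * \<tau>) (\<nu> s) \<le> \<eta> / (24 * ?N)"
        if "s \<in> {0..\<tau>}" for s
        using R1[OF R1'(1) that] R1[OF R1'(2) that] by auto
      note em = euler_measurable[OF sol R(1) n nj(2)] and ed = euler_displacement_le[OF sol R(1) n nj(2)]
      have Pj: "\<nu> (node n j) \<in> P1" "distr (\<nu> 0) borel (euler \<nu> R n j) \<in> P1"
        using P node_range[OF n nj(2)] distr_P1[OF P0 em ed] by auto
      have "W1 (\<nu> (node n j)) (distr (\<nu> 0) borel (euler \<nu> R n j)) \<le> real n * ?E +
          ?N * (6 / R + tail R (\<nu> (node n j)) + tail R (distr (\<nu> 0) borel (euler \<nu> R n j)))"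
      proof (rule W1_le_tests[OF Pj Rp K(2)])
        fix \<phi> :: "real ^ 'n \<Rightarrow> real" assume \<phi>: "bump_class (3 * ?N) ?K0 \<phi>"
        have "\<bar>(LINT x|\<nu> (node n j). \<phi> x) - (LINT x|\<nu> 0. \<phi> (euler \<nu> R n j x))\<bar> \<le> real j * ?E"
          by (rule euler_test[OF sol R(1) n tails(1) KR, of "3 * ?N" ?K0 0 j \<phi>]) (use K nj \<phi> in simp_all)
        also have "\<dots> \<le> real n * ?E"
          using nj step_const_nonneg \<tau> K KR speed_pos R(1)
          by (intro mult_right_mono add_nonneg_nonneg mult_nonneg_nonneg divide_nonneg_nonneg) auto
        finally show "(LINT x|\<nu> (node n j). \<phi> x) - (LINT x|distr (\<nu> 0) borel (euler \<nu> R n j). \<phi> x) \<le> real n * ?E"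
          using integral_distr[OF P1_measurable[OF P0 em], of \<phi>]
            borel_measurable_continuous_onI[OF C_k_continuous[OF bump_classD(1)[OF \<phi>, of 0]]] by simp
      qed
      also have "real n * ?E = 3 * ?N * ?Q * (3 * speed) * \<tau> / R + Z * ?h"
        using n by (simp add: Z_def power2_eq_square field_simps)
      also have "\<dots> + ?N * (6 / R + tail R (\<nu> (node n j)) + tail R (distr (\<nu> 0) borel (euler \<nu> R n j)))
          = A / R + Z * ?h + ?N * (tail R (\<nu> (node n j)) + tail R (distr (\<nu> 0) borel (euler \<nu> R n j)))"
        by (simp add: A_def add_divide_distrib distrib_left)
      also have "\<dots> \<le> \<eta> / 8 + \<eta> / 2 + ?N * (\<eta> / (24 * ?N) + 2 * (\<eta> / (24 * ?N)))"
      proof (intro add_mono mult_left_mono)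
        show "A / R \<le> \<eta> / 8" using R(4) \<eta> Rp by (simp add: field_simps)
        have "2 * Z * \<tau> / \<eta> \<le> real n" using n0 nj by linarith
        then show "Z * ?h \<le> \<eta> / 2" using \<eta> n by (simp add: field_simps)
        show "tail R (\<nu> (node n j)) \<le> \<eta> / (24 * ?N)" using tails node_range[OF n nj(2)] by simp
        have "tail R (distr (\<nu> 0) borel (euler \<nu> R n j)) \<le> 2 * tail (R - speed * \<tau>) (\<nu> 0)"
          by (rule tail_distr[OF P0 em ed R(2)])
        then show "tail R (distr (\<nu> 0) borel (euler \<nu> R n j)) \<le> 2 * (\<eta> / (24 * ?N))"
          using tails(3)[of 0] \<tau> by simp
      qed simp
      also have "\<dots> \<le> \<eta>" using N \<eta> by (simp add: field_simps)
      finally show ?thesis .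
    qed
    then show ?thesis using n0(2) by blast
  qed
  moreover have "1 \<le> R0" unfolding R0_def by simp
  ultimately show ?thesis by blast
qed

end

section \<open>Approximate flows at all times, and uniqueness\<close>

context controlled
begin

lemma nearest_node:
  assumes "0 < n" "s \<in> {0..\<tau>}"
  obtains j where "j \<le> n" "node n j \<le> s" "s - node n j \<le> \<tau> / real n"
proof -
  define j where "j = nat \<lfloor>s * real n / \<tau>\<rfloor>"
  have x: "0 \<le> s * real n / \<tau>" using assms \<tau> by simp
  have j: "real j \<le> s * real n / \<tau>" "s * real n / \<tau> < real j + 1"
    using x by (simp_all add: j_def of_nat_nat le_floor_iff)
  have "s * real n / \<tau> \<le> real n" using assms \<tau> by (simp add: divide_le_eq mult_right_mono mult.commute)
  then have "j \<le> n" using j(1) by linarith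
  moreover have "node n j \<le> s" using j(1) assms \<tau> by (simp add: node_def field_simps)
  moreover have "s - node n j \<le> \<tau> / real n"
  proof -
    have "s * real n \<le> real j * \<tau> + \<tau>" using j(2) \<tau> by (simp add: field_simps)
    then have "s \<le> (real j * \<tau> + \<tau>) / real n" using assms by (simp add: le_divide_eq)
    then show ?thesis by (simp add: node_def add_divide_distrib)
  qed
  ultimately show thesis by (rule that)
qed

text \<open>The Euler maps at a node close below \<open>s\<close>. They jump in time, hence the
  extra \<open>\<eta>\<close> in the last estimate; the bounds on displacement and Lipschitz
  constant are independent of \<open>\<eta>\<close>, which is what compactness needs.\<close>

lemma euler_flow:
  assumes sol: "solves \<tau> a b \<nu>" and \<eta>: "0 < \<eta>"
  obtains Y :: "real \<Rightarrow> real ^ 'n \<Rightarrow> real ^ 'n" where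
    "\<And>s. s \<in> {0..\<tau>} \<Longrightarrow> W1 (\<nu> s) (distr (\<nu> 0) borel (Y s)) \<le> \<eta>"
    "\<And>s x. norm (Y s x - x) \<le> speed * \<tau>"
    "\<And>s x y. norm (Y s x - Y s y) \<le> exp (2 * speed * \<tau>) * norm (x - y)"
    "\<And>s t x. s \<in> {0..\<tau>} \<Longrightarrow> t \<in> {0..\<tau>} \<Longrightarrow> norm (Y s x - Y t x) \<le> speed * \<bar>s - t\<bar> + \<eta>"
proof -
  let ?c = "3 * real CARD('n) * speed"
  have c: "0 < ?c" using speed_pos by simp
  obtain R where R: "1 \<le> R" and "\<exists>n0>0. \<forall>n\<ge>n0. \<forall>j\<le>n. W1 (\<nu> (node n j)) (distr (\<nu> 0) borel (euler \<nu> R n j)) \<le> \<eta> / 2"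
    using euler_convergence[OF sol, of "\<eta> / 2"] \<eta> by auto
  then obtain n0 where n0: "0 < n0" "\<And>n j. n0 \<le> n \<Longrightarrow> j \<le> n \<Longrightarrow> W1 (\<nu> (node n j)) (distr (\<nu> 0) borel (euler \<nu> R n j)) \<le> \<eta> / 2"
    by metis
  obtain n1 :: nat where n1: "2 * (?c + speed) * \<tau> / \<eta> < real n1" using reals_Archimedean2 by blast
  define n where "n = max n0 n1"
  have n: "0 < n" "n0 \<le> n" using n0 by (auto simp: n_def)
  have h: "(?c + speed) * (\<tau> / real n) \<le> \<eta> / 2"
  proof -
    have "2 * (?c + speed) * \<tau> / \<eta> < real n" using n1 by (simp add: n_def)
    then show ?thesis using \<eta> n by (simp add: field_simps)
  qed
  have hp: "0 < \<tau> / real n" using \<tau> n by simp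
  have ch: "?c * (\<tau> / real n) \<le> \<eta> / 2" "speed * (\<tau> / real n) \<le> \<eta>"
    using h mult_pos_pos[OF speed_pos hp] mult_pos_pos[OF c hp] \<eta> by (simp_all only: distrib_right)
  \<comment> \<open>Index 0 outside the interval gives the identity map, so the displacement and
    Lipschitz bounds hold for every \<open>s\<close>.\<close>
  define J where "J s = (if s \<in> {0..\<tau>} then SOME j. j \<le> n \<and> node n j \<le> s \<and> s - node n j \<le> \<tau> / real n else 0)" for s
  have J: "J s \<le> n \<and> node n (J s) \<le> s \<and> s - node n (J s) \<le> \<tau> / real n" if "s \<in> {0..\<tau>}" for s
  proof -
    have "\<exists>j. j \<le> n \<and> node n j \<le> s \<and> s - node n j \<le> \<tau> / real n"
      by (rule nearest_node[OF n(1) that]) blast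
    from someI_ex[OF this] show ?thesis using that unfolding J_def by (simp only: if_True)
  qed
  have Jn: "J s \<le> n" for s using J[of s] by (cases "s \<in> {0..\<tau>}") (auto simp: J_def)
  note em = euler_measurable[OF sol R n(1)] and ed = euler_displacement_le[OF sol R n(1)]
  show thesis
  proof (rule that[of "\<lambda>s. euler \<nu> R n (J s)"])
    fix s assume s: "s \<in> {0..\<tau>}"
    let ?j = "J s"
    have P: "\<nu> s \<in> P1" "\<nu> (node n ?j) \<in> P1" "distr (\<nu> 0) borel (euler \<nu> R n ?j) \<in> P1"
      using solves_P1[OF sol] s node_range[OF n(1) Jn] \<tau> distr_P1[OF _ em[OF Jn] ed[OF Jn]] by auto
    have "W1 (\<nu> s) (\<nu> (node n ?j)) \<le> ?c * \<bar>s - node n ?j\<bar>"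
      by (rule solves_lipschitz[OF sol s node_range[OF n(1) Jn]])
    also have "\<dots> \<le> ?c * (\<tau> / real n)" using J[OF s] c by (intro mult_left_mono) auto
    also note ch(1)
    finally have "W1 (\<nu> s) (\<nu> (node n ?j)) \<le> \<eta> / 2" .
    then show "W1 (\<nu> s) (distr (\<nu> 0) borel (euler \<nu> R n ?j)) \<le> \<eta>"
      using W1_triangle[OF P] n0(2)[OF n(2) Jn] by (smt (verit) field_sum_of_halves)
  next
    fix s x show "norm (euler \<nu> R n (J s) x - x) \<le> speed * \<tau>" by (rule ed[OF Jn])
  next
    fix s x y show "norm (euler \<nu> R n (J s) x - euler \<nu> R n (J s) y) \<le> exp (2 * speed * \<tau>) * norm (x - y)"
      by (rule euler_lipschitz[OF sol R n(1) Jn])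
  next
    fix s t x assume st: "s \<in> {0..\<tau>}" "t \<in> {0..\<tau>}"
    have "norm (euler \<nu> R n (J s) x - euler \<nu> R n (J t) x) \<le> speed * \<bar>node n (J s) - node n (J t)\<bar>"
    proof (cases "J t \<le> J s")
      case True
      have "speed * (node n (J s) - node n (J t)) \<le> speed * \<bar>node n (J s) - node n (J t)\<bar>"
        using speed_pos by (intro mult_left_mono) auto
      then show ?thesis using euler_increment[OF sol R n(1) True Jn, of x] by linarith
    next
      case False
      then have le: "J s \<le> J t" by simp
      have "speed * (node n (J t) - node n (J s)) \<le> speed * \<bar>node n (J s) - node n (J t)\<bar>"
        using speed_pos by (intro mult_left_mono) auto
      then show ?thesis using euler_increment[OF sol R n(1) le Jn, of x] by (simp add: norm_minus_commute)
    qed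
    also have "\<dots> \<le> speed * (\<bar>s - t\<bar> + \<tau> / real n)"
      using J[OF st(1)] J[OF st(2)] speed_pos by (intro mult_left_mono) (auto simp: abs_le_iff)
    finally show "norm (euler \<nu> R n (J s) x - euler \<nu> R n (J t) x) \<le> speed * \<bar>s - t\<bar> + \<eta>"
      using ch(2) by (simp only: distrib_left)
  qed
qed

text \<open>The Euler maps of the two solutions differ only through the convolution term, so a discrete Gronwall
  estimate bounds their distance by the errors that they make as approximations of the solutions.\<close>

theorem solves_unique:
  assumes sol: "solves \<tau> a b \<mu>" "solves \<tau> a b \<nu>" and eq0: "\<mu> 0 = \<nu> 0" and s: "s \<in> {0..\<tau>}"
  shows "\<mu> s = \<nu> s"
proof -
  let ?N = "real CARD('n)"
  \<comment> \<open>\<open>k\<close> measures how strongly an error in \<open>W1\<close> feeds back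
    into the velocity; \<open>\<rho>\<close> is the resulting growth rate, with
    \<open>2 * speed\<close> from the Lipschitz constant of the increments. In \<open>C\<close> the
    last summand pays for moving from \<open>s\<close> to a node, once for each solution.\<close>
  define k where "k = ?N * c * B"
  have k: "0 \<le> k" using c_pos B1 by (simp add: k_def)
  define \<rho> where "\<rho> = 2 * speed + k * ?N"
  have \<rho>: "0 \<le> \<rho>" using k speed_pos by (simp add: \<rho>_def)
  define C where "C = 2 + ?N * (2 * k * \<tau> * exp (\<rho> * \<tau>)) + 6 * ?N * speed"
  have C: "0 < C" using k speed_pos \<tau> by (simp add: C_def add_pos_nonneg)
  have P: "\<mu> s \<in> P1" "\<nu> s \<in> P1" if "s \<in> {0..\<tau>}" for s using solves_P1 sol that by auto
  have P0: "\<mu> 0 \<in> P1" using P \<tau> by simp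
  have main: "W1 (\<mu> s) (\<nu> s) \<le> C * \<eta>" if \<eta>: "0 < \<eta>" for \<eta>
  proof -
    obtain R1 where R1: "1 \<le> R1" "\<And>R. R1 \<le> R \<Longrightarrow> \<exists>n0>0. \<forall>n\<ge>n0. \<forall>j\<le>n. W1 (\<mu> (node n j)) (distr (\<mu> 0) borel (euler \<mu> R n j)) \<le> \<eta>"
      using euler_convergence[OF sol(1) \<eta>] by blast
    obtain R2 where R2: "1 \<le> R2" "\<And>R. R2 \<le> R \<Longrightarrow> \<exists>n0>0. \<forall>n\<ge>n0. \<forall>j\<le>n. W1 (\<nu> (node n j)) (distr (\<nu> 0) borel (euler \<nu> R n j)) \<le> \<eta>"
      using euler_convergence[OF sol(2) \<eta>] by blast
    \<comment> \<open>\<open>smear_diff_bounded\<close> compares smears of equal width, so both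
      schemes use the same \<open>R\<close>.\<close>
    define R where "R = max R1 R2"
    have R: "1 \<le> R" using R1 by (simp add: R_def)
    obtain n1 where n1: "0 < n1" "\<And>n j. n1 \<le> n \<Longrightarrow> j \<le> n \<Longrightarrow> W1 (\<mu> (node n j)) (distr (\<mu> 0) borel (euler \<mu> R n j)) \<le> \<eta>"
      using R1(2)[of R] unfolding R_def by auto
    obtain n2 where n2: "\<And>n j. n2 \<le> n \<Longrightarrow> j \<le> n \<Longrightarrow> W1 (\<nu> (node n j)) (distr (\<nu> 0) borel (euler \<nu> R n j)) \<le> \<eta>"
      using R2(2)[of R] unfolding R_def by auto
    obtain n3 :: nat where n3: "\<tau> / \<eta> < real n3" using reals_Archimedean2 by blast
    define n where "n = max (max n1 n2) n3"
    have n: "0 < n" using n1 by (simp add: n_def)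
    let ?h = "\<tau> / real n"
    have h: "0 < ?h" "?h \<le> \<eta>"
    proof -
      have "\<tau> / \<eta> < real n" using n3 by (simp add: n_def)
      then show "?h \<le> \<eta>" using \<eta> n by (simp add: field_simps)
    qed (use \<tau> n in simp)
    let ?X = "euler \<mu> R n" and ?Y = "euler \<nu> R n"
    \<comment> \<open>Closes the loop: the distance of the Euler maps bounds the distance of the
      solutions, which in turn governs the difference of the next increments.\<close>
    have W: "W1 (\<mu> (node n j)) (\<nu> (node n j)) \<le> 2 * \<eta> + ?N * e"
      if j: "j \<le> n" and e: "\<And>x. norm (?X j x - ?Y j x) \<le> e" for j e
    proof -
      note d1 = euler_measurable[OF sol(1) R n j] euler_displacement_le[OF sol(1) R n j]
      note d2 = euler_measurable[OF sol(2) R n j] euler_displacement_le[OF sol(2) R n j]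
      note Pj = P[OF node_range[OF n j]] distr_P1[OF P0 d1] distr_P1[OF P0 d2]
      have "W1 (\<mu> (node n j)) (\<nu> (node n j)) \<le> W1 (\<mu> (node n j)) (distr (\<mu> 0) borel (?X j))
          + (W1 (distr (\<mu> 0) borel (?X j)) (distr (\<mu> 0) borel (?Y j)) + W1 (distr (\<mu> 0) borel (?Y j)) (\<nu> (node n j)))"
        using W1_triangle[OF Pj(1,3,2)] W1_triangle[OF Pj(3,4,2)] by linarith
      also have "\<dots> \<le> \<eta> + (?N * e + \<eta>)"
      proof (intro add_mono)
        show "W1 (\<mu> (node n j)) (distr (\<mu> 0) borel (?X j)) \<le> \<eta>" by (rule n1(2)) (use j in \<open>auto simp: n_def\<close>)
        show "W1 (distr (\<mu> 0) borel (?X j)) (distr (\<mu> 0) borel (?Y j)) \<le> ?N * e"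
          by (rule W1_distr_le_sup[OF P0 d1 d2 e])
        show "W1 (distr (\<mu> 0) borel (?Y j)) (\<nu> (node n j)) \<le> \<eta>"
          unfolding eq0 by (subst W1_commute, rule n2) (use j in \<open>auto simp: n_def\<close>)
      qed
      finally show ?thesis by simp
    qed
    \<comment> \<open>The recursion e' \<le> (1 + \<rho> h) e + 2 k \<eta> h starts from 0, since
      both schemes begin with the identity.\<close>
    have d: "j \<le> n \<Longrightarrow> norm (?X j x - ?Y j x) \<le> 2 * k * \<eta> * node n j * (1 + \<rho> * ?h) ^ j" for j x
    proof (induction j arbitrary: x)
      case (Suc j)
      let ?s = "node n j" and ?t = "node n (Suc j)" and ?e = "2 * k * \<eta> * node n j * (1 + \<rho> * ?h) ^ j"
      have j: "j < n" "j \<le> n" using Suc.prems by auto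
      have IH: "norm (?X j x - ?Y j x) \<le> ?e" for x using Suc by simp
      have st: "0 \<le> ?s" "?s \<le> ?t" "?t \<le> \<tau>" and ts: "?t - ?s = ?h"
        using node_range[OF n, of j] node_range[OF n, of "Suc j"] node_Suc(2)[where j = j and n = n] node_Suc(1)[OF n, of j] j
        by auto
      have Ps: "\<mu> ?s \<in> P1" "\<nu> ?s \<in> P1" using P node_range[OF n j(2)] by auto
      have inc: "norm (increment \<mu> R n j y - increment \<nu> R n j y) \<le> k * ?h * (2 * \<eta> + ?N * ?e)" for y
        unfolding increment_def
      proof (rule smear_diff_bounded[OF increment_tame[OF sol(1) R n j(1)] increment_tame[OF sol(2) R n j(1)]])
        fix x
        have "\<bar>LINT r:{?s..?t}|lborel. a r\<bar> \<le> B * ?h"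
          using csize_integral_le[OF co st] norm1_nonneg[of "LINT r:{?s..?t}|lborel. b r"]
          by (simp add: csize_def ts)
        then have "\<bar>LINT r:{?s..?t}|lborel. a r\<bar> * (?N * c * W1 (\<mu> ?s) (\<nu> ?s)) \<le> B * ?h * (?N * c * (2 * \<eta> + ?N * ?e))"
          using c_pos W1_nonneg[OF Ps] W[OF j(2) IH] by (intro mult_mono mult_left_mono) auto
        then show "norm (mean_velocity (\<mu> ?s) ?s ?t x - mean_velocity (\<nu> ?s) ?s ?t x) \<le> k * ?h * (2 * \<eta> + ?N * ?e)"
          using velocity_diff[OF Ps, of "LINT r:{?s..?t}|lborel. a r" "LINT r:{?s..?t}|lborel. b r" x]
          unfolding mean_velocity_def k_def by (simp only: mult_ac)
      qed
      have eq: "?X (Suc j) x - ?Y (Suc j) x = (?X j x - ?Y j x) + ((increment \<mu> R n j (?X j x) - increment \<mu> R n j (?Y j x))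
          + (increment \<mu> R n j (?Y j x) - increment \<nu> R n j (?Y j x)))"
        by simp
      have "norm (?X (Suc j) x - ?Y (Suc j) x) \<le> norm (?X j x - ?Y j x) + (norm (increment \<mu> R n j (?X j x) - increment \<mu> R n j (?Y j x))
          + norm (increment \<mu> R n j (?Y j x) - increment \<nu> R n j (?Y j x)))"
        unfolding eq by (rule order_trans[OF norm_triangle_ineq add_left_mono[OF norm_triangle_ineq]])
      also have "\<dots> \<le> ?e + (2 * speed * ?h * ?e + k * ?h * (2 * \<eta> + ?N * ?e))"
      proof -
        have "0 \<le> 2 * speed * ?h" using speed_pos h by (intro mult_nonneg_nonneg) auto
        then show ?thesis
          by (intro add_mono IH inc order_trans[OF increment_lipschitz[OF sol(1) R n j(1)] mult_left_mono[OF IH]])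
      qed
      also have "\<dots> = (1 + \<rho> * ?h) * ?e + 2 * k * \<eta> * ?h"
        by (simp add: \<rho>_def algebra_simps)
      also have "\<dots> \<le> (1 + \<rho> * ?h) * ?e + 2 * k * \<eta> * ?h * (1 + \<rho> * ?h) ^ Suc j"
      proof -
        have "1 \<le> (1 + \<rho> * ?h) ^ Suc j"
          using mult_nonneg_nonneg[OF \<rho> less_imp_le[OF h(1)]] by (intro one_le_power) simp
        then have "2 * k * \<eta> * ?h * 1 \<le> 2 * k * \<eta> * ?h * (1 + \<rho> * ?h) ^ Suc j"
          using k \<eta> h(1) by (intro mult_left_mono mult_nonneg_nonneg) auto
        then show ?thesis by simp
      qed
      also have "\<dots> = 2 * k * \<eta> * ?t * (1 + \<rho> * ?h) ^ Suc j"
      proof -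
        have t: "?t = ?s + ?h" using ts by simp
        show ?thesis unfolding t by (simp add: algebra_simps)
      qed
      finally show ?case .
    qed simp
    obtain j where j: "j \<le> n" "node n j \<le> s" "s - node n j \<le> ?h" by (rule nearest_node[OF n s])
    have dj: "norm (?X j x - ?Y j x) \<le> 2 * k * \<tau> * exp (\<rho> * \<tau>) * \<eta>" for x
    proof -
      have "node n j * (1 + \<rho> * ?h) ^ j \<le> \<tau> * exp (\<rho> * \<tau>)"
        using node_range[OF n j(1)] growth[OF sol(1) R n j(1) \<rho>] mult_nonneg_nonneg[OF \<rho> less_imp_le[OF h(1)]] \<tau>
        by (intro mult_mono zero_le_power) auto
      then have "(2 * k * \<eta>) * (node n j * (1 + \<rho> * ?h) ^ j) \<le> (2 * k * \<eta>) * (\<tau> * exp (\<rho> * \<tau>))"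
        using k \<eta> by (intro mult_left_mono) auto
      then show ?thesis using d[OF j(1), of x] by (simp only: mult_ac)
    qed
    have l: "W1 (\<mu> s) (\<mu> (node n j)) \<le> 3 * ?N * speed * \<eta>" "W1 (\<nu> (node n j)) (\<nu> s) \<le> 3 * ?N * speed * \<eta>"
    proof -
      have "3 * ?N * speed * \<bar>s - node n j\<bar> \<le> 3 * ?N * speed * \<eta>"
        using j h speed_pos by (intro mult_left_mono) auto
      then show "W1 (\<mu> s) (\<mu> (node n j)) \<le> 3 * ?N * speed * \<eta>" "W1 (\<nu> (node n j)) (\<nu> s) \<le> 3 * ?N * speed * \<eta>"
        using solves_lipschitz[OF sol(1) s node_range[OF n j(1)]] solves_lipschitz[OF sol(2) node_range[OF n j(1)] s]
        unfolding abs_minus_commute[of "node n j" s] by (blast intro: order_trans)+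
    qed
    note Pj = P[OF node_range[OF n j(1)]]
    have "W1 (\<mu> s) (\<nu> s) \<le> W1 (\<mu> s) (\<mu> (node n j)) + (W1 (\<mu> (node n j)) (\<nu> (node n j)) + W1 (\<nu> (node n j)) (\<nu> s))"
      using W1_triangle[OF P(1)[OF s] Pj(1) P(2)[OF s]] W1_triangle[OF Pj P(2)[OF s]] by linarith
    also have "\<dots> \<le> 3 * ?N * speed * \<eta> + ((2 * \<eta> + ?N * (2 * k * \<tau> * exp (\<rho> * \<tau>) * \<eta>)) + 3 * ?N * speed * \<eta>)"
      by (intro add_mono l W[OF j(1) dj])
    also have "\<dots> = C * \<eta>" by (simp add: C_def algebra_simps)
    finally show ?thesis .
  qed
  have "W1 (\<mu> s) (\<nu> s) \<le> 0 + e" if "0 < e" for e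
    using main[of "e / C"] that C by simp
  then have "W1 (\<mu> s) (\<nu> s) \<le> 0" by (rule field_le_epsilon)
  then show ?thesis
    using W1_nonneg[OF P[OF s]] W1_eq_0[OF P[OF s]] by linarith
qed

end

section \<open>Compactness\<close>

text \<open>Diagonal extraction on a countable dense subset. The defects \<open>e k\<close> vanish,
  so the equicontinuity argument still gives Cauchy sequences at all points; for the Euler maps they
  account for the jumps in time.\<close>

lemma asymptotically_lipschitz_subsequence:
  fixes F :: "nat \<Rightarrow> 'a::euclidean_space \<Rightarrow> 'b::euclidean_space"
  assumes S: "S \<noteq> {}" and M: "\<And>k z. z \<in> S \<Longrightarrow> norm (F k z) \<le> M"
    and L: "\<And>k z w. z \<in> S \<Longrightarrow> w \<in> S \<Longrightarrow> norm (F k z - F k w) \<le> L * norm (z - w) + e k"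
    and e: "e \<longlonglongrightarrow> 0" and L0: "0 \<le> L"
  obtains r G where "strict_mono r" "\<And>z. z \<in> S \<Longrightarrow> (\<lambda>k. F (r k) z) \<longlonglongrightarrow> G z"
proof -
  obtain D where D: "countable D" "D \<subseteq> S" "S \<subseteq> closure D"
    by (rule separable)
  obtain r where r: "strict_mono (r :: nat \<Rightarrow> nat)" "\<And>x. x \<in> D \<Longrightarrow> \<exists>l. (\<lambda>n. F (r n) x) \<longlonglongrightarrow> l"
    by (rule function_convergent_subsequence[OF D(1), of F M]) (use M D(2) in blast)+
  have er: "(\<lambda>k. e (r k)) \<longlonglongrightarrow> 0" using LIMSEQ_subseq_LIMSEQ[OF e r(1)] by (simp add: o_def)
  have "convergent (\<lambda>k. F (r k) z)" if z: "z \<in> S" for z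
    unfolding Cauchy_convergent_iff[symmetric]
  proof (rule metric_CauchyI)
    fix \<epsilon> :: real assume \<epsilon>: "0 < \<epsilon>"
    have "0 < \<epsilon> / (5 * (L + 1))" using \<epsilon> L0 by simp
    then obtain w where w: "w \<in> D" "dist w z < \<epsilon> / (5 * (L + 1))"
      using D(3) z closure_approachable by blast
    have wS: "w \<in> S" using w D by blast
    have Lw: "L * norm (z - w) \<le> \<epsilon> / 5"
    proof -
      have "L * norm (z - w) \<le> (L + 1) * (\<epsilon> / (5 * (L + 1)))"
        using w(2) L0 by (intro mult_mono) (auto simp: dist_norm norm_minus_commute)
      moreover have "(L + 1) * (\<epsilon> / (5 * (L + 1))) = \<epsilon> / 5"
      proof -
        have "L + 1 \<noteq> 0" using L0 by simp
        then show ?thesis by (simp add: divide_simps)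
      qed
      ultimately show ?thesis by linarith
    qed
    obtain N1 where N1: "\<And>k. N1 \<le> k \<Longrightarrow> \<bar>e (r k)\<bar> < \<epsilon> / 5"
      using LIMSEQ_D[OF er, of "\<epsilon> / 5"] \<epsilon> by auto
    have "Cauchy (\<lambda>k. F (r k) w)" using r(2)[OF w(1)] LIMSEQ_imp_Cauchy by blast
    then obtain N2 where N2: "\<And>m n. N2 \<le> m \<Longrightarrow> N2 \<le> n \<Longrightarrow> dist (F (r m) w) (F (r n) w) < \<epsilon> / 5"
      using metric_CauchyD[of _ "\<epsilon> / 5"] \<epsilon> by (metis zero_less_divide_iff zero_less_numeral)
    have "dist (F (r m) z) (F (r n) z) < \<epsilon>" if "max N1 N2 \<le> m" "max N1 N2 \<le> n" for m n
    proof -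
      have "dist (F (r m) z) (F (r n) z) \<le> dist (F (r m) z) (F (r m) w) + (dist (F (r m) w) (F (r n) w) + dist (F (r n) w) (F (r n) z))"
        using dist_triangle[of "F (r m) z" "F (r n) z" "F (r m) w"] dist_triangle[of "F (r m) w" "F (r n) z" "F (r n) w"] by linarith
      moreover have d: "dist (F (r k) z) (F (r k) w) < 2 * (\<epsilon> / 5)" if "N1 \<le> k" for k
        using L[OF z wS, of "r k"] Lw N1[OF that] unfolding dist_norm by linarith
      ultimately show ?thesis
        using N2[of m n] d[of m] d[of n] that dist_commute[of "F (r n) w" "F (r n) z"] by linarith
    qed
    then show "\<exists>M. \<forall>m\<ge>M. \<forall>n\<ge>M. dist (F (r m) z) (F (r n) z) < \<epsilon>" by blast
  qed
  then have "(\<lambda>k. F (r k) z) \<longlonglongrightarrow> lim (\<lambda>k. F (r k) z)" if "z \<in> S" for z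
    by (rule convergent_LIMSEQ_iff[THEN iffD1, OF _ ]) (rule that)
  then show thesis by (rule that[OF r(1)])
qed

section \<open>From the weak formulation to the integral form\<close>

lemma primitive_continuous:
  fixes h :: "real \<Rightarrow> 'b::euclidean_space"
  assumes "set_integrable lborel {0..T} h"
  shows "continuous_on {0..T} (primitive h)"
proof -
  have c: "continuous_on {0..T} (\<lambda>t. integral {0..t} h)"
    by (rule indefinite_integral_continuous_1[OF set_borel_integral_eq_integral(1)[OF assms]])
  have "integral {0..t} h = primitive h t" if "t \<in> {0..T}" for t
    unfolding primitive_def
    using set_borel_integral_eq_integral(2)[OF set_integrable_Icc_subset[OF assms, of 0 t]] that by simp
  then show ?thesis by (rule continuous_on_eq[OF c])
qed

lemma primitive_diff:
  fixes h :: "real \<Rightarrow> 'b::euclidean_space"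
  assumes "set_integrable lborel {0..T} h" "0 \<le> s" "s \<le> t" "t \<le> T"
  shows "(LINT r:{s..t}|lborel. h r) = primitive h t - primitive h s"
proof -
  have i: "h integrable_on {0..t}" "(LINT r:{0..t}|lborel. h r) = integral {0..t} h"
      "(LINT r:{0..s}|lborel. h r) = integral {0..s} h" "(LINT r:{s..t}|lborel. h r) = integral {s..t} h"
    by (rule set_borel_integral_eq_integral[OF set_integrable_Icc_subset[OF assms(1)]]; use assms in simp)+
  show ?thesis
    unfolding primitive_def i(2-4)
    using Henstock_Kurzweil_Integration.integral_combine[OF assms(2,3) i(1)] by (simp add: algebra_simps)
qed

lemma primitive_lipschitz:
  fixes h :: "real \<Rightarrow> 'b::euclidean_space"
  assumes int: "set_integrable lborel {0..S} h" and B: "\<And>r. r \<in> {0..S} \<Longrightarrow> norm (h r) \<le> B" and st: "s \<in> {0..S}" "t \<in> {0..S}"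
  shows "norm (primitive h s - primitive h t) \<le> B * \<bar>s - t\<bar>"
proof -
  have le: "norm (primitive h t - primitive h s) \<le> B * (t - s)" if "0 \<le> s" "s \<le> t" "t \<le> S" for s t
  proof -
    have i1: "integrable lborel (\<lambda>r. norm (indicator {s..t} r *\<^sub>R h r))"
      using set_integrable_Icc_subset[OF int that(1,3)] unfolding set_integrable_def by (rule integrable_norm)
    have i2: "integrable lborel (\<lambda>r. indicator {s..t} r *\<^sub>R B)"
      by (rule borel_integrable_compact[OF compact_Icc]) (rule continuous_on_const)
    have "norm (LINT r|lborel. indicator {s..t} r *\<^sub>R h r) \<le> (LINT r|lborel. norm (indicator {s..t} r *\<^sub>R h r))"
      by (rule integral_norm_bound)
    also have "\<dots> \<le> (LINT r|lborel. indicator {s..t} r *\<^sub>R B)"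
      by (rule integral_mono[OF i1 i2]) (use B that in \<open>auto simp: indicator_def\<close>)
    also have "\<dots> = B * (t - s)" using that set_integral_const[of "{s..t}" lborel B] by (simp add: set_lebesgue_integral_def)
    finally show ?thesis unfolding primitive_diff[OF int that, symmetric] set_lebesgue_integral_def .
  qed
  show ?thesis
  proof (cases "s \<le> t")
    case True
    then show ?thesis using le[of s t] st by (simp add: norm_minus_commute)
  next
    case False
    then show ?thesis using le[of t s] st by simp
  qed
qed

lemma smooth_step_derivative:
  obtains st st' :: "real \<Rightarrow> real" and S where "\<And>k. C_k k st" "\<And>t. t \<le> 0 \<Longrightarrow> st t = 0" "\<And>t. 1 \<le> t \<Longrightarrow> st t = 1"
    "\<And>t. (st has_real_derivative st' t) (at t)" "continuous_on UNIV st'" "integrable lborel st'"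
    "(LINT t|lborel. st' t) = 1" "\<And>t. \<bar>st t\<bar> \<le> S"
proof -
  obtain st :: "real \<Rightarrow> real" where st: "\<And>k. C_k k st" "\<And>t. t \<le> 0 \<Longrightarrow> st t = 0" "\<And>t. 1 \<le> t \<Longrightarrow> st t = 1"
    using smooth_step by blast
  define st' where "st' t = frechet_derivative st (at t) 1" for t
  have d: "(st has_real_derivative st' t) (at t)" for t
  proof -
    have hd: "(st has_derivative frechet_derivative st (at t)) (at t)"
      by (rule C_k_Suc_has_derivative[OF st(1)[of "Suc 0"]])
    have "frechet_derivative st (at t) v = st' t * v" for v
      using linear_scale[OF has_derivative_linear[OF hd], of v 1]
      unfolding st'_def real_scaleR_def mult_1_right mult.commute[of v] .
    then have "frechet_derivative st (at t) = (*) (st' t)" by (rule ext)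
    then show ?thesis using hd unfolding has_field_derivative_def by (simp only:)
  qed
  have c: "continuous_on UNIV st'"
    using st(1)[of "Suc 0"] by (simp add: st'_def[abs_def])
  have z: "st' t = 0" if "t \<notin> cbox 0 1" for t
  proof -
    have "(st has_real_derivative 0) (at t)"
    proof (cases "t < 0")
      case True
      have "((\<lambda>_. 0) has_real_derivative 0) (at t)" by simp
      then show ?thesis
        by (rule has_field_derivative_transform_within_open[where S = "{..<0}"]) (use True st in auto)
    next
      case False
      have "((\<lambda>_. 1) has_real_derivative 0) (at t)" by simp
      then show ?thesis
        by (rule has_field_derivative_transform_within_open[where S = "{1<..}"]) (use False that st in auto)
    qed
    then show ?thesis using d DERIV_unique by blast
  qed
  note i = integrable_lborel_compact_support[OF c z]
  have "(st' has_integral (st 1 - st 0)) {0..1}"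
    by (rule fundamental_theorem_of_calculus)
       (use d in \<open>auto simp: has_real_derivative_iff_has_vector_derivative[symmetric] intro: has_field_derivative_at_within\<close>)
  then have "integral (cbox 0 1) st' = 1" using st by (simp add: integral_unique)
  with i(2) have i1: "(LINT t|lborel. st' t) = 1" by simp
  have "bounded (st ` {0..1})"
    by (intro compact_imp_bounded compact_continuous_image continuous_on_subset[OF C_k_continuous[OF st(1)[of 0]]]) auto
  then obtain S where S: "\<And>t. t \<in> {0..1} \<Longrightarrow> \<bar>st t\<bar> \<le> S"
    unfolding bounded_iff by (metis image_eqI real_norm_def)
  have "\<bar>st t\<bar> \<le> max 1 S" for t
    using S[of t] st(2)[of t] st(3)[of t] by (cases "t < 0"; cases "1 < t") auto
  then show thesis using that[OF st d c i(1) i1] by blast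
qed

text \<open>After the substitution r = p n + e n y this is dominated convergence. The centres may
  move because the falling edge of the time cutoff below is placed on
  \<open>{t - e n..t}\<close>.\<close>

lemma concentrating_kernel:
  fixes H st' :: "real \<Rightarrow> real"
  assumes "integrable lborel st'" "(LINT t|lborel. st' t) = 1" "continuous_on UNIV st'"
    and H: "continuous_on {0..\<tau>} H" and s: "0 < s" "s < \<tau>" and e: "\<And>n. 0 < e n" "e \<longlonglongrightarrow> 0"
    and p: "\<And>n. \<bar>p n - s\<bar> \<le> e n"
  shows "(\<lambda>n. LINT r:{0..\<tau>}|lborel. st' ((r - p n) / e n) / e n * H r) \<longlonglongrightarrow> H s"
proof -
  have "bounded (H ` {0..\<tau>})"
    by (intro compact_imp_bounded compact_continuous_image H compact_Icc)
  then obtain M where M: "\<And>r. r \<in> {0..\<tau>} \<Longrightarrow> \<bar>H r\<bar> \<le> M"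
    unfolding bounded_iff by (metis image_eqI real_norm_def)
  have M0: "0 \<le> M" using M[of s] s by auto
  define G where "G r = indicator {0..\<tau>} r *\<^sub>R H r" for r
  have Gm [measurable]: "G \<in> borel_measurable borel"
    unfolding G_def by (rule borel_measurable_continuous_on_indicator[OF _ H]) simp
  have stm [measurable]: "st' \<in> borel_measurable borel"
    by (rule borel_measurable_continuous_onI[OF assms(3)])
  have eq: "(LINT r:{0..\<tau>}|lborel. st' ((r - p n) / e n) / e n * H r) = (LINT y|lborel. st' y * G (p n + e n * y))" for n
  proof -
    have "(LINT r:{0..\<tau>}|lborel. st' ((r - p n) / e n) / e n * H r) = (LINT r|lborel. st' ((r - p n) / e n) / e n * G r)"
      unfolding set_lebesgue_integral_def G_def by (intro Bochner_Integration.integral_cong) (auto simp: indicator_def)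
    also have "\<dots> = \<bar>e n\<bar> *\<^sub>R (LINT y|lborel. st' ((p n + e n * y - p n) / e n) / e n * G (p n + e n * y))"
      by (rule lborel_integral_real_affine) (use e(1)[of n] in simp)
    also have "(\<lambda>y. st' ((p n + e n * y - p n) / e n) / e n * G (p n + e n * y)) = (\<lambda>y. 1 / e n * (st' y * G (p n + e n * y)))"
      using e(1)[of n] by (simp add: fun_eq_iff)
    also have "\<bar>e n\<bar> *\<^sub>R (LINT y|lborel. 1 / e n * (st' y * G (p n + e n * y))) = (LINT y|lborel. st' y * G (p n + e n * y))"
      unfolding integral_mult_right_zero using e(1)[of n] by simp
    finally show ?thesis .
  qed
  have pl: "p \<longlonglongrightarrow> s"
  proof -
    have "(\<lambda>n. p n - s) \<longlonglongrightarrow> 0" by (rule Lim_null_comparison[OF _ e(2)]) (use p in auto)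
    then show ?thesis by (simp add: LIM_zero_iff)
  qed
  have "(\<lambda>n. LINT y|lborel. st' y * G (p n + e n * y)) \<longlonglongrightarrow> (LINT y|lborel. st' y * H s)"
  proof (rule integral_dominated_convergence[where w = "\<lambda>y. \<bar>st' y\<bar> * M"])
    show "AE y in lborel. (\<lambda>n. st' y * G (p n + e n * y)) \<longlonglongrightarrow> st' y * H s"
    proof (rule AE_I2)
      fix y
      have "(\<lambda>n. p n + e n * y) \<longlonglongrightarrow> s + 0 * y" by (intro tendsto_intros pl e(2))
      then have l: "(\<lambda>n. p n + e n * y) \<longlonglongrightarrow> s" by simp
      have ev: "eventually (\<lambda>n. p n + e n * y \<in> {0<..<\<tau>}) sequentially"
        by (rule topological_tendstoD[OF l]) (use s in auto)
      have "isCont H s" using H s continuous_on_interior[of "{0..\<tau>}" H s] by (simp add: interior_atLeastAtMost_real)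
      then have "(\<lambda>n. H (p n + e n * y)) \<longlonglongrightarrow> H s" by (rule isCont_tendsto_compose[OF _ l])
      then have "(\<lambda>n. G (p n + e n * y)) \<longlonglongrightarrow> H s"
        by (rule Lim_transform_eventually) (use ev in eventually_elim, auto simp: G_def)
      then show "(\<lambda>n. st' y * G (p n + e n * y)) \<longlonglongrightarrow> st' y * H s" by (intro tendsto_intros)
    qed
    show "AE y in lborel. norm (st' y * G (p n + e n * y)) \<le> \<bar>st' y\<bar> * M" for n
    proof (rule AE_I2)
      fix y
      have "\<bar>G (p n + e n * y)\<bar> \<le> M" using M M0 by (simp add: G_def indicator_def)
      then show "norm (st' y * G (p n + e n * y)) \<le> \<bar>st' y\<bar> * M"
        by (simp add: abs_mult mult_left_mono)
    qed
    show "integrable lborel (\<lambda>y. \<bar>st' y\<bar> * M)" using assms(1) by simp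
  qed auto
  then show ?thesis unfolding eq by (simp add: assms(2))
qed

context drift
begin

text \<open>The tests have the form cut(r) \<phi>(x) with a smoothed indicator \<open>cut\<close> of
  \<open>{s..t}\<close>: the two edges of its derivative concentrate at \<open>s\<close> and
  \<open>t\<close> and produce the difference of the integrals of \<open>\<phi>\<close>.\<close>

theorem weak_solution_solves:
  fixes \<tau> B :: real
  assumes \<tau>: "0 < \<tau>" and co: "coefficients \<tau> B a b"
    and ws: "weak_solution \<tau> \<theta> (\<lambda>t. velocity (a t) (b t) (\<mu> t)) \<mu>"
  shows "solves \<tau> a b \<mu>"
proof -
  have P: "\<mu> t \<in> P1" if "t \<in> {0..\<tau>}" for t
    using ws that by (simp add: weak_solution_def abs_cont_curve_def)
  obtain \<rho> where \<rho>: "set_integrable lborel {0..\<tau>} \<rho>"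
    and le: "\<And>s t. 0 \<le> s \<Longrightarrow> s \<le> t \<Longrightarrow> t \<le> \<tau> \<Longrightarrow> W1 (\<mu> s) (\<mu> t) \<le> (LINT r:{s..t}|lborel. \<rho> r)"
  proof -
    obtain \<rho> where \<rho>: "set_integrable lborel {0..\<tau>} \<rho>"
      and le: "\<forall>s t. 0 \<le> s \<and> s \<le> t \<and> t \<le> \<tau> \<longrightarrow> mdist W1_metric (\<mu> s) (\<mu> t) \<le> (LINT r:{s..t}|lborel. \<rho> r)"
      using ws unfolding weak_solution_def abs_cont_curve_def by blast
    have "W1 (\<mu> s) (\<mu> t) \<le> (LINT r:{s..t}|lborel. \<rho> r)" if "0 \<le> s" "s \<le> t" "t \<le> \<tau>" for s t
      using le[rule_format, of s t] that mdist_W1_metric[OF P P, of s t] by simp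
    with \<rho> show thesis by (rule that)
  qed
  have cont: "W1_continuous \<tau> \<mu>"
    unfolding W1_continuous_def
  proof (intro conjI ballI P)
    fix s assume s: "s \<in> {0..\<tau>}"
    have "((\<lambda>r. \<bar>primitive \<rho> r - primitive \<rho> s\<bar>) \<longlongrightarrow> \<bar>primitive \<rho> s - primitive \<rho> s\<bar>) (at s within {0..\<tau>})"
      using primitive_continuous[OF \<rho>] s by (intro tendsto_intros) (simp add: continuous_on_def)
    then have lim: "((\<lambda>r. \<bar>primitive \<rho> r - primitive \<rho> s\<bar>) \<longlongrightarrow> 0) (at s within {0..\<tau>})" by simp
    show "((\<lambda>r. W1 (\<mu> r) (\<mu> s)) \<longlongrightarrow> 0) (at s within {0..\<tau>})"
    proof (rule Lim_null_comparison[OF _ lim])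
      have "norm (W1 (\<mu> r) (\<mu> s)) \<le> \<bar>primitive \<rho> r - primitive \<rho> s\<bar>" if r: "r \<in> {0..\<tau>}" for r
      proof (cases "r \<le> s")
        case True
        then show ?thesis
          using le[of r s] primitive_diff[OF \<rho>, of r s] r s W1_nonneg[OF P[OF r] P[OF s]] by simp
      next
        case False
        then show ?thesis
          using le[of s r] primitive_diff[OF \<rho>, of s r] r s W1_nonneg[OF P[OF r] P[OF s]] W1_commute[of "\<mu> r" "\<mu> s"] by simp
      qed
      then show "\<forall>\<^sub>F r in at s within {0..\<tau>}. norm (W1 (\<mu> r) (\<mu> s)) \<le> \<bar>primitive \<rho> r - primitive \<rho> s\<bar>"
        unfolding eventually_at_filter by (intro always_eventually) simp
    qed
  qed
  have eq: "(LINT x|\<mu> t. \<phi> x) - (LINT x|\<mu> s. \<phi> x) = (LINT r:{s..t}|lborel. pairing \<phi> (a r) (b r) (\<mu> r))"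
    if \<phi>0: "bump_class l0 K0 \<phi>" and st: "0 \<le> s" "s \<le> t" "t \<le> \<tau>" for \<phi> l0 K0 s t
  proof -
    define l where "l = max 0 l0" define K where "K = max 0 K0"
    have \<phi>: "bump_class l K \<phi>" "0 \<le> l" "0 \<le> K"
      using bump_class_mono[OF \<phi>0, of l K] by (auto simp: l_def K_def)
    define H where "H t = (LINT x|\<mu> t. \<phi> x)" for t
    define k where "k r = pairing \<phi> (a r) (b r) (\<mu> r)" for r
    have i\<phi>: "integrable (\<mu> r) \<phi>" if "r \<in> {0..\<tau>}" for r
    proof (rule P1_integrable_linear[OF P[OF that], of _ "\<bar>\<phi> 0\<bar>" l])
      show "\<phi> \<in> borel_measurable borel"
        by (rule borel_measurable_continuous_onI[OF C_k_continuous[OF bump_classD(1)[OF \<phi>(1), of 0]]])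
      show "norm (\<phi> x) \<le> \<bar>\<phi> 0\<bar> + l * norm x" for x
        using bump_class_lipschitz[OF \<phi>(1), of x 0] by simp
    qed
    have H: "continuous_on {0..\<tau>} H"
      unfolding H_def
      by (rule W1_continuous_functional[OF cont lipschitz_integral])
         (use \<phi> bump_class_lipschitz in auto)
    have k: "set_integrable lborel {0..\<tau>} k"
      unfolding k_def by (rule pairing_set_integrable[OF co cont \<phi>])
    \<comment> \<open>The claim is that \<open>Z\<close> is constant. Tests vanish near the ends of
      the time interval, so this is shown for interior times and extended by continuity.\<close>
    define Z where "Z r = H r - primitive k r" for r
    have Z: "continuous_on {0..\<tau>} Z"
      unfolding Z_def by (intro continuous_intros H primitive_continuous k)
    have const: "Z s = Z t" if st: "0 < s" "s < t" "t < \<tau>" for s t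
    proof -
      obtain st st' :: "real \<Rightarrow> real" and S where step: "\<And>k. C_k k st" "\<And>t. t \<le> 0 \<Longrightarrow> st t = 0" "\<And>t. 1 \<le> t \<Longrightarrow> st t = 1"
        and der: "\<And>t. (st has_real_derivative st' t) (at t)" and st': "continuous_on UNIV st'" "integrable lborel st'"
        "(LINT t|lborel. st' t) = 1" and S: "\<And>t. \<bar>st t\<bar> \<le> S"
        by (rule smooth_step_derivative) blast
      define e where "e n = (t - s) / real (Suc n)" for n
      have e: "0 < e n" "e n \<le> t - s" for n
        using st by (auto simp: e_def divide_le_eq mult_le_cancel_left1)
      have el: "e \<longlonglongrightarrow> 0"
        unfolding e_def using LIMSEQ_Suc[OF lim_const_over_n[of "t - s"]] by simp
      \<comment> \<open>Rises on \<open>{s..s + e n}\<close> and falls on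
        \<open>{t - e n..t}\<close>, so that its support never leaves \<open>{s..t}\<close>.\<close>
      define cut where "cut n r = st ((r - s) / e n) - st ((r - (t - e n)) / e n)" for n r
      define cut' where "cut' n r = st' ((r - s) / e n) / e n - st' ((r - (t - e n)) / e n) / e n" for n r
      have cut0: "cut n r = 0" if "r \<le> s \<or> t \<le> r" for n r
        using that e[of n] st unfolding cut_def by (auto simp: step divide_le_eq le_divide_eq)
      have dcut: "(cut n has_real_derivative cut' n r) (at r)" for n r
        unfolding cut_def[abs_def] cut'_def using e(1)[of n]
        by (auto intro!: derivative_eq_intros DERIV_chain2[OF der])
      have zero: "(LINT r:{0..\<tau>}|lborel. cut' n r * H r) + (LINT r:{0..\<tau>}|lborel. cut n r * k r) = 0" for n
      proof -
        define \<Phi> where "\<Phi> z = cut n (fst z) * \<phi> (snd z)" for z :: "real \<times> (real ^ 'n)"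
        have Ccut: "C_k j (cut n)" for j
        proof -
          have "C_k j (\<lambda>r. st (r * inverse (e n) + p))" for p
            by (rule C_k_compose_real[OF step(1) C_k_add[OF C_k_linear[OF bounded_linear_mult_left] C_k_const]])
          from C_k_add[OF this[of "- s * inverse (e n)"] C_k_mult[OF C_k_const[of j "-1"] this[of "- (t - e n) * inverse (e n)"]]]
          show ?thesis
            unfolding cut_def[abs_def] by (simp add: divide_inverse algebra_simps)
        qed
        have "\<Phi> \<in> test_functions \<tau>"
          unfolding test_functions_def
        proof (intro CollectI conjI allI)
          show "C_k j \<Phi>" for j
            unfolding \<Phi>_def[abs_def]
            by (intro C_k_mult C_k_compose_real[OF Ccut C_k_linear[OF bounded_linear_fst]] C_k_compose[OF bump_classD(1)[OF \<phi>(1)]]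
                C_k_linear bounded_linear_compose[OF bounded_linear_inner_left bounded_linear_snd])
          have sub: "{z. \<Phi> z \<noteq> 0} \<subseteq> {s..t} \<times> closure {x. \<phi> x \<noteq> 0}"
            using cut0 closure_subset[of "{x. \<phi> x \<noteq> 0}"] by (auto simp: \<Phi>_def) (meson linear)+
          have cp: "compact ({s..t} \<times> closure {x. \<phi> x \<noteq> 0})"
            using bump_classD(2)[OF \<phi>(1)] by (intro compact_Times) auto
          show "compact (closure {z. \<Phi> z \<noteq> 0})"
            using bounded_subset[OF compact_imp_bounded[OF cp] sub] by simp
          have "closure {z. \<Phi> z \<noteq> 0} \<subseteq> {s..t} \<times> closure {x. \<phi> x \<noteq> 0}"
            by (rule closure_minimal[OF sub compact_imp_closed[OF cp]])
          then show "closure {z. \<Phi> z \<noteq> 0} \<subseteq> {0<..<\<tau>} \<times> UNIV" using st by auto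
        qed
        then have 0: "(LINT r:{0..\<tau>}|lborel. LINT x|\<mu> r. frechet_derivative \<Phi> (at (r, x)) (1, velocity (a r) (b r) (\<mu> r) x)) = 0"
          using ws unfolding weak_solution_def by blast
        have fd: "frechet_derivative \<Phi> (at (r, x)) (1, v) = cut' n r * \<phi> x + cut n r * frechet_derivative \<phi> (at x) v" for r x v
        proof -
          have d1: "((\<lambda>z. cut n (fst z)) has_derivative (\<lambda>w. cut' n r * fst w)) (at (r, x))"
            using diff_chain_at[where f = fst and g = "cut n" and x = "(r, x)", OF bounded_linear_imp_has_derivative[OF bounded_linear_fst]]
              dcut[of n r] by (simp add: o_def has_field_derivative_def)
          have d2: "((\<lambda>z. \<phi> (snd z)) has_derivative (\<lambda>w. frechet_derivative \<phi> (at x) (snd w))) (at (r, x))"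
            using diff_chain_at[where f = snd and g = \<phi> and x = "(r, x)", OF bounded_linear_imp_has_derivative[OF bounded_linear_snd]]
              bump_classD(5)[OF \<phi>(1), of x] by (simp add: o_def)
          have "(\<Phi> has_derivative (\<lambda>w. cut n r * frechet_derivative \<phi> (at x) (snd w) + cut' n r * fst w * \<phi> x)) (at (r, x))"
            using has_derivative_mult[OF d1 d2] by (simp add: \<Phi>_def[abs_def])
          from fun_cong[OF frechet_derivative_at[OF this], of "(1, v)"] show ?thesis by simp
        qed
        have inner: "(LINT x|\<mu> r. frechet_derivative \<Phi> (at (r, x)) (1, velocity (a r) (b r) (\<mu> r) x)) = cut' n r * H r + cut n r * k r"
          if r: "r \<in> {0..\<tau>}" for r
          unfolding fd H_def k_def pairing_def
          using i\<phi>[OF r] derivative_velocity_integrable[OF \<phi> P[OF r] P[OF r]] by simp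
        have ccut': "continuous_on {0..\<tau>} (cut' n)"
          unfolding cut'_def[abs_def] using e(1)[of n]
          by (intro continuous_intros continuous_on_compose2[OF st'(1)]) auto
        have i1: "set_integrable lborel {0..\<tau>} (\<lambda>r. cut' n r * H r)"
          unfolding set_integrable_def
          by (rule borel_integrable_compact) (auto intro!: continuous_intros ccut' H)
        have i2: "set_integrable lborel {0..\<tau>} (\<lambda>r. cut n r * k r)"
        proof -
          have "set_integrable lborel {0..\<tau>} (\<lambda>r. cut n r *\<^sub>R k r)"
            unfolding set_integrable_def
          proof (rule Bochner_Integration.integrable_bound[where f = "\<lambda>r. 2 * S * \<bar>indicator {0..\<tau>} r *\<^sub>R k r\<bar>"])
            show "integrable lborel (\<lambda>r. 2 * S * \<bar>indicator {0..\<tau>} r *\<^sub>R k r\<bar>)"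
              using k by (intro integrable_mult_right integrable_abs) (simp add: set_integrable_def)
            have "(\<lambda>r. cut n r *\<^sub>R (indicator {0..\<tau>} r *\<^sub>R k r)) \<in> borel_measurable lborel"
              using borel_measurable_scaleR[of "cut n" lborel, OF _ borel_measurable_integrable[OF k[unfolded set_integrable_def]]]
                borel_measurable_continuous_onI[OF C_k_continuous[OF Ccut[of 0]]] by simp
            then show "(\<lambda>r. indicator {0..\<tau>} r *\<^sub>R cut n r *\<^sub>R k r) \<in> borel_measurable lborel"
              by (simp add: mult_ac)
            show "AE r in lborel. norm (indicator {0..\<tau>} r *\<^sub>R cut n r *\<^sub>R k r) \<le> norm (2 * S * \<bar>indicator {0..\<tau>} r *\<^sub>R k r\<bar>)"
            proof (rule AE_I2)
              fix r
              have "\<bar>cut n r\<bar> \<le> 2 * S" unfolding cut_def using S[of "(r - s) / e n"] S[of "(r - (t - e n)) / e n"] by linarith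
              then have "\<bar>cut n r\<bar> * \<bar>k r\<bar> \<le> \<bar>2 * S\<bar> * \<bar>k r\<bar>" by (intro mult_right_mono) auto
              then show "norm (indicator {0..\<tau>} r *\<^sub>R cut n r *\<^sub>R k r) \<le> norm (2 * S * \<bar>indicator {0..\<tau>} r *\<^sub>R k r\<bar>)"
                by (auto simp: abs_mult indicator_def)
            qed
          qed
          then show ?thesis by simp
        qed
        have "(LINT r:{0..\<tau>}|lborel. cut' n r * H r) + (LINT r:{0..\<tau>}|lborel. cut n r * k r)
            = (LINT r:{0..\<tau>}|lborel. cut' n r * H r + cut n r * k r)"
          by (rule set_integral_add(2)[OF i1 i2, symmetric])
        also have "\<dots> = (LINT r:{0..\<tau>}|lborel. LINT x|\<mu> r. frechet_derivative \<Phi> (at (r, x)) (1, velocity (a r) (b r) (\<mu> r) x))"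
          unfolding set_lebesgue_integral_def
          by (intro Bochner_Integration.integral_cong refl) (auto simp: indicator_def inner)
        finally show ?thesis using 0 by simp
      qed
      have l1: "(\<lambda>n. LINT r:{0..\<tau>}|lborel. cut' n r * H r) \<longlonglongrightarrow> H s - H t"
      proof -
        have c: "continuous_on {0..\<tau>} (\<lambda>r. st' ((r - p) / e n) / e n * H r)" for n p
          using e(1)[of n] by (intro continuous_intros H continuous_on_compose2[OF st'(1)]) auto
        have i: "set_integrable lborel {0..\<tau>} (\<lambda>r. st' ((r - p) / e n) / e n * H r)" for n p
          unfolding set_integrable_def by (rule borel_integrable_compact[OF compact_Icc c])
        have "(\<lambda>n. (LINT r:{0..\<tau>}|lborel. st' ((r - s) / e n) / e n * H r) -
            (LINT r:{0..\<tau>}|lborel. st' ((r - (t - e n)) / e n) / e n * H r)) \<longlonglongrightarrow> H s - H t"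
          by (intro tendsto_diff concentrating_kernel[OF st'(2,3,1) H _ _ e(1) el])
             (use st e(1) in \<open>auto simp: less_imp_le\<close>)
        moreover have "(LINT r:{0..\<tau>}|lborel. st' ((r - s) / e n) / e n * H r) -
            (LINT r:{0..\<tau>}|lborel. st' ((r - (t - e n)) / e n) / e n * H r) = (LINT r:{0..\<tau>}|lborel. cut' n r * H r)" for n
          unfolding cut'_def left_diff_distrib by (rule set_integral_diff(2)[OF i i, symmetric])
        ultimately show ?thesis by simp
      qed
      have l2: "(\<lambda>n. LINT r:{0..\<tau>}|lborel. cut n r * k r) \<longlonglongrightarrow> (LINT r:{s..t}|lborel. k r)"
      proof -
define kk where "kk r = indicator {0..\<tau>} r *\<^sub>R k r" for r
        have ki: "integrable lborel kk"
          using k by (simp add: set_integrable_def kk_def[abs_def])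
        have km: "kk \<in> borel_measurable borel"
          using borel_measurable_integrable[OF ki] by simp
        have cs: "cut n \<in> borel_measurable borel" for n
          by (rule borel_measurable_continuous_onI) (meson DERIV_isCont dcut continuous_at_imp_continuous_on)
        have "(\<lambda>n. LINT r|lborel. cut n r * kk r) \<longlonglongrightarrow>
            (LINT r|lborel. indicator {s<..<t} r * kk r)"
        proof (rule integral_dominated_convergence[where w = "\<lambda>r. 2 * \<bar>S\<bar> * \<bar>kk r\<bar>"])
          show "AE r in lborel. (\<lambda>n. cut n r * kk r) \<longlonglongrightarrow> indicator {s<..<t} r * kk r"
          proof (intro AE_I2 tendsto_intros)
            fix r
            show "(\<lambda>n. cut n r) \<longlonglongrightarrow> indicator {s<..<t} r"
            proof (cases "s < r \<and> r < t")
              case True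
              have "eventually (\<lambda>n. e n < min (r - s) (t - r)) sequentially"
                by (rule order_tendstoD(2)[OF el]) (use True in simp)
              then have "eventually (\<lambda>n. cut n r = indicator {s<..<t} r) sequentially"
              proof eventually_elim
                case (elim n)
                have "1 \<le> (r - s) / e n" "(r - (t - e n)) / e n \<le> 0"
                  using elim e(1)[of n] by (auto simp: le_divide_eq divide_le_eq)
                then show ?case using True by (simp add: cut_def step)
              qed
              then show ?thesis by (rule tendsto_eventually)
            qed (use cut0 in \<open>auto simp: indicator_def not_less\<close>)
          qed
          show "AE r in lborel. norm (cut n r * kk r) \<le> 2 * \<bar>S\<bar> * \<bar>kk r\<bar>" for n
          proof (rule AE_I2)
            fix r
            have "\<bar>cut n r\<bar> \<le> 2 * \<bar>S\<bar>" unfolding cut_def using S[of "(r - s) / e n"] S[of "(r - (t - e n)) / e n"] by linarith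
            then show "norm (cut n r * kk r) \<le> 2 * \<bar>S\<bar> * \<bar>kk r\<bar>"
              unfolding real_norm_def abs_mult[of "cut n r"] by (intro mult_right_mono) auto
          qed
        qed (use km ki cs in \<open>auto intro!: borel_measurable_times integrable_mult_right integrable_abs \<close>)
        moreover have "(LINT r|lborel. cut n r * kk r) = (LINT r:{0..\<tau>}|lborel. cut n r * k r)" for n
          unfolding set_lebesgue_integral_def by (intro Bochner_Integration.integral_cong) (auto simp: kk_def)
        moreover have "(LINT r|lborel. indicator {s<..<t} r * kk r) = (LINT r:{s..t}|lborel. k r)"
          unfolding set_lebesgue_integral_def
        proof (rule integral_cong_AE)
          show "AE r in lborel. indicator {s<..<t} r * kk r = indicator {s..t} r *\<^sub>R k r"
            using AE_lborel_singleton[of s] AE_lborel_singleton[of t]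
            by eventually_elim (use st in \<open>auto simp: indicator_def kk_def\<close>)
          show "(\<lambda>r. indicator {s..t} r *\<^sub>R k r) \<in> borel_measurable lborel"
            using set_integrable_Icc_subset[OF k, of s t] st by (auto simp: set_integrable_def)
        qed (use km in \<open>auto intro!: borel_measurable_times \<close>)
        ultimately show ?thesis by simp
      qed
      have "(\<lambda>n. 0) \<longlonglongrightarrow> (H s - H t) + (LINT r:{s..t}|lborel. k r)"
        using tendsto_add[OF l1 l2] by (simp add: zero)
      then have "(H s - H t) + (LINT r:{s..t}|lborel. k r) = 0"
        by (simp add: LIMSEQ_const_iff)
      then show ?thesis
        using primitive_diff[OF k, of s t] st by (simp add: Z_def)
    qed
    have "Z r = Z (\<tau> / 2)" if "r \<in> {0..\<tau>}" for r
    proof (rule continuous_constant_on_closure[of "{0<..<\<tau>}" Z "Z (\<tau> / 2)" r])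
      show "continuous_on (closure {0<..<\<tau>}) Z" "r \<in> closure {0<..<\<tau>}" using Z that \<tau> by auto
      show "Z x = Z (\<tau> / 2)" if "x \<in> {0<..<\<tau>}" for x
        by (rule linorder_cases[of x "\<tau> / 2"])
           (use const[of x "\<tau> / 2"] const[of "\<tau> / 2" x] that \<tau> in auto)
    qed
    from this[of s] this[of t] st have "Z s = Z t" by simp
    then show ?thesis
      using primitive_diff[OF k st] by (simp add: Z_def H_def k_def)
  qed
  show ?thesis
    unfolding solves_def using cont eq by blast
qed

end

section \<open>Reparametrisation of time\<close>

locale time_change =
  fixes T M :: real and u :: "real \<Rightarrow> real ^ 'm::finite"
  assumes T: "0 < T" and M: "0 < M" and u: "u \<in> controls T M"
begin

definition clock :: "real \<Rightarrow> real" where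
  "clock t = t + primitive (\<lambda>\<tau>. norm1 (u \<tau>)) t"

definition inv_clock :: "real \<Rightarrow> real" where
  "inv_clock = the_inv_into {0..T} clock"

text \<open>A control is known to be measurable only on its interval; extended by 0 it is Borel on
  the line and can be composed with \<open>ext_clock\<close>.\<close>

definition u0 :: "real \<Rightarrow> real ^ 'm" where
  "u0 t = indicator {0..T} t *\<^sub>R u t"

lemma u_measurable: "set_borel_measurable borel {0..T} u"
  using u by (auto simp: controls_def Linf_def)

lemma u0_measurable [measurable]: "u0 \<in> borel_measurable borel"
  using u_measurable unfolding set_borel_measurable_def u0_def[abs_def] .

lemma norm1_measurable [measurable]: "norm1 \<in> borel_measurable (borel :: (real ^ 'm) measure)"
  by (rule lipschitz_measurable[of _ "real CARD('m)"])
     (smt (verit) norm1_diff_triangle norm1_le_norm norm1_minus_commute norm1_triangle real_norm_def diff_add_cancel)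

lemma u_bound: obtains C where "0 \<le> C" "AE t in lborel. t \<in> {0..T} \<longrightarrow> norm1 (u t) \<le> C"
proof -
  obtain C where C: "AE t in lborel. t \<in> {0..T} \<longrightarrow> norm (u t) \<le> C"
    using u by (auto simp: controls_def Linf_def)
  have "AE t in lborel. t \<in> {0..T} \<longrightarrow> norm1 (u t) \<le> real CARD('m) * \<bar>C\<bar>"
    using C
  proof eventually_elim
    case (elim t)
    show ?case
    proof
      assume "t \<in> {0..T}"
      with elim have "norm (u t) \<le> \<bar>C\<bar>" by auto
      then have "real CARD('m) * norm (u t) \<le> real CARD('m) * \<bar>C\<bar>" by (intro mult_left_mono) auto
      then show "norm1 (u t) \<le> real CARD('m) * \<bar>C\<bar>" using norm1_le_norm[of "u t"] by linarith
    qed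
  qed
  then show thesis by (rule that[rotated]) simp
qed

lemma norm1_u_integrable: "set_integrable lborel {0..T} (\<lambda>t. norm1 (u t))"
proof -
  obtain C where C: "AE t in lborel. t \<in> {0..T} \<longrightarrow> norm1 (u t) \<le> C" by (rule u_bound)
  show ?thesis
  proof (rule set_integrable_bounded)
    have "(\<lambda>t. indicator {0..T} t *\<^sub>R norm1 (u0 t)) \<in> borel_measurable borel" by measurable
    then show "set_borel_measurable borel {0..T} (\<lambda>t. norm1 (u t))"
      unfolding set_borel_measurable_def
      by (rule measurable_cong[THEN iffD1, rotated]) (auto simp: indicator_def u0_def)
    show "AE t in lborel. t \<in> {0..T} \<longrightarrow> norm (norm1 (u t)) \<le> C"
      using C by (simp add: norm1_nonneg)
  qed
qed

lemma clock_0: "clock 0 = 0"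
  using primitive_diff[OF norm1_u_integrable, of 0 0] T by (simp add: clock_def primitive_def)

lemma clock_T: "clock T = T + M"
  using u by (simp add: clock_def primitive_def controls_def)

lemma clock_diff: "0 \<le> s \<Longrightarrow> s \<le> t \<Longrightarrow> t \<le> T \<Longrightarrow> t - s \<le> clock t - clock s"
proof -
  assume st: "0 \<le> s" "s \<le> t" "t \<le> T"
  have "0 \<le> (LINT r:{s..t}|lborel. norm1 (u r))"
    unfolding set_lebesgue_integral_def by (rule Bochner_Integration.integral_nonneg) (simp add: norm1_nonneg)
  then show ?thesis using primitive_diff[OF norm1_u_integrable st] by (simp add: clock_def)
qed

lemma clock_continuous: "continuous_on {0..T} clock"
  unfolding clock_def by (intro continuous_intros primitive_continuous norm1_u_integrable)

lemma clock_strict_mono: "strict_mono_on {0..T} clock"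
proof (rule strict_mono_onI)
  fix r s assume "r \<in> {0..T}" "s \<in> {0..T}" "r < s"
  then show "clock r < clock s" using clock_diff[of r s] by simp
qed

lemma clock_image: "clock ` {0..T} = {0..T + M}"
proof
  show "clock ` {0..T} \<subseteq> {0..T + M}"
  proof
    fix s assume "s \<in> clock ` {0..T}"
    then obtain t where t: "t \<in> {0..T}" "s = clock t" by blast
    then show "s \<in> {0..T + M}"
      using clock_diff[of 0 t] clock_diff[of t T] clock_0 clock_T by simp
  qed
  show "{0..T + M} \<subseteq> clock ` {0..T}"
  proof
    fix s assume "s \<in> {0..T + M}"
    then obtain t where "0 \<le> t" "t \<le> T" "clock t = s"
      using IVT'[of clock 0 s T] clock_0 clock_T clock_continuous T by auto
    then show "s \<in> clock ` {0..T}" by auto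
  qed
qed

lemma clock_inj: "inj_on clock {0..T}"
  by (rule strict_mono_on_imp_inj_on[OF clock_strict_mono])

lemma inv_clock:
  shows "s \<in> {0..T + M} \<Longrightarrow> inv_clock s \<in> {0..T}" "s \<in> {0..T + M} \<Longrightarrow> clock (inv_clock s) = s"
    and "t \<in> {0..T} \<Longrightarrow> inv_clock (clock t) = t" "t \<in> {0..T} \<Longrightarrow> clock t \<in> {0..T + M}"
  using the_inv_into_into[OF clock_inj, of s "{0..T}"] f_the_inv_into_f[OF clock_inj, of s]
    the_inv_into_f_f[OF clock_inj, of t] clock_image
  by (auto simp: inv_clock_def)

lemma inv_clock_0: "inv_clock 0 = 0" and inv_clock_S: "inv_clock (T + M) = T"
  using inv_clock(3)[of 0] inv_clock(3)[of T] clock_0 clock_T T by auto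

lemma clock_le_iff: "s \<in> {0..T} \<Longrightarrow> t \<in> {0..T} \<Longrightarrow> clock s \<le> clock t \<longleftrightarrow> s \<le> t"
  by (rule strict_mono_on_less_eq[OF clock_strict_mono])

lemma inv_clock_le_iff: "s \<in> {0..T + M} \<Longrightarrow> r \<in> {0..T + M} \<Longrightarrow> inv_clock s \<le> inv_clock r \<longleftrightarrow> s \<le> r"
  using clock_le_iff[of "inv_clock s" "inv_clock r"] inv_clock(1,2) by simp

lemma inv_clock_diff:
  assumes "s \<in> {0..T + M}" "r \<in> {0..T + M}"
  shows "\<bar>inv_clock s - inv_clock r\<bar> \<le> \<bar>s - r\<bar>"
proof -
  have *: "\<bar>inv_clock s - inv_clock r\<bar> \<le> \<bar>s - r\<bar>" if "s \<le> r" "s \<in> {0..T + M}" "r \<in> {0..T + M}" for s r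
  proof -
    have "inv_clock s \<le> inv_clock r" using inv_clock_le_iff that by simp
    then show ?thesis
      using clock_diff[of "inv_clock s" "inv_clock r"] inv_clock(1,2)[OF that(2)] inv_clock(1,2)[OF that(3)] that(1) by simp
  qed
  show ?thesis using *[of s r] *[of r s] assms by (cases "s \<le> r") (auto simp: abs_minus_commute)
qed

text \<open>Clamping the argument gives a 1-Lipschitz, hence Borel, map on the whole line, as image
  measures require.\<close>

definition ext_clock :: "real \<Rightarrow> real" where
  "ext_clock s = inv_clock (max 0 (min (T + M) s))"

lemma ext_clock_eq: "s \<in> {0..T + M} \<Longrightarrow> ext_clock s = inv_clock s"
  by (simp add: ext_clock_def)

lemma ext_clock_measurable [measurable]: "ext_clock \<in> borel_measurable borel"
proof (rule lipschitz_measurable[of _ 1])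
  fix x y
  have "\<bar>ext_clock x - ext_clock y\<bar> \<le> \<bar>max 0 (min (T + M) x) - max 0 (min (T + M) y)\<bar>"
    unfolding ext_clock_def by (rule inv_clock_diff) (use T M in auto)
  also have "\<dots> \<le> \<bar>x - y\<bar>" by linarith
  finally show "norm (ext_clock x - ext_clock y) \<le> 1 * norm (x - y)" by simp
qed

text \<open>Instead of differentiating the clock, which is merely absolutely continuous, the change
  of variables is stated for measures: the density 1 + |u| is the derivative of the clock.
  Half-lines \<open>{x<..}\<close> determine both measures, and on them both sides reduce to
  \<open>T + M - clock x\<close>.\<close>

lemma distr_clock:
  "distr (density lborel (indicator {0..T + M})) borel ext_clock =
    density lborel (\<lambda>t. ennreal (indicator {0..T} t * (1 + norm1 (u0 t))))"
  (is "?A = ?B")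
proof (rule measure_eqI_lessThan)
  have S: "0 < T + M" using T M by simp
  have A: "emeasure ?A {x<..} = emeasure lborel ({0..T + M} \<inter> {s. x < ext_clock s})" for x
  proof -
    have "emeasure ?A {x<..} = emeasure (density lborel (indicator {0..T + M})) {s. x < ext_clock s}"
      by (subst emeasure_distr) (auto intro!: arg_cong2[where f = emeasure])
    also have "\<dots> = (\<integral>\<^sup>+ s. indicator {0..T + M} s * indicator {s. x < ext_clock s} s \<partial>lborel)"
      by (rule emeasure_density) auto
    also have "\<dots> = (\<integral>\<^sup>+ s. indicator ({0..T + M} \<inter> {s. x < ext_clock s}) s \<partial>lborel)"
      by (intro nn_integral_cong) (auto simp: indicator_def)
    also have "\<dots> = emeasure lborel ({0..T + M} \<inter> {s. x < ext_clock s})"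
      by (rule nn_integral_indicator) auto
    finally show ?thesis .
  qed
  have B: "emeasure ?B {x<..} = (\<integral>\<^sup>+ t. ennreal (indicator {0..T} t * (1 + norm1 (u0 t))) * indicator {x<..} t \<partial>lborel)" for x
    by (rule emeasure_density) auto
  have B': "emeasure ?B {x<..} = ennreal (T + M - clock x)" if x: "x \<in> {0..T}" for x
  proof -
    have i: "set_integrable lborel {x..T} (\<lambda>t. 1 + norm1 (u t))"
      using set_integrable_Icc_subset[OF norm1_u_integrable, of x T] x
      by (intro set_integral_add(1)) (auto simp: set_integrable_def)
    have "emeasure ?B {x<..} = (\<integral>\<^sup>+ t. ennreal (indicator {x..T} t *\<^sub>R (1 + norm1 (u t))) \<partial>lborel)"
      unfolding B
    proof (rule nn_integral_cong_AE)
      show "AE t in lborel. ennreal (indicator {0..T} t * (1 + norm1 (u0 t))) * indicator {x<..} t = ennreal (indicator {x..T} t *\<^sub>R (1 + norm1 (u t)))"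
        using AE_lborel_singleton[of x]
        by eventually_elim (use x in \<open>auto simp: indicator_def u0_def\<close>)
    qed
    also have "\<dots> = ennreal (LINT t:{x..T}|lborel. 1 + norm1 (u t))"
      unfolding set_lebesgue_integral_def
      by (rule nn_integral_eq_integral) (use i norm1_nonneg in \<open>auto simp: set_integrable_def intro!: AE_I2 mult_nonneg_nonneg add_nonneg_nonneg\<close>)
    also have "(LINT t:{x..T}|lborel. 1 + norm1 (u t)) = (T - x) + (LINT t:{x..T}|lborel. norm1 (u t))"
      using set_integrable_Icc_subset[OF norm1_u_integrable, of x T] x
      by (subst set_integral_add(2)) (auto simp: set_integrable_def set_lebesgue_integral_def)
    also have "\<dots> = T + M - clock x"
      using primitive_diff[OF norm1_u_integrable, of x T] x clock_T by (simp add: clock_def)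
    finally show ?thesis .
  qed
  have A': "emeasure ?A {x<..} = ennreal (T + M - clock x)" if x: "x \<in> {0..T}" for x
  proof -
    have "{0..T + M} \<inter> {s. x < ext_clock s} = {clock x<..T + M}"
    proof -
      have "x < ext_clock s \<longleftrightarrow> clock x < s" if s: "s \<in> {0..T + M}" for s
        using inv_clock_le_iff[OF s inv_clock(4)[OF x]] inv_clock(3)[OF x] ext_clock_eq[OF s] by (auto simp: not_le[symmetric])
      moreover have "0 \<le> clock x" using inv_clock(4)[OF x] by simp
      ultimately show ?thesis by auto
    qed
    then show ?thesis unfolding A using inv_clock(4)[OF x] by simp
  qed
  have all: "emeasure ?A {x<..} = emeasure ?B {x<..} \<and> emeasure ?A {x<..} < \<infinity>" for x
  proof -
    have range: "ext_clock s \<in> {0..T}" for s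
      unfolding ext_clock_def by (rule inv_clock(1)) (use S in auto)
    consider "x < 0" | "x \<in> {0..T}" | "T < x" by force
    then show ?thesis
    proof cases
      case 1
      have "x < ext_clock s" for s using range[of s] 1 by simp
      then have "{0..T + M} \<inter> {s. x < ext_clock s} = {0..T + M}" by blast
      then have a: "emeasure ?A {x<..} = ennreal (T + M)" unfolding A using S by simp
      have "emeasure ?B {x<..} = emeasure ?B {0<..}"
        unfolding B
      proof (rule nn_integral_cong_AE)
        show "AE t in lborel. ennreal (indicator {0..T} t * (1 + norm1 (u0 t))) * indicator {x<..} t
            = ennreal (indicator {0..T} t * (1 + norm1 (u0 t))) * indicator {0<..} t"
          using AE_lborel_singleton[of 0] by eventually_elim (use 1 in \<open>auto simp: indicator_def\<close>)
      qed
      then show ?thesis using B'[of 0] a T clock_0 by simp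
    next
      case 2
      then show ?thesis using A' B' by simp
    next
      case 3
      have "\<not> x < ext_clock s" for s using range[of s] 3 by simp
      then have "{0..T + M} \<inter> {s. x < ext_clock s} = {}" by blast
      then have "emeasure ?A {x<..} = 0" unfolding A by simp
      moreover have "(\<lambda>t. ennreal (indicator {0..T} t * (1 + norm1 (u0 t))) * indicator {x<..} t) = (\<lambda>_. 0)"
        using 3 by (auto simp: indicator_def fun_eq_iff)
      then have "emeasure ?B {x<..} = 0" unfolding B by simp
      ultimately show ?thesis by simp
    qed
  qed
  show "emeasure ?A {x<..} = emeasure ?B {x<..}" "emeasure ?A {x<..} < \<infinity>" for x using all by blast+
qed simp_all

lemma integral_inv_clock:
  fixes F :: "real \<Rightarrow> 'b::euclidean_space"
  assumes F: "set_borel_measurable borel {0..T} F" and s: "0 \<le> s" "s \<le> r" "r \<le> T + M"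
  shows "(LINT \<sigma>:{s..r}|lborel. F (inv_clock \<sigma>)) = (LINT t:{inv_clock s..inv_clock r}|lborel. (1 + norm1 (u t)) *\<^sub>R F t)"
proof -
  have sr: "s \<in> {0..T + M}" "r \<in> {0..T + M}" using s by auto
  note ir = inv_clock(1)[OF sr(1)] inv_clock(1)[OF sr(2)]
  define G where "G t = indicator {inv_clock s..inv_clock r} t *\<^sub>R (indicator {0..T} t *\<^sub>R F t)" for t
  have Gm [measurable]: "G \<in> borel_measurable borel"
    unfolding G_def by (rule borel_measurable_scaleR[OF _ F[unfolded set_borel_measurable_def]]) simp
  have "(LINT \<sigma>:{s..r}|lborel. F (inv_clock \<sigma>)) = (LINT \<sigma>|lborel. indicator {0..T + M} \<sigma> *\<^sub>R G (ext_clock \<sigma>))"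
    unfolding set_lebesgue_integral_def
  proof (intro Bochner_Integration.integral_cong refl)
    fix \<sigma>
    show "indicator {s..r} \<sigma> *\<^sub>R F (inv_clock \<sigma>) = indicator {0..T + M} \<sigma> *\<^sub>R G (ext_clock \<sigma>)"
    proof (cases "\<sigma> \<in> {0..T + M}")
      case True
      then show ?thesis
        using inv_clock(1)[OF True] inv_clock_le_iff[OF sr(1) True] inv_clock_le_iff[OF True sr(2)]
        by (auto simp: G_def indicator_def ext_clock_eq)
    qed (use s in \<open>auto simp: indicator_def\<close>)
  qed
  also have "\<dots> = (LINT \<sigma>|density lborel (indicator {0..T + M}). G (ext_clock \<sigma>))"
    using integral_density[of "\<lambda>\<sigma>. G (ext_clock \<sigma>)" lborel "indicator {0..T + M} :: real \<Rightarrow> real"]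
    by (simp add: ennreal_indicator)
  also have "\<dots> = (LINT t|distr (density lborel (indicator {0..T + M})) borel ext_clock. G t)"
    by (rule integral_distr[symmetric]) auto
  also have "\<dots> = (LINT t|density lborel (\<lambda>t. ennreal (indicator {0..T} t * (1 + norm1 (u0 t)))). G t)"
    by (simp only: distr_clock)
  also have "\<dots> = (LINT t|lborel. (indicator {0..T} t * (1 + norm1 (u0 t))) *\<^sub>R G t)"
    by (rule integral_density) (auto intro!: AE_I2 mult_nonneg_nonneg add_nonneg_nonneg norm1_nonneg)
  also have "\<dots> = (LINT t:{inv_clock s..inv_clock r}|lborel. (1 + norm1 (u t)) *\<^sub>R F t)"
    unfolding set_lebesgue_integral_def
    by (intro Bochner_Integration.integral_cong refl) (use ir in \<open>auto simp: G_def indicator_def u0_def\<close>)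
  finally show ?thesis .
qed

end

context time_change
begin

lemma u_coefficients: obtains B where "1 \<le> B" "coefficients T B (\<lambda>_. 1) u"
proof -
  obtain C where C: "0 \<le> C" "AE t in lborel. t \<in> {0..T} \<longrightarrow> norm1 (u t) \<le> C" by (rule u_bound)
  have "coefficients T (1 + C) (\<lambda>_. 1) u"
    using C u_measurable by (simp add: coefficients_def csize_def set_borel_measurable_def)
  then show thesis using that[of "1 + C"] C(1) by simp
qed

end

lemma norm1_scaleR: "norm1 (r *\<^sub>R v) = \<bar>r\<bar> * norm1 v"
  by (simp add: norm1_def abs_mult sum_distrib_left)

section \<open>The associated process as a time change\<close>

context drift
begin

lemma pairing_scale:
  assumes "bump_class l K \<phi>" "0 \<le> l" "0 \<le> K" "\<mu> \<in> P1"
  shows "pairing \<phi> (r * a) (r *\<^sub>R b) \<mu> = r * pairing \<phi> a b \<mu>"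
proof -
  have "pairing \<phi> (r * a) (r *\<^sub>R b) \<mu> = (r * a) * pairing \<phi> 1 0 \<mu> + (\<Sum>i\<in>UNIV. (r *\<^sub>R b) $ i * pairing \<phi> 0 (axis i 1) \<mu>)"
    by (rule pairing_expand[OF assms])
  also have "\<dots> = r * (a * pairing \<phi> 1 0 \<mu> + (\<Sum>i\<in>UNIV. b $ i * pairing \<phi> 0 (axis i 1) \<mu>))"
    by (simp add: distrib_left sum_distrib_left mult.assoc)
  also have "\<dots> = r * pairing \<phi> a b \<mu>" by (simp only: pairing_expand[OF assms, of a b])
  finally show ?thesis .
qed

theorem associated_process_solves:
  fixes u :: "real \<Rightarrow> real ^ 'm"
  assumes T: "0 < T" and M: "0 < M" and pr: "process T M f0 f g \<theta> \<mu> u"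
    and as: "associated_process T M f0 f g \<theta> u \<nu> \<alpha> \<beta>"
  defines "\<xi> \<equiv> time_change.inv_clock T u"
  shows "coefficients (T + M) 1 \<alpha> \<beta>"
    and "s \<in> {0..T + M} \<Longrightarrow> 0 < \<alpha> s \<and> \<alpha> s + norm1 (\<beta> s) = 1"
    and "solves (T + M) \<alpha> \<beta> \<nu>"
    and "s \<in> {0..T + M} \<Longrightarrow> \<nu> s = \<mu> (\<xi> s)"
    and "s \<in> {0..T + M} \<Longrightarrow> primitive \<alpha> s = \<xi> s"
    and "s \<in> {0..T + M} \<Longrightarrow> primitive \<beta> s = primitive u (\<xi> s)"
proof -
  interpret tc: time_change T M u
    using T M pr by unfold_locales (auto simp: process_def)
  let ?S = "T + M" and ?k = "\<lambda>t. 1 / (1 + norm1 (u t))"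
  have S: "0 < ?S" using T M by simp
  have \<xi>: "\<xi> = tc.inv_clock" by (simp add: \<xi>_def)
  have \<alpha>: "\<alpha> s = ?k (\<xi> s)" and \<beta>: "\<beta> s = ?k (\<xi> s) *\<^sub>R u (\<xi> s)" if "s \<in> {0..?S}" for s
    using as that unfolding associated_process_def Let_def \<xi> tc.inv_clock_def tc.clock_def primitive_def
    by (auto simp: vec_eq_iff)
  have kp: "0 < ?k t" "0 < 1 + norm1 (u t)" for t using norm1_nonneg[of "u t"] by (simp_all add: add_pos_nonneg)
  show sz: "0 < \<alpha> s \<and> \<alpha> s + norm1 (\<beta> s) = 1" if "s \<in> {0..?S}" for s
    using kp[of "\<xi> s"] unfolding \<alpha>[OF that] \<beta>[OF that] norm1_scaleR by (simp add: field_simps)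
  have m\<alpha>: "set_borel_measurable borel {0..?S} \<alpha>" and m\<beta>: "set_borel_measurable borel {0..?S} \<beta>"
  proof -
    have u0: "tc.u0 (tc.ext_clock s) = u (\<xi> s)" if "s \<in> {0..?S}" for s
      using tc.inv_clock(1)[OF that] that by (simp add: tc.u0_def tc.ext_clock_eq \<xi>)
    have "(\<lambda>s. indicator {0..?S} s *\<^sub>R (1 / (1 + norm1 (tc.u0 (tc.ext_clock s))))) \<in> borel_measurable borel"
      by measurable
    then show "set_borel_measurable borel {0..?S} \<alpha>"
      unfolding set_borel_measurable_def
      by (rule measurable_cong[THEN iffD1, rotated]) (auto simp: indicator_def \<alpha> u0)
    have "(\<lambda>s. indicator {0..?S} s *\<^sub>R ((1 / (1 + norm1 (tc.u0 (tc.ext_clock s)))) *\<^sub>R tc.u0 (tc.ext_clock s))) \<in> borel_measurable borel"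
      by measurable
    then show "set_borel_measurable borel {0..?S} \<beta>"
      unfolding set_borel_measurable_def
      by (rule measurable_cong[THEN iffD1, rotated]) (auto simp: indicator_def \<beta> u0)
  qed
  show co: "coefficients ?S 1 \<alpha> \<beta>"
  proof -
    have "csize (\<alpha> s) (\<beta> s) = 1" if "s \<in> {0..?S}" for s
      using sz[OF that] by (simp add: csize_def)
    then show ?thesis unfolding coefficients_def using m\<alpha> m\<beta> by (auto intro!: AE_I2)
  qed
  interpret c2: controlled f0 g f c ?S 1 \<alpha> \<beta>
    using co S by unfold_locales auto
  have "(\<lambda>s x. \<alpha> s *\<^sub>R (f0 x + conv g (\<nu> s) x) + (\<Sum>i\<in>UNIV. \<beta> s $ i *\<^sub>R f i x)) = (\<lambda>s. velocity (\<alpha> s) (\<beta> s) (\<nu> s))"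
    by (simp add: velocity_def fun_eq_iff)
  then have wn: "weak_solution ?S \<theta> (\<lambda>s. velocity (\<alpha> s) (\<beta> s) (\<nu> s)) \<nu>"
    using as by (simp add: associated_process_def Let_def reduced_solution_def)
  show sn: "solves ?S \<alpha> \<beta> \<nu>"
    by (rule weak_solution_solves[OF S co wn])
  obtain B where B: "1 \<le> B" "coefficients T B (\<lambda>_. 1) u" by (rule tc.u_coefficients)
  interpret c1: controlled f0 g f c T B "\<lambda>_. 1" u
    using B T by unfold_locales auto
  have "(\<lambda>t x. f0 x + (\<Sum>i\<in>UNIV. u t $ i *\<^sub>R f i x) + conv g (\<mu> t) x) = (\<lambda>t. velocity 1 (u t) (\<mu> t))"
    by (simp add: velocity_def fun_eq_iff)
  then have wm: "weak_solution T \<theta> (\<lambda>t. velocity 1 (u t) (\<mu> t)) \<mu>"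
    using pr by (simp add: process_def)
  have sm: "solves T (\<lambda>_. 1) u \<mu>"
    by (rule weak_solution_solves[OF T B(2) wm])
  have Pm: "\<mu> t \<in> P1" if "t \<in> {0..T}" for t by (rule c1.solves_P1[OF sm that])
  have r\<xi>: "\<xi> s \<in> {0..T}" if "s \<in> {0..?S}" for s using tc.inv_clock(1)[OF that] by (simp add: \<xi>)
  have sol\<xi>: "solves ?S \<alpha> \<beta> (\<lambda>s. \<mu> (\<xi> s))"
    unfolding solves_def
  proof (intro conjI allI impI)
    let ?C = "3 * real CARD('n) * c1.speed"
    show "W1_continuous ?S (\<lambda>s. \<mu> (\<xi> s))"
      unfolding W1_continuous_def
    proof (intro conjI ballI)
      fix s assume s: "s \<in> {0..?S}"
      show "\<mu> (\<xi> s) \<in> P1" by (rule Pm[OF r\<xi>[OF s]])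
      have lim: "((\<lambda>r. ?C * \<bar>r - s\<bar>) \<longlongrightarrow> 0) (at s within {0..?S})"
        by (auto intro!: tendsto_eq_intros)
      show "((\<lambda>r. W1 (\<mu> (\<xi> r)) (\<mu> (\<xi> s))) \<longlongrightarrow> 0) (at s within {0..?S})"
      proof (rule Lim_null_comparison[OF _ lim])
        have "norm (W1 (\<mu> (\<xi> r)) (\<mu> (\<xi> s))) \<le> ?C * \<bar>r - s\<bar>" if r: "r \<in> {0..?S}" for r
        proof -
          have "W1 (\<mu> (\<xi> r)) (\<mu> (\<xi> s)) \<le> ?C * \<bar>\<xi> r - \<xi> s\<bar>"
            by (rule c1.solves_lipschitz[OF sm r\<xi>[OF r] r\<xi>[OF s]])
          also have "\<dots> \<le> ?C * \<bar>r - s\<bar>"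
            using tc.inv_clock_diff[OF r s] c1.speed_pos unfolding \<xi> by (intro mult_left_mono) auto
          finally show ?thesis using W1_nonneg[OF Pm[OF r\<xi>[OF r]] Pm[OF r\<xi>[OF s]]] by simp
        qed
        then show "\<forall>\<^sub>F r in at s within {0..?S}. norm (W1 (\<mu> (\<xi> r)) (\<mu> (\<xi> s))) \<le> ?C * \<bar>r - s\<bar>"
          unfolding eventually_at_filter by (intro always_eventually) simp
      qed
    qed
    fix \<phi> :: "real ^ 'n \<Rightarrow> real" and l0 K0 s t assume *: "bump_class l0 K0 \<phi> \<and> 0 \<le> s \<and> s \<le> t \<and> t \<le> ?S"
    define l where "l = max 0 l0" define K where "K = max 0 K0"
    have \<phi>: "bump_class l K \<phi>" "0 \<le> l" "0 \<le> K"
      using bump_class_mono[of l0 K0 \<phi> l K] * by (auto simp: l_def K_def)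
    have st: "s \<in> {0..?S}" "t \<in> {0..?S}" "0 \<le> s" "s \<le> t" "t \<le> ?S" using * by auto
    \<comment> \<open>\<open>?k\<close> cancels the density 1 + |u| of the change of variables and,
      by \<open>pairing_scale\<close>, turns the controls (1, u) into (\<alpha>, \<beta>).\<close>
    define F where "F r = ?k r * pairing \<phi> 1 (u r) (\<mu> r)" for r
    have pi: "set_integrable lborel {0..T} (\<lambda>r. pairing \<phi> 1 (u r) (\<mu> r))"
      using pairing_set_integrable[OF B(2) _ \<phi>] sm by (auto simp: solves_def)
    have F: "set_borel_measurable borel {0..T} F"
    proof -
      have p: "(\<lambda>r. indicator {0..T} r *\<^sub>R pairing \<phi> 1 (u r) (\<mu> r)) \<in> borel_measurable borel"
        using borel_measurable_integrable[OF pi[unfolded set_integrable_def]]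
        unfolding measurable_cong_sets[OF sets_lborel refl] .
      have "(\<lambda>r. (1 / (1 + norm1 (tc.u0 r))) *\<^sub>R (indicator {0..T} r *\<^sub>R pairing \<phi> 1 (u r) (\<mu> r))) \<in> borel_measurable borel"
        by (rule borel_measurable_scaleR[OF _ p]) measurable
      then show ?thesis
        unfolding set_borel_measurable_def F_def
        by (rule measurable_cong[THEN iffD1, rotated]) (auto simp: indicator_def tc.u0_def)
    qed
    have ord: "0 \<le> \<xi> s" "\<xi> s \<le> \<xi> t" "\<xi> t \<le> T"
      using r\<xi>[OF st(1)] r\<xi>[OF st(2)] tc.inv_clock_le_iff[OF st(1,2)] st(4) by (auto simp: \<xi>)
    have "(LINT x|\<mu> (\<xi> t). \<phi> x) - (LINT x|\<mu> (\<xi> s). \<phi> x) = (LINT r:{\<xi> s..\<xi> t}|lborel. pairing \<phi> 1 (u r) (\<mu> r))"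
      using sm \<phi>(1) ord unfolding solves_def by blast
    also have "\<dots> = (LINT r:{\<xi> s..\<xi> t}|lborel. (1 + norm1 (u r)) *\<^sub>R F r)"
      unfolding F_def using kp by (simp add: less_imp_neq[symmetric])
    also have "\<dots> = (LINT \<sigma>:{s..t}|lborel. F (\<xi> \<sigma>))"
      using tc.integral_inv_clock[OF F st(3-5)] by (simp add: \<xi>)
    also have "\<dots> = (LINT \<sigma>:{s..t}|lborel. pairing \<phi> (\<alpha> \<sigma>) (\<beta> \<sigma>) (\<mu> (\<xi> \<sigma>)))"
    proof (rule set_lebesgue_integral_cong)
      show "\<forall>\<sigma>. \<sigma> \<in> {s..t} \<longrightarrow> F (\<xi> \<sigma>) = pairing \<phi> (\<alpha> \<sigma>) (\<beta> \<sigma>) (\<mu> (\<xi> \<sigma>))"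
      proof (intro allI impI)
        fix \<sigma> assume "\<sigma> \<in> {s..t}"
        then have \<sigma>: "\<sigma> \<in> {0..?S}" using st by auto
        show "F (\<xi> \<sigma>) = pairing \<phi> (\<alpha> \<sigma>) (\<beta> \<sigma>) (\<mu> (\<xi> \<sigma>))"
          using pairing_scale[OF \<phi> Pm[OF r\<xi>[OF \<sigma>]], of "?k (\<xi> \<sigma>)" 1 "u (\<xi> \<sigma>)"]
          unfolding F_def \<alpha>[OF \<sigma>] \<beta>[OF \<sigma>] by simp
      qed
    qed simp
    finally show "(LINT x|\<mu> (\<xi> t). \<phi> x) - (LINT x|\<mu> (\<xi> s). \<phi> x) = (LINT \<sigma>:{s..t}|lborel. pairing \<phi> (\<alpha> \<sigma>) (\<beta> \<sigma>) (\<mu> (\<xi> \<sigma>)))" .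
  qed
  have \<xi>0: "\<xi> 0 = 0" using tc.inv_clock_0 by (simp add: \<xi>)
  show "\<nu> s = \<mu> (\<xi> s)" if "s \<in> {0..?S}" for s
  proof (rule c2.solves_unique[OF sn sol\<xi> _ that])
    show "\<nu> 0 = \<mu> (\<xi> 0)" using wn wm by (simp add: weak_solution_def \<xi>0)
  qed
  show "primitive \<alpha> s = \<xi> s" if s: "s \<in> {0..?S}" for s
  proof -
    have F: "set_borel_measurable borel {0..T} ?k"
    proof -
      have "(\<lambda>t. indicator {0..T} t *\<^sub>R (1 / (1 + norm1 (tc.u0 t)))) \<in> borel_measurable borel" by measurable
      then show ?thesis
        unfolding set_borel_measurable_def
        by (rule measurable_cong[THEN iffD1, rotated]) (auto simp: indicator_def tc.u0_def)
    qed
    have "primitive \<alpha> s = (LINT \<sigma>:{0..s}|lborel. ?k (\<xi> \<sigma>))"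
      unfolding primitive_def by (rule set_lebesgue_integral_cong) (use s \<alpha> in auto)
    also have "\<dots> = (LINT t:{0..\<xi> s}|lborel. (1 + norm1 (u t)) *\<^sub>R ?k t)"
      using tc.integral_inv_clock[OF F, of 0 s] s \<xi>0 by (simp add: \<xi>)
    also have "\<dots> = (LINT t:{0..\<xi> s}|lborel. 1)"
      using kp by (simp add: less_imp_neq[symmetric])
    also have "\<dots> = \<xi> s" using r\<xi>[OF s] by (simp add: set_lebesgue_integral_def)
    finally show ?thesis .
  qed
  show "primitive \<beta> s = primitive u (\<xi> s)" if s: "s \<in> {0..?S}" for s
  proof -
    have F: "set_borel_measurable borel {0..T} (\<lambda>t. ?k t *\<^sub>R u t)"
    proof -
      have "(\<lambda>t. indicator {0..T} t *\<^sub>R ((1 / (1 + norm1 (tc.u0 t))) *\<^sub>R tc.u0 t)) \<in> borel_measurable borel" by measurable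
      then show ?thesis
        unfolding set_borel_measurable_def
        by (rule measurable_cong[THEN iffD1, rotated]) (auto simp: indicator_def tc.u0_def)
    qed
    have "primitive \<beta> s = (LINT \<sigma>:{0..s}|lborel. ?k (\<xi> \<sigma>) *\<^sub>R u (\<xi> \<sigma>))"
      unfolding primitive_def by (rule set_lebesgue_integral_cong) (use s \<beta> in auto)
    also have "\<dots> = (LINT t:{0..\<xi> s}|lborel. (1 + norm1 (u t)) *\<^sub>R (?k t *\<^sub>R u t))"
      using tc.integral_inv_clock[OF F, of 0 s] s \<xi>0 by (simp add: \<xi>)
    also have "\<dots> = primitive u (\<xi> s)"
      using kp by (simp add: less_imp_neq[symmetric] primitive_def)
    finally show ?thesis .
  qed
qed

end

section \<open>Compactness of families of solutions\<close>

lemma pointwise_to_uniform: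
  fixes F :: "nat \<Rightarrow> real \<Rightarrow> real"
  assumes p: "\<And>s. s \<in> {0..S} \<Longrightarrow> (\<lambda>k. F k s) \<longlonglongrightarrow> 0"
    and l: "\<And>k s t. s \<in> {0..S} \<Longrightarrow> t \<in> {0..S} \<Longrightarrow> \<bar>F k s - F k t\<bar> \<le> C * \<bar>s - t\<bar>" and e: "0 < e"
  shows "\<forall>\<^sub>F k in sequentially. \<forall>s\<in>{0..S}. \<bar>F k s\<bar> < e"
proof -
  have "0 < e / (2 * (\<bar>C\<bar> + 1))" using e by simp
  then obtain D where D: "finite D" "D \<subseteq> {0..S}" "{0..S} \<subseteq> (\<Union>s\<in>D. ball s (e / (2 * (\<bar>C\<bar> + 1))))"
    using seq_compact_imp_totally_bounded[of "{0..S}"] compact_imp_seq_compact[OF compact_Icc] by meson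
  have "\<forall>\<^sub>F k in sequentially. \<forall>s\<in>D. \<bar>F k s\<bar> < e / 2"
  proof (rule eventually_ball_finite[OF D(1)], rule ballI)
    fix s assume "s \<in> D"
    then have "(\<lambda>k. \<bar>F k s\<bar>) \<longlonglongrightarrow> 0" using p D(2) tendsto_rabs_zero by blast
    then show "\<forall>\<^sub>F k in sequentially. \<bar>F k s\<bar> < e / 2" by (rule order_tendstoD) (use e in simp)
  qed
  then show ?thesis
  proof eventually_elim
    case (elim k)
    show ?case
    proof
      fix s assume s: "s \<in> {0..S}"
      then obtain t where t: "t \<in> D" "\<bar>s - t\<bar> < e / (2 * (\<bar>C\<bar> + 1))"
        using D(3) by (auto simp: dist_real_def abs_minus_commute)
      have "\<bar>F k s - F k t\<bar> \<le> C * \<bar>s - t\<bar>" using l s t D(2) by blast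
      also have "\<dots> \<le> (\<bar>C\<bar> + 1) * (e / (2 * (\<bar>C\<bar> + 1)))" using t(2) by (intro mult_mono) auto
      also have "\<dots> = e / 2" by (simp add: field_simps)
      finally show "\<bar>F k s\<bar> < e" using bspec[OF elim t(1)] by linarith
    qed
  qed
qed

context drift
begin

theorem solutions_subsequence:
  fixes \<nu>s :: "nat \<Rightarrow> real \<Rightarrow> (real ^ 'n) measure"
  assumes S: "0 < S" and \<theta>: "\<theta> \<in> P1" and co: "\<And>k. coefficients S 1 (\<alpha>s k) (\<beta>s k)"
    and sol: "\<And>k. solves S (\<alpha>s k) (\<beta>s k) (\<nu>s k)" and init: "\<And>k. \<nu>s k 0 = \<theta>"
  obtains r \<nu> where "strict_mono r" "\<And>s. s \<in> {0..S} \<Longrightarrow> \<nu> s \<in> P1"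
    "\<And>e. 0 < e \<Longrightarrow> \<forall>\<^sub>F k in sequentially. \<forall>s\<in>{0..S}. W1 (\<nu>s (r k) s) (\<nu> s) < e"
proof -
  let ?N = "real CARD('n)" and ?v = "2 * c"
  let ?Q = "exp (2 * ?v * S)"
  have con: "controlled f0 g f c S 1 (\<alpha>s k) (\<beta>s k)" for k
    using co S by unfold_locales auto
  have sp: "controlled.speed c 1 = ?v" using controlled.speed_def[OF con] by simp
  have c0: "0 < ?v" using c_pos by simp
  have P: "\<nu>s k s \<in> P1" if "s \<in> {0..S}" for k s
    by (rule controlled.solves_P1[OF con sol that])
  have L: "W1 (\<nu>s k s) (\<nu>s k t) \<le> 3 * ?N * ?v * \<bar>s - t\<bar>" if "s \<in> {0..S}" "t \<in> {0..S}" for k s t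
    using controlled.solves_lipschitz[OF con sol that] by (simp only: sp)
  \<comment> \<open>The k-th solution is represented with error 1/(k+1): the representation becomes
    exact in the limit while the bounds on the maps stay the same.\<close>
  define \<eta> where "\<eta> k = inverse (real (Suc k))" for k
  have \<eta>: "0 < \<eta> k" "\<eta> k \<le> 1" for k by (auto simp: \<eta>_def divide_simps)
  have \<eta>l: "\<eta> \<longlonglongrightarrow> 0" unfolding \<eta>_def by (rule LIMSEQ_inverse_real_of_nat)
  have "\<exists>Y. (\<forall>s\<in>{0..S}. W1 (\<nu>s k s) (distr \<theta> borel (Y s)) \<le> \<eta> k) \<and> (\<forall>s x. norm (Y s x - x) \<le> ?v * S) \<and>
    (\<forall>s x y. norm (Y s x - Y s y) \<le> ?Q * norm (x - y)) \<and>
    (\<forall>s\<in>{0..S}. \<forall>t\<in>{0..S}. \<forall>x. norm (Y s x - Y t x) \<le> ?v * \<bar>s - t\<bar> + \<eta> k)" for k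
    by (rule controlled.euler_flow[OF con sol \<eta>(1)[of k], unfolded sp init]) blast
  then obtain Y where Y: "\<And>k s. s \<in> {0..S} \<Longrightarrow> W1 (\<nu>s k s) (distr \<theta> borel (Y k s)) \<le> \<eta> k"
    "\<And>k s x. norm (Y k s x - x) \<le> ?v * S" "\<And>k s x y. norm (Y k s x - Y k s y) \<le> ?Q * norm (x - y)"
    "\<And>k s t x. s \<in> {0..S} \<Longrightarrow> t \<in> {0..S} \<Longrightarrow> norm (Y k s x - Y k t x) \<le> ?v * \<bar>s - t\<bar> + \<eta> k"
    by metis
  \<comment> \<open>Displacements instead of the maps themselves, because the extraction needs a
    uniform bound on the whole space.\<close>
  define F where "F k z = Y k (fst z) (snd z) - snd z" for k and z :: "real \<times> (real ^ 'n)"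
  have "\<exists>r G. strict_mono r \<and> (\<forall>z\<in>{0..S} \<times> UNIV. (\<lambda>k. F (r k) z) \<longlonglongrightarrow> G z)"
  proof (rule asymptotically_lipschitz_subsequence[of "{0..S} \<times> UNIV" F "?v * S" "?v + ?Q + 1" \<eta>])
    fix k and z w :: "real \<times> (real ^ 'n)" assume zw: "z \<in> {0..S} \<times> UNIV" "w \<in> {0..S} \<times> UNIV"
    obtain s x where z: "z = (s, x)" by (cases z)
    obtain t y where w: "w = (t, y)" by (cases w)
    have st: "s \<in> {0..S}" "t \<in> {0..S}" using zw z w by auto
    have n: "\<bar>s - t\<bar> \<le> norm (z - w)" "norm (x - y) \<le> norm (z - w)"
      using norm_fst_le[of "s - t" "x - y"] norm_snd_le[of "x - y" "s - t"] by (simp_all add: z w)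
    have eq: "F k z - F k w = (Y k s x - Y k t x) + ((Y k t x - Y k t y) - (x - y))"
      by (simp add: F_def z w)
    have "norm (F k z - F k w) \<le> norm (Y k s x - Y k t x) + (norm (Y k t x - Y k t y) + norm (x - y))"
      unfolding eq by (rule order_trans[OF norm_triangle_ineq add_left_mono[OF norm_triangle_ineq4]])
    also have "\<dots> \<le> (?v * \<bar>s - t\<bar> + \<eta> k) + (?Q * norm (x - y) + norm (x - y))"
      by (intro add_mono Y st order_refl)
    also have "\<dots> \<le> (?v * norm (z - w) + \<eta> k) + (?Q * norm (z - w) + norm (z - w))"
      using n c0 by (intro add_mono mult_left_mono) auto
    finally show "norm (F k z - F k w) \<le> (?v + ?Q + 1) * norm (z - w) + \<eta> k"
      by (simp add: algebra_simps)
  next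
    fix r G assume "strict_mono r" "\<And>z. z \<in> {0..S} \<times> UNIV \<Longrightarrow> (\<lambda>k. F (r k) z) \<longlonglongrightarrow> G z"
    then show "\<exists>r G. strict_mono r \<and> (\<forall>z\<in>{0..S} \<times> UNIV. (\<lambda>k. F (r k) z) \<longlonglongrightarrow> G z)" by blast
  qed (use S Y(2) \<eta>l c0 in \<open>auto simp: F_def\<close>)
  then obtain r G where r: "strict_mono r" and G: "\<And>z. z \<in> {0..S} \<times> UNIV \<Longrightarrow> (\<lambda>k. F (r k) z) \<longlonglongrightarrow> G z"
    by blast
  define X where "X s x = G (s, x) + x" for s x
  have X: "(\<lambda>k. Y (r k) s x) \<longlonglongrightarrow> X s x" if "s \<in> {0..S}" for s x
    using tendsto_add[OF G[of "(s, x)"] tendsto_const[of x]] that by (simp add: F_def X_def)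
  have \<eta>r: "(\<lambda>k. \<eta> (r k)) \<longlonglongrightarrow> 0" using LIMSEQ_subseq_LIMSEQ[OF \<eta>l r] by (simp add: o_def)
  have X1: "norm (X s x - x) \<le> ?v * S" if "s \<in> {0..S}" for s x
    by (rule LIMSEQ_le_const2[OF tendsto_norm[OF tendsto_diff[OF X[OF that] tendsto_const]]]) (use Y(2) in blast)
  have X2: "norm (X s x - X s y) \<le> ?Q * norm (x - y)" if "s \<in> {0..S}" for s x y
    by (rule LIMSEQ_le_const2[OF tendsto_norm[OF tendsto_diff[OF X[OF that] X[OF that]]]]) (use Y(3) in blast)
  have X3: "norm (X s x - X t x) \<le> ?v * \<bar>s - t\<bar>" if st: "s \<in> {0..S}" "t \<in> {0..S}" for s t x
  proof (rule LIMSEQ_le[OF tendsto_norm[OF tendsto_diff[OF X[OF st(1)] X[OF st(2)]]]])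
    show "(\<lambda>k. ?v * \<bar>s - t\<bar> + \<eta> (r k)) \<longlonglongrightarrow> ?v * \<bar>s - t\<bar>"
      using tendsto_add[OF tendsto_const \<eta>r] by simp
  qed (use Y(4) st in blast)
  \<comment> \<open>The limit curve is again an image of \<open>\<theta>\<close>; this puts it into
    \<open>P1\<close> and reduces convergence in \<open>W1\<close> to dominated convergence of the
    maps.\<close>
  define \<nu> where "\<nu> s = distr \<theta> borel (X s)" for s
  have Ym: "Y k s \<in> borel_measurable borel" for k s by (rule lipschitz_measurable[OF Y(3)])
  have Xm: "X s \<in> borel_measurable borel" if "s \<in> {0..S}" for s by (rule lipschitz_measurable[OF X2[OF that]])
  have P\<nu>: "\<nu> s \<in> P1" if "s \<in> {0..S}" for s
    unfolding \<nu>_def by (rule distr_P1[OF \<theta> Xm[OF that] X1[OF that]])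
  have L\<nu>: "W1 (\<nu> s) (\<nu> t) \<le> ?N * (?v * \<bar>s - t\<bar>)" if st: "s \<in> {0..S}" "t \<in> {0..S}" for s t
    unfolding \<nu>_def
    by (rule W1_distr_le_sup[OF \<theta> Xm[OF st(1)] X1[OF st(1)] Xm[OF st(2)] X1[OF st(2)] X3[OF st]])
  have pw: "(\<lambda>k. W1 (\<nu>s (r k) s) (\<nu> s)) \<longlonglongrightarrow> 0" if s: "s \<in> {0..S}" for s
  proof -
    have "(\<lambda>k. LINT x|\<theta>. norm (Y (r k) s x - X s x)) \<longlonglongrightarrow> (LINT x|\<theta>. 0)"
    proof (rule integral_dominated_convergence[where w = "\<lambda>_. 2 * (?v * S)"])
      show "AE x in \<theta>. (\<lambda>k. norm (Y (r k) s x - X s x)) \<longlonglongrightarrow> 0"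
        using X[OF s] by (intro AE_I2 tendsto_norm_zero) (simp add: LIM_zero_iff)
      show "AE x in \<theta>. norm (norm (Y (r k) s x - X s x)) \<le> 2 * (?v * S)" for k
      proof (rule AE_I2)
        fix x
        have "norm (Y (r k) s x - X s x) \<le> norm (Y (r k) s x - x) + norm (X s x - x)"
          using norm_triangle_ineq4[of "Y (r k) s x - x" "X s x - x"] by simp
        then show "norm (norm (Y (r k) s x - X s x)) \<le> 2 * (?v * S)"
          using Y(2)[of "r k" s x] X1[OF s, of x] by simp
      qed
      show "integrable \<theta> (\<lambda>_. 2 * (?v * S))"
        by (rule P1_integrable_bounded[OF \<theta>, of _ "\<bar>2 * (?v * S)\<bar>"]) auto
      show "(\<lambda>x. norm (Y (r k) s x - X s x)) \<in> borel_measurable \<theta>" for k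
        by (rule P1_measurable[OF \<theta>]) (use Ym Xm[OF s] in measurable)
    qed simp
    then have "(\<lambda>k. \<eta> (r k) + ?N * (LINT x|\<theta>. norm (Y (r k) s x - X s x))) \<longlonglongrightarrow> 0 + ?N * 0"
      by (intro tendsto_intros \<eta>r) simp
    then have lim: "(\<lambda>k. \<eta> (r k) + ?N * (LINT x|\<theta>. norm (Y (r k) s x - X s x))) \<longlonglongrightarrow> 0" by simp
    show ?thesis
    proof (rule Lim_null_comparison[OF always_eventually lim], rule allI)
      fix k
      have "W1 (\<nu>s (r k) s) (\<nu> s) \<le> W1 (\<nu>s (r k) s) (distr \<theta> borel (Y (r k) s)) + W1 (distr \<theta> borel (Y (r k) s)) (\<nu> s)"
        by (rule W1_triangle[OF P[OF s] distr_P1[OF \<theta> Ym Y(2)] P\<nu>[OF s]])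
      also have "\<dots> \<le> \<eta> (r k) + ?N * (LINT x|\<theta>. norm (Y (r k) s x - X s x))"
        unfolding \<nu>_def by (intro add_mono Y(1) s W1_distr_le[OF \<theta> Ym Y(2) Xm[OF s] X1[OF s]])
      finally show "norm (W1 (\<nu>s (r k) s) (\<nu> s)) \<le> \<eta> (r k) + ?N * (LINT x|\<theta>. norm (Y (r k) s x - X s x))"
        using W1_nonneg[OF P[OF s] P\<nu>[OF s]] by simp
    qed
  qed
  have "\<bar>W1 (\<nu>s k s) (\<nu> s) - W1 (\<nu>s k t) (\<nu> t)\<bar> \<le> 4 * ?N * ?v * \<bar>s - t\<bar>"
    if st: "s \<in> {0..S}" "t \<in> {0..S}" for k s t
  proof -
    have "W1 (\<nu>s k s) (\<nu> s) \<le> W1 (\<nu>s k s) (\<nu>s k t) + (W1 (\<nu>s k t) (\<nu> t) + W1 (\<nu> t) (\<nu> s))"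
      using W1_triangle[OF P[OF st(1), of k] P[OF st(2), of k] P\<nu>[OF st(1)]] W1_triangle[OF P[OF st(2), of k] P\<nu>[OF st(2)] P\<nu>[OF st(1)]] by linarith
    moreover have "W1 (\<nu>s k t) (\<nu> t) \<le> W1 (\<nu>s k t) (\<nu>s k s) + (W1 (\<nu>s k s) (\<nu> s) + W1 (\<nu> s) (\<nu> t))"
      using W1_triangle[OF P[OF st(2), of k] P[OF st(1), of k] P\<nu>[OF st(2)]] W1_triangle[OF P[OF st(1), of k] P\<nu>[OF st(1)] P\<nu>[OF st(2)]] by linarith
    ultimately show ?thesis
      using L[OF st, of k] L\<nu>[OF st] W1_commute[of "\<nu>s k s" "\<nu>s k t"] W1_commute[of "\<nu> s" "\<nu> t"] by linarith
  qed
  note uni = pointwise_to_uniform[OF pw this]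
  have "\<forall>\<^sub>F k in sequentially. \<forall>s\<in>{0..S}. W1 (\<nu>s (r k) s) (\<nu> s) < e" if "0 < e" for e
    using uni[OF _ _ _ that] by (rule eventually_mono) (auto simp: abs_less_iff)
  with r P\<nu> show thesis by (rule that)
qed

end

section \<open>Weak-* compactness\<close>

text \<open>The measures with the nonnegative densities \<open>h k + 1\<close> converge on intervals to the Lebesgue-Stieltjes
  measure of \<open>G t + t\<close>. All of them are dominated by twice Lebesgue measure, which
  extends the convergence to Borel sets and provides the density of the limit.\<close>

lemma weak_star_limit_sets:
  fixes h :: "nat \<Rightarrow> real \<Rightarrow> real"
  assumes S: "0 \<le> S" and h: "\<And>k. set_borel_measurable borel {0..S} (h k)" "\<And>k s. s \<in> {0..S} \<Longrightarrow> \<bar>h k s\<bar> \<le> 1"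
    and G: "\<And>t. t \<in> {0..S} \<Longrightarrow> (\<lambda>k. primitive (h k) t) \<longlonglongrightarrow> G t"
  obtains \<gamma> where "set_borel_measurable borel {0..S} \<gamma>" "AE s in lborel. s \<in> {0..S} \<longrightarrow> \<bar>\<gamma> s\<bar> \<le> 1"
    "\<And>A. A \<in> sets borel \<Longrightarrow> (\<lambda>k. LINT s:{0..S} \<inter> A|lborel. h k s) \<longlonglongrightarrow> (LINT s:{0..S} \<inter> A|lborel. \<gamma> s)"
proof -
  have hi: "set_integrable lborel {0..S} (h k)" for k
    by (rule set_integrable_bounded[OF h(1), of _ 1]) (use h(2) in auto)
  have i1: "set_integrable lborel {0..S} (\<lambda>_. 1 :: real)"
    by (simp add: set_integrable_def emeasure_lborel_Icc_eq)
  have hi1: "set_integrable lborel {0..S} (\<lambda>s. h k s + 1)" for k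
    by (rule set_integral_add(1)[OF hi i1])
  define w where "w k s = indicator {0..S} s *\<^sub>R (h k s + 1)" for k s
  have w: "0 \<le> w k s" "w k s \<le> 2 * indicator {0..S} s" for k s
    using h(2)[of s k] by (auto simp: w_def indicator_def)
  have wi: "integrable lborel (w k)" for k
    using hi1[of k] unfolding set_integrable_def w_def[abs_def] .
  have wm [measurable]: "w k \<in> borel_measurable borel" for k
    using borel_measurable_integrable[OF wi] by simp
  define L where "L = density lborel (\<lambda>s. ennreal (indicator {0..S} s))"
  define m where "m k = density lborel (\<lambda>s. ennreal (w k s))" for k
  have sets_m [simp]: "sets (m k) = sets borel" "space (m k) = UNIV" "sets L = sets borel" "space L = UNIV" for k
    by (simp_all add: m_def L_def)
  have m_eq: "emeasure (m k) A = ennreal (LINT s|lborel. indicator A s * w k s) \<and>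
      integrable lborel (\<lambda>s. indicator A s * w k s)" if A: "A \<in> sets borel" for k A
  proof -
    have i: "integrable lborel (\<lambda>s. indicator A s * w k s)"
      by (rule Bochner_Integration.integrable_bound[OF wi[of k]]) (use A in \<open>auto simp: indicator_def\<close>)
    have "emeasure (m k) A = (\<integral>\<^sup>+ s. ennreal (indicator A s * w k s) \<partial>lborel)"
      unfolding m_def using A by (subst emeasure_density) (auto intro!: nn_integral_cong simp: indicator_def)
    also have "\<dots> = ennreal (LINT s|lborel. indicator A s * w k s)"
      by (rule nn_integral_eq_integral[OF i]) (use w(1) in auto)
    finally show ?thesis using i by simp
  qed
  have L_eq: "emeasure L A = emeasure lborel ({0..S} \<inter> A)" if A: "A \<in> sets borel" for A
    unfolding L_def using A
    by (subst emeasure_density) (auto simp: ennreal_indicator indicator_inter_arith[symmetric] intro!: nn_integral_indicator)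
  interpret m: finite_measure "m k" for k
    by (rule finite_measureI) (simp add: m_eq)
  interpret L: finite_measure L
    by (rule finite_measureI) (simp add: L_eq emeasure_lborel_Icc_eq)
  have mM: "measure (m k) A = (LINT s|lborel. indicator A s * w k s)" if A: "A \<in> sets borel" for k A
    using m_eq[OF A, of k] w(1) by (simp add: measure_def)
  have LM: "measure L A = measure lborel ({0..S} \<inter> A)" if A: "A \<in> sets borel" for A
    using L_eq[OF A] by (simp add: measure_def)
  have Lint: "(LINT s|lborel. indicator A s * indicator {0..S} s) = measure L A \<and> integrable lborel (\<lambda>s. indicator A s * indicator {0..S} s :: real)"
    if A: "A \<in> sets borel" for A
  proof -
    have eq: "(\<lambda>s. indicator A s * indicator {0..S} s :: real) = indicator ({0..S} \<inter> A)"
      by (auto simp: indicator_def fun_eq_iff)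
    have "emeasure lborel ({0..S} \<inter> A) < \<infinity>"
      using emeasure_mono[of "{0..S} \<inter> A" "{0..S}" lborel] by (simp add: emeasure_lborel_Icc_eq le_less_trans)
    then show ?thesis unfolding eq using A by (simp add: LM)
  qed
  have mL: "measure (m k) A \<le> 2 * measure L A" if A: "A \<in> sets borel" for k A
  proof -
    have "measure (m k) A \<le> (LINT s|lborel. 2 * (indicator A s * indicator {0..S} s))"
      unfolding mM[OF A]
    proof (rule integral_mono)
      show "indicator A s * w k s \<le> 2 * (indicator A s * indicator {0..S} s)" for s
        using w(2)[of k s] by (auto simp: indicator_def)
    qed (use m_eq[OF A] Lint[OF A] in auto)
    then show ?thesis using Lint[OF A] by simp
  qed
  have m_alt: "measure (m k) A = (LINT s:{0..S} \<inter> A|lborel. h k s) + measure L A" if A: "A \<in> sets borel" for k A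
  proof -
    have "set_integrable lborel ({0..S} \<inter> A) (h k)"
      by (rule set_integrable_subset[OF hi]) (use A in auto)
    then have "(LINT s|lborel. (indicator ({0..S} \<inter> A) s *\<^sub>R h k s) + indicator A s * indicator {0..S} s) = (LINT s:{0..S} \<inter> A|lborel. h k s) + measure L A"
      unfolding set_integrable_def set_lebesgue_integral_def
      using Lint[OF A] by (subst Bochner_Integration.integral_add) auto
    also have "(\<lambda>s. (indicator ({0..S} \<inter> A) s *\<^sub>R h k s) + indicator A s * indicator {0..S} s) = (\<lambda>s. indicator A s * w k s)"
      by (auto simp: w_def indicator_def fun_eq_iff)
    finally show ?thesis using mM[OF A] by simp
  qed
  have borel_UNIV: "(UNIV :: real set) \<in> sets borel" and borel_Ioc: "{a<..b} \<in> sets borel" for a b :: real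
    by simp_all
  \<comment> \<open>Clamping makes \<open>F\<close> constant outside \<open>{0..S}\<close>, so that
    its Lebesgue-Stieltjes measure is finite.\<close>
  define cl where "cl t = max 0 (min S t)" for t
  have cl: "cl t \<in> {0..S}" for t using S by (auto simp: cl_def)
  define F where "F t = G (cl t) + cl t" for t
  have m_Ioc: "(\<lambda>k. measure (m k) {a<..b}) \<longlonglongrightarrow> F b - F a" if ab: "a \<le> b" for a b
  proof -
    have le: "cl a \<le> cl b" using ab by (simp add: cl_def)
    have "measure (m k) {a<..b} = (primitive (h k) (cl b) + cl b) - (primitive (h k) (cl a) + cl a)" for k
    proof -
      have "measure (m k) {a<..b} = (LINT s:{cl a..cl b}|lborel. h k s + 1)"
        unfolding mM[of "{a<..b}", simplified] set_lebesgue_integral_def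
      proof (rule integral_cong_AE)
        show "AE s in lborel. indicator {a<..b} s * w k s = indicator {cl a..cl b} s *\<^sub>R (h k s + 1)"
          using AE_lborel_singleton[of "cl a"] AE_lborel_singleton[of "cl b"] AE_lborel_singleton[of S] AE_lborel_singleton[of 0]
          by eventually_elim (auto simp: w_def indicator_def cl_def max_def min_def split: if_splits)
        have "set_integrable lborel {cl a..cl b} (\<lambda>s. h k s + 1)"
          by (rule set_integrable_Icc_subset[OF hi1]) (use cl in auto)
        then show "(\<lambda>s. indicator {cl a..cl b} s *\<^sub>R (h k s + 1)) \<in> borel_measurable lborel"
          by (auto simp: set_integrable_def)
      qed simp
      also have "\<dots> = primitive (\<lambda>s. h k s + 1) (cl b) - primitive (\<lambda>s. h k s + 1) (cl a)"
        by (rule primitive_diff[OF hi1]) (use cl le in auto)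
      also have "primitive (\<lambda>s. h k s + 1) t = primitive (h k) t + t" if "t \<in> {0..S}" for t
      proof -
        have "set_integrable lborel {0..t} (h k)" "set_integrable lborel {0..t} (\<lambda>_. 1 :: real)"
          using set_integrable_Icc_subset[OF hi[of k], of 0 t] set_integrable_Icc_subset[OF i1, of 0 t] that by auto
        then show ?thesis
          unfolding primitive_def using that
          by (subst set_integral_add(2)) (auto simp: set_lebesgue_integral_def)
      qed
      then have "primitive (\<lambda>s. h k s + 1) (cl b) - primitive (\<lambda>s. h k s + 1) (cl a) = (primitive (h k) (cl b) + cl b) - (primitive (h k) (cl a) + cl a)"
        using cl by simp
      finally show ?thesis .
    qed
    then show ?thesis
      unfolding F_def using cl by (auto intro!: tendsto_intros G)
  qed
  have F: "F a \<le> F b" "F b - F a \<le> 2 * (b - a)" if ab: "a \<le> b" for a b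
  proof -
    have "0 \<le> F b - F a"
      by (rule LIMSEQ_le_const[OF m_Ioc[OF ab]]) simp
    then show "F a \<le> F b" by simp
    have "measure (m k) {a<..b} \<le> 2 * (b - a)" for k
    proof -
      have "measure L {a<..b} \<le> measure lborel {a<..b}"
        unfolding LM[of "{a<..b}", simplified] using ab by (intro measure_mono_fmeasurable) (auto simp: fmeasurable_def)
      then show ?thesis using mL[of "{a<..b}" k] ab by simp
    qed
    then show "F b - F a \<le> 2 * (b - a)"
      by (intro LIMSEQ_le_const2[OF m_Ioc[OF ab]]) blast
  qed
  have F_cont: "continuous (at_right a) F" for a
  proof -
    have "continuous_on UNIV F"
    proof (rule lipschitz_continuous_on[of _ 2])
      show "norm (F x - F y) \<le> 2 * norm (x - y)" for x y
        using F[of x y] F[of y x] by (cases "x \<le> y") auto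
    qed
    then show ?thesis by (simp add: continuous_on_eq_continuous_at continuous_at_imp_continuous_at_within)
  qed
  define m1 where "m1 = interval_measure F"
  have m1_Ioc: "emeasure m1 {a<..b} = ennreal (F b - F a)" if "a \<le> b" for a b
    unfolding m1_def by (rule emeasure_interval_measure_Ioc[OF that F(1) F_cont])
  have m1_sets [simp]: "sets m1 = sets borel" "space m1 = UNIV" by (simp_all add: m1_def)
  have m1_UNIV: "emeasure m1 UNIV = ennreal (F S - F (- 1))"
  proof (rule LIMSEQ_unique)
    let ?A = "\<lambda>n. {- real (Suc n)<..real n + S}"
    have U: "(\<Union>n. ?A n) = UNIV"
    proof (intro equalityI subset_UNIV subsetI)
      fix x :: real
      obtain n :: nat where "\<bar>x\<bar> < real n" using reals_Archimedean2 by blast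
      then have "x \<in> ?A n" using S by auto
      then show "x \<in> (\<Union>n. ?A n)" by blast
    qed
    have "(\<lambda>n. emeasure m1 (?A n)) \<longlonglongrightarrow> emeasure m1 (\<Union>n. ?A n)"
      by (rule Lim_emeasure_incseq) (auto simp: incseq_def)
    then show "(\<lambda>n. emeasure m1 (?A n)) \<longlonglongrightarrow> emeasure m1 UNIV" by (simp only: U)
    have "emeasure m1 (?A n) = ennreal (F S - F (- 1))" for n
      using S by (subst m1_Ioc) (auto simp: F_def cl_def)
    then show "(\<lambda>n. emeasure m1 (?A n)) \<longlonglongrightarrow> ennreal (F S - F (- 1))" by simp
  qed
  interpret m1: finite_measure m1
    by (rule finite_measureI) (simp add: m1_UNIV)
  have conv: "(\<lambda>k. measure (m k) A) \<longlonglongrightarrow> measure m1 A" if A: "A \<in> sets borel" for A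
  proof -
    let ?G = "range (\<lambda>(a, b). {a<..b::real})"
    have sig: "sigma_sets UNIV ?G = sets borel"
      using arg_cong[OF borel_sigma_sets_Ioc, of sets] by (simp add: sets_measure_of)
    have "Int_stable ?G"
    proof (rule Int_stableI, safe)
      fix a b a' b' :: real
      show "{a<..b} \<inter> {a'<..b'} \<in> ?G"
        by (rule image_eqI[of _ _ "(max a a', min b b')"]) auto
    qed
    moreover have "?G \<subseteq> Pow UNIV" by simp
    moreover have "A \<in> sigma_sets UNIV ?G" using A by (simp add: sig)
    ultimately show ?thesis
    proof (induction rule: sigma_sets_induct_disjoint)
      case (basic A)
      then obtain a b where A: "A = {a<..b}" by auto
      show ?case
      proof (cases "a \<le> b")
        case True
        then show ?thesis using m_Ioc[OF True] F(1)[OF True] m1_Ioc[OF True] by (simp add: A measure_def)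
      qed (simp add: A)
    next
      case empty
      show ?case by simp
    next
      case (compl A)
      then have A: "A \<in> sets borel" by (simp add: sig)
      \<comment> \<open>All mass lies in \<open>{0..S}\<close>; the left end -1 keeps the point 0
        inside the half-open interval, so that the integrands agree everywhere.\<close>
      have U: "measure (m k) UNIV = measure (m k) {- 1<..S}" for k
      proof -
        have "(\<lambda>s. indicator UNIV s * w k s) = (\<lambda>s. indicator {-1<..S} s * w k s)"
          by (auto simp: w_def indicator_def fun_eq_iff)
        then show ?thesis by (simp only: mM[of UNIV k, OF borel_UNIV] mM[of "{-1<..S}" k, OF borel_Ioc])
      qed
      have U1: "measure m1 UNIV = F S - F (- 1)"
        using m1_UNIV F(1)[of "-1" S] S by (simp add: measure_def)
      have "(\<lambda>k. measure (m k) UNIV - measure (m k) A) \<longlonglongrightarrow> measure m1 UNIV - measure m1 A"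
        unfolding U U1 by (intro tendsto_diff compl.IH m_Ioc) (use S in simp)
      then show ?case
        using m.finite_measure_compl[of A] m1.finite_measure_compl[of A] A by simp
    next
      case (union A)
      then have A: "range A \<subseteq> sets borel" by (simp add: sig)
      have sm: "measure (m k) (\<Union>i. A i) = (\<Sum>i. measure (m k) (A i))" for k
        using m.finite_measure_UNION[of A k] A union.hyps(1) sums_unique by auto
      have sm1: "measure m1 (\<Union>i. A i) = (\<Sum>i. measure m1 (A i))"
        using m1.finite_measure_UNION[of A] A union.hyps(1) sums_unique by auto
      \<comment> \<open>The common majorant is summable over the disjoint union, so Tannery's
        theorem exchanges the limit in \<open>k\<close> with the sum.\<close>
      have "summable (\<lambda>i. 2 * measure L (A i))"
        using L.finite_measure_UNION[of A] A union.hyps(1) by (intro summable_mult sums_summable) auto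
      moreover have "\<forall>\<^sub>F (i, k) in at_top \<times>\<^sub>F sequentially. norm (measure (m k) (A i)) \<le> 2 * measure L (A i)"
        using mL A by (intro always_eventually) auto
      ultimately show ?case
        unfolding sm sm1 using tannerys_theorem[where a = "\<lambda>i k. measure (m k) (A i)", OF union.IH] by fastforce
    qed
  qed
  have m1_le: "measure m1 A \<le> 2 * measure L A" if "A \<in> sets borel" for A
    by (rule LIMSEQ_le_const2[OF conv[OF that]]) (use mL[OF that] in blast)
  have "absolutely_continuous lborel m1"
    unfolding absolutely_continuous_def
  proof
    fix A :: "real set" assume A: "A \<in> null_sets lborel"
    then have AB: "A \<in> sets borel" by auto
    have "emeasure lborel ({0..S} \<inter> A) \<le> emeasure lborel A"
      using AB by (intro emeasure_mono) auto
    then have "measure L A = 0" using A AB by (simp add: L_eq measure_def null_sets_def)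
    then have "measure m1 A = 0" using m1_le[OF AB] measure_nonneg[of m1 A] by linarith
    then show "A \<in> null_sets m1" using AB by (simp add: null_sets_def m1.emeasure_eq_measure)
  qed
  then obtain p where p: "p \<in> borel_measurable lborel" "density lborel p = m1"
    using sigma_finite_measure.Radon_Nikodym[OF lborel.sigma_finite_measure_axioms, of m1] by auto
  have "(\<integral>\<^sup>+ s. p s \<partial>lborel) = emeasure m1 UNIV"
    using p(1) by (subst p(2)[symmetric], subst emeasure_density) auto
  then have "(\<integral>\<^sup>+ s. p s \<partial>lborel) \<noteq> \<infinity>" by (simp add: m1_UNIV)
  then have pfin: "AE s in lborel. p s \<noteq> \<infinity>" by (rule nn_integral_PInf_AE[OF p(1)])
  define q where "q s = enn2real (p s)" for s
  have q_meas [measurable]: "q \<in> borel_measurable borel" using p(1) by (simp add: q_def[abs_def])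
  have q0: "0 \<le> q s" for s by (simp add: q_def)
  have m1_q: "m1 = density lborel (\<lambda>s. ennreal (q s))"
    unfolding p(2)[symmetric]
  proof (rule density_cong[OF p(1)])
    show "AE s in lborel. p s = ennreal (q s)"
      using pfin by eventually_elim (simp add: q_def less_top)
  qed simp
  have q_eq: "measure m1 A = (LINT s|lborel. indicator A s * q s) \<and> integrable lborel (\<lambda>s. indicator A s * q s)"
    if A: "A \<in> sets borel" for A
  proof -
    have "measure m1 A = (LINT s|m1. indicator A s)" using A by simp
    also have "\<dots> = (LINT s|lborel. q s *\<^sub>R indicator A s)"
      unfolding m1_q by (rule integral_density) (use A q0 in auto)
    finally have 1: "measure m1 A = (LINT s|lborel. indicator A s * q s)" by (simp add: mult.commute)
    have "integrable m1 (indicator A :: real \<Rightarrow> real)"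
      using A by (intro integrable_real_indicator) (auto simp: m1.emeasure_eq_measure)
    then have "integrable lborel (\<lambda>s. q s *\<^sub>R (indicator A s :: real))"
      unfolding m1_q by (subst (asm) integrable_density) (use A q0 in auto)
    then show ?thesis using 1 by (simp add: mult.commute)
  qed
  have q2: "AE s in lborel. s \<in> {0..S} \<longrightarrow> q s \<le> 2"
  proof -
    \<comment> \<open>On \<open>E\<close> the density exceeds 2, while \<open>m1_le\<close> bounds
      the measure of \<open>E\<close> by twice its length; so \<open>E\<close> is a null
      set.\<close>
    define E where "E = {0..S} \<inter> {s. 2 < q s}"
    have E: "E \<in> sets borel" by (simp add: E_def)
    have i: "integrable lborel (\<lambda>s. indicator E s * q s - 2 * (indicator E s * indicator {0..S} s))"
      using q_eq[OF E] Lint[OF E] by auto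
    have "(LINT s|lborel. indicator E s * q s - 2 * (indicator E s * indicator {0..S} s)) = measure m1 E - 2 * measure L E"
      using q_eq[OF E] Lint[OF E] by simp
    also have "\<dots> \<le> 0" using m1_le[OF E] by simp
    finally have le: "(LINT s|lborel. indicator E s * q s - 2 * (indicator E s * indicator {0..S} s)) \<le> 0" .
    have nn: "0 \<le> indicator E s * q s - 2 * (indicator E s * indicator {0..S} s)" for s
      by (auto simp: indicator_def E_def)
    have "0 \<le> (LINT s|lborel. indicator E s * q s - 2 * (indicator E s * indicator {0..S} s))"
      by (rule Bochner_Integration.integral_nonneg) (rule nn)
    with le have "(LINT s|lborel. indicator E s * q s - 2 * (indicator E s * indicator {0..S} s)) = 0" by simp
    then have "AE s in lborel. indicator E s * q s - 2 * (indicator E s * indicator {0..S} s) = 0"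
      using integral_nonneg_eq_0_iff_AE[OF i] nn by auto
    then show ?thesis by eventually_elim (auto simp: E_def indicator_def split: if_splits)
  qed
  show thesis
  proof (rule that[of "\<lambda>s. q s - 1"])
    show "set_borel_measurable borel {0..S} (\<lambda>s. q s - 1)"
      unfolding set_borel_measurable_def by measurable
    show "AE s in lborel. s \<in> {0..S} \<longrightarrow> \<bar>q s - 1\<bar> \<le> 1"
      using q2 by eventually_elim (use q0 in \<open>auto simp: abs_le_iff\<close>)
    fix A :: "real set" assume A: "A \<in> sets borel"
    let ?A = "{0..S} \<inter> A"
    have A': "?A \<in> sets borel" using A by simp
    have "(LINT s:{0..S} \<inter> A|lborel. q s - 1) = (LINT s|lborel. indicator ?A s * q s - indicator ?A s * indicator {0..S} s)"
      unfolding set_lebesgue_integral_def by (intro Bochner_Integration.integral_cong) (auto simp: indicator_def)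
    also have "\<dots> = measure m1 ?A - measure L ?A"
      using q_eq[OF A'] Lint[OF A'] by simp
    finally have eq: "(LINT s:{0..S} \<inter> A|lborel. q s - 1) = measure m1 ?A - measure L ?A" .
    have "(\<lambda>k. measure (m k) ?A - measure L ?A) \<longlonglongrightarrow> measure m1 ?A - measure L ?A"
      by (intro tendsto_intros conv A')
    then show "(\<lambda>k. LINT s:{0..S} \<inter> A|lborel. h k s) \<longlonglongrightarrow> (LINT s:{0..S} \<inter> A|lborel. q s - 1)"
      unfolding eq by (simp add: m_alt[OF A'])
  qed
qed

text \<open>From indicators to simple functions to their limits in \<open>L1\<close>: the bound by 1
  makes all functionals 1-Lipschitz on \<open>L1\<close>, so the convergence survives the last
  passage.\<close>

lemma weak_star_limit_L1:
  fixes h :: "nat \<Rightarrow> real \<Rightarrow> real"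
  assumes h: "\<And>k. set_borel_measurable borel {0..S} (h k)" "\<And>k. AE s in lborel. s \<in> {0..S} \<longrightarrow> \<bar>h k s\<bar> \<le> 1"
    and g: "set_borel_measurable borel {0..S} \<gamma>" "AE s in lborel. s \<in> {0..S} \<longrightarrow> \<bar>\<gamma> s\<bar> \<le> 1"
    and conv: "\<And>A. A \<in> sets borel \<Longrightarrow> (\<lambda>k. LINT s:{0..S} \<inter> A|lborel. h k s) \<longlonglongrightarrow> (LINT s:{0..S} \<inter> A|lborel. \<gamma> s)"
    and f: "set_integrable lborel {0..S} f"
  shows "(\<lambda>k. LINT s:{0..S}|lborel. h k s * f s) \<longlonglongrightarrow> (LINT s:{0..S}|lborel. \<gamma> s * f s)"
proof -
  define H where "H k s = indicator {0..S} s *\<^sub>R h k s" for k s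
  define g' where "g' s = indicator {0..S} s *\<^sub>R \<gamma> s" for s
  have Hm: "H k \<in> borel_measurable borel" "g' \<in> borel_measurable borel" for k
    using h(1)[of k] g(1) unfolding set_borel_measurable_def H_def[abs_def] g'_def[abs_def] by auto
  have Hb: "AE s in lborel. \<bar>H k s\<bar> \<le> 1" for k
    using h(2)[of k] by eventually_elim (auto simp: H_def indicator_def)
  have gb: "AE s in lborel. \<bar>g' s\<bar> \<le> 1"
    using g(2) by eventually_elim (auto simp: g'_def indicator_def)
  have i: "integrable lborel (\<lambda>s. K s * F s)" and b: "\<bar>LINT s|lborel. K s * F s\<bar> \<le> (LINT s|lborel. \<bar>F s\<bar>)"
    if K: "K \<in> borel_measurable borel" "AE s in lborel. \<bar>K s\<bar> \<le> 1" and F: "integrable lborel F" for K F :: "real \<Rightarrow> real"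
  proof -
    have le: "AE s in lborel. norm (K s * F s) \<le> \<bar>F s\<bar>"
      using K(2) by eventually_elim (simp add: abs_mult mult_left_le_one_le)
    show i: "integrable lborel (\<lambda>s. K s * F s)"
    proof (rule Bochner_Integration.integrable_bound[OF F])
      show "(\<lambda>s. K s * F s) \<in> borel_measurable lborel"
        using K(1) borel_measurable_integrable[OF F] by simp
      show "AE s in lborel. norm (K s * F s) \<le> norm (F s)" using le by simp
    qed
    have "\<bar>LINT s|lborel. K s * F s\<bar> \<le> (LINT s|lborel. \<bar>K s * F s\<bar>)" by (rule integral_abs_bound)
    also have "\<dots> \<le> (LINT s|lborel. \<bar>F s\<bar>)"
      by (rule integral_mono_AE[OF integrable_abs[OF i] integrable_abs[OF F]]) (use le in simp)
    finally show "\<bar>LINT s|lborel. K s * F s\<bar> \<le> (LINT s|lborel. \<bar>F s\<bar>)" .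
  qed
  have "integrable lborel F \<Longrightarrow> (\<lambda>k. LINT s|lborel. H k s * F s) \<longlonglongrightarrow> (LINT s|lborel. g' s * F s)" for F
  proof (induction rule: integrable_induct)
    case (base A c)
    have eq: "(LINT s|lborel. indicator {0..S} s *\<^sub>R k s * (indicator A s *\<^sub>R c)) = (LINT s:{0..S} \<inter> A|lborel. k s) * c" for k :: "real \<Rightarrow> real"
    proof -
      have "(LINT s|lborel. indicator {0..S} s *\<^sub>R k s * (indicator A s *\<^sub>R c)) = (LINT s|lborel. (indicator ({0..S} \<inter> A) s *\<^sub>R k s) * c)"
        by (intro Bochner_Integration.integral_cong) (auto simp: indicator_def)
      then show ?thesis unfolding set_lebesgue_integral_def by (simp only: integral_mult_left_zero)
    qed
    show ?case
      unfolding H_def g'_def eq by (intro tendsto_intros conv) (use base in simp)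
  next
    case (add F1 F2)
    have "(LINT s|lborel. K s * (F1 s + F2 s)) = (LINT s|lborel. K s * F1 s) + (LINT s|lborel. K s * F2 s)"
      if "K \<in> borel_measurable borel" "AE s in lborel. \<bar>K s\<bar> \<le> 1" for K
      unfolding distrib_left by (rule Bochner_Integration.integral_add) (use i[OF that] add in auto)
    then show ?case using Hm Hb gb tendsto_add[OF add.IH] by simp
  next
    case (lim F s)
    \<comment> \<open>The simple functions of \<open>integrable_induct\<close> are bounded by
      \<open>2 * \<bar>F x\<bar>\<close>, whence the factor 3.\<close>
    have "(\<lambda>n. LINT x|lborel. \<bar>s n x - F x\<bar>) \<longlonglongrightarrow> (LINT x|(lborel :: real measure). 0)"
    proof (rule integral_dominated_convergence[where w = "\<lambda>x. 3 * \<bar>F x\<bar>"])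
      show "AE x in lborel. (\<lambda>n. \<bar>s n x - F x\<bar>) \<longlonglongrightarrow> 0"
        using lim.hyps(2) by (auto intro!: AE_I2 tendsto_rabs_zero simp: LIM_zero_iff)
      show "AE x in lborel. norm \<bar>s n x - F x\<bar> \<le> 3 * \<bar>F x\<bar>" for n
      proof (rule AE_I2)
        fix x :: real
        show "norm \<bar>s n x - F x\<bar> \<le> 3 * \<bar>F x\<bar>"
          using lim.hyps(3)[of x n] by simp
      qed
      show "(\<lambda>x. \<bar>s n x - F x\<bar>) \<in> borel_measurable lborel" for n
        using borel_measurable_integrable[OF lim.hyps(1)[of n]] borel_measurable_integrable[OF lim.hyps(4)] by simp
      show "integrable lborel (\<lambda>x. 3 * \<bar>F x\<bar>)" using lim.hyps(4) by simp
    qed simp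
    then have l0: "(\<lambda>n. LINT x|lborel. \<bar>s n x - F x\<bar>) \<longlonglongrightarrow> 0" by simp
    have d: "\<bar>(LINT x|lborel. K x * s n x) - (LINT x|lborel. K x * F x)\<bar> \<le> (LINT x|lborel. \<bar>s n x - F x\<bar>)"
      if K: "K \<in> borel_measurable borel" "AE s in lborel. \<bar>K s\<bar> \<le> 1" for K n
    proof -
      have "(LINT x|lborel. K x * s n x) - (LINT x|lborel. K x * F x) = (LINT x|lborel. K x * (s n x - F x))"
        unfolding right_diff_distrib
        by (rule Bochner_Integration.integral_diff[symmetric]) (use i[OF K] lim.hyps(1,4) in auto)
      then show ?thesis using b[OF K, of "\<lambda>x. s n x - F x"] lim.hyps(1,4) by simp
    qed
    show ?case
    proof (rule LIMSEQ_I)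
      fix \<epsilon> :: real assume \<epsilon>: "0 < \<epsilon>"
      then obtain n where n: "(LINT x|lborel. \<bar>s n x - F x\<bar>) < \<epsilon> / 3"
        using order_tendstoD(2)[OF l0, of "\<epsilon> / 3"] by (auto simp: eventually_sequentially)
      obtain N where N: "\<And>k. N \<le> k \<Longrightarrow> \<bar>(LINT x|lborel. H k x * s n x) - (LINT x|lborel. g' x * s n x)\<bar> < \<epsilon> / 3"
        using LIMSEQ_D[OF lim.IH[of n], of "\<epsilon> / 3"] \<epsilon> by auto
      have "\<bar>(LINT x|lborel. H k x * F x) - (LINT x|lborel. g' x * F x)\<bar> < \<epsilon>" if "N \<le> k" for k
        using N[OF that] n d[OF Hm(1)[of k] Hb[of k], of n] d[OF Hm(2) gb, of n] by linarith
      then show "\<exists>no. \<forall>k\<ge>no. norm ((LINT x|lborel. H k x * F x) - (LINT x|lborel. g' x * F x)) < \<epsilon>"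
        by (auto simp only: real_norm_def)
    qed
  qed
  from this[OF f[unfolded set_integrable_def]]
  have "(\<lambda>k. LINT s|lborel. H k s * (indicator {0..S} s *\<^sub>R f s)) \<longlonglongrightarrow> (LINT s|lborel. g' s * (indicator {0..S} s *\<^sub>R f s))" .
  moreover have "(LINT s|lborel. indicator {0..S} s *\<^sub>R k s * (indicator {0..S} s *\<^sub>R f s)) = (LINT s:{0..S}|lborel. k s * f s)" for k
    unfolding set_lebesgue_integral_def by (intro Bochner_Integration.integral_cong) (auto simp: indicator_def)
  ultimately show ?thesis by (simp only: H_def g'_def)
qed

text \<open>The primitives are bounded and 1-Lipschitz, so one subsequence makes them converge at
  every time; their limits determine the weak-* limit, component by component.\<close>

theorem weak_star_subsequence:
  fixes \<gamma>s :: "nat \<Rightarrow> real \<Rightarrow> 'a::euclidean_space"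
  assumes S: "0 \<le> S" and m: "\<And>k. set_borel_measurable borel {0..S} (\<gamma>s k)" and b: "\<And>k s. s \<in> {0..S} \<Longrightarrow> norm (\<gamma>s k s) \<le> 1"
  obtains r \<gamma> where "strict_mono r" "\<gamma> \<in> Linf S"
    "\<And>f. f \<in> L1 S \<Longrightarrow> (\<lambda>k. LINT s:{0..S}|lborel. \<gamma>s (r k) s \<bullet> f s) \<longlonglongrightarrow> (LINT s:{0..S}|lborel. \<gamma> s \<bullet> f s)"
proof -
  have gi: "set_integrable lborel {0..S} (\<gamma>s k)" for k
    by (rule set_integrable_bounded[OF m, of _ 1]) (use b in auto)
  have pl: "norm (primitive (\<gamma>s k) t - primitive (\<gamma>s k) s) \<le> \<bar>t - s\<bar>" if "s \<in> {0..S}" "t \<in> {0..S}" for k s t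
    using primitive_lipschitz[OF gi b that(2,1), of k] by simp
  have p0: "primitive (\<gamma>s k) 0 = 0" for k
    using primitive_diff[OF gi, of 0 0] S by (simp add: primitive_def)
  have "\<exists>r G. strict_mono r \<and> (\<forall>t\<in>{0..S}. (\<lambda>k. primitive (\<gamma>s (r k)) t) \<longlonglongrightarrow> G t)"
  proof (rule asymptotically_lipschitz_subsequence[of "{0..S}" "\<lambda>k. primitive (\<gamma>s k)" S 1 "\<lambda>_. 0"])
    show "norm (primitive (\<gamma>s k) z) \<le> S" if "z \<in> {0..S}" for k z
      using pl[of 0 z k] that S by (simp add: p0)
    show "norm (primitive (\<gamma>s k) z - primitive (\<gamma>s k) w) \<le> 1 * norm (z - w) + 0" if "z \<in> {0..S}" "w \<in> {0..S}" for k z w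
      using pl[OF that(2,1), of k] by simp
    fix r G assume "strict_mono r" "\<And>t. t \<in> {0..S} \<Longrightarrow> (\<lambda>k. primitive (\<gamma>s (r k)) t) \<longlonglongrightarrow> G t"
    then show "\<exists>r G. strict_mono r \<and> (\<forall>t\<in>{0..S}. (\<lambda>k. primitive (\<gamma>s (r k)) t) \<longlonglongrightarrow> G t)" by blast
  qed (use S in auto)
  then obtain r G where r: "strict_mono r" and G: "\<And>t. t \<in> {0..S} \<Longrightarrow> (\<lambda>k. primitive (\<gamma>s (r k)) t) \<longlonglongrightarrow> G t"
    by blast
  have comp_m: "set_borel_measurable borel {0..S} (\<lambda>s. \<gamma>s k s \<bullet> i)" for k i
  proof -
    have "(\<lambda>s. (indicator {0..S} s *\<^sub>R \<gamma>s k s) \<bullet> i) \<in> borel_measurable borel"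
      using m[of k] unfolding set_borel_measurable_def by (rule borel_measurable_inner) simp
    then show ?thesis by (simp add: set_borel_measurable_def)
  qed
  have comp_b: "\<bar>\<gamma>s k s \<bullet> i\<bar> \<le> 1" if "i \<in> Basis" "s \<in> {0..S}" for k s i
    using Basis_le_norm[OF that(1), of "\<gamma>s k s"] b[OF that(2), of k] by linarith
  have comp_G: "(\<lambda>k. primitive (\<lambda>s. \<gamma>s (r k) s \<bullet> i) t) \<longlonglongrightarrow> G t \<bullet> i" if "t \<in> {0..S}" for t i
  proof -
    have "primitive (\<lambda>s. \<gamma>s k s \<bullet> i) t = primitive (\<gamma>s k) t \<bullet> i" for k
    proof -
      have gt: "set_integrable lborel {0..t} (\<gamma>s k)" by (rule set_integrable_Icc_subset[OF gi]) (use that in auto)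
      show ?thesis
        using integral_inner_left[of i lborel "\<lambda>s. indicator {0..t} s *\<^sub>R \<gamma>s k s"] gt
        by (simp add: primitive_def set_lebesgue_integral_def set_integrable_def)
    qed
    then show ?thesis using tendsto_inner[OF G[OF that] tendsto_const[of i]] by simp
  qed
  have "\<exists>g. set_borel_measurable borel {0..S} g \<and> (AE s in lborel. s \<in> {0..S} \<longrightarrow> \<bar>g s\<bar> \<le> 1) \<and>
      (\<forall>A\<in>sets borel. (\<lambda>k. LINT s:{0..S} \<inter> A|lborel. \<gamma>s (r k) s \<bullet> i) \<longlonglongrightarrow> (LINT s:{0..S} \<inter> A|lborel. g s))"
    if "i \<in> Basis" for i
  proof (rule weak_star_limit_sets[OF S comp_m comp_b[OF that] comp_G])
    fix g assume "set_borel_measurable borel {0..S} g" "AE s in lborel. s \<in> {0..S} \<longrightarrow> \<bar>g s\<bar> \<le> 1"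
      "\<And>A. A \<in> sets borel \<Longrightarrow> (\<lambda>k. LINT s:{0..S} \<inter> A|lborel. \<gamma>s (r k) s \<bullet> i) \<longlonglongrightarrow> (LINT s:{0..S} \<inter> A|lborel. g s)"
    then show ?thesis by blast
  qed
  then have "\<forall>i\<in>Basis. \<exists>g. set_borel_measurable borel {0..S} g \<and> (AE s in lborel. s \<in> {0..S} \<longrightarrow> \<bar>g s\<bar> \<le> 1) \<and>
      (\<forall>A\<in>sets borel. (\<lambda>k. LINT s:{0..S} \<inter> A|lborel. \<gamma>s (r k) s \<bullet> i) \<longlonglongrightarrow> (LINT s:{0..S} \<inter> A|lborel. g s))"
    by blast
  from bchoice[OF this] obtain g where g0: "\<forall>i\<in>Basis. set_borel_measurable borel {0..S} (g i) \<and> (AE s in lborel. s \<in> {0..S} \<longrightarrow> \<bar>g i s\<bar> \<le> 1) \<and>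
      (\<forall>A\<in>sets borel. (\<lambda>k. LINT s:{0..S} \<inter> A|lborel. \<gamma>s (r k) s \<bullet> i) \<longlonglongrightarrow> (LINT s:{0..S} \<inter> A|lborel. g i s))"
    by (erule exE)
  have g: "\<And>i. i \<in> Basis \<Longrightarrow> set_borel_measurable borel {0..S} (g i)"
      "\<And>i. i \<in> Basis \<Longrightarrow> AE s in lborel. s \<in> {0..S} \<longrightarrow> \<bar>g i s\<bar> \<le> 1"
      "\<And>i A. i \<in> Basis \<Longrightarrow> A \<in> sets borel \<Longrightarrow> (\<lambda>k. LINT s:{0..S} \<inter> A|lborel. \<gamma>s (r k) s \<bullet> i) \<longlonglongrightarrow> (LINT s:{0..S} \<inter> A|lborel. g i s)"
    using g0 by simp_all
  define \<gamma> where "\<gamma> s = (\<Sum>i\<in>Basis. g i s *\<^sub>R i)" for s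
  have gam: "\<gamma> s \<bullet> i = g i s" if "i \<in> Basis" for s i
    unfolding \<gamma>_def using that by (simp add: inner_sum_left inner_Basis if_distrib sum.delta cong: if_cong)
  show thesis
  proof (rule that[OF r])
    have gm: "set_borel_measurable borel {0..S} \<gamma>"
    proof -
      have "(\<lambda>s. \<Sum>i\<in>Basis. (indicator {0..S} s *\<^sub>R g i s) *\<^sub>R i) \<in> borel_measurable borel"
        by (intro borel_measurable_sum, rule borel_measurable_scaleR[OF g(1)[unfolded set_borel_measurable_def]]) auto
      then show ?thesis by (simp add: set_borel_measurable_def \<gamma>_def scaleR_sum_right)
    qed
    have "AE s in lborel. \<forall>i\<in>Basis. s \<in> {0..S} \<longrightarrow> \<bar>g i s\<bar> \<le> 1"
      using g(2) by (intro AE_finite_allI) auto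
    then have "AE s in lborel. s \<in> {0..S} \<longrightarrow> norm (\<gamma> s) \<le> real DIM('a)"
    proof eventually_elim
      case (elim s)
      show ?case
      proof
        assume s: "s \<in> {0..S}"
        have "norm (\<gamma> s) \<le> (\<Sum>i\<in>Basis. \<bar>\<gamma> s \<bullet> i\<bar>)" by (rule norm_le_l1)
        also have "\<dots> \<le> (\<Sum>i\<in>(Basis :: 'a set). 1)" using elim s by (intro sum_mono) (simp add: gam)
        finally show "norm (\<gamma> s) \<le> real DIM('a)" by simp
      qed
    qed
    with gm show "\<gamma> \<in> Linf S" by (auto simp: Linf_def)
    fix f :: "real \<Rightarrow> 'a" assume f: "f \<in> L1 S"
    then have fi: "set_integrable lborel {0..S} f" by (simp add: L1_def)
    have fc: "set_integrable lborel {0..S} (\<lambda>s. f s \<bullet> i)" for i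
      using integrable_inner_left[of i lborel "\<lambda>s. indicator {0..S} s *\<^sub>R f s"] fi by (simp add: set_integrable_def)
    have lim: "(\<lambda>k. LINT s:{0..S}|lborel. (\<gamma>s (r k) s \<bullet> i) * (f s \<bullet> i)) \<longlonglongrightarrow> (LINT s:{0..S}|lborel. g i s * (f s \<bullet> i))"
      if i: "i \<in> Basis" for i
      by (rule weak_star_limit_L1[OF comp_m _ g(1,2)[OF i] g(3)[OF i] fc]) (use comp_b[OF i] in auto)
    have prod_i: "set_integrable lborel {0..S} (\<lambda>s. k s * (f s \<bullet> i))"
      if k: "set_borel_measurable borel {0..S} k" "AE s in lborel. s \<in> {0..S} \<longrightarrow> \<bar>k s\<bar> \<le> 1" for k :: "real \<Rightarrow> real" and i
      unfolding set_integrable_def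
    proof (rule Bochner_Integration.integrable_bound[OF fc[of i, unfolded set_integrable_def]])
      have "(\<lambda>s. (indicator {0..S} s *\<^sub>R k s) * (indicator {0..S} s *\<^sub>R (f s \<bullet> i))) \<in> borel_measurable lborel"
        by (rule borel_measurable_times[OF _ borel_measurable_integrable[OF fc[of i, unfolded set_integrable_def]]])
           (use k(1) in \<open>simp add: set_borel_measurable_def\<close>)
      then show "(\<lambda>s. indicator {0..S} s *\<^sub>R (k s * (f s \<bullet> i))) \<in> borel_measurable lborel"
        by (rule measurable_cong[THEN iffD1, rotated]) (auto simp: indicator_def)
      show "AE s in lborel. norm (indicator {0..S} s *\<^sub>R (k s * (f s \<bullet> i))) \<le> norm (indicator {0..S} s *\<^sub>R (f s \<bullet> i))"
        using k(2) by eventually_elim (auto simp: indicator_def abs_mult mult_left_le_one_le)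
    qed
    have sum: "(LINT s:{0..S}|lborel. \<delta> s \<bullet> f s) = (\<Sum>i\<in>Basis. LINT s:{0..S}|lborel. (\<delta> s \<bullet> i) * (f s \<bullet> i))"
      if "\<And>i. i \<in> Basis \<Longrightarrow> set_integrable lborel {0..S} (\<lambda>s. (\<delta> s \<bullet> i) * (f s \<bullet> i))" for \<delta> :: "real \<Rightarrow> 'a"
    proof -
      have "(LINT s:{0..S}|lborel. \<delta> s \<bullet> f s) = (LINT s|lborel. (\<Sum>i\<in>Basis. indicator {0..S} s *\<^sub>R ((\<delta> s \<bullet> i) * (f s \<bullet> i))))"
        unfolding set_lebesgue_integral_def scaleR_sum_right[symmetric] by (subst euclidean_inner) (rule refl)
      also have "\<dots> = (\<Sum>i\<in>Basis. LINT s|lborel. indicator {0..S} s *\<^sub>R ((\<delta> s \<bullet> i) * (f s \<bullet> i)))"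
        by (rule Bochner_Integration.integral_sum) (use that in \<open>simp add: set_integrable_def\<close>)
      finally show ?thesis by (simp only: set_lebesgue_integral_def)
    qed
    have "(\<lambda>k. \<Sum>i\<in>Basis. LINT s:{0..S}|lborel. (\<gamma>s (r k) s \<bullet> i) * (f s \<bullet> i)) \<longlonglongrightarrow> (\<Sum>i\<in>Basis. LINT s:{0..S}|lborel. g i s * (f s \<bullet> i))"
      by (intro tendsto_sum lim)
    moreover have "(LINT s:{0..S}|lborel. \<gamma> s \<bullet> f s) = (\<Sum>i\<in>Basis. LINT s:{0..S}|lborel. g i s * (f s \<bullet> i))"
    proof -
      have "(LINT s:{0..S}|lborel. \<gamma> s \<bullet> f s) = (\<Sum>i\<in>Basis. LINT s:{0..S}|lborel. (\<gamma> s \<bullet> i) * (f s \<bullet> i))"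
        by (rule sum) (use prod_i[OF g(1,2)] in \<open>simp add: gam\<close>)
      then show ?thesis by (simp add: gam)
    qed
    moreover have "(LINT s:{0..S}|lborel. \<gamma>s k s \<bullet> f s) = (\<Sum>i\<in>Basis. LINT s:{0..S}|lborel. (\<gamma>s k s \<bullet> i) * (f s \<bullet> i))" for k
      by (rule sum, rule prod_i[OF comp_m]) (use comp_b in auto)
    ultimately show "(\<lambda>k. LINT s:{0..S}|lborel. \<gamma>s (r k) s \<bullet> f s) \<longlonglongrightarrow> (LINT s:{0..S}|lborel. \<gamma> s \<bullet> f s)" by simp
  qed
qed

section \<open>Cluster points\<close>

lemma limitin_mtopology_of:
  "limitin (mtopology_of m) f l F \<longleftrightarrow> l \<in> mspace m \<and> (\<forall>\<epsilon>>0. \<forall>\<^sub>F x in F. f x \<in> mspace m \<and> mdist m (f x) l < \<epsilon>)"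
  unfolding mtopology_of_def by (rule Metric_space.limitin_metric[OF Metric_space_mspace_mdist])

lemma openin_mball_of: "openin (mtopology_of m) (mball_of m x r)"
  unfolding mtopology_of_def mball_of_def by (rule Metric_space.openin_mball[OF Metric_space_mspace_mdist])

lemma C0_W1_iff:
  assumes S: "0 \<le> S"
  shows "restrict \<nu> {0..S} \<in> mspace (C0_metric S W1_metric) \<longleftrightarrow> W1_continuous S \<nu>"
proof -
  let ?\<nu> = "restrict \<nu> {0..S}"
  have "continuous_map (top_of_set {0..S}) (mtopology_of W1_metric) ?\<nu> \<longleftrightarrow> W1_continuous S \<nu>"
  proof
    assume c: "continuous_map (top_of_set {0..S}) (mtopology_of W1_metric) ?\<nu>"
    have P: "\<nu> s \<in> P1" if "s \<in> {0..S}" for s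
      using continuous_map_image_subset_topspace[OF c] that by auto
    have "((\<lambda>r. W1 (\<nu> r) (\<nu> s)) \<longlongrightarrow> 0) (at s within {0..S})" if s: "s \<in> {0..S}" for s
    proof -
      have "continuous_map (top_of_set {0..S}) (mtopology_of W1_metric) (\<lambda>r. \<nu> s)"
        using P[OF s] by simp
      from continuous_map_mdist[OF c this]
      have "continuous_on {0..S} (\<lambda>r. mdist W1_metric (?\<nu> r) (\<nu> s))" by simp
      then have "((\<lambda>r. mdist W1_metric (?\<nu> r) (\<nu> s)) \<longlongrightarrow> mdist W1_metric (?\<nu> s) (\<nu> s)) (at s within {0..S})"
        using s by (simp only: continuous_on_def)
      then have "((\<lambda>r. mdist W1_metric (?\<nu> r) (\<nu> s)) \<longlongrightarrow> 0) (at s within {0..S})"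
        using s P[OF s] by (simp add: mdist_W1_metric W1_self)
      then show ?thesis
      proof (rule Lim_transform_eventually)
        show "\<forall>\<^sub>F r in at s within {0..S}. mdist W1_metric (?\<nu> r) (\<nu> s) = W1 (\<nu> r) (\<nu> s)"
          unfolding eventually_at_filter
          by (rule always_eventually) (use P s in \<open>auto simp: mdist_W1_metric\<close>)
      qed
    qed
    with P show "W1_continuous S \<nu>" by (simp add: W1_continuous_def)
  next
    assume w: "W1_continuous S \<nu>"
    have P: "\<nu> s \<in> P1" if "s \<in> {0..S}" for s using w that by (simp add: W1_continuous_def)
    show "continuous_map (top_of_set {0..S}) (mtopology_of W1_metric) ?\<nu>"
      unfolding mtopology_of_def Metric_space.continuous_map_to_metric[OF Metric_space_mspace_mdist]
    proof (intro ballI allI impI)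
      fix s and \<epsilon> :: real assume "s \<in> topspace (top_of_set {0..S})" and \<epsilon>: "0 < \<epsilon>"
      then have s: "s \<in> {0..S}" by simp
      have "((\<lambda>r. W1 (\<nu> r) (\<nu> s)) \<longlongrightarrow> 0) (at s within {0..S})" using w s by (simp add: W1_continuous_def)
      then have "\<forall>\<^sub>F r in at s within {0..S}. W1 (\<nu> r) (\<nu> s) < \<epsilon>" using \<epsilon> by (rule order_tendstoD)
      then obtain T where T: "open T" "s \<in> T" "\<And>r. r \<in> T \<Longrightarrow> r \<noteq> s \<Longrightarrow> r \<in> {0..S} \<Longrightarrow> W1 (\<nu> r) (\<nu> s) < \<epsilon>"
        unfolding eventually_at_topological by blast
      show "\<exists>U. openin (top_of_set {0..S}) U \<and> s \<in> U \<and> (\<forall>y\<in>U. ?\<nu> y \<in> Metric_space.mball (mspace W1_metric) (mdist W1_metric) (?\<nu> s) \<epsilon>)"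
      proof (intro exI[of _ "{0..S} \<inter> T"] conjI ballI)
        show "openin (top_of_set {0..S}) ({0..S} \<inter> T)" using T(1) by (simp add: openin_open_Int)
        show "s \<in> {0..S} \<inter> T" using s T(2) by simp
        fix y assume y: "y \<in> {0..S} \<inter> T"
        have "W1 (\<nu> s) (\<nu> y) < \<epsilon>"
          using T(3)[of y] y \<epsilon> W1_self[of "\<nu> s"] W1_commute[of "\<nu> s" "\<nu> y"] by (cases "y = s") auto
        then show "?\<nu> y \<in> Metric_space.mball (mspace W1_metric) (mdist W1_metric) (?\<nu> s) \<epsilon>"
          unfolding Metric_space.in_mball[OF Metric_space_mspace_mdist] using s y P by (simp add: mdist_W1_metric)
      qed
    qed
  qed
  then show ?thesis by (simp add: C0_metric(1)[OF S])
qed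

lemma C0_W1_dist_le:
  assumes S: "0 \<le> S" and "W1_continuous S \<mu>" "W1_continuous S \<nu>" "s \<in> {0..S}"
  shows "W1 (\<mu> s) (\<nu> s) \<le> mdist (C0_metric S W1_metric) (restrict \<mu> {0..S}) (restrict \<nu> {0..S})"
proof -
  let ?\<mu> = "restrict \<mu> {0..S}" and ?\<nu> = "restrict \<nu> {0..S}"
  have m: "?\<mu> \<in> mspace (C0_metric S W1_metric)" "?\<nu> \<in> mspace (C0_metric S W1_metric)"
    using assms by (simp_all only: C0_W1_iff)
  have c: "continuous_map (top_of_set {0..S}) (mtopology_of W1_metric) ?\<mu>" "continuous_map (top_of_set {0..S}) (mtopology_of W1_metric) ?\<nu>"
    using m by (simp_all add: C0_metric(1)[OF S])
  have "continuous_on {0..S} (\<lambda>s. mdist W1_metric (?\<mu> s) (?\<nu> s))"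
    using continuous_map_mdist[OF c] by simp
  then have "bdd_above ((\<lambda>s. mdist W1_metric (?\<mu> s) (?\<nu> s)) ` {0..S})"
    by (intro bounded_imp_bdd_above compact_imp_bounded compact_continuous_image) auto
  from cSUP_upper[OF assms(4) this]
  have "mdist W1_metric (?\<mu> s) (?\<nu> s) \<le> (SUP s\<in>{0..S}. mdist W1_metric (?\<mu> s) (?\<nu> s))" .
  moreover have "mdist W1_metric (?\<mu> s) (?\<nu> s) = W1 (\<mu> s) (\<nu> s)"
    using assms by (simp add: mdist_W1_metric W1_continuous_def)
  ultimately show ?thesis by (simp only: C0_metric(2)[OF S m])
qed

lemma C0_W1_dist_bound:
  assumes S: "0 \<le> S" and "W1_continuous S \<mu>" "W1_continuous S \<nu>" and "\<And>s. s \<in> {0..S} \<Longrightarrow> W1 (\<mu> s) (\<nu> s) \<le> e"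
  shows "mdist (C0_metric S W1_metric) (restrict \<mu> {0..S}) (restrict \<nu> {0..S}) \<le> e"
proof -
  have m: "restrict \<mu> {0..S} \<in> mspace (C0_metric S W1_metric)" "restrict \<nu> {0..S} \<in> mspace (C0_metric S W1_metric)"
    using assms by (simp_all only: C0_W1_iff)
  show ?thesis
    unfolding C0_metric(2)[OF S m]
    by (rule cSUP_least) (use assms in \<open>auto simp: mdist_W1_metric W1_continuous_def\<close>)
qed

text \<open>A basic neighbourhood in the product is a uniform ball times finitely many weak-* tests.
  It is the product that makes both kinds of closeness hold at the same index, infinitely
  often.\<close>

lemma process_cluster_pointD:
  fixes \<nu>s :: "nat \<Rightarrow> real \<Rightarrow> (real ^ 'n::finite) measure" and \<beta>s :: "nat \<Rightarrow> real \<Rightarrow> real ^ 'm::finite"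
  assumes S: "0 \<le> S" and cl: "process_cluster_point S \<nu>s \<alpha>s \<beta>s \<nu> \<alpha> \<beta>"
    and cont: "\<And>k. W1_continuous S (\<nu>s k)"
  shows "W1_continuous S \<nu>" "(\<lambda>s. (\<alpha> s, \<beta> s)) \<in> Linf S"
    and "\<lbrakk>0 < e; finite H; H \<subseteq> L1 S\<rbrakk> \<Longrightarrow> \<exists>\<^sub>F k in sequentially. (\<forall>s\<in>{0..S}. W1 (\<nu>s k s) (\<nu> s) < e) \<and>
      (\<forall>h\<in>H. \<bar>(LINT s:{0..S}|lborel. (\<alpha>s k s, \<beta>s k s) \<bullet> h s) - (LINT s:{0..S}|lborel. (\<alpha> s, \<beta> s) \<bullet> h s)\<bar> < e)"
proof -
  let ?m = "C0_metric S W1_metric :: (real \<Rightarrow> (real ^ 'n) measure) metric"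
  let ?X = "mtopology_of ?m" and ?Y = "weak_star_topology S :: (real \<Rightarrow> real \<times> (real ^ 'm)) topology"
  let ?\<gamma> = "\<lambda>s. (\<alpha> s, \<beta> s)" and ?\<nu> = "restrict \<nu> {0..S}"
  have top: "?\<nu> \<in> mspace ?m" "?\<gamma> \<in> Linf S"
    using cl by (auto simp: process_cluster_point_def cluster_point_def topspace_weak_star_topology)
  show w: "W1_continuous S \<nu>" using top(1) C0_W1_iff[OF S] by blast
  show "?\<gamma> \<in> Linf S" by (rule top(2))
  assume e: "0 < e" and H: "finite H" "H \<subseteq> L1 S"
  define I where "I = (\<lambda>\<gamma>. \<lambda>h\<in>L1 S. LINT s:{0..S}|lborel. (\<gamma> s :: real \<times> (real ^ 'm)) \<bullet> h s)"
  \<comment> \<open>In the product topology only finitely many coordinates, here those in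
    \<open>H\<close>, may be constrained.\<close>
  define D where "D h = (if h \<in> H then ball (I ?\<gamma> h) e else UNIV)" for h
  define V where "V = I -` (PiE (L1 S) D) \<inter> Linf S"
  have "openin (powertop_real (L1 S)) (PiE (L1 S) D)"
    unfolding openin_PiE_gen
  proof (rule disjI2, intro conjI ballI)
    have "{i \<in> L1 S. D i \<noteq> topspace euclidean} \<subseteq> H" by (auto simp: D_def)
    then show "finite {i \<in> L1 S. D i \<noteq> topspace euclidean}" using H(1) finite_subset by blast
    show "openin euclidean (D i)" for i by (simp add: D_def)
  qed
  then have V: "openin ?Y V"
    unfolding weak_star_topology_def openin_pullback_topology V_def I_def by blast
  have "mdist ?m ?\<nu> ?\<nu> = 0" using top(1) by simp
  with e have self: "mdist ?m ?\<nu> ?\<nu> < e" by (simp only:)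
  have "openin (prod_topology ?X ?Y) (mball_of ?m ?\<nu> e \<times> V)"
    using openin_mball_of[of ?m ?\<nu> e] V by (simp add: openin_prod_Times_iff)
  moreover have "(?\<nu>, ?\<gamma>) \<in> mball_of ?m ?\<nu> e \<times> V"
    using top self e by (auto simp: V_def D_def I_def PiE_iff)
  ultimately have "\<exists>\<^sub>F k in sequentially. (restrict (\<nu>s k) {0..S}, \<lambda>s. (\<alpha>s k s, \<beta>s k s)) \<in> mball_of ?m ?\<nu> e \<times> V"
    using cl unfolding process_cluster_point_def cluster_point_def by blast
  then show "\<exists>\<^sub>F k in sequentially. (\<forall>s\<in>{0..S}. W1 (\<nu>s k s) (\<nu> s) < e) \<and>
      (\<forall>h\<in>H. \<bar>(LINT s:{0..S}|lborel. (\<alpha>s k s, \<beta>s k s) \<bullet> h s) - (LINT s:{0..S}|lborel. (\<alpha> s, \<beta> s) \<bullet> h s)\<bar> < e)"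
  proof (rule frequently_elim1)
    fix k assume k: "(restrict (\<nu>s k) {0..S}, \<lambda>s. (\<alpha>s k s, \<beta>s k s)) \<in> mball_of ?m ?\<nu> e \<times> V"
    have "W1 (\<nu>s k s) (\<nu> s) < e" if "s \<in> {0..S}" for s
      using C0_W1_dist_le[OF S w cont that, of k] k W1_commute[of "\<nu> s" "\<nu>s k s"] by simp
    moreover have "\<bar>(LINT s:{0..S}|lborel. (\<alpha>s k s, \<beta>s k s) \<bullet> h s) - (LINT s:{0..S}|lborel. ?\<gamma> s \<bullet> h s)\<bar> < e" if h: "h \<in> H" for h
    proof -
      have hL: "h \<in> L1 S" using h H by blast
      have "I (\<lambda>s. (\<alpha>s k s, \<beta>s k s)) h \<in> D h" using k hL unfolding V_def PiE_iff by blast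
      then show ?thesis using h hL by (simp add: D_def I_def dist_real_def abs_minus_commute)
    qed
    ultimately show "(\<forall>s\<in>{0..S}. W1 (\<nu>s k s) (\<nu> s) < e) \<and>
      (\<forall>h\<in>H. \<bar>(LINT s:{0..S}|lborel. (\<alpha>s k s, \<beta>s k s) \<bullet> h s) - (LINT s:{0..S}|lborel. (\<alpha> s, \<beta> s) \<bullet> h s)\<bar> < e)"
      by blast
  qed
qed

lemma W1_uniform_limit_continuous:
  assumes cont: "\<And>k. W1_continuous S (\<nu>s k)" and w: "\<And>s. s \<in> {0..S} \<Longrightarrow> \<nu> s \<in> P1"
    and conv: "\<And>e. 0 < e \<Longrightarrow> \<exists>k. \<forall>s\<in>{0..S}. W1 (\<nu>s k s) (\<nu> s) < e"
  shows "W1_continuous S \<nu>"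
  unfolding W1_continuous_def
proof (intro conjI ballI w)
  fix s assume s: "s \<in> {0..S}"
  have Pk: "\<nu>s k t \<in> P1" if "t \<in> {0..S}" for k t using cont that by (simp add: W1_continuous_def)
  show "((\<lambda>r. W1 (\<nu> r) (\<nu> s)) \<longlongrightarrow> 0) (at s within {0..S})"
  proof (rule tendstoI)
    fix e :: real assume e: "0 < e"
    obtain k where k: "\<forall>t\<in>{0..S}. W1 (\<nu>s k t) (\<nu> t) < e / 3"
      using conv[of "e / 3"] e by auto
    have "((\<lambda>r. W1 (\<nu>s k r) (\<nu>s k s)) \<longlongrightarrow> 0) (at s within {0..S})"
      using cont s by (simp add: W1_continuous_def)
    then have "\<forall>\<^sub>F r in at s within {0..S}. W1 (\<nu>s k r) (\<nu>s k s) < e / 3"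
      by (rule order_tendstoD) (use e in simp)
    then show "\<forall>\<^sub>F r in at s within {0..S}. dist (W1 (\<nu> r) (\<nu> s)) 0 < e"
      unfolding eventually_at_filter
    proof (rule eventually_mono, intro impI)
      fix t assume *: "t \<noteq> s \<longrightarrow> t \<in> {0..S} \<longrightarrow> W1 (\<nu>s k t) (\<nu>s k s) < e / 3" "t \<noteq> s" "t \<in> {0..S}"
      then have t: "t \<in> {0..S}" "W1 (\<nu>s k t) (\<nu>s k s) < e / 3" by auto
      have "W1 (\<nu> t) (\<nu> s) \<le> W1 (\<nu> t) (\<nu>s k t) + (W1 (\<nu>s k t) (\<nu>s k s) + W1 (\<nu>s k s) (\<nu> s))"
        using W1_triangle[OF w[OF t(1)] Pk[OF t(1), of k] w[OF s]] W1_triangle[OF Pk[OF t(1), of k] Pk[OF s, of k] w[OF s]] by linarith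
      moreover have "W1 (\<nu> t) (\<nu>s k t) < e / 3" "W1 (\<nu>s k s) (\<nu> s) < e / 3"
        using k s t(1) W1_commute[of "\<nu> t" "\<nu>s k t"] by auto
      ultimately show "dist (W1 (\<nu> t) (\<nu> s)) 0 < e"
        using t(2) W1_nonneg[OF w[OF t(1)] w[OF s]] by simp
    qed
  qed
qed

lemma process_cluster_pointI:
  fixes \<nu>s :: "nat \<Rightarrow> real \<Rightarrow> (real ^ 'n::finite) measure" and \<beta>s :: "nat \<Rightarrow> real \<Rightarrow> real ^ 'm::finite"
  assumes S: "0 \<le> S" and r: "strict_mono (r :: nat \<Rightarrow> nat)"
    and cont: "\<And>k. W1_continuous S (\<nu>s k)" and w: "\<And>s. s \<in> {0..S} \<Longrightarrow> \<nu> s \<in> P1"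
    and conv: "\<And>e. 0 < e \<Longrightarrow> \<forall>\<^sub>F k in sequentially. \<forall>s\<in>{0..S}. W1 (\<nu>s (r k) s) (\<nu> s) < e"
    and L: "\<And>k. (\<lambda>s. (\<alpha>s k s, \<beta>s k s)) \<in> Linf S" "(\<lambda>s. (\<alpha> s, \<beta> s)) \<in> Linf S"
    and lim: "\<And>h. h \<in> L1 S \<Longrightarrow> (\<lambda>k. LINT s:{0..S}|lborel. (\<alpha>s (r k) s, \<beta>s (r k) s) \<bullet> h s) \<longlonglongrightarrow> (LINT s:{0..S}|lborel. (\<alpha> s, \<beta> s) \<bullet> h s)"
  shows "process_cluster_point S \<nu>s \<alpha>s \<beta>s \<nu> \<alpha> \<beta>"
proof -
  let ?m = "C0_metric S W1_metric :: (real \<Rightarrow> (real ^ 'n) measure) metric"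
  let ?X = "mtopology_of ?m" and ?Y = "weak_star_topology S :: (real \<Rightarrow> real \<times> (real ^ 'm)) topology"
  let ?\<gamma> = "\<lambda>s. (\<alpha> s, \<beta> s)" and ?\<nu> = "restrict \<nu> {0..S}"
  let ?x = "\<lambda>k. (restrict (\<nu>s k) {0..S}, \<lambda>s. (\<alpha>s k s, \<beta>s k s))"
  have wc: "W1_continuous S \<nu>"
  proof (rule W1_uniform_limit_continuous[OF cont w])
    show "\<exists>k. \<forall>s\<in>{0..S}. W1 (\<nu>s k s) (\<nu> s) < e" if "0 < e" for e
      using conv[OF that] by (auto simp: eventually_sequentially)
  qed
  have mk: "restrict (\<nu>s k) {0..S} \<in> mspace ?m" "?\<nu> \<in> mspace ?m" for k
    using cont wc by (simp_all only: C0_W1_iff[OF S])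
  have "limitin ?X (\<lambda>k. restrict (\<nu>s (r k)) {0..S}) ?\<nu> sequentially"
    unfolding limitin_mtopology_of
  proof (intro conjI allI impI mk)
    fix e :: real assume e: "0 < e"
    then have "\<forall>\<^sub>F k in sequentially. \<forall>s\<in>{0..S}. W1 (\<nu>s (r k) s) (\<nu> s) < e / 2" by (intro conv) simp
    then show "\<forall>\<^sub>F k in sequentially. restrict (\<nu>s (r k)) {0..S} \<in> mspace ?m \<and> mdist ?m (restrict (\<nu>s (r k)) {0..S}) ?\<nu> < e"
    proof eventually_elim
      case (elim k)
      then have "mdist ?m (restrict (\<nu>s (r k)) {0..S}) ?\<nu> \<le> e / 2"
        by (intro C0_W1_dist_bound[OF S cont wc]) (simp add: less_imp_le)
      then show ?case using e mk by simp
    qed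
  qed
  moreover have "limitin ?Y (\<lambda>k. \<lambda>s. (\<alpha>s (r k) s, \<beta>s (r k) s)) ?\<gamma> sequentially"
    unfolding limitin_def
  proof (intro conjI allI impI)
    show "?\<gamma> \<in> topspace ?Y" using L by (simp add: topspace_weak_star_topology)
    define I where "I = (\<lambda>\<gamma>. \<lambda>h\<in>L1 S. LINT s:{0..S}|lborel. (\<gamma> s :: real \<times> (real ^ 'm)) \<bullet> h s)"
    fix U assume "openin ?Y U \<and> ?\<gamma> \<in> U"
    then obtain W where W: "openin (powertop_real (L1 S)) W" "U = I -` W \<inter> Linf S" "I ?\<gamma> \<in> W"
      unfolding weak_star_topology_def openin_pullback_topology I_def by auto
    have "limitin (powertop_real (L1 S)) (\<lambda>k. I (\<lambda>s. (\<alpha>s (r k) s, \<beta>s (r k) s))) (I ?\<gamma>) sequentially"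
      unfolding limitin_componentwise
      using lim by (auto simp: I_def)
    then have "\<forall>\<^sub>F k in sequentially. I (\<lambda>s. (\<alpha>s (r k) s, \<beta>s (r k) s)) \<in> W"
      using W unfolding limitin_def by blast
    then show "\<forall>\<^sub>F k in sequentially. (\<lambda>s. (\<alpha>s (r k) s, \<beta>s (r k) s)) \<in> U"
      by eventually_elim (use W(2) L(1) in auto)
  qed
  ultimately have lim: "limitin (prod_topology ?X ?Y) (\<lambda>k. ?x (r k)) (?\<nu>, ?\<gamma>) sequentially"
    by (simp add: limitin_pairwise o_def)
  show ?thesis
    unfolding process_cluster_point_def cluster_point_def
  proof (intro conjI allI impI)
    show "(?\<nu>, ?\<gamma>) \<in> topspace (prod_topology ?X ?Y)" using lim by (rule limitin_topspace)
    fix U assume "openin (prod_topology ?X ?Y) U \<and> (?\<nu>, ?\<gamma>) \<in> U"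
    then have "\<forall>\<^sub>F k in sequentially. ?x (r k) \<in> U" using lim unfolding limitin_def by blast
    then obtain N where N: "\<And>k. N \<le> k \<Longrightarrow> ?x (r k) \<in> U" by (auto simp: eventually_sequentially)
    show "\<exists>\<^sub>F k in sequentially. ?x k \<in> U"
      unfolding frequently_sequentially
    proof
      fix n
      have "n \<le> r (max N n)" using seq_suble[OF r, of "max N n"] by simp
      then show "\<exists>k\<ge>n. ?x k \<in> U" using N[of "max N n"] by auto
    qed
  qed
qed

section \<open>Cluster points are processes\<close>

lemma Linf_measurable: "\<gamma> \<in> Linf S \<Longrightarrow> set_borel_measurable borel {0..S} \<gamma>"
  by (simp add: Linf_def)

lemma Linf_integrable: "\<gamma> \<in> Linf S \<Longrightarrow> set_integrable lborel {0..S} \<gamma>"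
  using set_integrable_bounded by (auto simp: Linf_def)

text \<open>The test is \<open>d\<close> on the set \<open>E\<close> where the bound fails. There
  the integrals of the approximants are at most the integral of \<open>K\<close>, so the limit
  cannot exceed \<open>K\<close> on a set of positive measure.\<close>

lemma weak_star_halfspace:
  fixes \<gamma>s :: "nat \<Rightarrow> real \<Rightarrow> 'a::euclidean_space"
  assumes g: "\<gamma> \<in> Linf S" "\<And>k. \<gamma>s k \<in> Linf S" and le: "\<And>k s. s \<in> {0..S} \<Longrightarrow> \<gamma>s k s \<bullet> d \<le> K"
    and close: "\<And>e h. 0 < e \<Longrightarrow> h \<in> L1 S \<Longrightarrow> \<exists>k. \<bar>(LINT s:{0..S}|lborel. \<gamma>s k s \<bullet> h s) - (LINT s:{0..S}|lborel. \<gamma> s \<bullet> h s)\<bar> < e"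
  shows "AE s in lborel. s \<in> {0..S} \<longrightarrow> \<gamma> s \<bullet> d \<le> K"
proof -
  \<comment> \<open>The indicator inside makes \<open>E\<close> Borel, since \<open>\<gamma>\<close>
    is measurable only on \<open>{0..S}\<close>.\<close>
  define E where "E = {0..S} \<inter> {s. K < (indicator {0..S} s *\<^sub>R \<gamma> s) \<bullet> d}"
  have gm: "(\<lambda>s. (indicator {0..S} s *\<^sub>R \<gamma> s) \<bullet> d) \<in> borel_measurable borel"
    using Linf_measurable[OF g(1)] unfolding set_borel_measurable_def by (rule borel_measurable_inner) simp
  have E: "E \<in> sets borel"
    unfolding E_def using gm by measurable
  have EK: "s \<in> E \<Longrightarrow> s \<in> {0..S} \<and> K < \<gamma> s \<bullet> d" for s by (auto simp: E_def)
  have finE: "emeasure lborel E < \<infinity>"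
    using emeasure_mono[of E "{0..S}" lborel] by (auto simp: E_def emeasure_lborel_Icc_eq le_less_trans)
  define h where "h s = indicator E s *\<^sub>R d" for s
  have h: "h \<in> L1 S"
  proof -
    have "(\<lambda>s. indicator {0..S} s *\<^sub>R h s) = (\<lambda>s. indicator E s *\<^sub>R d)"
      by (auto simp: h_def E_def indicator_def fun_eq_iff)
    moreover have "integrable lborel (\<lambda>s. indicator E s *\<^sub>R d)"
      by (rule integrable_scaleR_left, rule integrable_real_indicator) (use E finE in auto)
    ultimately show ?thesis by (simp add: L1_def set_integrable_def)
  qed
  have eq: "(LINT s:{0..S}|lborel. \<delta> s \<bullet> h s) = (LINT s|lborel. indicator E s * (\<delta> s \<bullet> d))" for \<delta>
    unfolding set_lebesgue_integral_def
    by (intro Bochner_Integration.integral_cong) (auto simp: h_def E_def indicator_def)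
  have int: "integrable lborel (\<lambda>s. indicator E s * (\<delta> s \<bullet> d))" if "\<delta> \<in> Linf S" for \<delta>
  proof -
    have "set_integrable lborel E \<delta>"
      by (rule set_integrable_subset[OF Linf_integrable[OF that]]) (use E in \<open>auto simp: E_def\<close>)
    from integrable_inner_left[OF this[unfolded set_integrable_def], of d] show ?thesis by simp
  qed
  have i1: "integrable lborel (\<lambda>s. indicator E s * K)" by (rule integrable_mult_left, rule integrable_real_indicator) (use E finE in auto)
  have up: "(LINT s|lborel. indicator E s * (\<gamma>s k s \<bullet> d)) \<le> (LINT s|lborel. indicator E s * K)" for k
    by (rule integral_mono[OF int[OF g(2)] i1]) (use le EK in \<open>auto simp: indicator_def\<close>)
  have "(LINT s|lborel. indicator E s * (\<gamma> s \<bullet> d)) \<le> (LINT s|lborel. indicator E s * K) + e" if "0 < e" for e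
    using close[OF that h] up unfolding eq by (smt (verit))
  then have "(LINT s|lborel. indicator E s * (\<gamma> s \<bullet> d)) \<le> (LINT s|lborel. indicator E s * K)"
    by (rule field_le_epsilon)
  then have le0: "(LINT s|lborel. indicator E s * (\<gamma> s \<bullet> d) - indicator E s * K) \<le> 0"
    using int[OF g(1)] i1 by simp
  have nn: "0 \<le> indicator E s * (\<gamma> s \<bullet> d) - indicator E s * K" for s
    using EK[of s] by (auto simp: indicator_def)
  have "0 \<le> (LINT s|lborel. indicator E s * (\<gamma> s \<bullet> d) - indicator E s * K)"
    by (rule Bochner_Integration.integral_nonneg[OF nn])
  with le0 have "(LINT s|lborel. indicator E s * (\<gamma> s \<bullet> d) - indicator E s * K) = 0" by simp
  then have "AE s in lborel. indicator E s * (\<gamma> s \<bullet> d) - indicator E s * K = 0"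
    using integral_nonneg_eq_0_iff_AE[OF Bochner_Integration.integrable_diff[OF int[OF g(1)] i1]] nn by auto
  then show ?thesis
  proof eventually_elim
    case (elim s)
    then have "s \<notin> E" using EK[of s] by (auto simp: indicator_def)
    then show ?case by (auto simp: E_def)
  qed
qed

text \<open>The set of admissible control values is a polytope: the Manhattan norm is the maximum of
  the inner products with sign vectors, so finitely many half-spaces suffice and
  \<open>weak_star_halfspace\<close> applies to each.\<close>

lemma controls_halfspaces:
  fixes b :: "real ^ 'm::finite"
  assumes "- a \<le> 0" "\<And>\<sigma> :: 'm \<Rightarrow> bool. a + b \<bullet> vec_lambda (\<lambda>i. if \<sigma> i then 1 else - 1) \<le> 1"
  shows "0 \<le> a \<and> a + norm1 b \<le> 1"
proof -
  have "norm1 b = b \<bullet> vec_lambda (\<lambda>i. if 0 \<le> b $ i then 1 else - 1)"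
    unfolding norm1_def inner_vec_def by (intro sum.cong) auto
  then show ?thesis using assms(1) assms(2)[of "\<lambda>i. 0 \<le> b $ i"] by simp
qed

section \<open>Test functions depending on time\<close>

context drift
begin

context
  fixes \<Phi> :: "real \<times> (real ^ 'n) \<Rightarrow> real" and l K :: real
  assumes \<Phi>: "bump_class l K \<Phi>" and lK: "0 \<le> l" "0 \<le> K"
begin

text \<open>The counterpart of \<open>pairing\<close> on space-time: a cluster point has to satisfy
  the weak formulation itself. The weight \<open>p\<close> of the time derivative is 1 in the
  equation and 0 in the parts that the controls multiply.\<close>

definition pairing_time :: "real \<Rightarrow> real \<Rightarrow> real ^ 'm \<Rightarrow> (real ^ 'n) measure \<Rightarrow> real \<Rightarrow> real" where
  "pairing_time p a b \<mu> s = (LINT x|\<mu>. frechet_derivative \<Phi> (at (s, x)) (p, velocity a b \<mu> x))"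

lemma \<Phi>_linear: "linear (frechet_derivative \<Phi> (at z))"
  using bump_classD(5)[OF \<Phi>] has_derivative_linear by blast

lemma time_field_lipschitz:
  assumes "\<mu> \<in> P1"
  shows "\<bar>frechet_derivative \<Phi> (at (s, x)) (p, velocity a b \<mu> x) - frechet_derivative \<Phi> (at (t, y)) (p, velocity a b \<mu> y)\<bar>
    \<le> (K + l) * (\<bar>p\<bar> + 2 * c * csize a b) * (\<bar>s - t\<bar> + norm (x - y))"
proof -
  let ?v = "velocity a b \<mu>" and ?D = "\<lambda>z. frechet_derivative \<Phi> (at z)"
  have k: "0 \<le> 2 * c * csize a b" using c_pos csize_nonneg[of a b] by simp
  have n1: "norm ((s, x) - (t, y)) \<le> \<bar>s - t\<bar> + norm (x - y)"
    using norm_Pair_le[of "s - t" "x - y"] by simp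
  have n2: "norm (p, ?v x) \<le> \<bar>p\<bar> + 2 * c * csize a b"
    using norm_Pair_le[of p "?v x"] velocity_bounded[OF assms, of a b x] by simp
  have n3: "norm ((0::real), ?v x - ?v y) \<le> 2 * c * csize a b * norm (x - y)"
    using norm_Pair_le[of "0::real" "?v x - ?v y"] velocity_lipschitz[OF assms, of a b x y] by simp
  have e: "?D (t, y) (p, ?v x) - ?D (t, y) (p, ?v y) = ?D (t, y) (0, ?v x - ?v y)"
    using linear_diff[OF \<Phi>_linear, of "(t, y)" "(p, ?v x)" "(p, ?v y)"] by simp
  have "\<bar>?D (s, x) (p, ?v x) - ?D (t, y) (p, ?v y)\<bar> \<le> \<bar>?D (s, x) (p, ?v x) - ?D (t, y) (p, ?v x)\<bar> + \<bar>?D (t, y) (0, ?v x - ?v y)\<bar>"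
    unfolding e[symmetric] by linarith
  also have "\<dots> \<le> K * norm ((s, x) - (t, y)) * norm (p, ?v x) + l * norm ((0::real), ?v x - ?v y)"
    by (intro add_mono bump_classD(3,4)[OF \<Phi>])
  also have "\<dots> \<le> K * (\<bar>s - t\<bar> + norm (x - y)) * (\<bar>p\<bar> + 2 * c * csize a b) + l * (2 * c * csize a b * norm (x - y))"
    using lK by (intro add_mono mult_mono mult_left_mono n1 n2 n3) auto
  also have "l * (2 * c * csize a b * norm (x - y)) \<le> l * ((\<bar>p\<bar> + 2 * c * csize a b) * (\<bar>s - t\<bar> + norm (x - y)))"
    using lK k by (intro mult_left_mono mult_mono) auto
  finally show ?thesis by (simp add: algebra_simps)
qed

lemma time_field_bounded:
  assumes "\<mu> \<in> P1"
  shows "\<bar>frechet_derivative \<Phi> (at (s, x)) (p, velocity a b \<mu> x)\<bar> \<le> l * (\<bar>p\<bar> + 2 * c * csize a b)"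
proof -
  have "norm (p, velocity a b \<mu> x) \<le> \<bar>p\<bar> + 2 * c * csize a b"
    using norm_Pair_le[of p "velocity a b \<mu> x"] velocity_bounded[OF assms, of a b x] by simp
  then show ?thesis using bump_classD(3)[OF \<Phi>, of "(s, x)" "(p, velocity a b \<mu> x)"] mult_left_mono[OF _ lK(1)] order_trans by blast
qed

lemma time_field_integrable:
  assumes "\<mu> \<in> P1" "\<nu> \<in> P1"
  shows "integrable \<nu> (\<lambda>x. frechet_derivative \<Phi> (at (s, x)) (p, velocity a b \<mu> x))"
proof (rule P1_integrable_bounded[OF assms(2)])
  show "(\<lambda>x. frechet_derivative \<Phi> (at (s, x)) (p, velocity a b \<mu> x)) \<in> borel_measurable borel"
    by (rule lipschitz_measurable[of _ "(K + l) * (\<bar>p\<bar> + 2 * c * csize a b)"])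
       (use time_field_lipschitz[OF assms(1), of s _ p a b s] in simp)
  show "norm (frechet_derivative \<Phi> (at (s, x)) (p, velocity a b \<mu> x)) \<le> l * (\<bar>p\<bar> + 2 * c * csize a b)" for x
    using time_field_bounded[OF assms(1)] by simp
qed

lemma pairing_time_diff:
  assumes \<mu>: "\<mu> \<in> P1" "\<nu> \<in> P1"
  shows "\<bar>pairing_time p a b \<mu> s - pairing_time p a b \<nu> t\<bar>
    \<le> ((K + l) * (\<bar>p\<bar> + 2 * c * csize a b) + l * (\<bar>a\<bar> * (real CARD('n) * c))) * (\<bar>s - t\<bar> + W1 \<mu> \<nu>)"
proof -
  let ?D = "\<lambda>z. frechet_derivative \<Phi> (at z)" and ?C = "(K + l) * (\<bar>p\<bar> + 2 * c * csize a b)"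
  let ?F = "\<lambda>s \<mu> \<nu>. LINT x|\<nu>. ?D (s, x) (p, velocity a b \<mu> x)"
  have C: "0 \<le> ?C" using lK c_pos csize_nonneg[of a b] by simp
  have 1: "\<bar>?F s \<mu> \<mu> - ?F s \<mu> \<nu>\<bar> \<le> ?C * W1 \<mu> \<nu>"
    by (rule lipschitz_integral[OF \<mu> C]) (use time_field_lipschitz[OF \<mu>(1), of s _ p a b s] in simp)
  have 2: "\<bar>?F s \<mu> \<nu> - ?F t \<mu> \<nu>\<bar> \<le> ?C * \<bar>s - t\<bar>"
  proof -
    have "?F s \<mu> \<nu> - ?F t \<mu> \<nu> = (LINT x|\<nu>. ?D (s, x) (p, velocity a b \<mu> x) - ?D (t, x) (p, velocity a b \<mu> x))"
      by (rule Bochner_Integration.integral_diff[symmetric]; rule time_field_integrable[OF \<mu>])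
    moreover have "norm (LINT x|\<nu>. ?D (s, x) (p, velocity a b \<mu> x) - ?D (t, x) (p, velocity a b \<mu> x)) \<le> ?C * \<bar>s - t\<bar>"
    proof (rule P1_integral_bounded[OF \<mu>(2)])
      show "norm (?D (s, x) (p, velocity a b \<mu> x) - ?D (t, x) (p, velocity a b \<mu> x)) \<le> ?C * \<bar>s - t\<bar>" for x
        using time_field_lipschitz[OF \<mu>(1), of s x p a b t x] by simp
    qed
    ultimately show ?thesis by simp
  qed
  have 3: "\<bar>?F t \<mu> \<nu> - ?F t \<nu> \<nu>\<bar> \<le> l * (\<bar>a\<bar> * (real CARD('n) * c * W1 \<mu> \<nu>))"
  proof -
    have "?F t \<mu> \<nu> - ?F t \<nu> \<nu> = (LINT x|\<nu>. ?D (t, x) (p, velocity a b \<mu> x) - ?D (t, x) (p, velocity a b \<nu> x))"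
      by (rule Bochner_Integration.integral_diff[symmetric]; rule time_field_integrable; rule \<mu>)
    moreover have "norm (LINT x|\<nu>. ?D (t, x) (p, velocity a b \<mu> x) - ?D (t, x) (p, velocity a b \<nu> x)) \<le> l * (\<bar>a\<bar> * (real CARD('n) * c * W1 \<mu> \<nu>))"
    proof (rule P1_integral_bounded[OF \<mu>(2)])
      fix x
      let ?d = "velocity a b \<mu> x - velocity a b \<nu> x"
      have "?D (t, x) (p, velocity a b \<mu> x) - ?D (t, x) (p, velocity a b \<nu> x) = ?D (t, x) (0, ?d)"
        using linear_diff[OF \<Phi>_linear, of "(t, x)" "(p, velocity a b \<mu> x)" "(p, velocity a b \<nu> x)"] by simp
      moreover have "\<bar>?D (t, x) (0, ?d)\<bar> \<le> l * norm ?d"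
        using bump_classD(3)[OF \<Phi>, of "(t, x)" "(0, ?d)"] by simp
      moreover have "l * norm ?d \<le> l * (\<bar>a\<bar> * (real CARD('n) * c * W1 \<mu> \<nu>))"
        by (rule mult_left_mono[OF velocity_diff[OF \<mu>] lK(1)])
      ultimately show "norm (?D (t, x) (p, velocity a b \<mu> x) - ?D (t, x) (p, velocity a b \<nu> x)) \<le> l * (\<bar>a\<bar> * (real CARD('n) * c * W1 \<mu> \<nu>))"
        by simp
    qed
    ultimately show ?thesis by simp
  qed
  have "l * (\<bar>a\<bar> * (real CARD('n) * c * W1 \<mu> \<nu>)) \<le> l * (\<bar>a\<bar> * (real CARD('n) * c)) * (\<bar>s - t\<bar> + W1 \<mu> \<nu>)"
    using lK c_pos by (simp add: distrib_left mult.assoc)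
  then have "\<bar>?F s \<mu> \<mu> - ?F t \<nu> \<nu>\<bar> \<le> ?C * W1 \<mu> \<nu> + ?C * \<bar>s - t\<bar> + l * (\<bar>a\<bar> * (real CARD('n) * c)) * (\<bar>s - t\<bar> + W1 \<mu> \<nu>)"
    using 1 2 3 by linarith
  then show ?thesis by (simp add: pairing_time_def algebra_simps)
qed

lemma pairing_time_continuous:
  assumes "W1_continuous S \<nu>"
  shows "continuous_on {0..S} (\<lambda>s. pairing_time p a b (\<nu> s) s)"
  unfolding continuous_on_def
proof
  let ?C = "(K + l) * (\<bar>p\<bar> + 2 * c * csize a b) + l * (\<bar>a\<bar> * (real CARD('n) * c))"
  have P: "\<nu> r \<in> P1" if "r \<in> {0..S}" for r using assms(1) that by (simp add: W1_continuous_def)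
  fix s assume s: "s \<in> {0..S}"
  have "((\<lambda>r. ?C * (\<bar>r - s\<bar> + W1 (\<nu> r) (\<nu> s))) \<longlongrightarrow> ?C * (\<bar>s - s\<bar> + 0)) (at s within {0..S})"
    using assms(1) s by (intro tendsto_intros) (simp add: W1_continuous_def)
  then have lim: "((\<lambda>r. ?C * (\<bar>r - s\<bar> + W1 (\<nu> r) (\<nu> s))) \<longlongrightarrow> 0) (at s within {0..S})" by simp
  have "((\<lambda>r. pairing_time p a b (\<nu> r) r - pairing_time p a b (\<nu> s) s) \<longlongrightarrow> 0) (at s within {0..S})"
  proof (rule Lim_null_comparison[OF _ lim])
    show "\<forall>\<^sub>F r in at s within {0..S}. norm (pairing_time p a b (\<nu> r) r - pairing_time p a b (\<nu> s) s) \<le> ?C * (\<bar>r - s\<bar> + W1 (\<nu> r) (\<nu> s))"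
      unfolding eventually_at_filter
      by (rule always_eventually) (use pairing_time_diff P s in simp)
  qed
  then show "((\<lambda>r. pairing_time p a b (\<nu> r) r) \<longlongrightarrow> pairing_time p a b (\<nu> s) s) (at s within {0..S})"
    by (simp add: LIM_zero_iff)
qed

lemma pairing_time_expand:
  assumes \<mu>: "\<mu> \<in> P1"
  shows "pairing_time p a b \<mu> s = p * pairing_time 1 0 0 \<mu> s +
    (a * pairing_time 0 1 0 \<mu> s + (\<Sum>i\<in>UNIV. b $ i * pairing_time 0 0 (axis i 1) \<mu> s))"
proof -
  let ?D = "\<lambda>z. frechet_derivative \<Phi> (at z)"
  have v0: "velocity 0 0 \<mu> x = 0" for x by (simp add: velocity_def)
  have "?D (s, x) (p, velocity a b \<mu> x) = p * ?D (s, x) (1, velocity 0 0 \<mu> x) +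
      (a * ?D (s, x) (0, velocity 1 0 \<mu> x) + (\<Sum>i\<in>UNIV. b $ i * ?D (s, x) (0, velocity 0 (axis i 1) \<mu> x)))" for x
  proof -
    have "(p, velocity a b \<mu> x) = p *\<^sub>R (1, 0) + (a *\<^sub>R (0, velocity 1 0 \<mu> x) + (\<Sum>i\<in>UNIV. b $ i *\<^sub>R (0, velocity 0 (axis i 1) \<mu> x)))"
      by (subst velocity_expand) (simp add: prod_eq_iff fst_sum snd_sum)
    then have "?D (s, x) (p, velocity a b \<mu> x) = ?D (s, x) (p *\<^sub>R (1, 0) + (a *\<^sub>R (0, velocity 1 0 \<mu> x) + (\<Sum>i\<in>UNIV. b $ i *\<^sub>R (0, velocity 0 (axis i 1) \<mu> x))))"
      by (simp only:)
    then show ?thesis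
      by (simp only: linear_add[OF \<Phi>_linear] linear_scale[OF \<Phi>_linear] linear_sum[OF \<Phi>_linear] v0 real_scaleR_def)
  qed
  then show ?thesis
    unfolding pairing_time_def using time_field_integrable[OF \<mu> \<mu>] by simp
qed

text \<open>The controls are isolated in an inner product with a function that depends only on the
  curve, so that for a fixed curve the equation amounts to a single weak-* test.\<close>

lemma pairing_time_set_integrable:
  assumes "coefficients S B a b" "W1_continuous S \<nu>"
  shows "set_integrable lborel {0..S} (\<lambda>s. pairing_time 1 (a s) (b s) (\<nu> s) s)"
    and "(LINT s:{0..S}|lborel. pairing_time 1 (a s) (b s) (\<nu> s) s) =
      (LINT s:{0..S}|lborel. pairing_time 1 0 0 (\<nu> s) s) +
      (LINT s:{0..S}|lborel. (a s, b s) \<bullet> (pairing_time 0 1 0 (\<nu> s) s, vec_lambda (\<lambda>i. pairing_time 0 0 (axis i 1) (\<nu> s) s)))"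
proof -
  have P: "\<nu> r \<in> P1" if "r \<in> {0..S}" for r using assms(2) that by (simp add: W1_continuous_def)
  note q = pairing_time_continuous[OF assms(2)]
  have i0: "set_integrable lborel {0..S} (\<lambda>s. pairing_time 1 0 0 (\<nu> s) s)"
    unfolding set_integrable_def by (rule borel_integrable_compact[OF compact_Icc q])
  have i1: "set_integrable lborel {0..S} (\<lambda>s. pairing_time 0 1 0 (\<nu> s) s *\<^sub>R a s)"
    by (rule set_integrable_mult_continuous[OF _ _ q]) (rule coefficientsD[OF assms(1)])+
  have i2: "set_integrable lborel {0..S} (\<lambda>s. pairing_time 0 0 (axis i 1) (\<nu> s) s *\<^sub>R b s $ i)" for i
    by (rule set_integrable_mult_continuous[OF _ _ q])
       (rule coefficientsD[OF assms(1)] set_borel_measurable_component)+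
  have "set_integrable lborel {0..S} (\<lambda>s. pairing_time 0 1 0 (\<nu> s) s *\<^sub>R a s + (\<Sum>i\<in>UNIV. pairing_time 0 0 (axis i 1) (\<nu> s) s *\<^sub>R b s $ i))"
    by (intro set_integral_add(1) set_integrable_sum i1 i2)
  then have i3: "set_integrable lborel {0..S} (\<lambda>s. (a s, b s) \<bullet> (pairing_time 0 1 0 (\<nu> s) s, vec_lambda (\<lambda>i. pairing_time 0 0 (axis i 1) (\<nu> s) s)))"
    by (simp add: inner_vec_def mult.commute)
  have eq: "\<forall>s. s \<in> {0..S} \<longrightarrow> pairing_time 1 (a s) (b s) (\<nu> s) s = pairing_time 1 0 0 (\<nu> s) s + (a s, b s) \<bullet> (pairing_time 0 1 0 (\<nu> s) s, vec_lambda (\<lambda>i. pairing_time 0 0 (axis i 1) (\<nu> s) s))"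
    using pairing_time_expand[OF P, of _ 1 "a s" "b s" for s] by (simp add: inner_vec_def)
  show "set_integrable lborel {0..S} (\<lambda>s. pairing_time 1 (a s) (b s) (\<nu> s) s)"
    by (rule set_integrable_cong[THEN iffD1, OF refl refl _ set_integral_add(1)[OF i0 i3]]) (use eq in simp)
  have "(LINT s:{0..S}|lborel. pairing_time 1 (a s) (b s) (\<nu> s) s) = (LINT s:{0..S}|lborel. pairing_time 1 0 0 (\<nu> s) s + (a s, b s) \<bullet> (pairing_time 0 1 0 (\<nu> s) s, vec_lambda (\<lambda>i. pairing_time 0 0 (axis i 1) (\<nu> s) s)))"
    by (rule set_lebesgue_integral_cong[OF _ eq]) simp
  then show "(LINT s:{0..S}|lborel. pairing_time 1 (a s) (b s) (\<nu> s) s) =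
      (LINT s:{0..S}|lborel. pairing_time 1 0 0 (\<nu> s) s) +
      (LINT s:{0..S}|lborel. (a s, b s) \<bullet> (pairing_time 0 1 0 (\<nu> s) s, vec_lambda (\<lambda>i. pairing_time 0 0 (axis i 1) (\<nu> s) s)))"
    using set_integral_add(2)[OF i0 i3] by simp
qed

end

end

section \<open>Closedness of the controls and of the equation under limits\<close>

lemma coefficients_Linf:
  assumes "coefficients S B a b"
  shows "(\<lambda>s. (a s, b s)) \<in> Linf S"
proof -
  have "(\<lambda>s. (indicator {0..S} s *\<^sub>R a s, indicator {0..S} s *\<^sub>R b s)) \<in> borel_measurable borel"
    by (rule borel_measurable_Pair[OF coefficientsD(1,2)[OF assms, unfolded set_borel_measurable_def]])
  moreover have "AE s in lborel. s \<in> {0..S} \<longrightarrow> norm (a s, b s) \<le> B + B"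
    using coefficientsD(5,6)[OF assms]
  proof eventually_elim
    case (elim s)
    then show ?case using norm_Pair_le[of "a s" "b s"] by auto
  qed
  ultimately show ?thesis unfolding Linf_def set_borel_measurable_def by auto
qed

lemma Linf_coefficients:
  fixes b :: "real \<Rightarrow> real ^ 'm::finite"
  assumes "(\<lambda>s. (a s, b s)) \<in> Linf S" and "AE s in lborel. s \<in> {0..S} \<longrightarrow> 0 \<le> a s \<and> a s + norm1 (b s) \<le> 1"
  shows "coefficients S 1 a b"
proof -
  have m: "(\<lambda>s. indicator {0..S} s *\<^sub>R (a s, b s)) \<in> borel_measurable borel"
    using Linf_measurable[OF assms(1)] by (simp add: set_borel_measurable_def)
  have "set_borel_measurable borel {0..S} a" "set_borel_measurable borel {0..S} b"
    using borel_measurable_continuous_on[OF continuous_on_fst[OF continuous_on_id] m]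
      borel_measurable_continuous_on[OF continuous_on_snd[OF continuous_on_id] m]
    by (simp_all add: set_borel_measurable_def)
  moreover have "AE s in lborel. s \<in> {0..S} \<longrightarrow> csize (a s) (b s) \<le> 1"
    using assms(2) by eventually_elim (auto simp: csize_def)
  ultimately show ?thesis by (simp add: coefficients_def)
qed

lemma weak_star_controls:
  fixes \<beta>s :: "nat \<Rightarrow> real \<Rightarrow> real ^ 'm::finite"
  assumes k: "\<And>k. (\<lambda>s. (\<alpha>s k s, \<beta>s k s)) \<in> Linf (T + M)"
      "\<And>k s. s \<in> {0..T + M} \<Longrightarrow> 0 \<le> \<alpha>s k s \<and> \<alpha>s k s + norm1 (\<beta>s k s) \<le> 1"
      "\<And>k. (LINT s:{0..T + M}|lborel. \<alpha>s k s) = T"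
    and g: "(\<lambda>s. (\<alpha> s, \<beta> s)) \<in> Linf (T + M)"
    and close: "\<And>e h. 0 < e \<Longrightarrow> h \<in> L1 (T + M) \<Longrightarrow> \<exists>k. \<bar>(LINT s:{0..T + M}|lborel. (\<alpha>s k s, \<beta>s k s) \<bullet> h s) - (LINT s:{0..T + M}|lborel. (\<alpha> s, \<beta> s) \<bullet> h s)\<bar> < e"
  shows "(\<alpha>, \<beta>) \<in> reduced_controls T M"
proof -
  have "AE s in lborel. s \<in> {0..T + M} \<longrightarrow> (\<alpha> s, \<beta> s) \<bullet> (- 1, 0) \<le> 0"
    by (rule weak_star_halfspace[OF g k(1) _ close]) (use k(2) in auto)
  moreover have "AE s in lborel. \<forall>\<sigma> :: 'm \<Rightarrow> bool. s \<in> {0..T + M} \<longrightarrow> (\<alpha> s, \<beta> s) \<bullet> (1, vec_lambda (\<lambda>i. if \<sigma> i then 1 else - 1)) \<le> 1"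
    unfolding AE_all_countable
  proof
    fix \<sigma> :: "'m \<Rightarrow> bool"
    show "AE s in lborel. s \<in> {0..T + M} \<longrightarrow> (\<alpha> s, \<beta> s) \<bullet> (1, vec_lambda (\<lambda>i. if \<sigma> i then 1 else - 1)) \<le> 1"
    proof (rule weak_star_halfspace[OF g k(1) _ close])
      fix k s assume s: "s \<in> {0..T + M}"
      have "\<beta>s k s \<bullet> vec_lambda (\<lambda>i. if \<sigma> i then 1 else - 1) \<le> norm1 (\<beta>s k s)"
        unfolding norm1_def inner_vec_def by (intro sum_mono) auto
      then show "(\<alpha>s k s, \<beta>s k s) \<bullet> (1, vec_lambda (\<lambda>i. if \<sigma> i then 1 else - 1)) \<le> 1"
        using k(2)[OF s, of k] by simp
    qed
  qed
  ultimately have AE: "AE s in lborel. s \<in> {0..T + M} \<longrightarrow> 0 \<le> \<alpha> s \<and> \<alpha> s + norm1 (\<beta> s) \<le> 1"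
  proof eventually_elim
    case (elim s)
    then show ?case using controls_halfspaces[of "\<alpha> s" "\<beta> s"] by auto
  qed
  \<comment> \<open>The constant test (1, 0) carries the integral constraint on
    \<open>\<alpha>\<close> to the limit.\<close>
  have h: "(\<lambda>_. (1, 0)) \<in> L1 (T + M)"
    unfolding L1_def mem_Collect_eq set_integrable_def by (rule borel_integrable_compact[OF compact_Icc]) (rule continuous_on_const)
  have "\<bar>T - (LINT s:{0..T + M}|lborel. \<alpha> s)\<bar> \<le> 0 + e" if "0 < e" for e
    using close[OF that h] k(3) by (auto simp: less_imp_le)
  then have "\<bar>T - (LINT s:{0..T + M}|lborel. \<alpha> s)\<bar> \<le> 0" by (rule field_le_epsilon)
  then show ?thesis using g AE by (simp add: reduced_controls_def)
qed

context drift
begin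

lemma limit_weak_solution:
  fixes \<nu>s :: "nat \<Rightarrow> real \<Rightarrow> (real ^ 'n) measure"
  assumes S: "0 < S" and co: "\<And>k. coefficients S 1 (\<alpha>s k) (\<beta>s k)" "coefficients S 1 \<alpha> \<beta>"
    and wk: "\<And>k. weak_solution S \<theta> (\<lambda>s. velocity (\<alpha>s k s) (\<beta>s k s) (\<nu>s k s)) (\<nu>s k)"
    and cont: "W1_continuous S \<nu>"
    and close: "\<And>e h. 0 < e \<Longrightarrow> h \<in> L1 S \<Longrightarrow> \<exists>k. (\<forall>s\<in>{0..S}. W1 (\<nu>s k s) (\<nu> s) < e) \<and>
      \<bar>(LINT s:{0..S}|lborel. (\<alpha>s k s, \<beta>s k s) \<bullet> h s) - (LINT s:{0..S}|lborel. (\<alpha> s, \<beta> s) \<bullet> h s)\<bar> < e"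
  shows "weak_solution S \<theta> (\<lambda>s. velocity (\<alpha> s) (\<beta> s) (\<nu> s)) \<nu>"
proof -
  have con: "controlled f0 g f c S 1 (\<alpha>s k) (\<beta>s k)" for k
    unfolding controlled_def controlled_axioms_def using drift_axioms co S by simp
  have sol: "solves S (\<alpha>s k) (\<beta>s k) (\<nu>s k)" for k by (rule weak_solution_solves[OF S co(1) wk])
  have contk: "W1_continuous S (\<nu>s k)" for k using sol by (simp add: solves_def)
  have Pk: "\<nu>s k s \<in> P1" if "s \<in> {0..S}" for k s using contk that by (simp add: W1_continuous_def)
  have P: "\<nu> s \<in> P1" if "s \<in> {0..S}" for s using cont that by (simp add: W1_continuous_def)
  \<comment> \<open>The zero test asks for nothing, which leaves only the uniform closeness of the
    curves.\<close>
  have zero: "(\<lambda>_. 0) \<in> L1 S" by (simp add: L1_def set_integrable_def)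
  define \<kappa> where "\<kappa> = 3 * real CARD('n) * (2 * c)"
  have \<kappa>: "W1 (\<nu>s k s) (\<nu>s k t) \<le> \<kappa> * \<bar>s - t\<bar>" if "s \<in> {0..S}" "t \<in> {0..S}" for k s t
    using controlled.solves_lipschitz[OF con sol that] by (simp add: \<kappa>_def controlled.speed_def[OF con])
  have lip: "W1 (\<nu> s) (\<nu> t) \<le> \<kappa> * \<bar>s - t\<bar>" if st: "s \<in> {0..S}" "t \<in> {0..S}" for s t
  proof (rule field_le_epsilon)
    fix e :: real assume "0 < e"
    then obtain k where k: "\<forall>s\<in>{0..S}. W1 (\<nu>s k s) (\<nu> s) < e / 2" using close[OF _ zero, of "e / 2"] by auto
    have "W1 (\<nu> s) (\<nu> t) \<le> W1 (\<nu> s) (\<nu>s k s) + W1 (\<nu>s k s) (\<nu> t)" by (rule W1_triangle) (use st P Pk in auto)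
    also have "W1 (\<nu>s k s) (\<nu> t) \<le> W1 (\<nu>s k s) (\<nu>s k t) + W1 (\<nu>s k t) (\<nu> t)" by (rule W1_triangle) (use st P Pk in auto)
    finally show "W1 (\<nu> s) (\<nu> t) \<le> \<kappa> * \<bar>s - t\<bar> + e"
      using k[rule_format, OF st(1)] k[rule_format, OF st(2)] \<kappa>[OF st, of k] W1_commute[of "\<nu> s" "\<nu>s k s"] by linarith
  qed
  have ac: "abs_cont_curve W1_metric S \<nu>"
    unfolding abs_cont_curve_def
  proof (intro conjI exI[of _ "\<lambda>_. \<kappa>"] allI impI)
    show "\<forall>t\<in>{0..S}. \<nu> t \<in> mspace W1_metric" using P by simp
    show "set_integrable lborel {0..S} (\<lambda>_. \<kappa>)"
      unfolding set_integrable_def by (rule borel_integrable_compact[OF compact_Icc]) (rule continuous_on_const)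
    fix s t assume st: "0 \<le> s \<and> s \<le> t \<and> t \<le> S"
    then have "mdist W1_metric (\<nu> s) (\<nu> t) = W1 (\<nu> s) (\<nu> t)" by (intro mdist_W1_metric P) auto
    moreover have "(LINT r:{s..t}|lborel. \<kappa>) = \<kappa> * \<bar>s - t\<bar>" using st by (simp add: set_integral_const)
    ultimately show "mdist W1_metric (\<nu> s) (\<nu> t) \<le> (LINT r:{s..t}|lborel. \<kappa>)" using lip[of s t] st by simp
  qed
  have init: "\<nu> 0 = \<theta>"
  proof -
    have \<theta>: "\<nu>s k 0 = \<theta>" for k using wk by (simp add: weak_solution_def)
    have "\<theta> \<in> P1" using Pk[of 0] S \<theta> by simp
    moreover have "\<nu> 0 \<in> P1" using P[of 0] S by simp
    moreover have "W1 (\<nu> 0) \<theta> \<le> 0 + e" if e: "0 < e" for e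
    proof -
      obtain k where "\<forall>s\<in>{0..S}. W1 (\<nu>s k s) (\<nu> s) < e" using close[OF e zero] by blast
      then have "W1 (\<nu>s k 0) (\<nu> 0) < e" using S by simp
      then show ?thesis using \<theta>[of k] W1_commute[of "\<nu> 0" \<theta>] by simp
    qed
    then have "W1 (\<nu> 0) \<theta> \<le> 0" by (rule field_le_epsilon)
    ultimately show ?thesis using W1_eq_0 W1_nonneg order_antisym by blast
  qed
  have "(LINT s:{0..S}|lborel. LINT x|\<nu> s. frechet_derivative \<Phi> (at (s, x)) (1, velocity (\<alpha> s) (\<beta> s) (\<nu> s) x)) = 0"
    if test: "\<Phi> \<in> test_functions S" for \<Phi>
  proof -
    have "bounded {z. \<Phi> z \<noteq> 0}"
      using test bounded_subset[OF compact_imp_bounded closure_subset] by (auto simp: test_functions_def)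
    moreover have "\<forall>k. C_k k \<Phi>" using test by (simp add: test_functions_def)
    ultimately obtain l K where lK: "0 \<le> l" "0 \<le> K" and \<Phi>: "bump_class l K \<Phi>" by (metis bump_classE)
    note facts = \<Phi> lK
    \<comment> \<open>A Lipschitz constant of \<open>pairing_time\<close> with respect to the
      measure, valid for all controls of size at most 1.\<close>
    define C where "C = (K + l) * (1 + 2 * c) + l * (real CARD('n) * c)"
    have C: "0 \<le> C" using lK c_pos by (simp add: C_def)
    define h where "h s = (pairing_time \<Phi> 0 1 0 (\<nu> s) s, vec_lambda (\<lambda>i. pairing_time \<Phi> 0 0 (axis i 1) (\<nu> s) s))" for s
    define A where "A = (LINT s:{0..S}|lborel. pairing_time \<Phi> 1 0 0 (\<nu> s) s)"
    define L where "L a b \<mu> = (LINT s:{0..S}|lborel. pairing_time \<Phi> 1 (a s) (b s) (\<mu> s) s)" for a b \<mu>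
    have "continuous_on {0..S} h"
      unfolding h_def by (intro continuous_on_Pair continuous_on_vec_lambda pairing_time_continuous[OF facts cont])
    then have h: "h \<in> L1 S"
      unfolding L1_def mem_Collect_eq set_integrable_def by (rule borel_integrable_compact[OF compact_Icc])
    have split: "L a b \<nu> = A + (LINT s:{0..S}|lborel. (a s, b s) \<bullet> h s)" if "coefficients S 1 a b" for a b
      unfolding L_def A_def h_def by (rule pairing_time_set_integrable(2)[OF facts that cont])
    have zero: "L (\<alpha>s k) (\<beta>s k) (\<nu>s k) = 0" for k
      using wk test unfolding L_def weak_solution_def pairing_time_def[OF facts] by blast
    \<comment> \<open>The curve is exchanged first, at the approximating controls and uniformly in
      them; what remains differs only by the weak-* test \<open>h\<close>, which belongs to the
      limit curve.\<close>
    have diff: "\<bar>L (\<alpha>s k) (\<beta>s k) (\<nu>s k) - L (\<alpha>s k) (\<beta>s k) \<nu>\<bar> \<le> S * (C * e)"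
      if e: "\<forall>s\<in>{0..S}. W1 (\<nu>s k s) (\<nu> s) < e" for k e
    proof -
      let ?d = "\<lambda>s. pairing_time \<Phi> 1 (\<alpha>s k s) (\<beta>s k s) (\<nu>s k s) s - pairing_time \<Phi> 1 (\<alpha>s k s) (\<beta>s k s) (\<nu> s) s"
      note int = pairing_time_set_integrable(1)[OF facts co(1) contk] pairing_time_set_integrable(1)[OF facts co(1) cont]
      have eq: "L (\<alpha>s k) (\<beta>s k) (\<nu>s k) - L (\<alpha>s k) (\<beta>s k) \<nu> = (LINT s:{0..S}|lborel. ?d s)"
        unfolding L_def by (rule set_integral_diff(2)[symmetric, OF int])
      have i1: "set_integrable lborel {0..S} ?d" by (rule set_integral_diff(1)[OF int])
      have i2: "set_integrable lborel {0..S} (\<lambda>_. C * e)"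
        unfolding set_integrable_def by (rule borel_integrable_compact[OF compact_Icc]) (rule continuous_on_const)
      have AE: "AE s in lborel. norm (indicator {0..S} s *\<^sub>R ?d s) \<le> indicator {0..S} s *\<^sub>R (C * e)"
        using coefficientsD(4)[OF co(1), of k]
      proof eventually_elim
        case (elim s)
        show ?case
        proof (cases "s \<in> {0..S}")
          case True
          let ?a = "\<alpha>s k s" and ?b = "\<beta>s k s"
          have sz: "\<bar>?a\<bar> \<le> 1" "csize ?a ?b \<le> 1" using elim True csize_def[of ?a ?b] norm1_nonneg[of ?b] by auto
          have W: "0 \<le> W1 (\<nu>s k s) (\<nu> s)" by (rule W1_nonneg[OF Pk P]) (use True in auto)
          have We: "W1 (\<nu>s k s) (\<nu> s) \<le> e" using e True by (simp add: less_imp_le)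
          have le: "2 * c * csize ?a ?b \<le> 2 * c * 1" by (rule mult_left_mono[OF sz(2)]) (use c_pos in simp)
          have le2: "\<bar>?a\<bar> * (real CARD('n) * c) \<le> 1 * (real CARD('n) * c)" by (rule mult_right_mono[OF sz(1)]) (use c_pos in simp)
          have "\<bar>?d s\<bar> \<le> ((K + l) * (\<bar>1\<bar> + 2 * c * csize ?a ?b) + l * (\<bar>?a\<bar> * (real CARD('n) * c))) * (\<bar>s - s\<bar> + W1 (\<nu>s k s) (\<nu> s))"
            by (rule pairing_time_diff[OF facts Pk P]) (use True in auto)
          also have "\<dots> \<le> C * (\<bar>s - s\<bar> + W1 (\<nu>s k s) (\<nu> s))"
            unfolding C_def by (intro mult_right_mono add_mono mult_left_mono) (use lK le le2 W in auto)
          also have "\<dots> \<le> C * e" using mult_left_mono[OF We C] by simp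
          finally show ?thesis using True by simp
        qed simp
      qed
      have "norm (LINT s|lborel. indicator {0..S} s *\<^sub>R ?d s) \<le> (LINT s|lborel. norm (indicator {0..S} s *\<^sub>R ?d s))"
        by (rule integral_norm_bound)
      also have "\<dots> \<le> (LINT s|lborel. indicator {0..S} s *\<^sub>R (C * e))"
        by (rule integral_mono_AE[OF integrable_norm[OF i1[unfolded set_integrable_def]] i2[unfolded set_integrable_def] AE])
      also have "\<dots> = S * (C * e)"
        using S set_integral_const[of "{0..S}" lborel "C * e"] by (simp add: set_lebesgue_integral_def)
      finally show ?thesis unfolding eq set_lebesgue_integral_def real_norm_def .
    qed
    have "\<bar>L \<alpha> \<beta> \<nu>\<bar> \<le> 0 + e" if e: "0 < e" for e
    proof -
      define \<epsilon> where "\<epsilon> = e / (S * C + 1)"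
      have SC: "0 < S * C + 1" using S C by (simp add: add_nonneg_pos)
      then have \<epsilon>: "0 < \<epsilon>" "(S * C + 1) * \<epsilon> = e" using e by (simp_all add: \<epsilon>_def)
      obtain k where k: "\<forall>s\<in>{0..S}. W1 (\<nu>s k s) (\<nu> s) < \<epsilon>"
        "\<bar>(LINT s:{0..S}|lborel. (\<alpha>s k s, \<beta>s k s) \<bullet> h s) - (LINT s:{0..S}|lborel. (\<alpha> s, \<beta> s) \<bullet> h s)\<bar> < \<epsilon>"
        using close[OF \<epsilon>(1) h] by blast
      have "S * (C * \<epsilon>) + \<epsilon> = e" using \<epsilon>(2) by (simp add: algebra_simps)
      then show ?thesis
        using diff[OF k(1)] zero[of k] k(2) split[OF co(1)[of k]] split[OF co(2)] by linarith
    qed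
    then have "\<bar>L \<alpha> \<beta> \<nu>\<bar> \<le> 0" by (rule field_le_epsilon)
    then show ?thesis by (simp add: L_def pairing_time_def[OF facts])
  qed
  with ac init show ?thesis by (simp add: weak_solution_def)
qed

lemma reduced_solution_iff:
  "reduced_solution T M f0 f g \<theta> \<nu> \<alpha> \<beta> \<longleftrightarrow> weak_solution (T + M) \<theta> (\<lambda>s. velocity (\<alpha> s) (\<beta> s) (\<nu> s)) \<nu>"
  unfolding reduced_solution_def velocity_def[abs_def] ..

theorem cluster_point_process:
  fixes \<nu>s :: "nat \<Rightarrow> real \<Rightarrow> (real ^ 'n) measure"
  assumes T: "0 < T" "0 < M" and co: "\<And>k. coefficients (T + M) 1 (\<alpha>s k) (\<beta>s k)"
    and size: "\<And>k s. s \<in> {0..T + M} \<Longrightarrow> 0 \<le> \<alpha>s k s \<and> \<alpha>s k s + norm1 (\<beta>s k s) \<le> 1"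
    and T_eq: "\<And>k. primitive (\<alpha>s k) (T + M) = T"
    and sol: "\<And>k. reduced_solution T M f0 f g \<theta> (\<nu>s k) (\<alpha>s k) (\<beta>s k)"
    and cl: "process_cluster_point (T + M) \<nu>s \<alpha>s \<beta>s \<nu> \<alpha> \<beta>"
  shows "reduced_process T M f0 f g \<theta> \<nu> \<alpha> \<beta>"
proof -
  have S: "0 < T + M" using T by simp
  have wk: "weak_solution (T + M) \<theta> (\<lambda>s. velocity (\<alpha>s k s) (\<beta>s k s) (\<nu>s k s)) (\<nu>s k)" for k
    using sol by (simp add: reduced_solution_iff)
  have contk: "W1_continuous (T + M) (\<nu>s k)" for k
    using weak_solution_solves[OF S co wk] by (simp add: solves_def)
  note D = process_cluster_pointD[OF less_imp_le[OF S] cl contk]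
  have close: "\<exists>k. (\<forall>s\<in>{0..T + M}. W1 (\<nu>s k s) (\<nu> s) < e) \<and>
      \<bar>(LINT s:{0..T + M}|lborel. (\<alpha>s k s, \<beta>s k s) \<bullet> h s) - (LINT s:{0..T + M}|lborel. (\<alpha> s, \<beta> s) \<bullet> h s)\<bar> < e"
    if "0 < e" "h \<in> L1 (T + M)" for e h
    using D(3)[OF that(1), of "{h}"] that(2) frequently_ex by fastforce
  have T_int: "(LINT s:{0..T + M}|lborel. \<alpha>s k s) = T" for k using T_eq[of k] by (simp add: primitive_def)
  have ctrl: "(\<alpha>, \<beta>) \<in> reduced_controls T M"
  proof (rule weak_star_controls[OF coefficients_Linf[OF co] size T_int D(2)])
    fix e :: real and h :: "real \<Rightarrow> real \<times> (real ^ 'm)" assume "0 < e" "h \<in> L1 (T + M)"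
    from close[OF this] show "\<exists>k. \<bar>(LINT s:{0..T + M}|lborel. (\<alpha>s k s, \<beta>s k s) \<bullet> h s) - (LINT s:{0..T + M}|lborel. (\<alpha> s, \<beta> s) \<bullet> h s)\<bar> < e"
      by blast
  qed
  then have "coefficients (T + M) 1 \<alpha> \<beta>"
    by (intro Linf_coefficients D(2)) (simp add: reduced_controls_def)
  from limit_weak_solution[OF S co this wk D(1) close]
  show ?thesis using ctrl by (simp add: reduced_process_def reduced_solution_iff)
qed

end

section \<open>Limits under changes of time\<close>

text \<open>\<open>V\<close> is the total variation of \<open>F\<close> on \<open>{0..t}\<close>,
  continued by constants so that it is monotone on the whole line.\<close>

lemma BV_majorant:
  assumes F: "F \<in> BV_plus m T" and T: "0 \<le> T"
  obtains V :: "real \<Rightarrow> real" where "mono V" "\<And>s t. 0 \<le> s \<Longrightarrow> s \<le> t \<Longrightarrow> t \<le> T \<Longrightarrow> mdist m (F s) (F t) \<le> V t - V s"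
proof -
  define var where "var N \<tau> = (\<Sum>j<N. mdist m (F (\<tau> j)) (F (\<tau> (Suc j))))" for N and \<tau> :: "nat \<Rightarrow> real"
  define P where "P t = {var N \<tau> | N \<tau>. mono_on {..N} \<tau> \<and> \<tau> ` {..N} \<subseteq> {0..t}}" for t
  obtain C where C: "\<And>N \<tau>. mono_on {..N} \<tau> \<Longrightarrow> \<tau> ` {..N} \<subseteq> {0..T} \<Longrightarrow> var N \<tau> \<le> C"
    using F unfolding BV_plus_def var_def by blast
  have bdd: "bdd_above (P t)" if "t \<le> T" for t
  proof (rule bdd_aboveI[of _ C])
    fix x assume "x \<in> P t"
    then obtain N \<tau> where x: "x = var N \<tau>" "mono_on {..N} \<tau>" "\<tau> ` {..N} \<subseteq> {0..t}" unfolding P_def by blast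
    have "\<tau> ` {..N} \<subseteq> {0..T}" using x(3) that by (meson atLeastatMost_subset_iff order_refl subset_trans)
    then show "x \<le> C" using C x by simp
  qed
  have ne: "P t \<noteq> {}" if "0 \<le> t" for t
  proof -
    have "var 0 (\<lambda>_. 0) \<in> P t" unfolding P_def using that by (force simp: mono_on_def)
    then show ?thesis by blast
  qed
  have key: "Sup (P s) + mdist m (F s) (F t) \<le> Sup (P t)" if st: "0 \<le> s" "s \<le> t" "t \<le> T" for s t
  proof -
    have "Sup (P s) \<le> Sup (P t) - mdist m (F s) (F t)"
    proof (rule cSup_least[OF ne[OF st(1)]])
      fix x assume "x \<in> P s"
      then obtain N \<tau> where x: "x = var N \<tau>" and \<tau>: "mono_on {..N} \<tau>" "\<tau> ` {..N} \<subseteq> {0..s}" unfolding P_def by blast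
      have le: "0 \<le> \<tau> j" "\<tau> j \<le> s" if "j \<le> N" for j using \<tau>(2) that by auto
      \<comment> \<open>A partition of \<open>{0..s}\<close> is prolonged by \<open>s\<close> and
        then by \<open>t\<close>; the first added distance is discarded, the second is the one
        wanted.\<close>
      define \<tau>' where "\<tau>' j = (if j \<le> N then \<tau> j else if j = Suc N then s else t)" for j
      have "mono_on {..Suc (Suc N)} \<tau>'"
      proof (rule mono_onI)
        fix i j assume "i \<in> {..Suc (Suc N)}" "j \<in> {..Suc (Suc N)}" "i \<le> j"
        then show "\<tau>' i \<le> \<tau>' j"
          using monotone_onD[OF \<tau>(1), of i j] le(2)[of i] st by (auto simp: \<tau>'_def)
      qed
      moreover have "\<tau>' ` {..Suc (Suc N)} \<subseteq> {0..t}"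
      proof (rule image_subsetI)
        fix j assume "j \<in> {..Suc (Suc N)}"
        then show "\<tau>' j \<in> {0..t}" using le[of j] st by (auto simp: \<tau>'_def)
      qed
      ultimately have "var (Suc (Suc N)) \<tau>' \<in> P t" unfolding P_def by blast
      moreover have "var (Suc (Suc N)) \<tau>' = x + mdist m (F (\<tau> N)) (F s) + mdist m (F s) (F t)"
      proof -
        have "(\<Sum>j<N. mdist m (F (\<tau>' j)) (F (\<tau>' (Suc j)))) = x"
          unfolding x var_def by (rule sum.cong) (auto simp: \<tau>'_def)
        then show ?thesis unfolding var_def by (simp add: \<tau>'_def)
      qed
      ultimately have "x + mdist m (F (\<tau> N)) (F s) + mdist m (F s) (F t) \<le> Sup (P t)"
        using cSup_upper[OF _ bdd[OF st(3)]] by metis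
      then show "x \<le> Sup (P t) - mdist m (F s) (F t)" using mdist_nonneg[of m "F (\<tau> N)" "F s"] by linarith
    qed
    then show ?thesis by simp
  qed
  define V where "V t = Sup (P (max 0 (min T t)))" for t
  have "mono V"
  proof (rule monoI)
    fix s t :: real assume "s \<le> t"
    then show "V s \<le> V t"
      using key[of "max 0 (min T s)" "max 0 (min T t)"] T mdist_nonneg[of m "F (max 0 (min T s))" "F (max 0 (min T t))"]
      unfolding V_def by linarith
  qed
  moreover have "mdist m (F s) (F t) \<le> V t - V s" if "0 \<le> s" "s \<le> t" "t \<le> T" for s t
    using key[OF that] that unfolding V_def by (simp add: min_absorb2 max_absorb2)
  ultimately show thesis by (rule that)
qed

text \<open>The majorant of \<open>BV_majorant\<close> is monotone, and wherever it is continuous so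
  is \<open>F\<close>.\<close>

lemma BV_discontinuities_countable:
  assumes F: "F \<in> BV_plus m T" and T: "0 \<le> T"
  shows "countable {t \<in> {0..T}. \<not> limitin (mtopology_of m) F (F t) (at t within {0..T})}"
proof -
  obtain V :: "real \<Rightarrow> real" where V: "mono V" "\<And>s t. 0 \<le> s \<Longrightarrow> s \<le> t \<Longrightarrow> t \<le> T \<Longrightarrow> mdist m (F s) (F t) \<le> V t - V s"
    by (rule BV_majorant[OF F T]) blast
  have mem: "F t \<in> mspace m" if "t \<in> {0..T}" for t using F that by (simp add: BV_plus_def)
  have "limitin (mtopology_of m) F (F t) (at t within {0..T})" if t: "t \<in> {0..T}" and c: "isCont V t" for t
    unfolding limitin_mtopology_of
  proof (intro conjI allI impI mem t)
    fix \<epsilon> :: real assume \<epsilon>: "0 < \<epsilon>"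
    have "(V \<longlongrightarrow> V t) (at t within {0..T})"
      by (rule tendsto_within_subset[OF c[unfolded isCont_def]]) simp
    from tendstoD[OF this \<epsilon>] show "\<forall>\<^sub>F x in at t within {0..T}. F x \<in> mspace m \<and> mdist m (F x) (F t) < \<epsilon>"
      unfolding eventually_at_filter
    proof eventually_elim
      case (elim s)
      show ?case
      proof (intro impI)
        assume s: "s \<noteq> t" "s \<in> {0..T}"
        then have d: "\<bar>V s - V t\<bar> < \<epsilon>" using elim by (simp add: dist_real_def)
        have "mdist m (F s) (F t) \<le> \<bar>V s - V t\<bar>"
        proof (cases "s \<le> t")
          case True
          then show ?thesis using V(2)[of s t] s t by auto
        next
          case False
          then show ?thesis using V(2)[of t s] s t mdist_commute[of m "F s" "F t"] by auto
        qed
        then show "F s \<in> mspace m \<and> mdist m (F s) (F t) < \<epsilon>" using mem[OF s(2)] d by simp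
      qed
    qed
  qed
  then have "{t \<in> {0..T}. \<not> limitin (mtopology_of m) F (F t) (at t within {0..T})} \<subseteq> {t. \<not> isCont V t}" by blast
  then show ?thesis using mono_ctble_discont[OF V(1)] countable_subset by blast
qed

text \<open>Apart from countably many times, \<open>t\<close> is a continuity point of \<open>F\<close> and \<open>\<xi>\<close> takes the value \<open>t\<close> only once
  (a nondegenerate interval on which \<open>\<xi>\<close> is constant contains a rational), so that \<open>\<Xi>s k t\<close> comes close to the
  pseudo-inverse. Right continuity settles the remaining times.\<close>

lemma limit_time_change:
  fixes m :: "'a metric" and \<xi> :: "real \<Rightarrow> real"
  assumes T: "0 < T" and S: "0 \<le> S" and F: "F \<in> BV_plus m T" and conv: "conv_at_continuity m T Fs F"
    and mem: "\<And>k s. s \<in> {0..S} \<Longrightarrow> Gs k s \<in> mspace m" "\<And>s. s \<in> {0..S} \<Longrightarrow> G s \<in> mspace m"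
    and lip: "\<And>k s r. s \<in> {0..S} \<Longrightarrow> r \<in> {0..S} \<Longrightarrow> mdist m (Gs k s) (Gs k r) \<le> \<kappa> * \<bar>s - r\<bar>" and \<kappa>: "0 \<le> \<kappa>"
    and mono: "\<And>k s r. 0 \<le> s \<Longrightarrow> s \<le> r \<Longrightarrow> r \<le> S \<Longrightarrow> \<xi>s k s \<le> \<xi>s k r"
    and inv: "\<And>k t. t \<in> {0..T} \<Longrightarrow> \<Xi>s k t \<in> {0..S}" "\<And>k t. t \<in> {0..T} \<Longrightarrow> \<xi>s k (\<Xi>s k t) = t" "\<And>k. \<Xi>s k T = S"
    and Fs: "\<And>k t. t \<in> {0..T} \<Longrightarrow> Fs k t = Gs k (\<Xi>s k t)"
    and close: "\<And>e Q. 0 < e \<Longrightarrow> finite Q \<Longrightarrow> Q \<subseteq> {0..S} \<Longrightarrow>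
      \<exists>\<^sub>F k in sequentially. \<forall>s\<in>Q. \<bar>\<xi>s k s - \<xi> s\<bar> < e \<and> mdist m (Gs k s) (G s) < e"
    and t: "t \<in> {0..T}"
  shows "F t = G (pseudo_inverse T S \<xi> t)"
proof -
  have memF: "F s \<in> mspace m" if "s \<in> {0..T}" for s using F that by (simp add: BV_plus_def)
  have memFs: "Fs k s \<in> mspace m" if "s \<in> {0..T}" for k s using Fs[OF that] mem(1) inv(1)[OF that] by simp
  have lipG: "mdist m (G s) (G r) \<le> \<kappa> * \<bar>s - r\<bar>" if sr: "s \<in> {0..S}" "r \<in> {0..S}" for s r
  proof (rule field_le_epsilon)
    fix e :: real assume e: "0 < e"
    obtain k where k: "mdist m (Gs k s) (G s) < e / 2" "mdist m (Gs k r) (G r) < e / 2"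
      using frequently_ex[OF close[of "e / 2" "{s, r}"]] e sr by auto
    have "mdist m (G s) (G r) \<le> mdist m (G s) (Gs k s) + mdist m (Gs k s) (G r)" by (rule mdist_triangle) (use mem sr in auto)
    also have "mdist m (Gs k s) (G r) \<le> mdist m (Gs k s) (Gs k r) + mdist m (Gs k r) (G r)" by (rule mdist_triangle) (use mem sr in auto)
    finally show "mdist m (G s) (G r) \<le> \<kappa> * \<bar>s - r\<bar> + e"
      using k lip[OF sr, of k] mdist_commute[of m "G s" "Gs k s"] by linarith
  qed
  have mono\<xi>: "\<xi> s \<le> \<xi> r" if sr: "0 \<le> s" "s \<le> r" "r \<le> S" for s r
  proof (rule field_le_epsilon)
    fix e :: real assume e: "0 < e"
    obtain k where k: "\<bar>\<xi>s k s - \<xi> s\<bar> < e / 2" "\<bar>\<xi>s k r - \<xi> r\<bar> < e / 2"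
      using frequently_ex[OF close[of "e / 2" "{s, r}"]] e sr by auto
    then show "\<xi> s \<le> \<xi> r + e" using mono[OF sr, of k] by linarith
  qed
  have \<xi>S: "\<xi> S = T"
  proof -
    have eq: "\<xi>s k S = T" for k using inv(2)[of T k] inv(3)[of k] T by simp
    have "\<bar>\<xi> S - T\<bar> \<le> 0 + e" if e: "0 < e" for e
    proof -
      obtain k where "\<bar>\<xi>s k S - \<xi> S\<bar> < e" using frequently_ex[OF close[of e "{S}"]] e S by auto
      then show ?thesis using eq[of k] by linarith
    qed
    then have "\<bar>\<xi> S - T\<bar> \<le> 0" by (rule field_le_epsilon)
    then show ?thesis by simp
  qed
  define \<sigma> where "\<sigma> = pseudo_inverse T S \<xi>"
  have eqI: "x = y" if "x \<in> mspace m" "y \<in> mspace m" "\<And>e. 0 < e \<Longrightarrow> mdist m x y \<le> 0 + e" for x y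
  proof -
    have "mdist m x y \<le> 0" by (rule field_le_epsilon) (rule that(3))
    then show ?thesis using mdist_nonneg[of m x y] that(1,2) mdist_zero[of x m y] by simp
  qed
  have evclose: "\<forall>\<^sub>F x in A. mdist m (f x) l < e" if "limitin (mtopology_of m) f l A" "0 < e" for f l e and A :: "'b filter"
    using that(1)[unfolded limitin_mtopology_of, THEN conjunct2, rule_format, OF that(2)] by (rule eventually_mono) simp
  show ?thesis
  proof (cases "t = T")
    case True
    have "F T = G S"
    proof (rule eqI)
      fix e :: real assume e: "0 < e"
      have "limitin (mtopology_of m) (\<lambda>k. Fs k T) (F T) sequentially"
        using conv T by (auto simp: conv_at_continuity_def)
      from frequently_ex[OF frequently_eventually_conj[OF close[of "e / 2" "{S}"] evclose[OF this, of "e / 2"]]] e S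
      obtain k where k: "mdist m (Gs k S) (G S) < e / 2" "mdist m (Fs k T) (F T) < e / 2" by auto
      have "mdist m (F T) (G S) \<le> mdist m (F T) (Fs k T) + mdist m (Fs k T) (G S)"
        by (rule mdist_triangle) (use memF memFs mem T S in auto)
      then show "mdist m (F T) (G S) \<le> 0 + e"
        using k Fs[of T k] inv(3)[of k] T mdist_commute[of m "F T" "Fs k T"] by simp
    qed (use memF mem T S in auto)
    then show ?thesis using True by (simp add: pseudo_inverse_def)
  next
    case False
    have \<sigma>_eq: "\<sigma> s = Inf {r \<in> {0..S}. s < \<xi> r}" if "s < T" for s
      using that by (simp add: \<sigma>_def pseudo_inverse_def)
    have bdd: "bdd_below {r \<in> {0..S}. s < \<xi> r}" for s by (rule bdd_belowI[of _ 0]) simp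
    have ne: "{r \<in> {0..S}. s < \<xi> r} \<noteq> {}" if "s < T" for s using that \<xi>S S by auto
    have \<sigma>_le: "\<sigma> s \<le> r" if "s < T" "r \<in> {0..S}" "s < \<xi> r" for s r
      unfolding \<sigma>_eq[OF that(1)] by (rule cInf_lower[OF _ bdd]) (use that in simp)
    have \<sigma>_less: "\<exists>q\<in>{0..S}. s < \<xi> q \<and> q < r" if "s < T" "\<sigma> s < r" for s r
      using cInf_lessD[OF ne[OF that(1)]] that(2) unfolding \<sigma>_eq[OF that(1)] by blast
    have \<sigma>_mem: "\<sigma> s \<in> {0..S}" if "s < T" for s
    proof -
      have "0 \<le> \<sigma> s" unfolding \<sigma>_eq[OF that] by (rule cInf_greatest[OF ne[OF that]]) simp
      moreover have "\<sigma> s \<le> S" by (rule \<sigma>_le[OF that]) (use that S \<xi>S in auto)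
      ultimately show ?thesis by simp
    qed
    have \<sigma>_mono: "\<sigma> s \<le> \<sigma> r" if "s \<le> r" "r < T" for s r
    proof -
      have "s < T" using that by simp
      then show ?thesis
        unfolding \<sigma>_eq[OF that(2)] \<sigma>_eq[OF \<open>s < T\<close>]
        by (intro cInf_superset_mono ne bdd that(2)) (use that(1) in auto)
    qed
    define N where "N = {s \<in> {0..T}. \<not> limitin (mtopology_of m) F (F s) (at s within {0..T})} \<union> \<xi> ` \<rat>"
    have N: "countable N"
      unfolding N_def by (intro countable_Un countable_image countable_rat BV_discontinuities_countable[OF F less_imp_le[OF T]])
    have good: "F s = G (\<sigma> s)" if s: "0 < s" "s < T" "s \<notin> N" for s
    proof (rule eqI)
      have s': "s \<in> {0..T}" using s by simp
      show "F s \<in> mspace m" "G (\<sigma> s) \<in> mspace m" using memF mem(2) s' \<sigma>_mem[OF s(2)] by auto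
      fix e :: real assume e: "0 < e"
      \<comment> \<open>Dividing by \<open>\<kappa> + 1\<close> covers the case
        \<open>\<kappa> = 0\<close>.\<close>
      define \<delta> where "\<delta> = e / 3 / (\<kappa> + 1)"
      have "0 < \<delta>" using e \<kappa> by (simp add: \<delta>_def)
      moreover have "(\<kappa> + 1) * \<delta> = e / 3"
        unfolding \<delta>_def times_divide_eq_right[of "\<kappa> + 1" "e / 3" "\<kappa> + 1"]
        by (rule nonzero_mult_div_cancel_left) (use \<kappa> in simp)
      ultimately have \<delta>: "0 < \<delta>" "\<kappa> * \<delta> \<le> e / 3" by (simp_all add: distrib_right)
      \<comment> \<open>Neighbours of \<open>\<sigma> s\<close> on both sides, clamped to
        \<open>{0..S}\<close>, between which \<open>\<Xi>s k s\<close> will be caught.\<close>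
      define s1 where "s1 = max 0 (\<sigma> s - \<delta> / 2)"
      define s2 where "s2 = min S (\<sigma> s + \<delta> / 2)"
      have mem12: "s1 \<in> {0..S}" "s2 \<in> {0..S}" using \<sigma>_mem[OF s(2)] S \<delta>(1) by (auto simp: s1_def s2_def)
      have lo: "\<xi> s1 < s" if "\<sigma> s \<noteq> 0"
      proof (rule ccontr)
        assume n: "\<not> \<xi> s1 < s"
        have "s1 < \<sigma> s" using that \<delta>(1) \<sigma>_mem[OF s(2)] by (auto simp: s1_def)
        then obtain q where q: "q \<in> \<rat>" "s1 < q" "q < \<sigma> s" using Rats_dense_in_real by blast
        have qS: "q \<in> {0..S}" using q mem12(1) \<sigma>_mem[OF s(2)] by auto
        have "\<xi> q \<le> s" using \<sigma>_le[OF s(2) qS] q(3) by linarith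
        moreover have "\<xi> s1 \<le> \<xi> q" by (rule mono\<xi>) (use q qS mem12 in auto)
        ultimately have "s = \<xi> q" using n by simp
        then show False using s(3) q(1) by (auto simp: N_def)
      qed
      have up: "s < \<xi> s2" if "\<sigma> s \<noteq> S"
      proof -
        have "\<sigma> s < s2" using that \<delta>(1) \<sigma>_mem[OF s(2)] by (auto simp: s2_def)
        from \<sigma>_less[OF s(2) this] obtain q where q: "q \<in> {0..S}" "s < \<xi> q" "q < s2" by blast
        have "\<xi> q \<le> \<xi> s2" by (rule mono\<xi>) (use q mem12 in auto)
        with q(2) show ?thesis by simp
      qed
      \<comment> \<open>Small enough that \<open>\<xi>s k\<close> is still below \<open>s\<close> at
        \<open>s1\<close> and above it at \<open>s2\<close>. If \<open>\<sigma> s\<close> is an end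
        of \<open>{0..S}\<close>, nothing has to be shown on that side and 1 is a neutral
        default.\<close>
      define e' where "e' = min (e / 3) (min (if \<sigma> s = 0 then 1 else s - \<xi> s1) (if \<sigma> s = S then 1 else \<xi> s2 - s))"
      have "0 < e'" using e lo up by (auto simp: e'_def)
      moreover have "{s1, s2, \<sigma> s} \<subseteq> {0..S}" using mem12 \<sigma>_mem[OF s(2)] by blast
      ultimately have fr: "\<exists>\<^sub>F k in sequentially. \<forall>r\<in>{s1, s2, \<sigma> s}. \<bar>\<xi>s k r - \<xi> r\<bar> < e' \<and> mdist m (Gs k r) (G r) < e'"
        by (intro close) auto
      have "limitin (mtopology_of m) F (F s) (at s within {0..T})" using s s' by (auto simp: N_def)
      then have "limitin (mtopology_of m) (\<lambda>k. Fs k s) (F s) sequentially"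
        using conv s' by (simp add: conv_at_continuity_def)
      from frequently_ex[OF frequently_eventually_conj[OF fr evclose[OF this, of "e / 3"]]] e
      obtain k where k: "\<forall>r\<in>{s1, s2, \<sigma> s}. \<bar>\<xi>s k r - \<xi> r\<bar> < e' \<and> mdist m (Gs k r) (G r) < e'"
        "mdist m (Fs k s) (F s) < e / 3" by auto
      let ?\<Xi> = "\<Xi>s k s"
      note \<Xi> = inv(1)[OF s', of k] inv(2)[OF s', of k]
      have "\<sigma> s - ?\<Xi> \<le> \<delta>"
      proof (cases "\<sigma> s = 0")
        case True
        then show ?thesis using \<Xi>(1) \<delta>(1) by auto
      next
        case False
        then have "e' \<le> s - \<xi> s1" by (simp add: e'_def)
        then have "\<xi>s k s1 < \<xi>s k ?\<Xi>" using k(1) \<Xi>(2) by auto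
        then have "\<not> ?\<Xi> \<le> s1" using mono[of ?\<Xi> s1 k] \<Xi>(1) mem12 by auto
        then show ?thesis using \<delta>(1) by (simp add: s1_def)
      qed
      moreover have "?\<Xi> - \<sigma> s \<le> \<delta>"
      proof (cases "\<sigma> s = S")
        case True
        then show ?thesis using \<Xi>(1) \<delta>(1) by auto
      next
        case False
        then have "e' \<le> \<xi> s2 - s" by (simp add: e'_def)
        then have "\<xi>s k ?\<Xi> < \<xi>s k s2" using k(1) \<Xi>(2) by auto
        then have "\<not> s2 \<le> ?\<Xi>" using mono[of s2 ?\<Xi> k] \<Xi>(1) mem12 by auto
        then show ?thesis using \<delta>(1) by (simp add: s2_def)
      qed
      ultimately have "\<bar>?\<Xi> - \<sigma> s\<bar> \<le> \<delta>" by linarith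
      then have "\<kappa> * \<bar>?\<Xi> - \<sigma> s\<bar> \<le> \<kappa> * \<delta>" by (rule mult_left_mono[OF _ \<kappa>])
      then have d1: "mdist m (Fs k s) (Gs k (\<sigma> s)) \<le> e / 3"
        using lip[OF \<Xi>(1) \<sigma>_mem[OF s(2)], of k] Fs[OF s', of k] \<delta>(2) by simp
      have d2: "mdist m (Gs k (\<sigma> s)) (G (\<sigma> s)) < e / 3" using k(1) by (auto simp: e'_def)
      have "mdist m (F s) (G (\<sigma> s)) \<le> mdist m (F s) (Fs k s) + mdist m (Fs k s) (G (\<sigma> s))"
        by (rule mdist_triangle) (use memF memFs mem s' \<sigma>_mem[OF s(2)] in auto)
      also have "mdist m (Fs k s) (G (\<sigma> s)) \<le> mdist m (Fs k s) (Gs k (\<sigma> s)) + mdist m (Gs k (\<sigma> s)) (G (\<sigma> s))"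
        by (rule mdist_triangle) (use memFs mem s' \<sigma>_mem[OF s(2)] in auto)
      finally show "mdist m (F s) (G (\<sigma> s)) \<le> 0 + e"
        using k(2) d1 d2 mdist_commute[of m "F s" "Fs k s"] by linarith
    qed
    have tT: "t < T" using False t by simp
    have "F t = G (\<sigma> t)"
    proof (rule eqI)
      show "F t \<in> mspace m" "G (\<sigma> t) \<in> mspace m" using memF mem(2) t \<sigma>_mem[OF tT] by auto
      fix e :: real assume e: "0 < e"
      define \<delta> where "\<delta> = e / 2 / (\<kappa> + 1)"
      have "0 < \<delta>" using e \<kappa> by (simp add: \<delta>_def)
      moreover have "(\<kappa> + 1) * \<delta> = e / 2"
        unfolding \<delta>_def times_divide_eq_right[of "\<kappa> + 1" "e / 2" "\<kappa> + 1"]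
        by (rule nonzero_mult_div_cancel_left) (use \<kappa> in simp)
      ultimately have \<delta>: "0 < \<delta>" "\<kappa> * \<delta> \<le> e / 2" by (simp_all add: distrib_right)
      have "limitin (mtopology_of m) F (F t) (at_right t)" using F t tT by (simp add: BV_plus_def)
      from evclose[OF this, of "e / 2"] e obtain b where b: "t < b" "\<And>y. t < y \<Longrightarrow> y < b \<Longrightarrow> mdist m (F y) (F t) < e / 2"
        unfolding eventually_at_right_field by auto
      obtain r where r: "r \<in> {0..S}" "t < \<xi> r" "r < \<sigma> t + \<delta>" using \<sigma>_less[OF tT, of "\<sigma> t + \<delta>"] \<delta>(1) by auto
      \<comment> \<open>Any \<open>t'\<close> between \<open>t\<close> and this bound has
        \<open>F t'\<close> near \<open>F t\<close> and lies below \<open>\<xi> r\<close>, so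
        \<open>\<sigma> t'\<close> lies between \<open>\<sigma> t\<close> and \<open>r\<close>. The
        interval is uncountable, hence some such \<open>t'\<close> avoids \<open>N\<close>.\<close>
      have "t < min (min b (\<xi> r)) T" using b r tT by simp
      from uncountable_open_interval[of t "min (min b (\<xi> r)) T"] this
      have "\<not> {t<..<min (min b (\<xi> r)) T} \<subseteq> N" using N countable_subset by blast
      then obtain t' where "t' \<in> {t<..<min (min b (\<xi> r)) T}" and "t' \<notin> N" by blast
      then have t': "t < t'" "t' < b" "t' < \<xi> r" "t' < T" "t' \<notin> N" by auto
      have "\<sigma> t \<le> \<sigma> t'" by (rule \<sigma>_mono) (use t' in auto)
      moreover have "\<sigma> t' \<le> r" by (rule \<sigma>_le[OF t'(4) r(1) t'(3)])
      ultimately have "\<bar>\<sigma> t' - \<sigma> t\<bar> \<le> \<delta>" using r(3) by linarith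
      then have "\<kappa> * \<bar>\<sigma> t' - \<sigma> t\<bar> \<le> \<kappa> * \<delta>" by (rule mult_left_mono[OF _ \<kappa>])
      then have d: "mdist m (F t') (G (\<sigma> t)) \<le> e / 2"
        using lipG[OF \<sigma>_mem[OF t'(4)] \<sigma>_mem[OF tT]] good[of t'] t' t \<delta>(2) by simp
      have "mdist m (F t) (G (\<sigma> t)) \<le> mdist m (F t) (F t') + mdist m (F t') (G (\<sigma> t))"
        by (rule mdist_triangle) (use memF mem t t' \<sigma>_mem[OF tT] in auto)
      then show "mdist m (F t) (G (\<sigma> t)) \<le> 0 + e"
        using b(2)[OF t'(1,2)] d mdist_commute[of m "F t" "F t'"] by linarith
    qed
    then show ?thesis by (simp add: \<sigma>_def)
  qed
qed

section \<open>Convergence of the primitives of the controls\<close>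

lemma primitive_as_test:
  fixes b :: "real \<Rightarrow> real ^ 'm::finite"
  assumes co: "coefficients S B a b" and s: "s \<in> {0..S}"
  shows "(LINT r:{0..S}|lborel. (a r, b r) \<bullet> (indicator {0..s} r *\<^sub>R (1, 0))) = primitive a s"
    and "(LINT r:{0..S}|lborel. (a r, b r) \<bullet> (indicator {0..s} r *\<^sub>R (0, axis i 1))) = primitive b s $ i"
proof -
  have ind: "indicator {0..S} r * (x * indicator {0..s} r) = indicator {0..s} r * (x :: real)"
    "indicator {0..S} r * (indicator {0..s} r * x) = indicator {0..s} r * x" for r x
    using s by (auto simp: indicator_def)
  show "(LINT r:{0..S}|lborel. (a r, b r) \<bullet> (indicator {0..s} r *\<^sub>R (1, 0))) = primitive a s"
    by (simp add: primitive_def set_lebesgue_integral_def ind)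
  have "set_integrable lborel {0..S} b" by (rule set_integrable_bounded[OF coefficientsD(2,6)[OF co]])
  then have "integrable lborel (\<lambda>r. indicator {0..s} r *\<^sub>R b r)"
    using set_integrable_Icc_subset[of S b 0 s] s by (simp add: set_integrable_def)
  from integral_inner_left[OF this, of "axis i 1"]
  show "(LINT r:{0..S}|lborel. (a r, b r) \<bullet> (indicator {0..s} r *\<^sub>R (0, axis i 1))) = primitive b s $ i"
    by (simp add: primitive_def set_lebesgue_integral_def ind inner_axis)
qed

lemma indicator_L1: "(\<lambda>r. indicator {0..s} r *\<^sub>R v) \<in> L1 S" for v :: "'a::euclidean_space"
proof -
  have "integrable lborel (\<lambda>r. indicator {max 0 0..min S s} r *\<^sub>R v)"
    by (rule borel_integrable_compact[OF compact_Icc]) (rule continuous_on_const)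
  moreover have "(\<lambda>r. indicator {0..S} r *\<^sub>R indicator {0..s} r *\<^sub>R v) = (\<lambda>r. indicator {max 0 0..min S s} r *\<^sub>R v)"
    by (auto simp: indicator_def fun_eq_iff)
  ultimately show ?thesis by (simp only: L1_def set_integrable_def mem_Collect_eq)
qed

lemma cluster_point_close:
  fixes \<nu>s :: "nat \<Rightarrow> real \<Rightarrow> (real ^ 'n::finite) measure" and \<beta>s :: "nat \<Rightarrow> real \<Rightarrow> real ^ 'm::finite"
  assumes S: "0 \<le> S" and cl: "process_cluster_point S \<nu>s \<alpha>s \<beta>s \<nu> \<alpha> \<beta>" and cont: "\<And>k. W1_continuous S (\<nu>s k)"
    and co: "\<And>k. coefficients S B (\<alpha>s k) (\<beta>s k)" "coefficients S B \<alpha> \<beta>"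
    and e: "0 < e" and Q: "finite Q" "Q \<subseteq> {0..S}"
  shows "\<exists>\<^sub>F k in sequentially. \<forall>s\<in>Q. \<bar>primitive (\<alpha>s k) s - primitive \<alpha> s\<bar> < e \<and> W1 (\<nu>s k s) (\<nu> s) < e \<and>
    norm1 (primitive (\<beta>s k) s - primitive \<beta> s) < e"
proof -
  \<comment> \<open>The Manhattan norm adds one such error per component.\<close>
  define \<epsilon> where "\<epsilon> = e / real CARD('m)"
  have \<epsilon>: "0 < \<epsilon>" "\<epsilon> \<le> e" "real CARD('m) * \<epsilon> = e"
    using e mult_left_mono[of 1 "real CARD('m)" e] by (simp_all add: \<epsilon>_def field_simps)
  define p :: "real \<Rightarrow> real \<Rightarrow> real \<times> (real ^ 'm)" where "p s r = indicator {0..s} r *\<^sub>R (1, 0)" for s r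
  define q :: "'m \<Rightarrow> real \<Rightarrow> real \<Rightarrow> real \<times> (real ^ 'm)" where "q i s r = indicator {0..s} r *\<^sub>R (0, axis i 1)" for i s r
  have "p s \<in> L1 S" "q i s \<in> L1 S" for s i unfolding p_def[abs_def] q_def[abs_def] by (rule indicator_L1)+
  then have H: "finite (p ` Q \<union> (\<Union>i. q i ` Q))" "p ` Q \<union> (\<Union>i. q i ` Q) \<subseteq> L1 S" using Q(1) by auto
  show ?thesis
  proof (rule frequently_elim1[OF process_cluster_pointD(3)[OF S cl cont \<epsilon>(1) H]], intro ballI conjI)
    fix k s
    assume k: "(\<forall>s\<in>{0..S}. W1 (\<nu>s k s) (\<nu> s) < \<epsilon>) \<and> (\<forall>h\<in>p ` Q \<union> (\<Union>i. q i ` Q).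
      \<bar>(LINT s:{0..S}|lborel. (\<alpha>s k s, \<beta>s k s) \<bullet> h s) - (LINT s:{0..S}|lborel. (\<alpha> s, \<beta> s) \<bullet> h s)\<bar> < \<epsilon>)" and s: "s \<in> Q"
    have sS: "s \<in> {0..S}" using s Q(2) by blast
    have "W1 (\<nu>s k s) (\<nu> s) < \<epsilon>" using k sS by blast
    with \<epsilon>(2) show "W1 (\<nu>s k s) (\<nu> s) < e" by linarith
    have "\<bar>(LINT r:{0..S}|lborel. (\<alpha>s k r, \<beta>s k r) \<bullet> p s r) - (LINT r:{0..S}|lborel. (\<alpha> r, \<beta> r) \<bullet> p s r)\<bar> < \<epsilon>" using k s by blast
    then show "\<bar>primitive (\<alpha>s k) s - primitive \<alpha> s\<bar> < e"
      unfolding p_def primitive_as_test(1)[OF co(1) sS] primitive_as_test(1)[OF co(2) sS] using \<epsilon>(2) by simp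
    have "\<bar>(primitive (\<beta>s k) s - primitive \<beta> s) $ i\<bar> < \<epsilon>" for i
    proof -
      have "\<bar>(LINT r:{0..S}|lborel. (\<alpha>s k r, \<beta>s k r) \<bullet> q i s r) - (LINT r:{0..S}|lborel. (\<alpha> r, \<beta> r) \<bullet> q i s r)\<bar> < \<epsilon>" using k s by blast
      then show ?thesis
        unfolding q_def primitive_as_test(2)[OF co(1) sS] primitive_as_test(2)[OF co(2) sS] by simp
    qed
    then have "norm1 (primitive (\<beta>s k) s - primitive \<beta> s) < of_nat (card (UNIV :: 'm set)) * \<epsilon>"
      unfolding norm1_def by (intro sum_bounded_above_strict) auto
    then show "norm1 (primitive (\<beta>s k) s - primitive \<beta> s) < e" using \<epsilon>(3) by simp
  qed
qed

context drift
begin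

text \<open>A subsequence for the controls is extracted first and refined for the curves. That the
  limit curve solves the equation is a separate matter, settled for every cluster point in
  \<open>cluster_point_process\<close>.\<close>

lemma cluster_point_exists:
  fixes \<nu>s :: "nat \<Rightarrow> real \<Rightarrow> (real ^ 'n) measure" and \<beta>s :: "nat \<Rightarrow> real \<Rightarrow> real ^ 'm"
  assumes S: "0 < S" and \<theta>: "\<theta> \<in> P1" and co: "\<And>k. coefficients S 1 (\<alpha>s k) (\<beta>s k)"
    and size: "\<And>k s. s \<in> {0..S} \<Longrightarrow> csize (\<alpha>s k s) (\<beta>s k s) \<le> 1"
    and sol: "\<And>k. solves S (\<alpha>s k) (\<beta>s k) (\<nu>s k)" and init: "\<And>k. \<nu>s k 0 = \<theta>"
  shows "\<exists>\<nu> \<alpha> \<beta>. process_cluster_point S \<nu>s \<alpha>s \<beta>s \<nu> \<alpha> \<beta>"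
proof -
  let ?\<gamma> = "\<lambda>k s. (\<alpha>s k s, \<beta>s k s)"
  have meas: "set_borel_measurable borel {0..S} (?\<gamma> k)" for k by (rule Linf_measurable[OF coefficients_Linf[OF co]])
  have bd: "norm (?\<gamma> k s) \<le> 1" if "s \<in> {0..S}" for k s
    using norm_Pair_le[of "\<alpha>s k s" "\<beta>s k s"] norm_le_norm1[of "\<beta>s k s"] size[OF that, of k] by (simp add: csize_def)
  obtain r \<gamma> where r: "strict_mono r" "\<gamma> \<in> Linf S"
    and lim: "\<And>h. h \<in> L1 S \<Longrightarrow> (\<lambda>k. LINT s:{0..S}|lborel. ?\<gamma> (r k) s \<bullet> h s) \<longlonglongrightarrow> (LINT s:{0..S}|lborel. \<gamma> s \<bullet> h s)"
    by (rule weak_star_subsequence[OF less_imp_le[OF S], of ?\<gamma>, OF meas]) (erule bd, rule that)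
  obtain r' \<nu> where r': "strict_mono r'" "\<And>s. s \<in> {0..S} \<Longrightarrow> \<nu> s \<in> P1"
    "\<And>e. 0 < e \<Longrightarrow> \<forall>\<^sub>F k in sequentially. \<forall>s\<in>{0..S}. W1 (\<nu>s (r (r' k)) s) (\<nu> s) < e"
    by (rule solutions_subsequence[OF S \<theta>, of "\<lambda>k. \<alpha>s (r k)" "\<lambda>k. \<beta>s (r k)" "\<lambda>k. \<nu>s (r k)", OF co sol init]) (rule that)
  have "process_cluster_point S \<nu>s \<alpha>s \<beta>s \<nu> (\<lambda>s. fst (\<gamma> s)) (\<lambda>s. snd (\<gamma> s))"
  proof (rule process_cluster_pointI[OF less_imp_le[OF S], where r = "r \<circ> r'"])
    show "strict_mono (r \<circ> r')" by (rule strict_mono_o[OF r(1) r'(1)])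
    show "W1_continuous S (\<nu>s k)" for k using sol by (simp add: solves_def)
    show "\<nu> s \<in> P1" if "s \<in> {0..S}" for s by (rule r'(2)[OF that])
    show "\<forall>\<^sub>F k in sequentially. \<forall>s\<in>{0..S}. W1 (\<nu>s ((r \<circ> r') k) s) (\<nu> s) < e" if "0 < e" for e
      using r'(3)[OF that] by simp
    show "?\<gamma> k \<in> Linf S" for k by (rule coefficients_Linf[OF co])
    show "(\<lambda>s. (fst (\<gamma> s), snd (\<gamma> s))) \<in> Linf S" using r(2) by simp
    show "(\<lambda>k. LINT s:{0..S}|lborel. ?\<gamma> ((r \<circ> r') k) s \<bullet> h s) \<longlonglongrightarrow> (LINT s:{0..S}|lborel. (fst (\<gamma> s), snd (\<gamma> s)) \<bullet> h s)"
      if "h \<in> L1 S" for h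
      using LIMSEQ_subseq_LIMSEQ[OF lim[OF that] r'(1)] by (simp only: o_def prod.collapse)
  qed
  then show ?thesis by blast
qed

end

section \<open>The three claims on cluster points\<close>

theorem theorem3p6:
  fixes f0 g :: "real ^ 'n::finite \<Rightarrow> real ^ 'n"
    and f :: "'m::finite \<Rightarrow> real ^ 'n \<Rightarrow> real ^ 'n"
    and \<theta> :: "(real ^ 'n) measure"
    and T M :: real
    and \<mu>s \<nu>s :: "nat \<Rightarrow> real \<Rightarrow> (real ^ 'n) measure"
    and us \<beta>s :: "nat \<Rightarrow> real \<Rightarrow> real ^ 'm"
    and \<alpha>s :: "nat \<Rightarrow> real \<Rightarrow> real"
    and \<mu> :: "real \<Rightarrow> (real ^ 'n) measure"
    and U :: "real \<Rightarrow> real ^ 'm"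
  assumes "0 < T" and "0 < M"
    and "A1 f0 f g"
    and "\<theta> \<in> P1"
    and "\<And>k. process T M f0 f g \<theta> (\<mu>s k) (us k)"
    and "\<mu> \<in> BV_plus W1_metric T" and "U \<in> BV_plus manhattan_metric T"
    and "conv_at_continuity W1_metric T \<mu>s \<mu>"
    and "conv_at_continuity manhattan_metric T (\<lambda>k. primitive (us k)) U"
    and "\<And>k. associated_process T M f0 f g \<theta> (us k) (\<nu>s k) (\<alpha>s k) (\<beta>s k)"
  shows "(\<exists>\<nu> \<alpha> \<beta>. process_cluster_point (T + M) \<nu>s \<alpha>s \<beta>s \<nu> \<alpha> \<beta>) \<and>
    (\<forall>\<nu> \<alpha> \<beta>. process_cluster_point (T + M) \<nu>s \<alpha>s \<beta>s \<nu> \<alpha> \<beta> \<longrightarrow>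
      reduced_process T M f0 f g \<theta> \<nu> \<alpha> \<beta>) \<and>
    (\<forall>\<nu> \<alpha> \<beta>. process_cluster_point (T + M) \<nu>s \<alpha>s \<beta>s \<nu> \<alpha> \<beta> \<longrightarrow>
      (\<forall>t\<in>{0..T}.
        \<mu> t = \<nu> (pseudo_inverse T (T + M) (primitive \<alpha>) t) \<and>
        U t = (LINT s:{0..pseudo_inverse T (T + M) (primitive \<alpha>) t}|lborel. \<beta> s)))"
proof -
  obtain c where "drift f0 g f c" by (rule A1_drift[OF assms(3)])
  then interpret drift f0 g f c .
  let ?S = "T + M"
  have S: "0 < ?S" using assms by simp
  have tc: "time_change T M (us k)" for k
    using assms(1,2) assms(5)[of k] by (simp add: time_change_def process_def)
  note A = associated_process_solves[OF assms(1,2,5,10)]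
  have red: "reduced_solution T M f0 f g \<theta> (\<nu>s k) (\<alpha>s k) (\<beta>s k)" for k
    using assms(10)[of k] by (simp add: associated_process_def Let_def)
  then have init: "\<nu>s k 0 = \<theta>" for k by (simp add: reduced_solution_def weak_solution_def)
  have cont: "W1_continuous ?S (\<nu>s k)" for k using A(3) by (simp add: solves_def)
  have Pk: "\<nu>s k s \<in> P1" if "s \<in> {0..?S}" for k s using cont that by (simp add: W1_continuous_def)
  have part1: "\<exists>\<nu> \<alpha> \<beta>. process_cluster_point ?S \<nu>s \<alpha>s \<beta>s \<nu> \<alpha> \<beta>"
  proof (rule cluster_point_exists[OF S assms(4) A(1) _ A(3) init])
    show "csize (\<alpha>s k s) (\<beta>s k s) \<le> 1" if "s \<in> {0..?S}" for k s using A(2)[OF that, of k] by (simp add: csize_def)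
  qed
  have prim_T: "primitive (\<alpha>s k) ?S = T" for k
    using A(5)[of ?S k] time_change.inv_clock_S[OF tc, of k] S by simp
  have part2: "reduced_process T M f0 f g \<theta> \<nu> \<alpha> \<beta>" if "process_cluster_point ?S \<nu>s \<alpha>s \<beta>s \<nu> \<alpha> \<beta>" for \<nu> \<alpha> \<beta>
  proof (rule cluster_point_process[OF assms(1,2) A(1) _ prim_T red that])
    show "0 \<le> \<alpha>s k s \<and> \<alpha>s k s + norm1 (\<beta>s k s) \<le> 1" if "s \<in> {0..?S}" for k s using A(2)[OF that, of k] by simp
  qed
  define \<Xi> where "\<Xi> k = time_change.clock (us k)" for k
  have \<Xi>: "\<Xi> k t \<in> {0..?S}" "time_change.inv_clock T (us k) (\<Xi> k t) = t" if "t \<in> {0..T}" for k t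
    using time_change.inv_clock(3,4)[OF tc that, of k] by (simp_all add: \<Xi>_def)
  have \<Xi>T: "\<Xi> k T = ?S" for k using time_change.clock_T[OF tc, of k] by (simp add: \<Xi>_def)
  have \<Xi>': "primitive (\<alpha>s k) (\<Xi> k t) = t" "\<mu>s k t = \<nu>s k (\<Xi> k t)" "primitive (us k) t = primitive (\<beta>s k) (\<Xi> k t)"
    if "t \<in> {0..T}" for k t
    using A(4-6)[OF \<Xi>(1)[OF that], of k] \<Xi>(2)[OF that, of k] by simp_all
  have mono: "primitive (\<alpha>s k) s \<le> primitive (\<alpha>s k) r" if sr: "0 \<le> s" "s \<le> r" "r \<le> ?S" for k s r
    using A(5)[of s k] A(5)[of r k] time_change.inv_clock_le_iff[OF tc, of s r k] sr by simp
  have con: "controlled f0 g f c ?S 1 (\<alpha>s k) (\<beta>s k)" for k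
    unfolding controlled_def controlled_axioms_def using drift_axioms A(1) S by simp
  have part3: "\<mu> t = \<nu> (pseudo_inverse T ?S (primitive \<alpha>) t) \<and> U t = primitive \<beta> (pseudo_inverse T ?S (primitive \<alpha>) t)"
    if cl: "process_cluster_point ?S \<nu>s \<alpha>s \<beta>s \<nu> \<alpha> \<beta>" and t: "t \<in> {0..T}" for \<nu> \<alpha> \<beta> t
  proof
    note D = process_cluster_pointD[OF less_imp_le[OF S] cl cont]
    have co: "coefficients ?S 1 \<alpha> \<beta>"
      by (rule Linf_coefficients[OF D(2)]) (use part2[OF cl] in \<open>simp add: reduced_process_def reduced_controls_def\<close>)
    note close = cluster_point_close[OF less_imp_le[OF S] cl cont A(1) co]
    have P: "\<nu> s \<in> P1" if "s \<in> {0..?S}" for s using D(1) that by (simp add: W1_continuous_def)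
    \<comment> \<open>\<open>limit_time_change\<close> in the Wasserstein metric: the
      \<open>\<nu>s k\<close> share one Lipschitz constant in time, since all controls of the
      reduced system have size at most 1.\<close>
    show "\<mu> t = \<nu> (pseudo_inverse T ?S (primitive \<alpha>) t)"
    proof (rule limit_time_change[OF assms(1) less_imp_le[OF S] assms(6,8) _ _ _ _ mono \<Xi>(1) \<Xi>'(1) \<Xi>T \<Xi>'(2) _ t])
      show "\<nu>s k s \<in> mspace W1_metric" "\<nu> s \<in> mspace W1_metric" if "s \<in> {0..?S}" for k s using P Pk that by simp_all
      show "mdist W1_metric (\<nu>s k s) (\<nu>s k r) \<le> 3 * real CARD('n) * (2 * c) * \<bar>s - r\<bar>" if "s \<in> {0..?S}" "r \<in> {0..?S}" for k s r
        using controlled.solves_lipschitz[OF con A(3) that] that Pk by (simp add: controlled.speed_def[OF con] mdist_W1_metric)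
      show "0 \<le> 3 * real CARD('n) * (2 * c)" using c_pos by simp
      fix e :: real and Q :: "real set" assume e: "0 < e" "finite Q" "Q \<subseteq> {0..?S}"
      show "\<exists>\<^sub>F k in sequentially. \<forall>s\<in>Q. \<bar>primitive (\<alpha>s k) s - primitive \<alpha> s\<bar> < e \<and> mdist W1_metric (\<nu>s k s) (\<nu> s) < e"
        by (rule frequently_elim1[OF close[OF e]]) (use e(3) P Pk in \<open>auto simp: mdist_W1_metric subset_iff\<close>)
    qed
    \<comment> \<open>The same argument in the Manhattan metric, with the primitives of the controls
      as curves; \<open>\<beta>s k\<close> has norm at most 1, so they too share a Lipschitz
      constant.\<close>
    show "U t = primitive \<beta> (pseudo_inverse T ?S (primitive \<alpha>) t)"
    proof (rule limit_time_change[OF assms(1) less_imp_le[OF S] assms(7,9) _ _ _ _ mono \<Xi>(1) \<Xi>'(1) \<Xi>T \<Xi>'(3) _ t])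
      show "mdist manhattan_metric (primitive (\<beta>s k) s) (primitive (\<beta>s k) r) \<le> real CARD('m) * \<bar>s - r\<bar>"
        if "s \<in> {0..?S}" "r \<in> {0..?S}" for k s r
      proof -
        have "norm (\<beta>s k q) \<le> 1" if "q \<in> {0..?S}" for q
          using A(2)[OF that, of k] norm_le_norm1[of "\<beta>s k q"] by simp
        then have "norm (primitive (\<beta>s k) s - primitive (\<beta>s k) r) \<le> 1 * \<bar>s - r\<bar>"
          by (intro primitive_lipschitz[OF set_integrable_bounded[OF coefficientsD(2,6)[OF A(1)]]] that)
        then have "real CARD('m) * norm (primitive (\<beta>s k) s - primitive (\<beta>s k) r) \<le> real CARD('m) * \<bar>s - r\<bar>"
          by (intro mult_left_mono) auto
        then show ?thesis using norm1_le_norm[of "primitive (\<beta>s k) s - primitive (\<beta>s k) r"] unfolding mdist_manhattan_metric by linarith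
      qed
      fix e :: real and Q :: "real set" assume e: "0 < e" "finite Q" "Q \<subseteq> {0..?S}"
      show "\<exists>\<^sub>F k in sequentially. \<forall>s\<in>Q. \<bar>primitive (\<alpha>s k) s - primitive \<alpha> s\<bar> < e \<and>
          mdist manhattan_metric (primitive (\<beta>s k) s) (primitive \<beta> s) < e"
        by (rule frequently_elim1[OF close[OF e]]) auto
    qed simp_all
  qed
  show ?thesis using part1 part2 part3 unfolding primitive_def by blast
qed

end
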